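(* Let $(G,\mathcal{M})$ be an instance of \textsc{MaxEDP} and let $(f,\mathbf{x})$ be a fractional solution, where $f$ is a feasible multicommodity flow in $G$ for the pairs $\mathcal{M}$ with marginals $\mathbf{x}$. Let $(\mathcal{T},\beta)$ be a rooted tree decomposition of $G$ of width less than $r$. Let $\ell_1$ be the maximum size of a parent adhesion of an unsafe node, and $\ell_2$ the maximum size of a parent adhesion of a bad node. There is a polynomial time algorithm that constructs a partition of $G$ into node-disjoint induced subgraphs $G_1,\dots,G_q$ and weight functions $\pi_i:V(G_i)\to\mathbb{R}_+$ such that, letting $\mathcal{M}_i$ be the pairs of $\mathcal{M}$ with both vertices in $G_i$ and $X_i$ the set of endpoints of pairs in $\mathcal{M}_i$: (a) $\pi_i(u)=\pi_i(v)$ for each pair $uv\in\mathcal{M}_i$; (b) there is a feasible multicommodity flow $g_i$ in $G_i$ from $X_i$ to a single vertex $z$ that routes $\pi_i(v)$ units of flow from $v$ to $z$ for each $v\in X_i$; consequently $X_i$ is $\pi_i$-flow-well-linked in $G_i$; (c) $\sum_{i=1}^q\pi_i(X_i)\ge\frac{1}{12r^3}\left(1-\frac1r\right)^{\ell_1+\ell_2}|f|$.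
   Context: \textsc{MaxEDP}: undirected graph $G$ with edge capacities $\mathrm{cap}(e)\in\mathbb{Z}_+$ and pairs $\mathcal{M}$. A multicommodity flow $f$ for $\mathcal{M}$ is a nonnegative weighting of paths connecting pairs; feasible if each edge $e$ carries total weight at most $\mathrm{cap}(e)$; $\mathbf{x}(v)$ is the total weight of paths with endpoint $v$; $|f|=\frac12\sum_v\mathbf{x}(v)$. Tree decomposition notation: $\sigma(t)=\beta(t)\cap\beta(\mathrm{parent}(t))$ for non-root $t$, $\emptyset$ at the root; $\gamma(t)$ is the union of bags of descendants of $t$ including $t$; $\alpha(t)=\gamma(t)\setminus\sigma(t)$; $G(t)=G[\gamma(t)]$ minus edges of $G[\sigma(t)]$. Width less than $r$ means every bag has at most $r$ vertices. A node $t$ is safe if there is a flow in $G(t)$ respecting edge capacities routing at least $\frac{1}{4r}\mathbf{x}(z)$ units from each $z\in\gamma(t)$ to $\sigma(t)$; otherwise unsafe. A node $t$ is good if every flow path of $f$ with an endpoint in $\gamma(t)$ intersects $\sigma(t)$; otherwise bad. For $\pi:X\to\mathbb{R}_+$, $\pi(X)=\sum_{v\in X}\pi(v)$, and $X$ is $\pi$-flow-well-linked in $G$ if there is a feasible multicommodity flow simultaneously routing $\pi(u)\pi(v)/\pi(X)$ units from $u$ to $v$ for all pairs $u,v\in X$.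
   Formalization: The pairs in M are assumed to form a matching (each terminal in exactly one pair); without this (c) fails, e.g. on a star with capacities k!/j and all pairs sharing the centre. The algorithm takes rational flow weights; for real-valued flows existence of the partition is stated. *)

theory Defs
  imports Complex_Main "HOL-Library.Disjoint_Sets" "HOL-Library.Log_Nat"
begin

section \<open>Graphs and multicommodity flows\<close>

definition simple_graph :: "'a set \<Rightarrow> 'a set set \<Rightarrow> bool" where
  "simple_graph V E \<longleftrightarrow>
     finite V \<and> (\<forall>e\<in>E. \<exists>u v. u \<in> V \<and> v \<in> V \<and> u \<noteq> v \<and> e = {u, v})"

definition induced_edges :: "'a set set \<Rightarrow> 'a set \<Rightarrow> 'a set set" where
  "induced_edges E U = {e \<in> E. e \<subseteq> U}"

definition path_edges :: "'a list \<Rightarrow> 'a set set" where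
  "path_edges p = set (map2 (\<lambda>u v. {u, v}) p (tl p))"

definition is_path :: "'a set \<Rightarrow> 'a set set \<Rightarrow> 'a list \<Rightarrow> bool" where
  "is_path V E p \<longleftrightarrow> p \<noteq> [] \<and> distinct p \<and> set p \<subseteq> V \<and> path_edges p \<subseteq> E"

text \<open>
  A flow is a weight function on simple paths, which are given by their vertex sequences; one-vertex
  paths are allowed.  A sequence and its reversal describe the same undirected path, and every
  quantity below adds up the weights of both.  On a finite vertex set a flow has finite support, so
  all sums below are finite.
\<close>

definition flow_sum :: "('a list \<Rightarrow> real) \<Rightarrow> ('a list \<Rightarrow> bool) \<Rightarrow> real" where
  "flow_sum f P = (\<Sum>p | f p \<noteq> 0 \<and> P p. f p)"

definition feasible_flow ::
    "'a set \<Rightarrow> 'a set set \<Rightarrow> ('a set \<Rightarrow> nat) \<Rightarrow> ('a list \<Rightarrow> real) \<Rightarrow> bool" where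
  "feasible_flow V E c f \<longleftrightarrow>
     (\<forall>p. 0 \<le> f p) \<and> (\<forall>p. f p \<noteq> 0 \<longrightarrow> is_path V E p) \<and>
     (\<forall>e\<in>E. flow_sum f (\<lambda>p. e \<in> path_edges p) \<le> real (c e))"

definition marginal :: "('a list \<Rightarrow> real) \<Rightarrow> 'a \<Rightarrow> real" where
  "marginal f v = flow_sum f (\<lambda>p. hd p = v \<or> last p = v)"

definition flow_value :: "'a set \<Rightarrow> ('a list \<Rightarrow> real) \<Rightarrow> real" where
  "flow_value V f = 1 / 2 * (\<Sum>v\<in>V. marginal f v)"

text \<open>The pairs \<open>u, v\<close> are unordered: both orientations of a path contribute to the same demand.\<close>

definition flow_well_linked ::
    "'a set \<Rightarrow> 'a set set \<Rightarrow> ('a set \<Rightarrow> nat) \<Rightarrow> 'a set \<Rightarrow> ('a \<Rightarrow> real) \<Rightarrow> bool" where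
  "flow_well_linked V E c X \<pi> \<longleftrightarrow>
     (\<exists>g. feasible_flow V E c g \<and>
          (\<forall>u\<in>X. \<forall>v\<in>X. flow_sum g (\<lambda>p. {hd p, last p} = {u, v}) = \<pi> u * \<pi> v / sum \<pi> X))"


section \<open>Instances with a fractional solution and a rooted tree decomposition\<close>

text \<open>The value of \<open>parent\<close> at the root is irrelevant.\<close>

record ('a, 't) edp =
  verts  :: "'a set"
  edges  :: "'a set set"
  cap    :: "'a set \<Rightarrow> nat"
  pairs  :: "'a set set"
  flow   :: "'a list \<Rightarrow> real"
  nodes  :: "'t set"
  root   :: "'t"
  parent :: "'t \<Rightarrow> 't"
  bag    :: "'t \<Rightarrow> 'a set"
  width_bound :: nat

text \<open>
  The pairs form a matching: every terminal belongs to exactly one pair.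
\<close>

definition maxedp_instance :: "('a, 't) edp \<Rightarrow> bool" where
  "maxedp_instance I \<longleftrightarrow>
     simple_graph (verts I) (edges I) \<and> simple_graph (verts I) (pairs I) \<and> disjoint (pairs I)"

definition fractional_solution :: "('a, 't) edp \<Rightarrow> bool" where
  "fractional_solution I \<longleftrightarrow>
     feasible_flow (verts I) (edges I) (cap I) (flow I) \<and>
     (\<forall>p. flow I p \<noteq> 0 \<longrightarrow> {hd p, last p} \<in> pairs I)"

definition parent_rel :: "('a, 't) edp \<Rightarrow> ('t \<times> 't) set" where
  "parent_rel I = {(t, parent I t) | t. t \<in> nodes I \<and> t \<noteq> root I}"

definition rooted_tree :: "('a, 't) edp \<Rightarrow> bool" where
  "rooted_tree I \<longleftrightarrow>
     finite (nodes I) \<and> root I \<in> nodes I \<and> parent_rel I \<subseteq> nodes I \<times> nodes I \<and>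
     (\<forall>t\<in>nodes I. (t, root I) \<in> (parent_rel I)\<^sup>*)"

definition nodes_at :: "('a, 't) edp \<Rightarrow> 'a \<Rightarrow> 't set" where
  "nodes_at I v = {t \<in> nodes I. v \<in> bag I t}"

definition tree_decomposition :: "('a, 't) edp \<Rightarrow> bool" where
  "tree_decomposition I \<longleftrightarrow>
     rooted_tree I \<and>
     (\<Union>t\<in>nodes I. bag I t) = verts I \<and>
     (\<forall>e\<in>edges I. \<exists>t\<in>nodes I. e \<subseteq> bag I t) \<and>
     (\<forall>v\<in>verts I. \<forall>s\<in>nodes_at I v. \<forall>t\<in>nodes_at I v.
        (s, t) \<in> ((parent_rel I \<union> (parent_rel I)\<inverse>) \<inter> nodes_at I v \<times> nodes_at I v)\<^sup>*)"

definition valid_input :: "('a, 't) edp \<Rightarrow> bool" where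
  "valid_input I \<longleftrightarrow>
     maxedp_instance I \<and> fractional_solution I \<and> tree_decomposition I \<and>
     (\<forall>t\<in>nodes I. card (bag I t) \<le> width_bound I)"

definition parent_adhesion :: "('a, 't) edp \<Rightarrow> 't \<Rightarrow> 'a set" where
  "parent_adhesion I t = (if t = root I then {} else bag I t \<inter> bag I (parent I t))"

definition cone :: "('a, 't) edp \<Rightarrow> 't \<Rightarrow> 'a set" where
  "cone I t = (\<Union>s \<in> {s \<in> nodes I. (s, t) \<in> (parent_rel I)\<^sup>*}. bag I s)"

definition cone_edges :: "('a, 't) edp \<Rightarrow> 't \<Rightarrow> 'a set set" where
  "cone_edges I t =
     induced_edges (edges I) (cone I t) - induced_edges (edges I) (parent_adhesion I t)"

definition safe :: "('a, 't) edp \<Rightarrow> 't \<Rightarrow> bool" where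
  "safe I t \<longleftrightarrow>
     (\<exists>g. feasible_flow (cone I t) (cone_edges I t) (cap I) g \<and>
          (\<forall>p. g p \<noteq> 0 \<longrightarrow> last p \<in> parent_adhesion I t) \<and>
          (\<forall>z\<in>cone I t. flow_sum g (\<lambda>p. hd p = z)
              \<ge> 1 / (4 * real (width_bound I)) * marginal (flow I) z))"

definition good :: "('a, 't) edp \<Rightarrow> 't \<Rightarrow> bool" where
  "good I t \<longleftrightarrow>
     (\<forall>p. flow I p \<noteq> 0 \<and> (hd p \<in> cone I t \<or> last p \<in> cone I t) \<longrightarrow>
          set p \<inter> parent_adhesion I t \<noteq> {})"

text \<open>
  The default 0 matters only for the zero flow: otherwise the root, whose parent adhesion is empty,
  is both unsafe and bad.
\<close>

definition max_adhesion :: "('a, 't) edp \<Rightarrow> ('t \<Rightarrow> bool) \<Rightarrow> nat" where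
  "max_adhesion I P = Max (insert 0 {card (parent_adhesion I t) | t. t \<in> nodes I \<and> P t})"


section \<open>The required decomposition\<close>

definition pairs_in :: "('a, 't) edp \<Rightarrow> 'a set \<Rightarrow> 'a set set" where
  "pairs_in I U = {m \<in> pairs I. m \<subseteq> U}"

definition terminals_in :: "('a, 't) edp \<Rightarrow> 'a set \<Rightarrow> 'a set" where
  "terminals_in I U = \<Union> (pairs_in I U)"

definition linked_partition ::
    "('a, 't) edp \<Rightarrow> nat \<Rightarrow> (nat \<Rightarrow> 'a set) \<Rightarrow> (nat \<Rightarrow> 'a \<Rightarrow> real) \<Rightarrow> bool" where
  "linked_partition I q U \<pi> \<longleftrightarrow>
     (\<forall>i<q. U i \<noteq> {}) \<and> disjoint_family_on U {..<q} \<and> (\<Union>i<q. U i) = verts I \<and>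
     (\<forall>i<q. \<forall>v\<in>U i. 0 \<le> \<pi> i v) \<and>
     (\<forall>i<q. \<forall>u v. {u, v} \<in> pairs_in I (U i) \<longrightarrow> \<pi> i u = \<pi> i v) \<and>
     (\<forall>i<q. \<exists>z\<in>U i. \<exists>g.
        feasible_flow (U i) (induced_edges (edges I) (U i)) (cap I) g \<and>
        (\<forall>p. g p \<noteq> 0 \<longrightarrow> hd p \<in> terminals_in I (U i) \<and> last p = z) \<and>
        (\<forall>v\<in>terminals_in I (U i). flow_sum g (\<lambda>p. hd p = v) = \<pi> i v)) \<and>
     (\<forall>i<q. flow_well_linked (U i) (induced_edges (edges I) (U i)) (cap I)
               (terminals_in I (U i)) (\<pi> i)) \<and>
     (\<Sum>i<q. sum (\<pi> i) (terminals_in I (U i)))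
       \<ge> 1 / (12 * real (width_bound I) ^ 3)
         * (1 - 1 / real (width_bound I))
             ^ (max_adhesion I (\<lambda>t. \<not> safe I t) + max_adhesion I (\<lambda>t. \<not> good I t))
         * flow_value (verts I) (flow I)"


section \<open>A model of computation\<close>

text \<open>
  Programs of a while language transform binary trees whose leaves are natural numbers.  The measure
  is logarithmic: numbers count with their binary length, and every primitive step is charged the
  full size of its argument and of its result.  All primitives are computable in polynomial time on
  a Turing machine and, since results are charged as well, sizes never exceed the running time;
  hence polynomial time in this model is polynomial time in the usual sense.
\<close>

datatype val = Num nat | Pair val val

fun vsize :: "val \<Rightarrow> nat" where
  "vsize (Num n) = 1 + floorlog 2 n"
| "vsize (Pair x y) = 1 + vsize x + vsize y"

datatype prim = PId | PConst val | PFst | PSnd | PIsPair | PLess | PAdd | PSub | PMul | PDiv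

fun arith :: "(nat \<Rightarrow> nat \<Rightarrow> nat) \<Rightarrow> val \<Rightarrow> val" where
  "arith h (Pair (Num a) (Num b)) = Num (h a b)"
| "arith h _ = Num 0"

fun apply_prim :: "prim \<Rightarrow> val \<Rightarrow> val" where
  "apply_prim PId x = x"
| "apply_prim (PConst c) x = c"
| "apply_prim PFst x = (case x of Pair y z \<Rightarrow> y | Num n \<Rightarrow> Num 0)"
| "apply_prim PSnd x = (case x of Pair y z \<Rightarrow> z | Num n \<Rightarrow> Num 0)"
| "apply_prim PIsPair x = (case x of Pair y z \<Rightarrow> Num 1 | Num n \<Rightarrow> Num 0)"
| "apply_prim PLess x = arith (\<lambda>a b. if a < b then 1 else 0) x"
| "apply_prim PAdd x = arith (+) x"
| "apply_prim PSub x = arith (-) x"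
| "apply_prim PMul x = arith (*) x"
| "apply_prim PDiv x = arith (div) x"

datatype prog =
    Prim prim
  | Seq prog prog
  | Fork prog prog
  | Cond prog prog prog
  | While prog prog

text \<open>
  \<open>exec P x y n\<close>: on input \<open>x\<close> the program \<open>P\<close> halts with result \<open>y\<close> after time \<open>n\<close>.
  A test succeeds iff its result is not \<open>Num 0\<close>.
\<close>

inductive exec :: "prog \<Rightarrow> val \<Rightarrow> val \<Rightarrow> nat \<Rightarrow> bool" where
  Prim: "exec (Prim b) x (apply_prim b x) (vsize x + vsize (apply_prim b x))"
| Seq: "exec P x y m \<Longrightarrow> exec Q y z n \<Longrightarrow> exec (Seq P Q) x z (m + n)"
| Fork: "exec P x y m \<Longrightarrow> exec Q x z n \<Longrightarrow> exec (Fork P Q) x (Pair y z) (1 + m + n)"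
| Cond_True: "exec B x b m \<Longrightarrow> b \<noteq> Num 0 \<Longrightarrow> exec P x y n \<Longrightarrow> exec (Cond B P Q) x y (1 + m + n)"
| Cond_False: "exec B x (Num 0) m \<Longrightarrow> exec Q x y n \<Longrightarrow> exec (Cond B P Q) x y (1 + m + n)"
| While_Done: "exec B x (Num 0) m \<Longrightarrow> exec (While B P) x x (1 + m)"
| While_Step: "exec B x b m \<Longrightarrow> b \<noteq> Num 0 \<Longrightarrow> exec P x y n \<Longrightarrow> exec (While B P) y z k
    \<Longrightarrow> exec (While B P) x z (1 + m + n + k)"


section \<open>Encoding of inputs and outputs\<close>

fun enc_list :: "('b \<Rightarrow> val) \<Rightarrow> 'b list \<Rightarrow> val" where
  "enc_list e [] = Num 0"
| "enc_list e (x # xs) = Pair (e x) (enc_list e xs)"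

fun enc_pair :: "('b \<Rightarrow> val) \<Rightarrow> ('c \<Rightarrow> val) \<Rightarrow> 'b \<times> 'c \<Rightarrow> val" where
  "enc_pair d e (x, y) = Pair (d x) (e y)"

text \<open>
  Vertices and tree nodes are natural numbers.  An instance is given by the lists of its vertices,
  of its edges with capacities, of its pairs, of the flow paths with their weights as fractions
  \<open>a / b\<close>, and of its tree nodes with parents and bags, by the root and by the bound on the
  size of the bags.  Only instances with a rational-valued flow have an encoding.
\<close>

definition encodes_input :: "val \<Rightarrow> (nat, nat) edp \<Rightarrow> bool" where
  "encodes_input x I \<longleftrightarrow>
     (\<exists>(vs :: nat list) (es :: (nat \<times> nat \<times> nat) list) (ms :: (nat \<times> nat) list)
       (fs :: (nat list \<times> nat \<times> nat) list) (ts :: (nat \<times> nat \<times> nat list) list).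
        distinct vs \<and> set vs = verts I \<and>
        distinct (map (\<lambda>(u, v, c). {u, v}) es) \<and>
        (\<lambda>(u, v, c). {u, v}) ` set es = edges I \<and>
        (\<forall>(u, v, c) \<in> set es. cap I {u, v} = c) \<and>
        distinct (map (\<lambda>(u, v). {u, v}) ms) \<and>
        (\<lambda>(u, v). {u, v}) ` set ms = pairs I \<and>
        distinct (map fst fs) \<and> fst ` set fs = {p. flow I p \<noteq> 0} \<and>
        (\<forall>(p, a, b) \<in> set fs. 0 < b \<and> flow I p = real a / real b) \<and>
        distinct (map fst ts) \<and> fst ` set ts = nodes I \<and>
        (\<forall>(t, s, b) \<in> set ts. parent I t = s \<and> distinct b \<and> set b = bag I t) \<and>
        x = Pair (enc_list Num vs)
           (Pair (enc_list (enc_pair Num (enc_pair Num Num)) es)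
           (Pair (enc_list (enc_pair Num Num) ms)
           (Pair (enc_list (enc_pair (enc_list Num) (enc_pair Num Num)) fs)
           (Pair (enc_list (enc_pair Num (enc_pair Num (enc_list Num))) ts)
           (Pair (Num (root I)) (Num (width_bound I))))))))"

text \<open>
  An output lists, for every part, its vertices together with their weights as fractions \<open>a / b\<close>.
\<close>

definition encodes_output ::
    "val \<Rightarrow> nat \<Rightarrow> (nat \<Rightarrow> nat set) \<Rightarrow> (nat \<Rightarrow> nat \<Rightarrow> real) \<Rightarrow> bool" where
  "encodes_output y q U \<pi> \<longleftrightarrow>
     (\<exists>ps :: (nat \<times> nat \<times> nat) list list.
        length ps = q \<and>
        (\<forall>i<q. distinct (map fst (ps ! i)) \<and> fst ` set (ps ! i) = U i \<and>
               (\<forall>(v, a, b) \<in> set (ps ! i). 0 < b \<and> \<pi> i v = real a / real b)) \<and>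
        y = enc_list (enc_list (enc_pair Num (enc_pair Num Num))) ps)"

end

theory Submission
  imports Defs "HOL-Library.Multiset"
begin

text \<open>
  Keep a partition of the vertices and a set of surviving flow paths, each inside one part, and treat
  the adhesion sizes \<open>s\<close> from large to small. For a part \<open>P\<close> and a node \<open>t\<close> with adhesion \<open>B\<close>,
  \<open>|B \<inter> P| = s\<close>, compute single-sink flows from the ends of the paths inside \<open>(cone t - B) \<inter> P\<close> to
  every vertex of \<open>B \<inter> P\<close>. If none of them has value at least \<open>1 / (3 s)\<close> of the (scaled) demand,
  the intersection of the sink-avoiding sides of the minimum cuts is a sparse set; it becomes a part
  of its own. Taking the deepest such node first, the sets cut off at one size are disjoint and stay
  linked, so at most a fraction \<open>1 / (2 r)\<close> of the flow is lost. Now all cones of size \<open>s\<close> that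
  contain a path are linked to a single adhesion vertex. If these paths carry a fraction \<open>1 / r\<close> of
  the flow, the maximal such cones, grouped by their sinks, are the answer; otherwise these paths are
  dropped. The first loss occurs only for \<open>s \<le> l1\<close>, since before any cut a sparse set certifies that
  the node is unsafe, and the second one only for \<open>s \<le> l2\<close>. When size 0 is reached, the parts can be
  separated such that all paths of a part meet one bag, and the vertex of the bag with the largest
  flow through it serves as sink.
\<close>

section \<open>A calculus of polynomial-time functions on typed data\<close>

section \<open>Polynomial-time functions on encoded data\<close>

subsection \<open>Polynomial bounds\<close>

text \<open>Everything is measured against the safety threshold. Capacities are blown up by
  \<open>4 * r\<close>, so an unlinked cone yields a set \<open>S\<close> whose boundary capacity is
  below 1/(4r) of the flow ending in \<open>S\<close>. The sets are disjoint and a path has two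
  ends, hence the loss 2/(4r). A linked cone containing paths of weight w has demand 2w and routes
  at least 2w/(3s * 4r) to one adhesion vertex. Equal weights within a pair then require
  symmetrisation: a third of the supply of an end is credited to each of the two ends, a factor 2/3.
  This gives w/(9 s r); with s <= r and a fraction 1/r of the flow in the selected cones, |f|/(9
  r^3) results. The step from 9 to 12 is reserved for irrational flows. Two obstacles shape the
  rest. Capacities are binary numbers, so unit augmentations must run on rounded data; the threshold
  1/(3s) leaves room for a rounding error of half the demand, since 1/3 + 1/2 < 1. And a loop of
  polynomial steps may still blow up its state, so every loop needs a bound on the growth per
  round.\<close>

definition polyb :: "(nat \<Rightarrow> nat) \<Rightarrow> bool" where
  "polyb p \<longleftrightarrow> (\<exists>c k. \<forall>s. p s \<le> c * (s + 1) ^ k)"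

lemma polyb_const: "polyb (\<lambda>s. c)"
  unfolding polyb_def by (rule exI[of _ c], rule exI[of _ 0]) simp

lemma polyb_id: "polyb (\<lambda>s. s)"
  unfolding polyb_def by (rule exI[of _ 1], rule exI[of _ 1]) simp

lemma polyb_Suc: "polyb Suc"
  unfolding polyb_def by (rule exI[of _ 1], rule exI[of _ 1]) simp

lemma polyb_add:
  assumes "polyb p" "polyb q" shows "polyb (\<lambda>s. p s + q s)"
proof -
  obtain c k d l where p: "\<And>s. p s \<le> c * (s + 1) ^ k" and q: "\<And>s. q s \<le> d * (s + 1) ^ l"
    using assms unfolding polyb_def by blast
  have "p s + q s \<le> (c + d) * (s + 1) ^ (k + l)" for s
  proof -
    have "c * (s + 1) ^ k \<le> c * (s + 1) ^ (k + l)" "d * (s + 1) ^ l \<le> d * (s + 1) ^ (k + l)"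
      by (auto intro!: mult_left_mono power_increasing)
    then have "p s \<le> c * (s + 1) ^ (k + l)" "q s \<le> d * (s + 1) ^ (k + l)"
      using p[of s] q[of s] by (meson order_trans)+
    then show ?thesis by (simp only: add_mult_distrib add_mono)
  qed
  then show ?thesis unfolding polyb_def by blast
qed

lemma polyb_mult:
  assumes "polyb p" "polyb q" shows "polyb (\<lambda>s. p s * q s)"
proof -
  obtain c k d l where p: "\<And>s. p s \<le> c * (s + 1) ^ k" and q: "\<And>s. q s \<le> d * (s + 1) ^ l"
    using assms unfolding polyb_def by blast
  have "p s * q s \<le> (c * d) * (s + 1) ^ (k + l)" for s
    using mult_mono[OF p[of s] q[of s]] by (simp add: power_add ac_simps)
  then show ?thesis unfolding polyb_def by blast
qed

lemma polyb_comp: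
  assumes "polyb p" "polyb q" shows "polyb (\<lambda>s. p (q s))"
proof -
  obtain c k d l where p: "\<And>s. p s \<le> c * (s + 1) ^ k" and q: "\<And>s. q s \<le> d * (s + 1) ^ l"
    using assms unfolding polyb_def by blast
  have "p (q s) \<le> (c * (d + 1) ^ k) * (s + 1) ^ (l * k)" for s
  proof -
    have "q s + 1 \<le> (d + 1) * (s + 1) ^ l"
      using q[of s] by (simp add: add_mult_distrib) (metis add_mono one_le_power Suc_eq_plus1 le_add2 plus_1_eq_Suc)
    then have "(q s + 1) ^ k \<le> ((d + 1) * (s + 1) ^ l) ^ k" by (rule power_mono) simp
    then have "c * (q s + 1) ^ k \<le> c * (((d + 1) * (s + 1) ^ l) ^ k)" by simp
    with p[of "q s"] have "p (q s) \<le> c * (((d + 1) * (s + 1) ^ l) ^ k)" by (rule order_trans)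
    then show ?thesis by (simp only: power_mult_distrib power_mult mult.assoc)
  qed
  then show ?thesis unfolding polyb_def by blast
qed

text \<open>Bounds are evaluated at over-estimates of sizes, which is sound only for monotone
  functions; the witness of \<open>polyb\<close> is itself a monotone majorant.\<close>

lemma polyb_mono:
  assumes "polyb p" obtains q where "polyb q" "mono q" "\<And>s. p s \<le> q s"
proof -
  obtain c k where p: "\<And>s. p s \<le> c * (s + 1) ^ k" using assms unfolding polyb_def by blast
  show ?thesis
  proof (rule that[of "\<lambda>s. c * (s + 1) ^ k"])
    show "polyb (\<lambda>s. c * (s + 1) ^ k)" unfolding polyb_def by blast
    show "mono (\<lambda>s. c * (s + 1) ^ k)" by (auto intro!: monoI mult_left_mono power_mono)
  qed (rule p)
qed

lemma vsize_pos [simp]: "0 < vsize x" "vsize x \<noteq> 0" "Suc 0 \<le> vsize x"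
  by (cases x; simp)+

text \<open>Each primitive is charged its argument and its result. Time bounds thereby become size
  bounds, which is what composition of programs needs.\<close>

lemma exec_size: "exec P x y n \<Longrightarrow> vsize x \<le> n \<and> vsize y \<le> n"
  by (induction rule: exec.induct) auto

subsection \<open>Encodable types\<close>

text \<open>The instances agree with \<open>enc_list\<close>, \<open>enc_pair\<close> and
  \<open>Num\<close>, so the final program acts on the prescribed encodings directly; truth values
  follow the test convention of \<open>Cond\<close> and \<open>While\<close>.\<close>

class representable = fixes repr :: "'a \<Rightarrow> val"

instantiation nat :: representable begin
definition repr_nat :: "nat \<Rightarrow> val" where "repr_nat n = Num n"
instance ..
end

instantiation bool :: representable begin
definition repr_bool :: "bool \<Rightarrow> val" where "repr_bool b = Num (if b then 1 else 0)"
instance ..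
end

instantiation prod :: (representable, representable) representable begin
definition repr_prod :: "'a \<times> 'b \<Rightarrow> val" where "repr_prod p = Pair (repr (fst p)) (repr (snd p))"
instance ..
end

instantiation list :: (representable) representable begin
definition repr_list :: "'a list \<Rightarrow> val" where "repr_list xs = enc_list repr xs"
instance ..
end

lemma repr_simps [simp]:
  "repr (n :: nat) = Num n" "repr b = Num (if b then 1 else 0)"
  "repr (a, c) = Pair (repr a) (repr c)" "repr [] = Num 0" "repr (d # ds) = Pair (repr d) (repr ds)"
  by (simp_all add: repr_nat_def repr_bool_def repr_prod_def repr_list_def)

lemma repr_prod_eq: "repr p = Pair (repr (fst p)) (repr (snd p))"
  by (simp add: repr_prod_def)

abbreviation sz :: "'a::representable \<Rightarrow> nat" where "sz x \<equiv> vsize (repr x)"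

definition ptime :: "('a::representable \<Rightarrow> 'b::representable) \<Rightarrow> bool" where
  "ptime f \<longleftrightarrow> (\<exists>P p. polyb p \<and> (\<forall>x. \<exists>n \<le> p (sz x). exec P (repr x) (repr (f x)) n))"

lemma ptimeI:
  assumes "polyb p" "\<And>x. \<exists>n \<le> p (sz x). exec P (repr x) (repr (f x)) n" shows "ptime f"
  using assms unfolding ptime_def by blast

text \<open>\<open>ptime\<close> with its witnesses named and the bound made monotone; by
  \<open>exec_size\<close> the same bound controls the size of the result.\<close>

definition runs :: "prog \<Rightarrow> (nat \<Rightarrow> nat) \<Rightarrow> ('a::representable \<Rightarrow> 'b::representable) \<Rightarrow> bool" where
  "runs P p f \<longleftrightarrow> polyb p \<and> mono p \<and> (\<forall>x. \<exists>n \<le> p (sz x). exec P (repr x) (repr (f x)) n)"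

lemma runsD:
  assumes "runs P p f"
  shows "polyb p" "mono p" "\<exists>n \<le> p (sz x). exec P (repr x) (repr (f x)) n" "sz (f x) \<le> p (sz x)"
proof -
  show "polyb p" "mono p" and 1: "\<exists>n \<le> p (sz x). exec P (repr x) (repr (f x)) n"
    using assms unfolding runs_def by simp_all
  from 1 show "sz (f x) \<le> p (sz x)" using exec_size[of P "repr x" "repr (f x)"] by (meson order_trans)
qed

lemma ptimeE:
  assumes "ptime f" obtains P p where "runs P p f"
proof -
  obtain P p where p: "polyb p" "\<And>x. \<exists>n \<le> p (sz x). exec P (repr x) (repr (f x)) n"
    using assms unfolding ptime_def by blast
  obtain q where q: "polyb q" "mono q" "\<And>s. p s \<le> q s" using polyb_mono[OF p(1)] by blast
  have "\<exists>n \<le> q (sz x). exec P (repr x) (repr (f x)) n" for x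
    using p(2)[of x] q(3)[of "sz x"] by (meson order_trans)
  with q have "runs P q f" unfolding runs_def by simp
  then show thesis by (rule that)
qed

text \<open>A primitive costs its argument plus its result, so a bound on the size of the result is
  all that has to be supplied.\<close>

lemma pt_prim:
  assumes "polyb p" "\<And>x. apply_prim b (repr x) = repr (f x)" "\<And>x. sz (f x) \<le> p (sz x)"
  shows "ptime f"
proof (rule ptimeI[where p = "\<lambda>s. s + p s" and P = "Prim b"])
  show "polyb (\<lambda>s. s + p s)" using assms(1) by (intro polyb_add polyb_id)
  fix x
  have "exec (Prim b) (repr x) (repr (f x)) (sz x + sz (f x))"
    using exec.Prim[of b "repr x"] assms(2)[of x] by simp
  then show "\<exists>n \<le> sz x + p (sz x). exec (Prim b) (repr x) (repr (f x)) n"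
    using assms(3)[of x] by (meson add_left_mono)
qed

lemma pt_id: "ptime (\<lambda>x. x)"
  by (rule pt_prim[of "\<lambda>s. s" PId]) (auto simp: polyb_id)

lemma pt_const: "ptime (\<lambda>x. c)"
  by (rule pt_prim[of "\<lambda>s. sz c" "PConst (repr c)"]) (auto simp: polyb_const)

lemma pt_comp:
  assumes "ptime g" "ptime f" shows "ptime (\<lambda>x. g (f x))"
proof -
  obtain P p where f: "runs P p (\<lambda>x. (f x))" by (rule ptimeE[OF assms(2)])
  note f = runsD[OF f]
  obtain Q q where g: "runs Q q (\<lambda>x. (g x))" by (rule ptimeE[OF assms(1)])
  note g = runsD[OF g]
  show ?thesis
  proof (rule ptimeI[where p = "\<lambda>s. p s + q (p s)" and P = "Seq P Q"])
    show "polyb (\<lambda>s. p s + q (p s))" by (rule polyb_add[OF f(1) polyb_comp[OF g(1) f(1)]])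
    fix x
    obtain m where m: "m \<le> p (sz x)" "exec P (repr x) (repr (f x)) m" using f(3)[of x] by blast
    obtain n where n: "n \<le> q (sz (f x))" "exec Q (repr (f x)) (repr (g (f x))) n" using g(3)[of "f x"] by blast
    have "q (sz (f x)) \<le> q (p (sz x))" by (rule monoD[OF g(2) f(4)])
    then have "m + n \<le> p (sz x) + q (p (sz x))" using m n by linarith
    then show "\<exists>n \<le> p (sz x) + q (p (sz x)). exec (Seq P Q) (repr x) (repr (g (f x))) n"
      by (intro exI[of _ "m + n"] conjI exec.Seq[OF m(2) n(2)])
  qed
qed

lemma pt_pair:
  assumes "ptime f" "ptime g" shows "ptime (\<lambda>x. (f x, g x))"
proof -
  obtain P p where f: "runs P p (\<lambda>x. (f x))" by (rule ptimeE[OF assms(1)])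
  note f = runsD[OF f]
  obtain Q q where g: "runs Q q (\<lambda>x. (g x))" by (rule ptimeE[OF assms(2)])
  note g = runsD[OF g]
  show ?thesis
  proof (rule ptimeI[where p = "\<lambda>s. 1 + p s + q s" and P = "Fork P Q"])
    show "polyb (\<lambda>s. 1 + p s + q s)" using f(1) g(1) by (intro polyb_add polyb_const)
    fix x
    obtain m where m: "m \<le> p (sz x)" "exec P (repr x) (repr (f x)) m" using f(3)[of x] by blast
    obtain n where n: "n \<le> q (sz x)" "exec Q (repr x) (repr (g x)) n" using g(3)[of x] by blast
    show "\<exists>n \<le> 1 + p (sz x) + q (sz x). exec (Fork P Q) (repr x) (repr (f x, g x)) n"
      using exec.Fork[OF m(2) n(2)] m n
      by (intro exI[of _ "1 + m + n"]) auto
  qed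
qed

lemma pt_if:
  assumes "ptime b" "ptime f" "ptime g" shows "ptime (\<lambda>x. if b x then f x else g x)"
proof -
  obtain B p' where b: "runs B p' (\<lambda>x. (b x))" by (rule ptimeE[OF assms(1)])
  note b = runsD[OF b]
  obtain P p where f: "runs P p (\<lambda>x. (f x))" by (rule ptimeE[OF assms(2)])
  note f = runsD[OF f]
  obtain Q q where g: "runs Q q (\<lambda>x. (g x))" by (rule ptimeE[OF assms(3)])
  note g = runsD[OF g]
  show ?thesis
  proof (rule ptimeI[where p = "\<lambda>s. 1 + p' s + (p s + q s)" and P = "Cond B P Q"])
    show "polyb (\<lambda>s. 1 + p' s + (p s + q s))" using b(1) f(1) g(1) by (intro polyb_add polyb_const)
    fix x
    obtain m where m: "m \<le> p (sz x)" "exec P (repr x) (repr (f x)) m" using f(3)[of x] by blast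
    obtain n where n: "n \<le> q (sz x)" "exec Q (repr x) (repr (g x)) n" using g(3)[of x] by blast
    obtain k where k: "k \<le> p' (sz x)" "exec B (repr x) (repr (b x)) k" using b(3)[of x] by blast
    note * = m n k
    show "\<exists>n \<le> 1 + p' (sz x) + (p (sz x) + q (sz x)).
        exec (Cond B P Q) (repr x) (repr (if b x then f x else g x)) n"
    proof (cases "b x")
      case True
      then have "exec (Cond B P Q) (repr x) (repr (f x)) (1 + k + m)"
        using * by (intro exec.Cond_True[of _ _ "Num 1"]) auto
      with True * show ?thesis by (intro exI[of _ "1 + k + m"]) auto
    next
      case False
      then have "exec (Cond B P Q) (repr x) (repr (g x)) (1 + k + n)"
        using * by (intro exec.Cond_False) auto
      with False * show ?thesis by (intro exI[of _ "1 + k + n"]) auto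
    qed
  qed
qed

lemma pt_fst: "ptime f \<Longrightarrow> ptime (\<lambda>x. fst (f x))"
proof (rule pt_comp[of fst])
  show "ptime (fst :: 'b \<times> 'c \<Rightarrow> _)"
    by (rule pt_prim[OF polyb_id, of PFst]) (simp_all add: repr_prod_eq)
qed

lemma pt_snd: "ptime f \<Longrightarrow> ptime (\<lambda>x. snd (f x))"
proof (rule pt_comp[of snd])
  show "ptime (snd :: 'b \<times> 'c \<Rightarrow> _)"
    by (rule pt_prim[OF polyb_id, of PSnd]) (simp_all add: repr_prod_eq)
qed

lemma sz_nat_add: "sz (a + b :: nat) \<le> sz a + sz b"
proof -
  have "a < 2 ^ floorlog 2 a" "b < 2 ^ floorlog 2 b"
    using floorlog_leD[of 2 a "floorlog 2 a"] floorlog_leD[of 2 b "floorlog 2 b"] by auto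
  moreover have "(2::nat) ^ floorlog 2 a \<le> 2 ^ (floorlog 2 a + floorlog 2 b)"
    "(2::nat) ^ floorlog 2 b \<le> 2 ^ (floorlog 2 a + floorlog 2 b)" by (auto intro: power_increasing)
  ultimately have "a + b < 2 ^ (floorlog 2 a + floorlog 2 b) + 2 ^ (floorlog 2 a + floorlog 2 b)" by linarith
  then have "a + b < 2 ^ (floorlog 2 a + floorlog 2 b + 1)" by simp
  then have "floorlog 2 (a + b) \<le> floorlog 2 a + floorlog 2 b + 1" by (intro floorlog_leI) auto
  then show ?thesis by simp
qed

lemma sz_nat_mult: "sz (a * b :: nat) \<le> sz a + sz b"
proof -
  have "a < 2 ^ floorlog 2 a" "b < 2 ^ floorlog 2 b"
    using floorlog_leD[of 2 a "floorlog 2 a"] floorlog_leD[of 2 b "floorlog 2 b"] by auto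
  then have "a * b < 2 ^ floorlog 2 a * 2 ^ floorlog 2 b" by (intro mult_strict_mono) auto
  then have "floorlog 2 (a * b) \<le> floorlog 2 a + floorlog 2 b"
    by (intro floorlog_leI) (auto simp: power_add)
  then show ?thesis by simp
qed

lemma sz_nat_mono: "(a :: nat) \<le> b \<Longrightarrow> sz a \<le> sz b"
  by (simp add: floorlog_mono)

lemma pt_arith:
  assumes b: "\<And>a c. apply_prim b (Pair (Num a) (Num c)) = repr (h a c)"
    and s: "\<And>a c. sz (h a c) \<le> sz a + sz c + 2"
    and "ptime f" "ptime g"
  shows "ptime (\<lambda>x. h (f x :: nat) (g x :: nat))"
proof -
  have "ptime (\<lambda>z. h (fst z) (snd z))"
  proof (rule pt_prim[of "\<lambda>s. s + 2" b])
    show "polyb (\<lambda>s. s + 2)" by (intro polyb_add polyb_id polyb_const)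
    show "apply_prim b (repr x) = repr (h (fst x) (snd x))" for x by (cases x) (use b in auto)
    show "sz (h (fst x) (snd x)) \<le> sz x + 2" for x
      using s[of "fst x" "snd x"] by (cases x) auto
  qed
  from pt_comp[OF this pt_pair[OF assms(3,4)]] show ?thesis by simp
qed

lemma pt_less: "ptime f \<Longrightarrow> ptime g \<Longrightarrow> ptime (\<lambda>x. (f x :: nat) < g x)"
  by (rule pt_arith[where b = PLess and h = "(<)"]) (auto simp: floorlog_def)

lemma pt_add: "ptime f \<Longrightarrow> ptime g \<Longrightarrow> ptime (\<lambda>x. (f x :: nat) + g x)"
  by (rule pt_arith[where b = PAdd and h = "(+)"]) (use sz_nat_add in \<open>auto intro: le_SucI\<close>)

lemma pt_sub: "ptime f \<Longrightarrow> ptime g \<Longrightarrow> ptime (\<lambda>x. (f x :: nat) - g x)"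
proof (rule pt_arith[where b = PSub and h = "(-)"])
  show "sz (a - c) \<le> sz a + sz c + 2" for a c :: nat
    using sz_nat_mono[of "a - c" a] by simp
qed auto

lemma pt_mult: "ptime f \<Longrightarrow> ptime g \<Longrightarrow> ptime (\<lambda>x. (f x :: nat) * g x)"
  by (rule pt_arith[where b = PMul and h = "(*)"]) (use sz_nat_mult in \<open>auto intro: le_SucI\<close>)

lemma pt_div: "ptime f \<Longrightarrow> ptime g \<Longrightarrow> ptime (\<lambda>x. (f x :: nat) div g x)"
proof (rule pt_arith[where b = PDiv and h = "(div)"])
  show "sz (a div c) \<le> sz a + sz c + 2" for a c :: nat
    using sz_nat_mono[of "a div c" a] by simp
qed auto

lemma pt_not: "ptime b \<Longrightarrow> ptime (\<lambda>x. \<not> b x)"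
proof -
  assume "ptime b"
  then have "ptime (\<lambda>x. if b x then False else True)" by (intro pt_if pt_const)
  moreover have "(\<lambda>x. if b x then False else True) = (\<lambda>x. \<not> b x)" by auto
  ultimately show ?thesis by simp
qed

lemma pt_conj: "ptime b \<Longrightarrow> ptime c \<Longrightarrow> ptime (\<lambda>x. b x \<and> c x)"
proof -
  assume "ptime b" "ptime c"
  then have "ptime (\<lambda>x. if b x then c x else False)" by (intro pt_if pt_const)
  moreover have "(\<lambda>x. if b x then c x else False) = (\<lambda>x. b x \<and> c x)" by auto
  ultimately show ?thesis by simp
qed

lemma pt_disj: "ptime b \<Longrightarrow> ptime c \<Longrightarrow> ptime (\<lambda>x. b x \<or> c x)"
  using pt_not[OF pt_conj[OF pt_not pt_not, of b c]] by simp

lemma pt_le: "ptime f \<Longrightarrow> ptime g \<Longrightarrow> ptime (\<lambda>x. (f x :: nat) \<le> g x)"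
  using pt_not[OF pt_less, of g f] by (simp add: not_less)

lemma pt_eq: "ptime f \<Longrightarrow> ptime g \<Longrightarrow> ptime (\<lambda>x. (f x :: nat) = g x)"
  using pt_conj[OF pt_le pt_le, of f g g f] by (simp add: order_eq_iff)

lemma pt_Cons: "ptime f \<Longrightarrow> ptime g \<Longrightarrow> ptime (\<lambda>x. f x # g x)"
proof -
  assume "ptime f" "ptime g"
  \<comment> \<open>A list cell is encoded like a pair, so the identity program computes
    \<open>Cons\<close>.\<close>
  have "ptime (\<lambda>z. fst z # snd z)"
    by (rule pt_prim[of "\<lambda>s. s" PId]) (auto simp: repr_prod_eq polyb_id)
  from pt_comp[OF this pt_pair[OF \<open>ptime f\<close> \<open>ptime g\<close>]] show ?thesis by simp
qed

text \<open>Nonempty lists are encoded as pairs and the empty list as a number, so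
  \<open>PIsPair\<close> is the whole case distinction.\<close>

lemma pt_case_list:
  assumes xs: "ptime xs" and a: "ptime a" and b: "ptime (\<lambda>z. b (fst z) (fst (snd z)) (snd (snd z)))"
  shows "ptime (\<lambda>x. case xs x of [] \<Rightarrow> a x | y # ys \<Rightarrow> b x y ys)"
proof -
  obtain X p where X: "runs X p (\<lambda>x. (xs x))" by (rule ptimeE[OF xs])
  note X = runsD[OF X]
  obtain A q where A: "runs A q (\<lambda>x. (a x))" by (rule ptimeE[OF a])
  note A = runsD[OF A]
  obtain B l where B: "runs B l (\<lambda>z. (b (fst z) (fst (snd z)) (snd (snd z))))" by (rule ptimeE[OF b])
  note B = runsD[OF B]
  let ?T = "Seq X (Prim PIsPair)" and ?R = "Seq (Fork (Prim PId) X) B"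
  let ?p = "\<lambda>s. 1 + (p s + (p s + 2)) + (1 + (s + s) + p s + l (1 + s + p s)) + q s"
  show ?thesis
  proof (rule ptimeI[where p = ?p and P = "Cond ?T ?R A"])
    show "polyb ?p" by (intro polyb_add polyb_comp[OF B(1)] X(1) A(1) polyb_const polyb_id)
    fix x
    obtain m where m: "m \<le> p (sz x)" "exec X (repr x) (repr (xs x)) m" using X(3)[of x] by blast
    obtain n where n: "n \<le> q (sz x)" "exec A (repr x) (repr (a x)) n" using A(3)[of x] by blast
    have T: "exec ?T (repr x) (apply_prim PIsPair (repr (xs x)))
        (m + (sz (xs x) + vsize (apply_prim PIsPair (repr (xs x)))))"
      by (rule exec.Seq[OF m(2) exec.Prim])
    show "\<exists>n \<le> ?p (sz x). exec (Cond ?T ?R A) (repr x)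
        (repr (case xs x of [] \<Rightarrow> a x | y # ys \<Rightarrow> b x y ys)) n"
    proof (cases "xs x")
      case Nil
      then have "exec ?T (repr x) (Num 0) (m + 2)" using T by (simp add: floorlog_def)
      then have "exec (Cond ?T ?R A) (repr x) (repr (a x)) (1 + (m + 2) + n)"
        using n by (intro exec.Cond_False) auto
      then show ?thesis using Nil m n by (intro exI[of _ "1 + (m + 2) + n"]) auto
    next
      case (Cons y ys)
      let ?z = "(x, y, ys)"
      \<comment> \<open>The input paired with the nonempty list is already the encoding of the
        triple that the second branch expects.\<close>
      have e: "repr ?z = Pair (repr x) (repr (xs x))" using Cons by simp
      have s: "sz ?z \<le> 1 + sz x + p (sz x)" using X(4)[of x] e by simp
      have T': "exec ?T (repr x) (Num 1) (m + (sz (xs x) + 2))"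
        using T Cons by (simp add: floorlog_def)
      have I: "exec (Prim PId) (repr x) (repr x) (sz x + sz x)" using exec.Prim[of PId "repr x"] by simp
      obtain k where k: "k \<le> l (sz ?z)" "exec B (repr ?z) (repr (b x y ys)) k" using B(3)[of ?z] by auto
      have "exec (Cond ?T ?R A) (repr x) (repr (b x y ys))
          (1 + (m + (sz (xs x) + 2)) + (1 + (sz x + sz x) + m + k))"
        by (rule exec.Cond_True[OF T'], simp, rule exec.Seq[OF exec.Fork[OF I m(2)]])
          (use k(2) e in simp)
      moreover have "k \<le> l (1 + sz x + p (sz x))" using k(1) monoD[OF B(2) s] by linarith
      ultimately show ?thesis using Cons m X(4)[of x]
        by (intro exI[of _ "1 + (m + (sz (xs x) + 2)) + (1 + (sz x + sz x) + m + k)"]) auto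
    qed
  qed
qed

section \<open>Bounded loops: folds, maps, filters, sums, products\<close>

subsection \<open>Loops over lists\<close>

lemma length_le_sz: "length xs \<le> sz xs"
  by (induction xs) auto

lemma sz_mem: "a \<in> set xs \<Longrightarrow> sz a \<le> sz xs"
  by (induction xs) auto

lemma sz_drop: "sz (drop i xs) \<le> sz xs"
proof (induction xs arbitrary: i)
  case (Cons a xs)
  then show ?case by (cases i) (auto intro: le_SucI trans_le_add2)
qed simp

text \<open>The loop carries the environment, the rest of the list and the state. The number of
  rounds is at most the input size, but polynomial steps alone could square the state in every
  round; hence the separate bound on all intermediate states.\<close>

lemma pt_fold_raw:
  fixes step :: "'e::representable \<Rightarrow> 'a::representable \<Rightarrow> 's::representable \<Rightarrow> 's"
  assumes step: "ptime (\<lambda>z. step (fst z) (fst (snd z)) (snd (snd z)))"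
    and q: "polyb q"
    and size: "\<And>e xs st i. i \<le> length xs \<Longrightarrow>
      sz (fold (step e) (take i xs) st) \<le> q (sz (e, xs, st))"
  shows "ptime (\<lambda>z. fold (step (fst z)) (fst (snd z)) (snd (snd z)))"
proof -
  define body where "body = (\<lambda>z. case fst (snd z) of [] \<Rightarrow> z
    | a # ys \<Rightarrow> (fst z, ys, step (fst z) a (snd (snd z))))"
  have body_ptime: "ptime body"
    unfolding body_def
  proof (intro pt_case_list pt_fst pt_snd pt_id pt_pair)
    show "ptime (\<lambda>z. step (fst (fst z)) (fst (snd z)) (snd (snd (fst z))))"
      using pt_comp[OF step, of "\<lambda>z. (fst (fst z), fst (snd z), snd (snd (fst z)))"]
      by (simp add: pt_pair pt_fst pt_snd pt_id)
  qed
  obtain P p where P: "runs P p (\<lambda>z. (body z))" by (rule ptimeE[OF body_ptime])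
  note P = runsD[OF P]
  have "ptime (\<lambda>z :: 'e \<times> 'a list \<times> 's. (case fst (snd z) of [] \<Rightarrow> False | a # ys \<Rightarrow> True))"
    by (intro pt_case_list pt_fst pt_snd pt_id pt_const)
  then obtain T p' where T: "runs T p' (\<lambda>z :: 'e \<times> 'a list \<times> 's. (case fst (snd z) of [] \<Rightarrow> False | a # ys \<Rightarrow> True))"
    by (rule ptimeE)
  note T = runsD[OF T]
  have loop: "\<exists>n \<le> (length xs + 1) * (1 + p' M + p M).
      exec (While T P) (repr (e, xs, st)) (repr (e, [] :: 'a list, fold (step e) xs st)) n"
    if "\<And>i. i \<le> length xs \<Longrightarrow> sz (e, drop i xs, fold (step e) (take i xs) st) \<le> M" for e xs st M
    using that
  proof (induction xs arbitrary: st)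
    case Nil
    obtain n where n: "n \<le> p' (sz (e, [] :: 'a list, st))" "exec T (repr (e, [] :: 'a list, st)) (Num 0) n"
      using T(3)[of "(e, [], st)"] by auto
    have "p' (sz (e, [] :: 'a list, st)) \<le> p' M" using Nil[of 0] by (intro monoD[OF T(2)]) simp
    then show ?case using n exec.While_Done[OF n(2), of P]
      by (intro exI[of _ "1 + n"]) auto
  next
    case (Cons a xs)
    let ?z = "(e, a # xs, st)" and ?st = "step e a st"
    have M: "sz ?z \<le> M" using Cons.prems[of 0] by simp
    obtain n where n: "n \<le> p' (sz ?z)" "exec T (repr ?z) (Num 1) n"
      using T(3)[of ?z] by auto
    obtain m where m: "m \<le> p (sz ?z)" "exec P (repr ?z) (repr (e, xs, ?st)) m"
      using P(3)[of ?z] by (auto simp: body_def)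
    have "sz (e, drop i xs, fold (step e) (take i xs) ?st) \<le> M" if "i \<le> length xs" for i
      using Cons.prems[of "Suc i"] that by simp
    then obtain k where k: "k \<le> (length xs + 1) * (1 + p' M + p M)"
      "exec (While T P) (repr (e, xs, ?st)) (repr (e, [] :: 'a list, fold (step e) xs ?st)) k"
      using Cons.IH by blast
    have "exec (While T P) (repr ?z) (repr (e, [] :: 'a list, fold (step e) (a # xs) st)) (1 + n + m + k)"
      using exec.While_Step[OF n(2) _ m(2) k(2)] by simp
    moreover have "p' (sz ?z) \<le> p' M" "p (sz ?z) \<le> p M" by (rule monoD[OF T(2) M], rule monoD[OF P(2) M])
    then have "1 + n + m + k \<le> (length (a # xs) + 1) * (1 + p' M + p M)"
      using n m k by simp
    ultimately show ?case by blast
  qed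
  \<comment> \<open>Two pair constructors, the environment, the remaining list and the
    state.\<close>
  let ?M = "\<lambda>s. 2 + s + s + q s"
  have main: "ptime (\<lambda>z. (fst z, [] :: 'a list, fold (step (fst z)) (fst (snd z)) (snd (snd z))))"
  proof (rule ptimeI[where p = "\<lambda>s. (s + 1) * (1 + p' (?M s) + p (?M s))" and P = "While T P"])
    show "polyb (\<lambda>s. (s + 1) * (1 + p' (?M s) + p (?M s)))"
      by (intro polyb_add polyb_mult polyb_comp[OF T(1)] polyb_comp[OF P(1)] q polyb_const polyb_id)
    fix z :: "'e \<times> 'a list \<times> 's"
    obtain e xs st where z: "z = (e, xs, st)" by (cases z)
    have "sz (e, drop i xs, fold (step e) (take i xs) st) \<le> ?M (sz z)" if "i \<le> length xs" for i
      using size[OF that, of e st] sz_drop[of i xs] by (simp add: z)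
    from loop[OF this] obtain n where n: "n \<le> (length xs + 1) * (1 + p' (?M (sz z)) + p (?M (sz z)))"
      "exec (While T P) (repr (e, xs, st)) (repr (e, [] :: 'a list, fold (step e) xs st)) n" by blast
    have "length xs \<le> sz z" using length_le_sz[of xs] by (simp add: z)
    then have "(length xs + 1) * (1 + p' (?M (sz z)) + p (?M (sz z)))
        \<le> (sz z + 1) * (1 + p' (?M (sz z)) + p (?M (sz z)))" by (intro mult_right_mono) auto
    with n show "\<exists>n \<le> (sz z + 1) * (1 + p' (?M (sz z)) + p (?M (sz z))). exec (While T P) (repr z)
        (repr (fst z, [] :: 'a list, fold (step (fst z)) (fst (snd z)) (snd (snd z)))) n"
      unfolding z fst_conv snd_conv by (meson order_trans)
  qed
  from pt_snd[OF pt_snd[OF main]] show ?thesis by simp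
qed

text \<open>In a loop whose state grows by an amount that depends on the environment and the current list
  element only, all intermediate states have polynomial size.\<close>

lemma pt_fold:
  fixes step :: "'e::representable \<Rightarrow> 'a::representable \<Rightarrow> 's::representable \<Rightarrow> 's"
  assumes xs: "ptime xs" and init: "ptime init"
    and step: "ptime (\<lambda>z. step (fst z) (fst (snd z)) (snd (snd z)))"
    and q: "polyb q"
    and size: "\<And>e a st. sz (step e a st) \<le> sz st + q (sz e + sz a)"
  shows "ptime (\<lambda>x. fold (step x) (xs x) (init x))"
proof -
  obtain q' where q': "polyb q'" "mono q'" "\<And>s. q s \<le> q' s" using polyb_mono[OF q] by blast
  have bound: "sz (fold (step e) ys st) \<le> sz st + length ys * q' (sz e + sz zs)"
    if "set ys \<subseteq> set zs" for e st and ys zs :: "'a list"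
    using that
  proof (induction ys arbitrary: st)
    case (Cons a ys)
    have "sz a \<le> sz zs" using Cons.prems by (auto intro: sz_mem)
    then have "q (sz e + sz a) \<le> q' (sz e + sz zs)"
      using q'(3)[of "sz e + sz a"] monoD[OF q'(2), of "sz e + sz a" "sz e + sz zs"] by linarith
    then show ?case using Cons.IH[of "step e a st"] size[of e a st] Cons.prems by auto
  qed simp
  have "ptime (\<lambda>z. fold (step (fst z)) (fst (snd z)) (snd (snd z)))"
  proof (rule pt_fold_raw[OF step, of "\<lambda>s. s + s * q' s"])
    show "polyb (\<lambda>s. s + s * q' s)" using q'(1) by (intro polyb_add polyb_mult polyb_id)
    fix e st i and xs :: "'a list" assume i: "i \<le> length xs"
    have "sz (fold (step e) (take i xs) st) \<le> sz st + i * q' (sz e + sz xs)"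
      using bound[of "take i xs" xs e st] i set_take_subset by fastforce
    also have "\<dots> \<le> sz st + sz (e, xs, st) * q' (sz (e, xs, st))"
    proof -
      have "i \<le> sz (e, xs, st)" using i length_le_sz[of xs] by simp
      moreover have "q' (sz e + sz xs) \<le> q' (sz (e, xs, st))" by (intro monoD[OF q'(2)]) auto
      ultimately show ?thesis by (intro add_left_mono mult_mono) auto
    qed
    finally show "sz (fold (step e) (take i xs) st) \<le> sz (e, xs, st) + sz (e, xs, st) * q' (sz (e, xs, st))"
      by simp
  qed
  from pt_comp[OF this pt_pair[OF pt_id pt_pair[OF xs init]]] show ?thesis by simp
qed

text \<open>Results never exceed the running time. This turns polynomial time of a loop body into
  the growth bound that \<open>pt_fold\<close> asks for.\<close>

lemma ptime_size:
  assumes "ptime (\<lambda>z. f (fst z) (snd z))"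
  obtains q where "polyb q" "\<And>e a. sz (f e a) \<le> q (sz e + sz a)"
proof -
  obtain P p where P: "runs P p (\<lambda>z. (f (fst z) (snd z)))" by (rule ptimeE[OF assms])
  note P = runsD[OF P]
  show ?thesis
  proof (rule that[of "\<lambda>s. p (1 + s)"])
    show "polyb (\<lambda>s. p (1 + s))" by (intro polyb_comp[OF P(1)] polyb_add polyb_const polyb_id)
    show "sz (f e a) \<le> p (1 + (sz e + sz a))" for e a using P(4)[of "(e, a)"] by (simp add: add.assoc)
  qed
qed

lemma rev_fold: "rev xs = fold Cons xs []"
  using fold_Cons_rev[of xs] by (simp add: fun_eq_iff)

lemma pt_rev: "ptime xs \<Longrightarrow> ptime (\<lambda>x. rev (xs x))"
  unfolding rev_fold
  by (rule pt_fold[of _ _ "\<lambda>e. Cons" "\<lambda>s. 1 + s"])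
    (auto intro!: pt_const pt_Cons pt_fst pt_snd pt_id polyb_Suc)

lemma pt_map:
  assumes "ptime xs" "ptime (\<lambda>z. f (fst z) (snd z))"
  shows "ptime (\<lambda>x. map (f x) (xs x))"
proof -
  obtain q where q: "polyb q" "\<And>e a. sz (f e a) \<le> q (sz e + sz a)" using ptime_size[OF assms(2)] by blast
  have "ptime (\<lambda>x. rev (fold (\<lambda>a acc. f x a # acc) (xs x) []))"
  proof (intro pt_rev pt_fold[of _ _ _ "\<lambda>s. 1 + q s"] assms(1) pt_const pt_Cons pt_fst pt_snd pt_id)
    show "ptime (\<lambda>z. f (fst z) (fst (snd z)))"
      using pt_comp[OF assms(2), of "\<lambda>z. (fst z, fst (snd z))"] by (simp add: pt_pair pt_fst pt_snd pt_id)
    show "polyb (\<lambda>s. 1 + q s)" using q(1) by (intro polyb_add polyb_const)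
  qed (use q in \<open>auto simp: add.commute\<close>)
  moreover have "fold (\<lambda>a acc. f x a # acc) ys acc = rev (map (f x) ys) @ acc" for x ys acc
    by (induction ys arbitrary: acc) auto
  ultimately show ?thesis by simp
qed

lemma pt_filter:
  assumes "ptime xs" "ptime (\<lambda>z. P (fst z) (snd z))"
  shows "ptime (\<lambda>x. filter (P x) (xs x))"
proof -
  have "ptime (\<lambda>x. rev (fold (\<lambda>a acc. if P x a then a # acc else acc) (xs x) []))"
  proof (intro pt_rev pt_fold[of _ _ _ "\<lambda>s. 1 + s"] assms(1) pt_const pt_if pt_Cons pt_fst pt_snd pt_id)
    show "ptime (\<lambda>z. P (fst z) (fst (snd z)))"
      using pt_comp[OF assms(2), of "\<lambda>z. (fst z, fst (snd z))"] by (simp add: pt_pair pt_fst pt_snd pt_id)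
    show "polyb (\<lambda>s. 1 + s)" by (intro polyb_add polyb_id polyb_const)
  qed auto
  moreover have "fold (\<lambda>a acc. if P x a then a # acc else acc) ys acc = rev (filter (P x) ys) @ acc" for x ys acc
    by (induction ys arbitrary: acc) auto
  ultimately show ?thesis by simp
qed

lemma pt_append: "ptime xs \<Longrightarrow> ptime ys \<Longrightarrow> ptime (\<lambda>x. xs x @ ys x)"
proof -
  assume "ptime xs" "ptime ys"
  then have "ptime (\<lambda>x. fold Cons (rev (xs x)) (ys x))"
    by (intro pt_fold[of _ _ "\<lambda>e. Cons" "\<lambda>s. 1 + s"] pt_rev)
      (auto intro!: pt_Cons pt_fst pt_snd pt_id polyb_Suc)
  then show ?thesis by (simp add: fold_Cons_rev)
qed

lemma sz_append: "sz (xs @ ys) \<le> sz xs + sz ys"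
  by (induction xs) auto

lemma pt_concat: "ptime xs \<Longrightarrow> ptime (\<lambda>x. concat (xs x))"
proof -
  assume "ptime xs"
  then have "ptime (\<lambda>x. fold (\<lambda>a acc. acc @ a) (xs x) [])"
  proof (rule pt_fold[of _ _ "\<lambda>e a acc. acc @ a" "\<lambda>s. s"])
    show "sz (st @ a) \<le> sz st + (sz e + sz a)" for e :: 'a and a st :: "'b list"
      using sz_append[of st a] by simp
  qed (auto intro!: pt_const pt_append pt_fst pt_snd pt_id polyb_id)
  moreover have "fold (\<lambda>a acc. acc @ a) yss acc = acc @ concat yss" for yss and acc :: "'b list"
    by (induction yss arbitrary: acc) auto
  ultimately show ?thesis by simp
qed

lemma pt_Bex:
  assumes "ptime xs" "ptime (\<lambda>z. P (fst z) (snd z))"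
  shows "ptime (\<lambda>x. \<exists>a\<in>set (xs x). P x a)"
proof -
  have "ptime (\<lambda>x. case filter (P x) (xs x) of [] \<Rightarrow> False | a # ys \<Rightarrow> True)"
    by (intro pt_case_list pt_filter assms pt_const)
  moreover have "(case filter (P x) (xs x) of [] \<Rightarrow> False | a # ys \<Rightarrow> True) = (\<exists>a\<in>set (xs x). P x a)" for x
  proof (cases "filter (P x) (xs x)")
    case (Cons a ys)
    have "a \<in> set (filter (P x) (xs x))" unfolding Cons by simp
    then have "a \<in> set (xs x) \<and> P x a" by (simp only: set_filter mem_Collect_eq)
    then show ?thesis unfolding Cons by auto
  qed (auto simp: filter_empty_conv)
  ultimately show ?thesis by simp
qed

lemma pt_Ball:
  assumes "ptime xs" "ptime (\<lambda>z. P (fst z) (snd z))"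
  shows "ptime (\<lambda>x. \<forall>a\<in>set (xs x). P x a)"
  using pt_not[OF pt_Bex[OF assms(1) pt_not[OF assms(2)]]] by simp

lemma pt_mem:
  assumes "ptime f" "ptime xs" shows "ptime (\<lambda>x. (f x :: nat) \<in> set (xs x))"
proof -
  have "ptime (\<lambda>x. \<exists>a\<in>set (xs x). a = f x)"
    using pt_comp[OF assms(1) pt_fst[OF pt_id]] by (intro pt_Bex assms pt_eq pt_snd pt_id)
  then show ?thesis by (simp add: eq_commute)
qed

lemma pt_sum_list:
  assumes "ptime xs" "ptime (\<lambda>z. f (fst z) (snd z) :: nat)"
  shows "ptime (\<lambda>x. sum_list (map (f x) (xs x)))"
proof -
  obtain q where q: "polyb q" "\<And>e a. sz (f e a) \<le> q (sz e + sz a)" using ptime_size[OF assms(2)] by blast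
  have "ptime (\<lambda>x. fold (\<lambda>a acc. acc + f x a) (xs x) 0)"
  proof (intro pt_fold[of _ _ _ q] assms(1) pt_const pt_add pt_fst pt_snd pt_id q(1))
    show "ptime (\<lambda>z. f (fst z) (fst (snd z)))"
      using pt_comp[OF assms(2), of "\<lambda>z. (fst z, fst (snd z))"] by (simp add: pt_pair pt_fst pt_snd pt_id)
    show "sz (st + f e a) \<le> sz st + q (sz e + sz a)" for e a st
      using sz_nat_add[of st "f e a"] q(2)[of e a] by linarith
  qed
  moreover have "fold (\<lambda>a acc. acc + f x a) ys acc = acc + sum_list (map (f x) ys)" for x ys acc
    by (induction ys arbitrary: acc) auto
  ultimately show ?thesis by simp
qed

text \<open>The length of a product is at most the sum of the lengths of its factors
  (\<open>sz_nat_mult\<close>), so the accumulator grows additively. The common denominator of the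
  flow weights is computed this way.\<close>

lemma pt_prod_list:
  assumes "ptime xs" "ptime (\<lambda>z. f (fst z) (snd z) :: nat)"
  shows "ptime (\<lambda>x. prod_list (map (f x) (xs x)))"
proof -
  obtain q where q: "polyb q" "\<And>e a. sz (f e a) \<le> q (sz e + sz a)" using ptime_size[OF assms(2)] by blast
  have "ptime (\<lambda>x. fold (\<lambda>a acc. acc * f x a) (xs x) 1)"
  proof (intro pt_fold[of _ _ _ q] assms(1) pt_const pt_mult pt_fst pt_snd pt_id q(1))
    show "ptime (\<lambda>z. f (fst z) (fst (snd z)))"
      using pt_comp[OF assms(2), of "\<lambda>z. (fst z, fst (snd z))"] by (simp add: pt_pair pt_fst pt_snd pt_id)
    show "sz (st * f e a) \<le> sz st + q (sz e + sz a)" for e a st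
      using sz_nat_mult[of st "f e a"] q(2)[of e a] by linarith
  qed
  moreover have "fold (\<lambda>a acc. acc * f x a) ys acc = acc * prod_list (map (f x) ys)" for x ys acc
    by (induction ys arbitrary: acc) auto
  ultimately show ?thesis by simp
qed

lemma pt_length: "ptime xs \<Longrightarrow> ptime (\<lambda>x. length (xs x))"
proof -
  assume "ptime xs"
  then have "ptime (\<lambda>x. sum_list (map (\<lambda>_. 1 :: nat) (xs x)))" by (intro pt_sum_list pt_const)
  then show ?thesis by (simp add: sum_list_triv)
qed

lemmas pt_intros = pt_id pt_const pt_fst pt_snd pt_pair pt_if pt_less pt_le pt_eq pt_add pt_sub pt_mult
  pt_div pt_not pt_conj pt_disj pt_Cons pt_rev pt_map pt_filter pt_append pt_concat pt_Bex
  pt_Ball pt_mem pt_sum_list pt_prod_list pt_length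

section \<open>Path flows: walks, weighted families, routing to a single sink\<close>

section \<open>Path flows\<close>

text \<open>Keeps the direction of travel, which \<open>path_edges\<close> forgets: a path becomes a
  subset of a relation, and net flow can be expressed.\<close>

definition arcs :: "'a list \<Rightarrow> ('a \<times> 'a) set" where
  "arcs p = set (zip p (tl p))"

lemma arcs_simps [simp]:
  "arcs [] = {}" "arcs [x] = {}" "arcs (x # y # p) = insert (x, y) (arcs (y # p))"
  by (simp_all add: arcs_def)

lemma path_edges_arcs: "path_edges p = (\<lambda>(a, b). {a, b}) ` arcs p"
  by (simp add: path_edges_def arcs_def)

lemma path_edges_single [simp]: "path_edges [x] = {}"
  by (simp add: path_edges_arcs)

lemma arcs_in_set: "(a, b) \<in> arcs p \<Longrightarrow> a \<in> set p \<and> b \<in> set p"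
  by (induction p rule: induct_list012) auto

lemma arcs_append: "p \<noteq> [] \<Longrightarrow> q \<noteq> [] \<Longrightarrow> arcs (p @ q) = arcs p \<union> arcs q \<union> {(last p, hd q)}"
  by (induction p rule: induct_list012) (cases q; auto)+

lemma arcs_snoc: "p \<noteq> [] \<Longrightarrow> arcs (p @ [x]) = insert (last p, x) (arcs p)"
  by (subst arcs_append) auto

lemma arcs_rev: "arcs (rev p) = (arcs p)\<inverse>"
proof (induction p rule: induct_list012)
  case (3 x y zs)
  have "arcs (rev (x # y # zs)) = arcs (rev (y # zs) @ [x])" by simp
  also have "\<dots> = insert (y, x) (arcs (rev (y # zs)))" by (subst arcs_snoc) (auto simp: last_rev)
  finally show ?case using 3(2) by auto
qed auto

lemma path_edges_rev [simp]: "path_edges (rev p) = path_edges p"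
  unfolding path_edges_arcs arcs_rev by (auto simp: image_def doubleton_eq_iff)

lemma arcs_distinct_neq: "distinct p \<Longrightarrow> (a, b) \<in> arcs p \<Longrightarrow> a \<noteq> b"
  by (induction p rule: induct_list012) auto

lemma set_arcs: "p \<noteq> [] \<Longrightarrow> set p = insert (hd p) (snd ` arcs p)"
  by (induction p rule: induct_list012) auto

text \<open>Loop erasure: if the new first vertex already occurs on the path, everything before that
  occurrence is dropped.\<close>

lemma rtrancl_path:
  "(a, b) \<in> R\<^sup>* \<Longrightarrow> \<exists>p. p \<noteq> [] \<and> distinct p \<and> hd p = a \<and> last p = b \<and> arcs p \<subseteq> R"
proof (induction rule: converse_rtrancl_induct)
  case base
  show ?case by (intro exI[of _ "[b]"]) auto
next
  case (step a y)
  then obtain p where p: "p \<noteq> []" "distinct p" "hd p = y" "last p = b" "arcs p \<subseteq> R" by blast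
  show ?case
  proof (cases "a \<in> set p")
    case True
    then obtain us vs where us: "p = us @ a # vs" by (meson split_list)
    have "arcs (a # vs) \<subseteq> arcs p"
      by (cases "us = []") (use us in \<open>auto simp: arcs_append\<close>)
    then show ?thesis using p us by (intro exI[of _ "a # vs"]) auto
  next
    case False
    then show ?thesis using p step(1) by (intro exI[of _ "a # p"]) (cases p; auto)
  qed
qed

lemma hd_last_rtrancl: "w \<noteq> [] \<Longrightarrow> (hd w, last w) \<in> (arcs w)\<^sup>*"
proof (induction w rule: induct_list012)
  case (3 x y zs)
  then have "(y, last (y # zs)) \<in> (arcs (y # zs))\<^sup>*" by simp
  then have "(y, last (y # zs)) \<in> (arcs (x # y # zs))\<^sup>*"
    by (rule subsetD[OF rtrancl_mono, rotated]) auto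
  then show ?case by (auto intro: converse_rtrancl_into_rtrancl)
qed auto

text \<open>Chosen, not computed: it occurs only in flows whose existence is asserted, never in the
  algorithm.\<close>

definition shortcut :: "'a list \<Rightarrow> 'a list" where
  "shortcut w = (SOME p. p \<noteq> [] \<and> distinct p \<and> hd p = hd w \<and> last p = last w \<and> arcs p \<subseteq> arcs w)"

lemma shortcut:
  assumes "w \<noteq> []"
  shows "shortcut w \<noteq> []" "distinct (shortcut w)" "hd (shortcut w) = hd w"
    "last (shortcut w) = last w" "path_edges (shortcut w) \<subseteq> path_edges w" "set (shortcut w) \<subseteq> set w"
proof -
  have "\<exists>p. p \<noteq> [] \<and> distinct p \<and> hd p = hd w \<and> last p = last w \<and> arcs p \<subseteq> arcs w"
    using rtrancl_path[OF hd_last_rtrancl[OF assms]] .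
  from someI_ex[OF this] have *: "shortcut w \<noteq> [] \<and> distinct (shortcut w) \<and> hd (shortcut w) = hd w
    \<and> last (shortcut w) = last w \<and> arcs (shortcut w) \<subseteq> arcs w" unfolding shortcut_def .
  then show "shortcut w \<noteq> []" "distinct (shortcut w)" "hd (shortcut w) = hd w"
    "last (shortcut w) = last w" "path_edges (shortcut w) \<subseteq> path_edges w" by (auto simp: path_edges_arcs)
  have "snd ` arcs (shortcut w) \<subseteq> snd ` arcs w" using * by blast
  then show "set (shortcut w) \<subseteq> set w" using * assms by (simp add: set_arcs) blast
qed

lemma is_path_rev [simp]: "is_path V E (rev p) \<longleftrightarrow> is_path V E p"
  by (simp add: is_path_def)

lemma join_path:
  assumes p: "is_path V E p" and q: "is_path V E q" and pq: "last p = hd q"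
  shows "hd (shortcut (p @ tl q)) = hd p" "last (shortcut (p @ tl q)) = last q"
    "is_path V E (shortcut (p @ tl q))" "path_edges (shortcut (p @ tl q)) \<subseteq> path_edges p \<union> path_edges q"
proof -
  have ne: "p \<noteq> []" "q \<noteq> []" "p @ tl q \<noteq> []" using p q by (auto simp: is_path_def)
  obtain z r where r: "q = z # r" using ne by (cases q) auto
  have "path_edges (p @ tl q) \<subseteq> path_edges p \<union> path_edges q"
  proof (cases "r = []")
    case False
    then have "arcs (p @ r) = arcs p \<union> arcs r \<union> {(z, hd r)}" using ne r pq by (simp add: arcs_append)
    moreover have "arcs (z # r) = insert (z, hd r) (arcs r)" using False by (cases r) auto
    ultimately have "arcs (p @ r) = arcs p \<union> arcs (z # r)" by simp
    then have "path_edges (p @ r) = path_edges p \<union> path_edges (z # r)"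
      unfolding path_edges_arcs by (simp only: image_Un)
    then show ?thesis using r by simp
  qed (use r in auto)
  note e = this and sh = shortcut[OF ne(3)]
  show "hd (shortcut (p @ tl q)) = hd p" using sh ne by simp
  show "last (shortcut (p @ tl q)) = last q" using sh ne r pq by (simp add: last_append)
  show s: "path_edges (shortcut (p @ tl q)) \<subseteq> path_edges p \<union> path_edges q" using sh e by blast
  have "set (shortcut (p @ tl q)) \<subseteq> set p \<union> set q" using sh(6) r by auto
  then show "is_path V E (shortcut (p @ tl q))"
    using p q s sh unfolding is_path_def by blast
qed

lemma finite_paths: "finite V \<Longrightarrow> finite {p. is_path V E p}"
  by (rule finite_subset[OF _ finite_subset_distinct]) (auto simp: is_path_def)

lemma feasible_finite:
  assumes "finite V" "feasible_flow V E c g" shows "finite {p. g p \<noteq> 0}"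
  by (rule finite_subset[OF _ finite_paths[OF assms(1)]]) (use assms(2) in \<open>auto simp: feasible_flow_def\<close>)

text \<open>The constructions below yield weighted families in which one path may arise from several
  indices. Adding the weights over each fibre makes every \<open>flow_sum\<close> a sum over
  indices.\<close>

lemma flow_family:
  fixes wt :: "'j \<Rightarrow> real" and pp :: "'j \<Rightarrow> 'a list"
  assumes J: "finite J" and nn: "\<And>j. j \<in> J \<Longrightarrow> 0 \<le> wt j" and path: "\<And>j. j \<in> J \<Longrightarrow> is_path V E (pp j)"
    and cap: "\<And>e. e \<in> E \<Longrightarrow> (\<Sum>j\<in>{j\<in>J. e \<in> path_edges (pp j)}. wt j) \<le> real (c e)"
  obtains g where "feasible_flow V E c g" "\<And>Q. flow_sum g Q = (\<Sum>j\<in>{j\<in>J. Q (pp j)}. wt j)"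
    "\<And>p. g p \<noteq> 0 \<Longrightarrow> \<exists>j\<in>J. pp j = p"
proof -
  define g where "g p = (\<Sum>j\<in>{j\<in>J. pp j = p}. wt j)" for p
  have supp: "\<exists>j\<in>J. pp j = p" if "g p \<noteq> 0" for p
    using that sum.not_neutral_contains_not_neutral[of wt "{j\<in>J. pp j = p}"] unfolding g_def by blast
  have fs: "flow_sum g Q = (\<Sum>j\<in>{j\<in>J. Q (pp j)}. wt j)" for Q
  proof -
    have "flow_sum g Q = sum g (pp ` {j\<in>J. Q (pp j)})"
      unfolding flow_sum_def using J supp by (intro sum.mono_neutral_left) auto
    also have "\<dots> = (\<Sum>p\<in>pp ` {j\<in>J. Q (pp j)}. \<Sum>j\<in>{j\<in>{j\<in>J. Q (pp j)}. pp j = p}. wt j)"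
      unfolding g_def by (intro sum.cong) auto
    also have "\<dots> = (\<Sum>j\<in>{j\<in>J. Q (pp j)}. wt j)"
      using J by (intro sum.image_gen[symmetric]) auto
    finally show ?thesis .
  qed
  show ?thesis
  proof (rule that[of g])
    have "0 \<le> g p" for p unfolding g_def using nn by (auto intro: sum_nonneg)
    moreover have "is_path V E p" if "g p \<noteq> 0" for p using supp[OF that] path by auto
    ultimately show "feasible_flow V E c g" unfolding feasible_flow_def fs using cap by auto
  qed (use fs supp in auto)
qed

lemma flow_sum_finite:
  assumes "finite {p. g p \<noteq> 0}"
  shows "flow_sum g Q = (\<Sum>p\<in>{p. g p \<noteq> 0}. if Q p then g p else 0)"
proof -
  have "{p. g p \<noteq> 0 \<and> Q p} = {p. g p \<noteq> 0} \<inter> {p. Q p}" by auto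
  then show ?thesis unfolding flow_sum_def using assms by (simp add: sum.inter_restrict)
qed

lemma flow_sum_zero [simp]: "flow_sum (\<lambda>p. 0) Q = 0"
  by (simp add: flow_sum_def)

lemma feasible_zero [simp]: "feasible_flow V E c (\<lambda>p. 0)"
  by (simp add: feasible_flow_def)

lemma sum_Collect_if: "finite A \<Longrightarrow> (\<Sum>j\<in>{j\<in>A. P j}. h j) = (\<Sum>j\<in>A. if P j then h j else 0)"
  by (simp add: sum.inter_filter)

text \<open>Demands \<open>\<pi> u * \<pi> v / \<pi> X\<close> are routed by joining half of each pair of sink paths at the common sink.\<close>

lemma well_linked_of_sink_flow:
  assumes V: "finite V" and X: "X \<subseteq> V" and g: "feasible_flow V E c g"
    and sink: "\<And>p. g p \<noteq> 0 \<Longrightarrow> hd p \<in> X \<and> last p = z"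
    and pi: "\<And>v. v \<in> X \<Longrightarrow> flow_sum g (\<lambda>p. hd p = v) = \<pi> v"
  shows "flow_well_linked V E c X \<pi>"
proof -
  define G where "G = {p. g p \<noteq> 0}"
  have fG: "finite G" unfolding G_def by (rule feasible_finite[OF V g])
  have fX: "finite X" using V X finite_subset by blast
  have g0: "0 \<le> g p" for p using g by (auto simp: feasible_flow_def)
  have pathG: "is_path V E p" if "p \<in> G" for p using that g by (auto simp: feasible_flow_def G_def)
  have pi': "\<pi> v = (\<Sum>p\<in>G. if hd p = v then g p else 0)" if "v \<in> X" for v
    using pi[OF that] flow_sum_finite[of g] fG by (simp add: G_def)
  have pi0: "0 \<le> \<pi> v" if "v \<in> X" for v unfolding pi'[OF that] using g0 by (auto intro: sum_nonneg)
  define S where "S = sum \<pi> X"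
  have S: "S = sum g G"
  proof -
    have "S = (\<Sum>v\<in>X. \<Sum>p\<in>G. if hd p = v then g p else 0)" unfolding S_def by (intro sum.cong) (auto simp: pi')
    also have "\<dots> = (\<Sum>p\<in>G. \<Sum>v\<in>X. if hd p = v then g p else 0)" by (rule sum.swap)
    also have "\<dots> = sum g G" using fX sink by (intro sum.cong) (auto simp: G_def)
    finally show ?thesis .
  qed
  show ?thesis
  proof (cases "S = 0")
    case True
    then have "\<pi> v = 0" if "v \<in> X" for v
      using that fX pi0 sum_nonneg_eq_0_iff[of X \<pi>] unfolding S_def by auto
    then show ?thesis unfolding flow_well_linked_def by (intro exI[of _ "\<lambda>p. 0"]) auto
  next
    case False
    then have Spos: "0 < S" using S g0 sum_nonneg[of G g] by auto
    \<comment> \<open>\<open>(p, q)\<close> and \<open>(q, p)\<close> serve the same unordered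
      demand, hence the factor 2 in the denominator of the weights. The demand of a vertex with
      itself is carried by a one-vertex path, which uses no edge.\<close>
    define J where "J = Inl ` {(p, q) \<in> G \<times> G. hd p \<noteq> hd q} \<union> Inr ` X"
    define pp where "pp j = (case j of Inl (p, q) \<Rightarrow> shortcut (p @ tl (rev q)) | Inr u \<Rightarrow> [u])" for j :: "('a list \<times> 'a list) + 'a"
    define wt where "wt j = (case j of Inl (p, q) \<Rightarrow> g p * g q / (2 * S) | Inr u \<Rightarrow> \<pi> u * \<pi> u / S)" for j :: "('a list \<times> 'a list) + 'a"
    have fJ: "finite J" unfolding J_def using fG fX
      by (auto intro: finite_subset[OF _ finite_cartesian_product[OF fG fG]])
    have sumJ: "sum h J = (\<Sum>(p, q)\<in>{(p, q) \<in> G \<times> G. hd p \<noteq> hd q}. h (Inl (p, q))) + (\<Sum>u\<in>X. h (Inr u))"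
      for h :: "('a list \<times> 'a list) + 'a \<Rightarrow> real"
    proof -
      have "finite {(p, q) \<in> G \<times> G. hd p \<noteq> hd q}"
        by (rule finite_subset[OF _ finite_cartesian_product[OF fG fG]]) auto
      then have "sum h J = sum h (Inl ` {(p, q) \<in> G \<times> G. hd p \<noteq> hd q}) + sum h (Inr ` X)"
        unfolding J_def using fX by (intro sum.union_disjoint) auto
      then show ?thesis by (simp add: sum.reindex split_def)
    qed
    have join: "hd (shortcut (p @ tl (rev q))) = hd p"
      "last (shortcut (p @ tl (rev q))) = hd q" "is_path V E (shortcut (p @ tl (rev q)))"
      "path_edges (shortcut (p @ tl (rev q))) \<subseteq> path_edges p \<union> path_edges q"
      if pq: "p \<in> G" "q \<in> G" for p q
    proof -
      have pth: "is_path V E p" "is_path V E (rev q)" using pathG pq by auto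
      have "last p = hd (rev q)" using sink pq pathG[OF pq(2)] by (auto simp: G_def is_path_def hd_rev)
      note j = join_path[OF pth this]
      show "hd (shortcut (p @ tl (rev q))) = hd p" "is_path V E (shortcut (p @ tl (rev q)))" using j by auto
      show "last (shortcut (p @ tl (rev q))) = hd q" using j pathG[OF pq(2)] by (simp add: is_path_def last_rev)
      show "path_edges (shortcut (p @ tl (rev q))) \<subseteq> path_edges p \<union> path_edges q" using j by simp
    qed
    have "\<exists>h. feasible_flow V E c h \<and> (\<forall>Q. flow_sum h Q = (\<Sum>j\<in>{j\<in>J. Q (pp j)}. wt j))"
    proof (rule flow_family[of J wt V E pp c])
      show "finite J" by (rule fJ)
      show "0 \<le> wt j" if "j \<in> J" for j
        using that g0 Spos pi0 by (auto simp: wt_def J_def split: sum.splits)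
      show "is_path V E (pp j)" if "j \<in> J" for j
      proof (cases j)
        case (Inl pq)
        then show ?thesis using that join(3) by (auto simp: pp_def J_def)
      next
        case (Inr u)
        then show ?thesis using that X by (auto simp: pp_def J_def is_path_def)
      qed
      fix e assume e: "e \<in> E"
      let ?l = "\<lambda>p. if e \<in> path_edges p then 1 else 0 :: real"
      have "(\<Sum>j\<in>{j\<in>J. e \<in> path_edges (pp j)}. wt j) = (\<Sum>j\<in>J. if e \<in> path_edges (pp j) then wt j else 0)"
        using fJ by (rule sum_Collect_if)
      also have "\<dots> = (\<Sum>(p, q)\<in>{(p, q) \<in> G \<times> G. hd p \<noteq> hd q}.
          if e \<in> path_edges (shortcut (p @ tl (rev q))) then g p * g q / (2 * S) else 0)"
        unfolding sumJ by (simp add: pp_def wt_def cong: if_cong)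
      also have "\<dots> \<le> (\<Sum>(p, q)\<in>{(p, q) \<in> G \<times> G. hd p \<noteq> hd q}. g p * g q / (2 * S) * (?l p + ?l q))"
      proof (intro sum_mono, clarify)
        fix p q assume pq: "p \<in> G" "q \<in> G"
        have "0 \<le> g p * g q / (2 * S)" using g0[of p] g0[of q] Spos by simp
        then show "(if e \<in> path_edges (shortcut (p @ tl (rev q))) then g p * g q / (2 * S) else 0)
            \<le> g p * g q / (2 * S) * (?l p + ?l q)" using join(4)[OF pq] by auto
      qed
      also have "\<dots> \<le> (\<Sum>(p, q)\<in>G \<times> G. g p * g q / (2 * S) * (?l p + ?l q))"
        using fG g0 Spos by (intro sum_mono2) auto
      also have "\<dots> = (\<Sum>p\<in>G. \<Sum>q\<in>G. g p * g q / (2 * S) * ?l p) + (\<Sum>p\<in>G. \<Sum>q\<in>G. g p * g q / (2 * S) * ?l q)"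
        by (simp add: sum.cartesian_product[symmetric] distrib_left sum.distrib)
      \<comment> \<open>First and second halves load an edge equally. Summing over the other half
        leaves \<open>g p / 2\<close> per path, so both together use exactly the load of
        \<open>g\<close>.\<close>
      also have "(\<Sum>p\<in>G. \<Sum>q\<in>G. g p * g q / (2 * S) * ?l q) = (\<Sum>p\<in>G. \<Sum>q\<in>G. g p * g q / (2 * S) * ?l p)"
        by (subst sum.swap) (simp add: ac_simps)
      also have "(\<Sum>p\<in>G. \<Sum>q\<in>G. g p * g q / (2 * S) * ?l p) = (\<Sum>p\<in>G. g p * ?l p / 2)"
      proof (intro sum.cong refl)
        fix p
        have "(\<Sum>q\<in>G. g p * g q / (2 * S) * ?l p) = g p * ?l p / (2 * S) * sum g G"
          unfolding sum_distrib_left by (intro sum.cong refl) (simp add: mult_ac)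
        then show "(\<Sum>q\<in>G. g p * g q / (2 * S) * ?l p) = g p * ?l p / 2" using S Spos by simp
      qed
      also have "(\<Sum>p\<in>G. g p * ?l p / 2) + (\<Sum>p\<in>G. g p * ?l p / 2) = flow_sum g (\<lambda>p. e \<in> path_edges p)"
        using fG by (subst flow_sum_finite) (auto simp: G_def sum.distrib[symmetric] intro!: sum.cong)
      also have "\<dots> \<le> real (c e)" using g e by (auto simp: feasible_flow_def)
      finally show "(\<Sum>j\<in>{j\<in>J. e \<in> path_edges (pp j)}. wt j) \<le> real (c e)" .
    qed blast
    then obtain h where h: "feasible_flow V E c h" "\<And>Q. flow_sum h Q = (\<Sum>j\<in>{j\<in>J. Q (pp j)}. wt j)" by blast
    have "flow_sum h (\<lambda>p. {hd p, last p} = {u, v}) = \<pi> u * \<pi> v / S" if uv: "u \<in> X" "v \<in> X" for u v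
    proof -
      let ?D = "{(p, q) \<in> G \<times> G. hd p \<noteq> hd q}"
      have "flow_sum h (\<lambda>p. {hd p, last p} = {u, v}) =
          (\<Sum>j\<in>J. if {hd (pp j), last (pp j)} = {u, v} then wt j else 0)"
        unfolding h(2) using fJ by (rule sum_Collect_if)
      also have "\<dots> = (\<Sum>(p, q)\<in>?D. if {hd p, hd q} = {u, v} then g p * g q / (2 * S) else 0)
          + (\<Sum>y\<in>X. if {y} = {u, v} then \<pi> y * \<pi> y / S else 0)"
        unfolding sumJ by (rule arg_cong2[where f = plus]; intro sum.cong) (auto simp: pp_def wt_def join)
      also have "\<dots> = \<pi> u * \<pi> v / S"
      proof (cases "u = v")
        case True
        have "(\<Sum>(p, q)\<in>?D. if {hd p, hd q} = {u, v} then g p * g q / (2 * S) else 0) = 0"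
          using True by (intro sum.neutral) auto
        moreover have "(\<Sum>y\<in>X. if {y} = {u, v} then \<pi> y * \<pi> y / S else 0) = \<pi> u * \<pi> v / S"
          using True uv fX by simp
        ultimately show ?thesis by simp
      next
        case False
        let ?i = "\<lambda>a p. if hd p = a then g p else 0"
        have "(\<Sum>(p, q)\<in>?D. if {hd p, hd q} = {u, v} then g p * g q / (2 * S) else 0)
            = (\<Sum>(p, q)\<in>G \<times> G. (?i u p * ?i v q + ?i v p * ?i u q) / (2 * S))"
          using False fG by (intro sum.mono_neutral_cong_left) (auto simp: doubleton_eq_iff split: if_splits)
        also have "\<dots> = (sum (?i u) G * sum (?i v) G + sum (?i v) G * sum (?i u) G) / (2 * S)"
          by (simp add: sum.cartesian_product[symmetric] sum_divide_distrib[symmetric] sum.distrib sum_product)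
        also have "\<dots> = \<pi> u * \<pi> v / S" using pi' uv by simp
        finally have "(\<Sum>(p, q)\<in>?D. if {hd p, hd q} = {u, v} then g p * g q / (2 * S) else 0) = \<pi> u * \<pi> v / S" .
        moreover have "(\<Sum>y\<in>X. if {y} = {u, v} then \<pi> y * \<pi> y / S else 0) = 0"
          using False by (intro sum.neutral) auto
        ultimately show ?thesis by simp
      qed
      finally show ?thesis .
    qed
    then show ?thesis unfolding flow_well_linked_def S_def[symmetric] using h(1) by blast
  qed
qed

abbreviation ends :: "'a list \<Rightarrow> 'a set" where "ends p \<equiv> {hd p, last p}"

text \<open>A path through \<open>z\<close> splits there into two pieces without a common edge.
  Directed towards \<open>z\<close>, they route the weight of both ends and load no edge more than
  the path did.\<close>

lemma sink_flow_through:
  fixes w :: "'a list \<Rightarrow> real"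
  assumes A: "finite A" "\<And>p. p \<in> A \<Longrightarrow> is_path U E p" "\<And>p. p \<in> A \<Longrightarrow> hd p \<noteq> last p" "\<And>p. 0 \<le> w p"
    and cap: "\<And>e. e \<in> E \<Longrightarrow> (\<Sum>p\<in>{p\<in>A. e \<in> path_edges p}. w p) \<le> real (c e)"
  obtains g where "feasible_flow U E c g" "\<And>p. g p \<noteq> 0 \<Longrightarrow> last p = z \<and> (\<exists>q\<in>A. hd p \<in> ends q)"
    "\<And>v. flow_sum g (\<lambda>p. hd p = v) = (\<Sum>p\<in>{p\<in>A. z \<in> set p \<and> v \<in> ends p}. w p)"
proof -
  define B where "B = {p\<in>A. z \<in> set p}"
  define J where "J = B \<times> (UNIV :: bool set)"
  define pr where "pr p = takeWhile (\<lambda>y. y \<noteq> z) p @ [z]" for p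
  define pp where "pp j = pr (if snd j then fst j else rev (fst j))" for j :: "'a list \<times> bool"
  have fB: "finite B" using A(1) by (simp add: B_def)
  have fJ: "finite J" using fB by (simp add: J_def)
  have prs: "pr p = xs @ [z]" "pr (rev p) = rev ys @ [z]" if "p = xs @ z # ys" "distinct p" for p xs ys
  proof -
    show "pr p = xs @ [z]" unfolding pr_def that(1) using that by (subst takeWhile_append2) auto
    show "pr (rev p) = rev ys @ [z]" unfolding pr_def that(1) using that by (simp, subst takeWhile_append2) auto
  qed
  have split: "\<exists>xs ys. p = xs @ z # ys \<and> distinct p \<and> is_path U E p" if "p \<in> B" for p
    using that A(2) split_list[of z p] by (auto simp: B_def is_path_def)
  have edge_split: "path_edges p = path_edges (xs @ [z]) \<union> path_edges (z # ys)"
      "path_edges (rev ys @ [z]) = path_edges (z # ys)" if "p = xs @ z # ys" for p xs ys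
  proof -
    have "arcs p = arcs (xs @ [z]) \<union> arcs (z # ys)"
      unfolding that by (cases "xs = []") (simp_all add: arcs_append)
    then show "path_edges p = path_edges (xs @ [z]) \<union> path_edges (z # ys)"
      unfolding path_edges_arcs by (simp only: image_Un)
    show "path_edges (rev ys @ [z]) = path_edges (z # ys)" using path_edges_rev[of "z # ys"] by simp
  qed
  have path: "is_path U E (pp (p, b))" "hd (pp (p, b)) = (if b then hd p else last p)" "last (pp (p, b)) = z"
    if pB: "p \<in> B" for p b
  proof -
    obtain xs ys where p: "p = xs @ z # ys" "distinct p" "is_path U E p" using split[OF pB] by blast
    have e: "path_edges (xs @ [z]) \<subseteq> path_edges p" "path_edges (rev ys @ [z]) \<subseteq> path_edges p"
      using edge_split[OF p(1)] by auto
    show "is_path U E (pp (p, b))"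
    proof (cases b)
      case True
      then have "pp (p, b) = xs @ [z]" using prs[OF p(1,2)] by (simp add: pp_def)
      then show ?thesis using p e(1) by (auto simp: is_path_def)
    next
      case False
      then have "pp (p, b) = rev ys @ [z]" using prs[OF p(1,2)] by (simp add: pp_def)
      then show ?thesis using p e(2) by (auto simp: is_path_def)
    qed
    show "hd (pp (p, b)) = (if b then hd p else last p)" unfolding pp_def using prs[OF p(1,2)] p(1)
      by (cases xs; cases ys rule: rev_cases) auto
    show "last (pp (p, b)) = z" unfolding pp_def pr_def by simp
  qed
  have edges: "(if e \<in> path_edges (pp (p, True)) then 1 else 0) + (if e \<in> path_edges (pp (p, False)) then 1 else 0)
      \<le> (if e \<in> path_edges p then 1 else 0 :: real)" if pB: "p \<in> B" for p e
  proof -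
    obtain xs ys where p: "p = xs @ z # ys" "distinct p" using split[OF pB] by blast
    have s: "path_edges (xs @ [z]) \<subseteq> path_edges p" "path_edges (z # ys) \<subseteq> path_edges p"
      using edge_split[OF p(1)] by auto
    \<comment> \<open>The path is simple, so its two pieces meet in \<open>z\<close> only; a common
      edge would have both ends equal to \<open>z\<close>.\<close>
    have "e \<notin> path_edges (z # ys)" if e: "e \<in> path_edges (xs @ [z])"
    proof
      assume e': "e \<in> path_edges (z # ys)"
      obtain a b where a: "e = {a, b}" "(a, b) \<in> arcs (xs @ [z])" using e by (auto simp: path_edges_arcs)
      then have "a \<noteq> b" "a \<in> set xs \<union> {z}" "b \<in> set xs \<union> {z}"
        using arcs_distinct_neq[of "xs @ [z]" a b] arcs_in_set[of a b "xs @ [z]"] p by auto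
      moreover have "e \<subseteq> set (z # ys)" using e' arcs_in_set by (fastforce simp: path_edges_arcs)
      ultimately show False using a p by auto
    qed
    moreover have "path_edges (rev ys @ [z]) = path_edges (z # ys)" using path_edges_rev[of "z # ys"] by simp
    ultimately show ?thesis unfolding pp_def using prs[OF p] s by auto
  qed
  have sumJ: "sum h J = (\<Sum>p\<in>B. h (p, True) + h (p, False))" for h :: "'a list \<times> bool \<Rightarrow> real"
  proof -
    have "sum h J = (\<Sum>(p, b)\<in>B \<times> UNIV. h (p, b))" by (simp add: J_def)
    also have "\<dots> = (\<Sum>p\<in>B. \<Sum>b\<in>UNIV. h (p, b))" by (rule sum.cartesian_product[symmetric])
    finally show ?thesis by (simp add: UNIV_bool add.commute)
  qed
  show ?thesis
  proof (rule flow_family[of J "\<lambda>j. w (fst j)" U E pp c])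
    show "finite J" "\<And>j. j \<in> J \<Longrightarrow> 0 \<le> w (fst j)" using fJ A(4) by auto
    show "is_path U E (pp j)" if "j \<in> J" for j using that path(1) by (cases j) (auto simp: J_def)
    show "(\<Sum>j\<in>{j\<in>J. e \<in> path_edges (pp j)}. w (fst j)) \<le> real (c e)" if e: "e \<in> E" for e
    proof -
      have "(\<Sum>j\<in>{j\<in>J. e \<in> path_edges (pp j)}. w (fst j))
          = (\<Sum>p\<in>B. w p * ((if e \<in> path_edges (pp (p, True)) then 1 else 0) + (if e \<in> path_edges (pp (p, False)) then 1 else 0)))"
        unfolding sum_Collect_if[OF fJ] sumJ by (intro sum.cong) auto
      also have "\<dots> \<le> (\<Sum>p\<in>B. w p * (if e \<in> path_edges p then 1 else 0))"
        using edges A(4) by (intro sum_mono mult_left_mono) auto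
      also have "\<dots> \<le> (\<Sum>p\<in>A. w p * (if e \<in> path_edges p then 1 else 0))"
        using A(1,4) by (intro sum_mono2) (auto simp: B_def)
      also have "\<dots> = (\<Sum>p\<in>{p\<in>A. e \<in> path_edges p}. w p)"
        using A(1) by (subst sum_Collect_if) (auto intro: sum.cong)
      also have "\<dots> \<le> real (c e)" by (rule cap[OF e])
      finally show ?thesis .
    qed
    fix g assume g: "feasible_flow U E c g" "\<And>Q. flow_sum g Q = (\<Sum>j\<in>{j\<in>J. Q (pp j)}. w (fst j))"
      "\<And>p. g p \<noteq> 0 \<Longrightarrow> \<exists>j\<in>J. pp j = p"
    show thesis
    proof (rule that[OF g(1)])
      show "last p = z \<and> (\<exists>q\<in>A. hd p \<in> ends q)" if gp: "g p \<noteq> 0" for p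
      proof -
        obtain p' b where p': "p' \<in> B" "p = pp (p', b)" using g(3)[OF gp] by (auto simp: J_def)
        have "hd p \<in> ends p'" "last p = z" using path(2,3)[OF p'(1)] unfolding p'(2) by simp_all
        then show ?thesis using p'(1) unfolding B_def by blast
      qed
      show "flow_sum g (\<lambda>p. hd p = v) = (\<Sum>p\<in>{p\<in>A. z \<in> set p \<and> v \<in> ends p}. w p)" for v
      proof -
        have "flow_sum g (\<lambda>p. hd p = v) = (\<Sum>p\<in>B. (if hd p = v then w p else 0) + (if last p = v then w p else 0))"
          unfolding g(2) sum_Collect_if[OF fJ] sumJ using path(2) by (intro sum.cong) auto
        also have "\<dots> = (\<Sum>p\<in>B. if v \<in> ends p then w p else 0)"
        proof (intro sum.cong refl)
          fix p assume "p \<in> B"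
          then have "hd p \<noteq> last p" using A(3) by (simp add: B_def)
          then show "(if hd p = v then w p else 0) + (if last p = v then w p else 0) = (if v \<in> ends p then w p else 0)"
            by auto
        qed
        also have "\<dots> = (\<Sum>p\<in>{p\<in>A. z \<in> set p \<and> v \<in> ends p}. w p)"
          unfolding sum_Collect_if[OF fB, symmetric] by (intro sum.cong) (auto simp: B_def)
        finally show ?thesis .
      qed
    qed
  qed
qed

text \<open>From each end of a pair a third of the sink flow of either end is sent: the own part directly,
  the partner's part first along the flow of the pair.\<close>

lemma sym_sink:
  fixes w :: "'a list \<Rightarrow> real" and wt :: "'j \<Rightarrow> real" and q :: "'j \<Rightarrow> 'a list"
  assumes A: "finite A" "\<And>p. p \<in> A \<Longrightarrow> is_path U E p" "\<And>p. p \<in> A \<Longrightarrow> hd p \<noteq> last p" "\<And>p. p \<in> A \<Longrightarrow> 0 < w p"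
    and match: "\<And>p p'. p \<in> A \<Longrightarrow> p' \<in> A \<Longrightarrow> ends p \<inter> ends p' \<noteq> {} \<Longrightarrow> ends p = ends p'"
    and J: "finite J" "\<And>j. j \<in> J \<Longrightarrow> 0 \<le> wt j" "\<And>j. j \<in> J \<Longrightarrow> is_path U E (q j)" "\<And>j. j \<in> J \<Longrightarrow> last (q j) = u"
    and src: "\<And>j. j \<in> J \<Longrightarrow> \<exists>p\<in>A. hd (q j) \<in> ends p"
    and half: "\<And>v. (\<Sum>j\<in>{j\<in>J. hd (q j) = v}. wt j) \<le> (\<Sum>p\<in>{p\<in>A. v \<in> ends p}. w p) / 2"
    and capA: "\<And>e. e \<in> E \<Longrightarrow> (\<Sum>p\<in>{p\<in>A. e \<in> path_edges p}. w p) \<le> real (c e)"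
    and capJ: "\<And>e. e \<in> E \<Longrightarrow> (\<Sum>j\<in>{j\<in>J. e \<in> path_edges (q j)}. wt j) \<le> real (c e)"
  obtains g where "feasible_flow U E c g" "\<And>p. g p \<noteq> 0 \<Longrightarrow> last p = u \<and> (\<exists>p'\<in>A. hd p \<in> ends p')"
    "\<And>v. flow_sum g (\<lambda>p. hd p = v) = (\<Sum>j\<in>{j\<in>J. \<exists>p\<in>A. v \<in> ends p \<and> hd (q j) \<in> ends p}. wt j) / 3"
proof -
  define x where "x v = (\<Sum>p\<in>{p\<in>A. v \<in> ends p}. w p)" for v
  define AA where "AA j = {p\<in>A. hd (q j) \<in> ends p}" for j
  define other where "other j p = (if last p = hd (q j) then hd p else last p)" for j p
  define tow where "tow j p = (if last p = hd (q j) then p else rev p)" for j p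
  define K where "K = Inl ` J \<union> Inr ` (SIGMA j:J. AA j)"
  define pp where "pp k = (case k of Inl j \<Rightarrow> q j | Inr (j, p) \<Rightarrow> shortcut (tow j p @ tl (q j)))" for k
  \<comment> \<open>The detour of \<open>j\<close> spreads \<open>wt j / 3\<close> over the flow
    paths \<open>p\<close> at its source in proportion to \<open>w p\<close>; \<open>x\<close> is
    the total weight of these paths.\<close>
  define kw where "kw k = (case k of Inl j \<Rightarrow> wt j / 3 | Inr (j, p) \<Rightarrow> wt j * w p / (3 * x (hd (q j))))" for k
  have fAA: "finite (AA j)" for j using A(1) by (simp add: AA_def)
  have fK: "finite K" unfolding K_def using J(1) fAA by auto
  have sumK: "sum h K = (\<Sum>j\<in>J. h (Inl j)) + (\<Sum>j\<in>J. \<Sum>p\<in>AA j. h (Inr (j, p)))" for h :: "_ \<Rightarrow> real"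
  proof -
    have "sum h K = sum h (Inl ` J) + sum h (Inr ` (SIGMA j:J. AA j))"
      unfolding K_def using J(1) fAA by (intro sum.union_disjoint) auto
    also have "sum h (Inr ` (SIGMA j:J. AA j)) = (\<Sum>j\<in>J. \<Sum>p\<in>AA j. h (Inr (j, p)))"
      using J(1) fAA by (simp add: sum.reindex sum.Sigma split_def)
    finally show ?thesis by (simp add: sum.reindex)
  qed
  have xpos: "0 < x (hd (q j))" if "j \<in> J" for j
    unfolding x_def using src[OF that] A(1,4) by (intro sum_pos) auto
  have xAA: "(\<Sum>p\<in>AA j. w p) = x (hd (q j))" for j by (simp add: x_def AA_def)
  have tow: "is_path U E (tow j p)" "hd (tow j p) = other j p" "last (tow j p) = hd (q j)"
    "path_edges (tow j p) = path_edges p" "other j p \<noteq> hd (q j)" "ends p = {hd (q j), other j p}" if "p \<in> AA j" for j p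
  proof -
    have p: "is_path U E p" "p \<noteq> []" "hd p \<noteq> last p" "hd (q j) = hd p \<or> hd (q j) = last p"
      using that A(2)[of p] A(3)[of p] by (auto simp: AA_def is_path_def)
    show "is_path U E (tow j p)" using p(1) by (simp add: tow_def)
    show "path_edges (tow j p) = path_edges p" by (simp add: tow_def)
    show "hd (tow j p) = other j p" using p(2) by (simp add: tow_def other_def hd_rev)
    show "last (tow j p) = hd (q j)" using p by (auto simp: tow_def last_rev)
    show "other j p \<noteq> hd (q j)" using p(3,4) unfolding other_def by (cases "last p = hd (q j)") simp_all
    show "ends p = {hd (q j), other j p}" using p(3,4) unfolding other_def
      by (cases "last p = hd (q j)") (simp_all add: insert_commute)
  qed
  have jn: "hd (pp (Inr (j, p))) = other j p" "last (pp (Inr (j, p))) = u" "is_path U E (pp (Inr (j, p)))"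
    "path_edges (pp (Inr (j, p))) \<subseteq> path_edges p \<union> path_edges (q j)" if jp: "j \<in> J" "p \<in> AA j" for j p
  proof -
    have e: "pp (Inr (j, p)) = shortcut (tow j p @ tl (q j))" by (simp add: pp_def)
    note jj = join_path[OF tow(1)[OF jp(2)] J(3)[OF jp(1)] tow(3)[OF jp(2)], folded e]
    show "hd (pp (Inr (j, p))) = other j p" using jj(1) tow(2)[OF jp(2)] by simp
    show "last (pp (Inr (j, p))) = u" using jj(2) J(4)[OF jp(1)] by simp
    show "is_path U E (pp (Inr (j, p)))" by (rule jj(3))
    show "path_edges (pp (Inr (j, p))) \<subseteq> path_edges p \<union> path_edges (q j)"
      using jj(4) tow(4)[OF jp(2)] by simp
  qed
  \<comment> \<open>By \<open>match\<close> all paths at one source end in the same second vertex,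
    so the detours of \<open>j\<close> supply a single partner.\<close>
  have other_eq: "other j p = other j p'" if "p \<in> AA j" "p' \<in> AA j" for j p p'
  proof -
    have "ends p = ends p'" using that by (intro match) (auto simp: AA_def)
    then show ?thesis using tow(5,6)[OF that(1)] tow(5,6)[OF that(2)] by (auto simp: doubleton_eq_iff)
  qed
  show ?thesis
  proof (rule flow_family[of K kw U E pp c])
    show "finite K" by (rule fK)
    show "0 \<le> kw k" if kK: "k \<in> K" for k
    proof (cases k)
      case (Inl j)
      then show ?thesis using kK J(2) by (auto simp: K_def kw_def)
    next
      case (Inr jp)
      then obtain j p where jp: "k = Inr (j, p)" "j \<in> J" "p \<in> A" using kK by (auto simp: K_def AA_def)
      show ?thesis using J(2)[OF jp(2)] A(4)[OF jp(3)] xpos[OF jp(2)] unfolding jp(1) kw_def by simp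
    qed
    show "is_path U E (pp k)" if "k \<in> K" for k
    proof (cases k)
      case (Inl j)
      then show ?thesis using that J(3) by (auto simp: K_def pp_def)
    next
      case (Inr jp)
      then show ?thesis using that jn(3) by (auto simp: K_def)
    qed
    show "(\<Sum>k\<in>{k\<in>K. e \<in> path_edges (pp k)}. kw k) \<le> real (c e)" if e: "e \<in> E" for e
    proof -
      let ?i = "\<lambda>p. if e \<in> path_edges p then 1 else 0 :: real"
      have "(\<Sum>k\<in>{k\<in>K. e \<in> path_edges (pp k)}. kw k) = (\<Sum>j\<in>J. if e \<in> path_edges (q j) then wt j / 3 else 0)
          + (\<Sum>j\<in>J. \<Sum>p\<in>AA j. if e \<in> path_edges (pp (Inr (j, p))) then wt j * w p / (3 * x (hd (q j))) else 0)"
        unfolding sum_Collect_if[OF fK] sumK by (simp add: pp_def kw_def cong: if_cong)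
      also have "\<dots> \<le> (\<Sum>j\<in>J. wt j / 3 * ?i (q j))
          + (\<Sum>j\<in>J. \<Sum>p\<in>AA j. wt j * w p / (3 * x (hd (q j))) * (?i p + ?i (q j)))"
      proof (intro add_mono sum_mono)
        fix j p assume j: "j \<in> J" "p \<in> AA j"
        have "0 \<le> wt j * w p / (3 * x (hd (q j)))"
          using J(2)[OF j(1)] A(4)[of p] xpos[OF j(1)] j(2) by (auto simp: AA_def)
        then show "(if e \<in> path_edges (pp (Inr (j, p))) then wt j * w p / (3 * x (hd (q j))) else 0)
            \<le> wt j * w p / (3 * x (hd (q j))) * (?i p + ?i (q j))"
          using jn(4)[OF j] by auto
      qed auto
      also have "(\<Sum>j\<in>J. \<Sum>p\<in>AA j. wt j * w p / (3 * x (hd (q j))) * (?i p + ?i (q j)))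
          = (\<Sum>j\<in>J. \<Sum>p\<in>AA j. wt j * w p / (3 * x (hd (q j))) * ?i p) + (\<Sum>j\<in>J. wt j / 3 * ?i (q j))"
      proof -
        have "(\<Sum>p\<in>AA j. wt j * w p / (3 * x (hd (q j))) * ?i (q j)) = wt j / 3 * ?i (q j)" if "j \<in> J" for j
        proof -
          have "(\<Sum>p\<in>AA j. wt j * w p / (3 * x (hd (q j))) * ?i (q j)) = wt j * ?i (q j) / (3 * x (hd (q j))) * (\<Sum>p\<in>AA j. w p)"
            unfolding sum_distrib_left by (intro sum.cong refl) (simp add: mult_ac)
          then show ?thesis using xpos[OF that] unfolding xAA by simp
        qed
        then have "(\<Sum>j\<in>J. \<Sum>p\<in>AA j. wt j * w p / (3 * x (hd (q j))) * ?i (q j)) = (\<Sum>j\<in>J. wt j / 3 * ?i (q j))"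
          by (intro sum.cong refl)
        then show ?thesis by (simp only: distrib_left sum.distrib)
      qed
      also have "(\<Sum>j\<in>J. \<Sum>p\<in>AA j. wt j * w p / (3 * x (hd (q j))) * ?i p)
          = (\<Sum>p\<in>A. w p * ?i p / 3 * (\<Sum>j\<in>{j\<in>J. hd (q j) \<in> ends p}. wt j / x (hd (q j))))"
      proof -
        have "(\<Sum>j\<in>J. \<Sum>p\<in>AA j. wt j * w p / (3 * x (hd (q j))) * ?i p)
            = (\<Sum>j\<in>J. \<Sum>p\<in>A. if hd (q j) \<in> ends p then wt j * w p / (3 * x (hd (q j))) * ?i p else 0)"
          unfolding AA_def sum_Collect_if[OF A(1)] ..
        also have "\<dots> = (\<Sum>p\<in>A. \<Sum>j\<in>J. if hd (q j) \<in> ends p then wt j * w p / (3 * x (hd (q j))) * ?i p else 0)"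
          by (rule sum.swap)
        also have "\<dots> = (\<Sum>p\<in>A. \<Sum>j\<in>{j\<in>J. hd (q j) \<in> ends p}. wt j * w p / (3 * x (hd (q j))) * ?i p)"
          unfolding sum_Collect_if[OF J(1)] ..
        also have "\<dots> = (\<Sum>p\<in>A. w p * ?i p / 3 * (\<Sum>j\<in>{j\<in>J. hd (q j) \<in> ends p}. wt j / x (hd (q j))))"
          unfolding sum_distrib_left by (intro sum.cong refl) (simp add: mult_ac)
        finally show ?thesis .
      qed
      also have "\<dots> \<le> (\<Sum>p\<in>A. w p * ?i p / 3 * 1)"
      proof (intro sum_mono mult_left_mono)
        fix p assume p: "p \<in> A"
        \<comment> \<open>This is where \<open>half\<close> enters: each of the two ends draws on at
          most half of the flow of its pair, so a flow path is used at most once in total.\<close>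
        have *: "(\<Sum>j\<in>{j\<in>J. hd (q j) = v}. wt j / x (hd (q j))) \<le> 1 / 2" if "v \<in> ends p" for v
        proof -
          have xv: "0 < x v" unfolding x_def using A(1,4) p that by (intro sum_pos) auto
          have "(\<Sum>j\<in>{j\<in>J. hd (q j) = v}. wt j / x (hd (q j))) = (\<Sum>j\<in>{j\<in>J. hd (q j) = v}. wt j) / x v"
            by (simp add: sum_divide_distrib)
          also have "\<dots> \<le> 1 / 2" using half[of v] xv unfolding x_def[symmetric] by (simp add: field_simps)
          finally show ?thesis .
        qed
        have "{j\<in>J. hd (q j) \<in> ends p} = {j\<in>J. hd (q j) = hd p} \<union> {j\<in>J. hd (q j) = last p}" by auto
        then have "(\<Sum>j\<in>{j\<in>J. hd (q j) \<in> ends p}. wt j / x (hd (q j)))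
            = (\<Sum>j\<in>{j\<in>J. hd (q j) = hd p}. wt j / x (hd (q j))) + (\<Sum>j\<in>{j\<in>J. hd (q j) = last p}. wt j / x (hd (q j)))"
          using J(1) A(3)[OF p] by (simp only:, intro sum.union_disjoint) auto
        also have "\<dots> \<le> 1 / 2 + 1 / 2" by (intro add_mono *) auto
        finally show "(\<Sum>j\<in>{j\<in>J. hd (q j) \<in> ends p}. wt j / x (hd (q j))) \<le> 1" by simp
      qed (use A(4) in \<open>auto simp: less_imp_le\<close>)
      also have "(\<Sum>p\<in>A. w p * ?i p / 3 * 1) = (\<Sum>p\<in>{p\<in>A. e \<in> path_edges p}. w p) / 3"
        unfolding sum_Collect_if[OF A(1)] by (auto simp: sum_divide_distrib intro!: sum.cong)
      also have "(\<Sum>j\<in>J. wt j / 3 * ?i (q j)) = (\<Sum>j\<in>{j\<in>J. e \<in> path_edges (q j)}. wt j) / 3"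
        unfolding sum_Collect_if[OF J(1)] by (auto simp: sum_divide_distrib intro!: sum.cong)
      \<comment> \<open>Direct routes, last legs of the detours and first legs of the detours use a
        third of the capacity each.\<close>
      finally show ?thesis using capA[OF e] capJ[OF e] by linarith
    qed
    fix g assume g: "feasible_flow U E c g" "\<And>Q. flow_sum g Q = (\<Sum>k\<in>{k\<in>K. Q (pp k)}. kw k)"
      "\<And>p. g p \<noteq> 0 \<Longrightarrow> \<exists>k\<in>K. pp k = p"
    show thesis
    proof (rule that[OF g(1)])
      fix p assume "g p \<noteq> 0"
      then obtain k where k: "k \<in> K" "pp k = p" using g(3) by blast
      show "last p = u \<and> (\<exists>p'\<in>A. hd p \<in> ends p')"
      proof (cases k)
        case (Inl j)
        then show ?thesis using k J(4) src by (auto simp: K_def pp_def)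
      next
        case (Inr jp)
        then obtain j p' where jp: "k = Inr (j, p')" "j \<in> J" "p' \<in> AA j" using k by (auto simp: K_def)
        then have "hd p \<in> ends p'" "last p = u" "p' \<in> A"
          using k(2) jn[OF jp(2,3)] tow(6)[OF jp(3)] by (auto simp: AA_def)
        then show ?thesis by blast
      qed
    next
      fix v
      have "(\<Sum>p\<in>AA j. if other j p = v then wt j * w p / (3 * x (hd (q j))) else 0)
          = (if v \<noteq> hd (q j) \<and> (\<exists>p\<in>A. v \<in> ends p \<and> hd (q j) \<in> ends p) then wt j / 3 else 0)" if j: "j \<in> J" for j
      proof -
        obtain p0 where p0: "p0 \<in> AA j" using src[OF j] by (auto simp: AA_def)
        have o: "other j p = other j p0" if "p \<in> AA j" for p using other_eq[OF that p0] .
        have "(v \<noteq> hd (q j) \<and> (\<exists>p\<in>A. v \<in> ends p \<and> hd (q j) \<in> ends p)) \<longleftrightarrow> other j p0 = v"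
        proof
          assume "v \<noteq> hd (q j) \<and> (\<exists>p\<in>A. v \<in> ends p \<and> hd (q j) \<in> ends p)"
          then obtain p where "v \<noteq> hd (q j)" "p \<in> AA j" "v \<in> ends p" by (auto simp: AA_def)
          then show "other j p0 = v" using tow(6)[of p j] o[of p] by auto
        next
          assume "other j p0 = v"
          then show "v \<noteq> hd (q j) \<and> (\<exists>p\<in>A. v \<in> ends p \<and> hd (q j) \<in> ends p)"
            using tow(5,6)[OF p0] p0 by (auto simp: AA_def)
        qed
        moreover have "(\<Sum>p\<in>AA j. if other j p = v then wt j * w p / (3 * x (hd (q j))) else 0)
            = (\<Sum>p\<in>AA j. if other j p0 = v then wt j * w p / (3 * x (hd (q j))) else 0)"
          by (intro sum.cong) (auto simp: o)
        moreover have "(\<Sum>p\<in>AA j. wt j * w p / (3 * x (hd (q j)))) = wt j / (3 * x (hd (q j))) * (\<Sum>p\<in>AA j. w p)"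
          unfolding sum_distrib_left by (intro sum.cong refl) (simp add: mult_ac)
        then have "(\<Sum>p\<in>AA j. wt j * w p / (3 * x (hd (q j)))) = wt j / 3" using xpos[OF j] unfolding xAA by simp
        ultimately show ?thesis by simp
      qed
      note other_sum = this
      have "flow_sum g (\<lambda>p. hd p = v) = (\<Sum>j\<in>J. if hd (q j) = v then wt j / 3 else 0)
          + (\<Sum>j\<in>J. \<Sum>p\<in>AA j. if hd (pp (Inr (j, p))) = v then wt j * w p / (3 * x (hd (q j))) else 0)"
        unfolding g(2) sum_Collect_if[OF fK] sumK by (simp add: pp_def kw_def cong: if_cong)
      also have "(\<Sum>j\<in>J. \<Sum>p\<in>AA j. if hd (pp (Inr (j, p))) = v then wt j * w p / (3 * x (hd (q j))) else 0)
          = (\<Sum>j\<in>J. \<Sum>p\<in>AA j. if other j p = v then wt j * w p / (3 * x (hd (q j))) else 0)"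
        by (intro sum.cong) (auto simp: jn(1))
      also have "\<dots> = (\<Sum>j\<in>J. if v \<noteq> hd (q j) \<and> (\<exists>p\<in>A. v \<in> ends p \<and> hd (q j) \<in> ends p) then wt j / 3 else 0)"
        by (intro sum.cong other_sum refl)
      also have "(\<Sum>j\<in>J. if hd (q j) = v then wt j / 3 else 0) + \<dots>
          = (\<Sum>j\<in>J. if \<exists>p\<in>A. v \<in> ends p \<and> hd (q j) \<in> ends p then wt j / 3 else 0)"
        unfolding sum.distrib[symmetric] using src by (intro sum.cong) auto
      also have "\<dots> = (\<Sum>j\<in>{j\<in>J. \<exists>p\<in>A. v \<in> ends p \<and> hd (q j) \<in> ends p}. wt j) / 3"
        unfolding sum_Collect_if[OF J(1)] by (auto simp: sum_divide_distrib intro!: sum.cong)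
      finally show "flow_sum g (\<lambda>p. hd p = v) = (\<Sum>j\<in>{j\<in>J. \<exists>p\<in>A. v \<in> ends p \<and> hd (q j) \<in> ends p}. wt j) / 3" .
    qed
  qed
qed

section \<open>Maximum flow by unit augmentations, minimum cuts, flow decomposition\<close>

section \<open>Maximum flow to one sink by augmenting paths\<close>

definition ccap :: "('a \<times> 'a \<times> nat) list \<Rightarrow> 'a \<Rightarrow> 'a \<Rightarrow> nat" where
  "ccap es a b = sum_list (map (\<lambda>(u, v, c). if (u = a \<and> v = b) \<or> (u = b \<and> v = a) then c else 0) es)"

definition acount :: "('a \<times> 'a) list \<Rightarrow> 'a \<Rightarrow> 'a \<Rightarrow> nat" where
  "acount A a b = length (filter (\<lambda>(x, y). x = a \<and> y = b) A)"

definition vcount :: "'a list \<Rightarrow> 'a \<Rightarrow> nat" where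
  "vcount S v = length (filter (\<lambda>y. y = v) S)"

text \<open>The net flow from \<open>a\<close> to \<open>b\<close> is below the capacity, written
  without subtraction. Arcs of opposite directions are both kept in the list; only their difference
  counts.\<close>

definition resid :: "('a \<times> 'a \<times> nat) list \<Rightarrow> ('a \<times> 'a) list \<Rightarrow> 'a \<Rightarrow> 'a \<Rightarrow> bool" where
  "resid es A a b \<longleftrightarrow> acount A a b < ccap es a b + acount A b a"

text \<open>The search runs backwards from the sink \<open>u\<close>; an entry \<open>(v, w)\<close> says that \<open>w\<close> follows \<open>v\<close> on
  a residual path to \<open>u\<close>.\<close>

definition rstep :: "('a \<times> 'a \<times> nat) list \<Rightarrow> 'a list \<Rightarrow> 'a \<Rightarrow> ('a \<times> 'a) list \<Rightarrow> 'a \<Rightarrow> ('a \<times> 'a) list \<Rightarrow> ('a \<times> 'a) list" where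
  "rstep es xs u A v L = (if v \<in> set (u # map fst L) then L else
     case filter (\<lambda>w. w \<in> set (u # map fst L) \<and> resid es A v w) (u # xs) of [] \<Rightarrow> L | w # _ \<Rightarrow> (v, w) # L)"

definition rpass :: "('a \<times> 'a \<times> nat) list \<Rightarrow> 'a list \<Rightarrow> 'a \<Rightarrow> ('a \<times> 'a) list \<Rightarrow> ('a \<times> 'a) list \<Rightarrow> ('a \<times> 'a) list" where
  "rpass es xs u A L = fold (rstep es xs u A) xs L"

text \<open>Every pass before the fixed point adds a vertex of \<open>xs\<close>, so
  \<open>length xs\<close> passes suffice.\<close>

definition reach :: "('a \<times> 'a \<times> nat) list \<Rightarrow> 'a list \<Rightarrow> 'a \<Rightarrow> ('a \<times> 'a) list \<Rightarrow> ('a \<times> 'a) list" where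
  "reach es xs u A = fold (\<lambda>_. rpass es xs u A) xs []"

text \<open>New entries are put in front, so the successor of a vertex stands further back in the
  list and one scan from the front follows the whole path to the sink.\<close>

definition route :: "('a \<times> 'a) list \<Rightarrow> 'a \<Rightarrow> ('a \<times> 'a) list" where
  "route L v = snd (fold (\<lambda>e s. if fst e = fst s then (snd e, e # snd s) else s) L (v, []))"

definition augment :: "('a \<times> 'a \<times> nat) list \<Rightarrow> ('a \<times> nat) list \<Rightarrow> 'a \<Rightarrow> ('a \<times> 'a) list \<times> 'a list \<Rightarrow> ('a \<times> 'a) list \<times> 'a list" where
  "augment es sl u st =
     (case filter (\<lambda>e. fst e \<in> set (map fst (reach es (map fst sl) u (fst st))) \<and> vcount (snd st) (fst e) < snd e) sl of
        [] \<Rightarrow> st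
      | e # _ \<Rightarrow> (route (reach es (map fst sl) u (fst st)) (fst e) @ fst st, fst e # snd st))"

text \<open>\<open>N\<close> is a unary counter with one augmentation by a single unit per element.
  The state consists of the unit arcs used and of the sources of the units.\<close>

definition mf :: "('a \<times> 'a \<times> nat) list \<Rightarrow> ('a \<times> nat) list \<Rightarrow> 'a \<Rightarrow> 'b list \<Rightarrow> ('a \<times> 'a) list \<times> 'a list" where
  "mf es sl u N = fold (\<lambda>_. augment es sl u) N ([], [])"

lemma fold_const: "fold (\<lambda>_. F) xs s = (F ^^ length xs) s"
  by (induction xs arbitrary: s) (auto simp: funpow_swap1)

text \<open>A step that raises a potential bounded by \<open>N\<close> unless it is stationary must
  be stationary after \<open>N\<close> rounds. This settles termination of the search, of the
  maximum flow and of the cutting loop alike.\<close>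

lemma funpow_stable:
  fixes m :: "'s \<Rightarrow> nat"
  assumes "Inv s" "\<And>s. Inv s \<Longrightarrow> Inv (F s)" "\<And>s. Inv s \<Longrightarrow> m s \<le> N" "\<And>s. Inv s \<Longrightarrow> F s = s \<or> m s < m (F s)"
    and "N \<le> M"
  shows "F ((F ^^ M) s) = (F ^^ M) s \<and> Inv ((F ^^ M) s)"
proof -
  have I: "Inv ((F ^^ n) s)" for n using assms(1,2) by (induction n) auto
  have "F ((F ^^ n) s) = (F ^^ n) s \<or> n \<le> m ((F ^^ n) s)" for n
  proof (induction n)
    case (Suc n)
    then show ?case using assms(4)[OF I[of n]] by auto
  qed simp
  from this[of M] have "F ((F ^^ M) s) = (F ^^ M) s \<or> N \<le> m ((F ^^ M) s)" using assms(5) by auto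
  moreover have "m (F ((F ^^ M) s)) \<le> N" using assms(3)[OF assms(2)[OF I[of M]]] .
  ultimately show ?thesis using assms(4)[OF I[of M]] I[of M] by auto
qed

lemma ccap_sym: "ccap es a b = ccap es b a"
  unfolding ccap_def by (rule arg_cong[where f = sum_list], rule map_cong) auto

lemma vcount_Nil [simp]: "vcount [] v = 0"
  and vcount_Cons: "vcount (x # S) v = (if x = v then 1 else 0) + vcount S v"
  by (auto simp: vcount_def)

lemma sum_vcount: "finite X \<Longrightarrow> set S \<subseteq> X \<Longrightarrow> (\<Sum>v\<in>X. vcount S v) = length S"
  by (induction S) (auto simp: vcount_Cons sum.distrib)

definition outd :: "('a \<times> 'a) list \<Rightarrow> 'a \<Rightarrow> nat" where "outd A x = length (filter (\<lambda>e. fst e = x) A)"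
definition ind :: "('a \<times> 'a) list \<Rightarrow> 'a \<Rightarrow> nat" where "ind A x = length (filter (\<lambda>e. snd e = x) A)"

abbreviation netf :: "('a \<times> 'a) list \<Rightarrow> 'a \<Rightarrow> 'a \<Rightarrow> int" where
  "netf A a b \<equiv> int (acount A a b) - int (acount A b a)"

lemma acount_append: "acount (A @ B) a b = acount A a b + acount B a b"
  by (simp add: acount_def)

lemma acount_distinct: "distinct R \<Longrightarrow> acount R a b = (if (a, b) \<in> set R then 1 else 0)"
  by (induction R) (auto simp: acount_def)

lemma sum_netf:
  assumes "finite Y" "set A \<subseteq> Y \<times> Y"
  shows "(\<Sum>w\<in>Y. netf A v w) = int (outd A v) - int (ind A v)"
proof -
  have "(\<Sum>w\<in>Y. acount A v w) = outd A v \<and> (\<Sum>w\<in>Y. acount A w v) = ind A v"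
    using assms(2)
  proof (induction A)
    case (Cons e A)
    have ac: "acount (e # A) a b = (if e = (a, b) then 1 else 0) + acount A a b" for a b
      by (cases e) (auto simp: acount_def)
    have "(\<Sum>w\<in>Y. if e = (v, w) then 1 else 0) = (if fst e = v then 1 else 0 :: nat)"
      using Cons.prems assms(1) by (cases e) auto
    moreover have "(\<Sum>w\<in>Y. if e = (w, v) then 1 else 0) = (if snd e = v then 1 else 0 :: nat)"
      using Cons.prems assms(1) by (cases e) auto
    ultimately show ?case
      using Cons by (auto simp: ac sum.distrib outd_def ind_def)
  qed (auto simp: acount_def outd_def ind_def)
  then show ?thesis by (simp add: sum_subtractf flip: of_nat_sum)
qed

locale network =
  fixes es :: "('a \<times> 'a \<times> nat) list" and xs :: "'a list" and u :: 'a and s :: "'a \<Rightarrow> nat"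
  assumes dist: "distinct xs" and u: "u \<notin> set xs"
begin

abbreviation "X \<equiv> set xs"
abbreviation "Y \<equiv> insert u (set xs)"
abbreviation "c \<equiv> ccap es"

text \<open>A tree directed towards \<open>u\<close>, children in front of their parents. The order
  excludes cycles and lets \<open>route\<close> work in one scan.\<close>

fun rok :: "('a \<times> 'a) list \<Rightarrow> ('a \<times> 'a) list \<Rightarrow> bool" where
  "rok A [] \<longleftrightarrow> True"
| "rok A (e # L) \<longleftrightarrow> rok A L \<and> fst e \<in> X \<and> fst e \<notin> fst ` set L \<and> (snd e = u \<or> snd e \<in> fst ` set L) \<and> resid es A (fst e) (snd e)"

lemma rok_fst: "rok A L \<Longrightarrow> fst ` set L \<subseteq> X \<and> length L = card (fst ` set L) \<and> distinct L"
  by (induction L) auto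

lemma rok_snd: "rok A L \<Longrightarrow> e \<in> set L \<Longrightarrow> snd e = u \<or> snd e \<in> fst ` set L"
  by (induction L) auto

lemma rok_resid: "rok A L \<Longrightarrow> (a, b) \<in> set L \<Longrightarrow> resid es A a b"
  by (induction L) auto

text \<open>Opposite entries would form a cycle in the tree. Consequently an arc of the augmenting
  path changes the net flow by exactly one.\<close>

lemma rok_asym: "rok A L \<Longrightarrow> (a, b) \<in> set L \<Longrightarrow> (b, a) \<notin> set L"
proof (induction L)
  case (Cons e L)
  have nu: "fst e \<noteq> u" using Cons.prems u by auto
  have *: "(y, fst e) \<notin> set L" for y
    using rok_snd[of A L "(y, fst e)"] Cons.prems nu by auto
  have "snd e = u \<or> snd e \<in> fst ` set L" "fst e \<notin> fst ` set L" using Cons.prems by simp_all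
  then have "fst e \<noteq> snd e" using nu by metis
  then show ?case using Cons * by (cases e) auto
qed simp

lemma rstep_cases:
  obtains "rstep es xs u A v L = L" "v = u \<or> v \<in> fst ` set L \<or> (\<forall>w\<in>Y. w = u \<or> w \<in> fst ` set L \<longrightarrow> \<not> resid es A v w)"
  | w where "rstep es xs u A v L = (v, w) # L" "v \<noteq> u" "v \<notin> fst ` set L" "w = u \<or> w \<in> fst ` set L" "resid es A v w"
proof (cases "v \<in> set (u # map fst L)")
  case True
  then show ?thesis using that(1) by (auto simp: rstep_def)
next
  case False
  show ?thesis
  proof (cases "filter (\<lambda>w. w \<in> set (u # map fst L) \<and> resid es A v w) (u # xs)")
    case Nil
    then have "\<forall>w\<in>set (u # xs). \<not> (w \<in> set (u # map fst L) \<and> resid es A v w)"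
      by (simp only: filter_empty_conv)
    moreover have "rstep es xs u A v L = L" unfolding rstep_def Nil by simp
    ultimately show ?thesis by (intro that(1)) auto
  next
    case (Cons w ws)
    have "w \<in> set (filter (\<lambda>w. w \<in> set (u # map fst L) \<and> resid es A v w) (u # xs))" unfolding Cons by simp
    then have "w \<in> set (u # map fst L) \<and> resid es A v w" by (simp only: set_filter mem_Collect_eq)
    moreover have "rstep es xs u A v L = (v, w) # L" unfolding rstep_def Cons using False by simp
    ultimately show ?thesis using False by (intro that(2)) auto
  qed
qed

text \<open>A pass that adds nothing has tested every unreached vertex against the final list; it
  certifies that no residual arc enters the reached set.\<close>

lemma rpass_props:
  assumes "rok A L" "set ys \<subseteq> X"
  shows "rok A (fold (rstep es xs u A) ys L) \<and> length L \<le> length (fold (rstep es xs u A) ys L) \<and>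
    (length (fold (rstep es xs u A) ys L) \<le> length L \<longrightarrow> fold (rstep es xs u A) ys L = L \<and>
      (\<forall>v\<in>set ys. v \<in> fst ` set L \<or> (\<forall>w\<in>Y. w = u \<or> w \<in> fst ` set L \<longrightarrow> \<not> resid es A v w)))"
  using assms
proof (induction ys arbitrary: L)
  case (Cons v ys)
  have "v \<noteq> u" "v \<in> X" using Cons.prems u by auto
  show ?case
  proof (cases rule: rstep_cases[of A v L])
    case 1
    then show ?thesis using Cons.IH[of L] Cons.prems \<open>v \<noteq> u\<close> by auto
  next
    case (2 w)
    have "rok A ((v, w) # L)" using 2 Cons.prems \<open>v \<in> X\<close> by simp
    from Cons.IH[OF this] show ?thesis using 2(1) Cons.prems by auto
  qed
qed simp

lemma reach_props:
  shows "rok A (reach es xs u A)"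
    and "v \<in> X \<Longrightarrow> v \<notin> fst ` set (reach es xs u A) \<Longrightarrow> w = u \<or> w \<in> fst ` set (reach es xs u A) \<Longrightarrow> \<not> resid es A v w"
proof -
  let ?F = "rpass es xs u A"
  have *: "?F ((?F ^^ length xs) []) = (?F ^^ length xs) [] \<and> rok A ((?F ^^ length xs) [])"
  proof (rule funpow_stable[where m = length and Inv = "rok A" and N = "length xs"])
    fix L assume L: "rok A L"
    show "rok A (?F L)" using rpass_props[OF L, of xs] by (simp add: rpass_def)
    show "?F L = L \<or> length L < length (?F L)" using rpass_props[OF L, of xs] by (auto simp: rpass_def)
    show "length L \<le> length xs"
      using rok_fst[OF L] card_mono[of X "fst ` set L"] card_length[of xs] by simp
  qed auto
  have r: "reach es xs u A = (?F ^^ length xs) []" by (simp add: reach_def fold_const)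
  show ok: "rok A (reach es xs u A)" using * r by simp
  assume v: "v \<in> X" "v \<notin> fst ` set (reach es xs u A)" "w = u \<or> w \<in> fst ` set (reach es xs u A)"
  have wY: "w \<in> Y" using v(3) rok_fst[OF ok] by auto
  have fx: "fold (rstep es xs u A) xs (reach es xs u A) = reach es xs u A" using * r by (simp add: rpass_def)
  have "\<forall>v\<in>X. v \<in> fst ` set (reach es xs u A) \<or>
      (\<forall>w\<in>Y. w = u \<or> w \<in> fst ` set (reach es xs u A) \<longrightarrow> \<not> resid es A v w)"
    using rpass_props[OF ok subset_refl, unfolded fx] by simp
  then show "\<not> resid es A v w" using v wY by blast
qed

lemma route_aux:
  assumes "rok A L" "cur = u \<or> cur \<in> fst ` set L"
  shows "\<exists>R. fold (\<lambda>e s. if fst e = fst s then (snd e, e # snd s) else s) L (cur, acc) = (u, R @ acc)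
    \<and> set R \<subseteq> set L \<and> distinct R \<and> (\<forall>x. int (outd R x) - int (ind R x) = (if x = cur then 1 else 0) - (if x = u then 1 else 0))"
  using assms
proof (induction L arbitrary: cur acc)
  case Nil
  then show ?case by (intro exI[of _ "[]"]) (auto simp: outd_def ind_def)
next
  case (Cons e L)
  show ?case
  proof (cases "fst e = cur")
    case True
    have "rok A L" "snd e = u \<or> snd e \<in> fst ` set L" using Cons.prems by auto
    from Cons.IH[OF this, of "e # acc"] obtain R where R:
      "fold (\<lambda>e s. if fst e = fst s then (snd e, e # snd s) else s) L (snd e, e # acc) = (u, R @ e # acc)"
      "set R \<subseteq> set L" "distinct R"
      "\<And>x. int (outd R x) - int (ind R x) = (if x = snd e then 1 else 0) - (if x = u then 1 else 0)" by blast
    have "e \<notin> set R" using R(2) Cons.prems by force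
    moreover have "int (outd (R @ [e]) x) - int (ind (R @ [e]) x) = (if x = cur then 1 else 0) - (if x = u then 1 else 0)" for x
      using R(4)[of x] True by (auto simp: outd_def ind_def)
    ultimately show ?thesis using R True by (intro exI[of _ "R @ [e]"]) auto
  next
    case False
    have "rok A L" "cur = u \<or> cur \<in> fst ` set L" using Cons.prems False by auto
    from Cons.IH[OF this, of acc] obtain R where R:
      "fold (\<lambda>e s. if fst e = fst s then (snd e, e # snd s) else s) L (cur, acc) = (u, R @ acc)"
      "set R \<subseteq> set L" "distinct R"
      "\<forall>x. int (outd R x) - int (ind R x) = (if x = cur then 1 else 0) - (if x = u then 1 else 0)" by blast
    have "fold (\<lambda>e s. if fst e = fst s then (snd e, e # snd s) else s) (e # L) (cur, acc) = (u, R @ acc)"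
      using R(1) False by simp
    moreover have "set R \<subseteq> set (e # L)" using R(2) by auto
    ultimately show ?thesis using R(3,4) by blast
  qed
qed

lemma route:
  assumes "rok A L" "v \<in> fst ` set L"
  shows "set (route L v) \<subseteq> set L" "distinct (route L v)"
    "int (outd (route L v) x) - int (ind (route L v) x) = (if x = v then 1 else 0) - (if x = u then 1 else 0)"
proof -
  obtain R where "fold (\<lambda>e s. if fst e = fst s then (snd e, e # snd s) else s) L (v, []) = (u, R @ [])"
    "set R \<subseteq> set L" "distinct R"
    "\<forall>x. int (outd R x) - int (ind R x) = (if x = v then 1 else 0) - (if x = u then 1 else 0)"
    using route_aux[OF assms(1), of v "[]"] assms(2) by blast
  moreover from this(1) have "route L v = R" by (simp add: route_def)
  ultimately show "set (route L v) \<subseteq> set L" "distinct (route L v)"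
    "int (outd (route L v) x) - int (ind (route L v) x) = (if x = v then 1 else 0) - (if x = u then 1 else 0)"
    by simp_all
qed

definition finv :: "('a \<times> 'a) list \<times> 'a list \<Rightarrow> bool" where
  "finv st \<longleftrightarrow> (\<forall>a b. netf (fst st) a b \<le> int (c a b)) \<and> set (fst st) \<subseteq> Y \<times> Y \<and>
     (\<forall>v\<in>X. int (outd (fst st) v) - int (ind (fst st) v) = int (vcount (snd st) v)) \<and>
     set (snd st) \<subseteq> X \<and> (\<forall>v\<in>X. vcount (snd st) v \<le> s v)"

abbreviation "sl \<equiv> map (\<lambda>v. (v, s v)) xs"

lemma augment_cases:
  obtains "augment es sl u st = st" "\<And>v. v \<in> X \<Longrightarrow> v \<in> fst ` set (reach es xs u (fst st)) \<Longrightarrow> s v \<le> vcount (snd st) v"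
  | v where "augment es sl u st = (route (reach es xs u (fst st)) v @ fst st, v # snd st)" "v \<in> X"
      "v \<in> fst ` set (reach es xs u (fst st))" "vcount (snd st) v < s v"
proof -
  have m: "map fst sl = xs" by (simp add: comp_def)
  let ?P = "\<lambda>e. fst e \<in> set (map fst (reach es xs u (fst st))) \<and> vcount (snd st) (fst e) < snd e"
  show ?thesis
  proof (cases "filter ?P sl")
    case Nil
    then have "\<forall>e\<in>set sl. \<not> ?P e" by (simp only: filter_empty_conv)
    moreover have "augment es sl u st = st" unfolding augment_def m Nil by simp
    ultimately show ?thesis by (intro that(1)) (auto simp: not_less)
  next
    case (Cons e ws)
    have "e \<in> set (filter ?P sl)" unfolding Cons by simp
    then have "e \<in> set sl \<and> ?P e" by (simp only: set_filter mem_Collect_eq)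
    moreover have "augment es sl u st = (route (reach es xs u (fst st)) (fst e) @ fst st, fst e # snd st)"
      unfolding augment_def m Cons by simp
    ultimately show ?thesis by (intro that(2)[of "fst e"]) auto
  qed
qed

lemma augment_finv:
  assumes "finv st" shows "finv (augment es sl u st)"
proof (cases rule: augment_cases[of st])
  case 1
  then show ?thesis using assms by simp
next
  case (2 v)
  define L where "L = reach es xs u (fst st)"
  define R where "R = route L v"
  have L: "rok (fst st) L" unfolding L_def by (rule reach_props(1))
  note rt = route[OF L 2(3)[folded L_def], folded R_def]
  \<comment> \<open>An arc of the new path gains one unit, for which \<open>resid\<close> leaves
    room; for all other pairs the net flow does not grow.\<close>
  have "netf (R @ fst st) a b \<le> int (c a b)" for a b
  proof (cases "(a, b) \<in> set R")
    case True
    then have "(b, a) \<notin> set R" "resid es (fst st) a b" using rt(1) rok_asym[OF L] rok_resid[OF L] by blast+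
    then show ?thesis using True rt(2) by (auto simp: acount_append acount_distinct resid_def)
  next
    case False
    then show ?thesis using assms rt(2) by (auto simp: acount_append acount_distinct finv_def)
      (smt (verit))+
  qed
  moreover have "set R \<subseteq> Y \<times> Y"
  proof
    fix e assume "e \<in> set R"
    then have "e \<in> set L" using rt(1) by blast
    then have "fst e \<in> Y" "snd e \<in> Y" using rok_fst[OF L] rok_snd[OF L, of e] by auto
    then show "e \<in> Y \<times> Y" by (cases e) auto
  qed
  moreover have "int (outd (R @ fst st) x) - int (ind (R @ fst st) x) = int (vcount (v # snd st) x)" if "x \<in> X" for x
  proof -
    have "x \<noteq> u" using that u by auto
    then show ?thesis using rt(3)[of x] assms that by (auto simp: finv_def outd_def ind_def vcount_Cons)
  qed
  moreover have "vcount (v # snd st) x \<le> s x" if "x \<in> X" for x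
    using assms that 2(4) by (auto simp: vcount_Cons finv_def)
  ultimately show ?thesis unfolding 2(1) L_def[symmetric] R_def[symmetric]
    using assms 2(2) by (auto simp: finv_def)
qed

lemma mf_stable:
  assumes "sum s X \<le> length N"
  shows "finv (mf es sl u N)" "augment es sl u (mf es sl u N) = mf es sl u N"
proof -
  let ?F = "augment es sl u"
  have "?F ((?F ^^ length N) ([], [])) = (?F ^^ length N) ([], []) \<and> finv ((?F ^^ length N) ([], []))"
  proof (rule funpow_stable[where m = "length \<circ> snd" and N = "sum s X"])
    show "finv ([], [])" by (simp add: finv_def acount_def outd_def ind_def)
    fix st assume st: "finv st"
    show "finv (?F st)" by (rule augment_finv[OF st])
    have "length (snd st) = (\<Sum>v\<in>X. vcount (snd st) v)" using st by (simp add: sum_vcount finv_def)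
    also have "\<dots> \<le> sum s X" using st by (intro sum_mono) (auto simp: finv_def)
    finally show "(length \<circ> snd) st \<le> sum s X" by simp
    show "?F st = st \<or> (length \<circ> snd) st < (length \<circ> snd) (?F st)"
      by (cases rule: augment_cases[of st]) auto
  qed (use assms in auto)
  then show "finv (mf es sl u N)" "augment es sl u (mf es sl u N) = mf es sl u N"
    by (auto simp: mf_def fold_const)
qed

text \<open>The vertices without a residual path to the sink: the side of a minimum cut that avoids
  the sink.\<close>

definition cutside :: "('a \<times> 'a) list \<Rightarrow> 'a set" where
  "cutside A = X - fst ` set (reach es xs u A)"

text \<open>Max-flow min-cut for the network with a super-source joined to each \<open>v\<close> by
  an arc of capacity \<open>s v\<close>. Outside \<open>D\<close> the supplies are exhausted, else
  an augmentation would exist; all edges out of \<open>D\<close> are saturated; the net flow inside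
  \<open>D\<close> cancels.\<close>

lemma mf_cut:
  assumes N: "sum s X \<le> length N"
  defines "D \<equiv> cutside (fst (mf es sl u N))"
  shows "length (snd (mf es sl u N)) = (\<Sum>v\<in>D. \<Sum>w\<in>Y - D. c v w) + (\<Sum>v\<in>X - D. s v)"
proof -
  obtain A S where AS: "mf es sl u N = (A, S)" by (cases "mf es sl u N")
  have inv: "finv (A, S)" using mf_stable(1)[OF N] AS by simp
  have D: "D \<subseteq> X" "u \<notin> D" using u by (auto simp: D_def cutside_def)
  have sat: "vcount S v = s v" if "v \<in> X - D" for v
  proof (cases rule: augment_cases[of "(A, S)"])
    case 1
    have vr: "v \<in> X" "v \<in> fst ` set (reach es xs u (fst (A, S)))" using that by (auto simp: D_def cutside_def AS)
    have "s v \<le> vcount S v" using 1(2)[OF vr] by simp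
    moreover have "vcount S v \<le> s v" using inv vr(1) by (simp add: finv_def)
    ultimately show ?thesis by simp
  next
    case (2 v)
    then show ?thesis using mf_stable(2)[OF N] AS by simp
  qed
  have full: "netf A v w = int (c v w)" if "v \<in> D" "w \<in> Y - D" for v w
  proof -
    have "\<not> resid es A v w"
      using that reach_props(2)[of v A w] by (auto simp: D_def cutside_def AS)
    moreover have "netf A v w \<le> int (c v w)" using inv by (simp add: finv_def)
    ultimately show ?thesis by (simp add: resid_def)
  qed
  have "int (\<Sum>v\<in>D. vcount S v) = (\<Sum>v\<in>D. \<Sum>w\<in>Y. netf A v w)"
  proof -
    have "int (vcount S v) = (\<Sum>w\<in>Y. netf A v w)" if "v \<in> D" for v
      using that inv D by (subst sum_netf) (auto simp: finv_def)
    then show ?thesis by (simp cong: sum.cong)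
  qed
  also have "\<dots> = (\<Sum>v\<in>D. (\<Sum>w\<in>Y - D. netf A v w) + (\<Sum>w\<in>D. netf A v w))"
    using D by (intro sum.cong refl sum.subset_diff) auto
  also have "\<dots> = (\<Sum>v\<in>D. \<Sum>w\<in>Y - D. netf A v w) + (\<Sum>v\<in>D. \<Sum>w\<in>D. netf A v w)" by (rule sum.distrib)
  also have "(\<Sum>v\<in>D. \<Sum>w\<in>D. netf A v w) = 0"
  proof -
    have "(\<Sum>v\<in>D. \<Sum>w\<in>D. netf A v w) = (\<Sum>v\<in>D. \<Sum>w\<in>D. int (acount A v w)) - (\<Sum>v\<in>D. \<Sum>w\<in>D. int (acount A w v))"
      by (simp only: sum_subtractf)
    also have "(\<Sum>v\<in>D. \<Sum>w\<in>D. int (acount A w v)) = (\<Sum>v\<in>D. \<Sum>w\<in>D. int (acount A v w))" by (rule sum.swap)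
    finally show ?thesis by simp
  qed
  also have "(\<Sum>v\<in>D. \<Sum>w\<in>Y - D. netf A v w) = (\<Sum>v\<in>D. \<Sum>w\<in>Y - D. int (c v w))"
    by (intro sum.cong refl full)
  finally have 1: "(\<Sum>v\<in>D. vcount S v) = (\<Sum>v\<in>D. \<Sum>w\<in>Y - D. c v w)" by (simp flip: of_nat_sum)
  have "length S = (\<Sum>v\<in>X. vcount S v)" using inv by (simp add: sum_vcount finv_def)
  also have "\<dots> = (\<Sum>v\<in>X - D. vcount S v) + (\<Sum>v\<in>D. vcount S v)"
    using D by (intro sum.subset_diff) auto
  also have "(\<Sum>v\<in>X - D. vcount S v) = (\<Sum>v\<in>X - D. s v)" by (intro sum.cong refl sat)
  finally show ?thesis using 1 AS by simp
qed

text \<open>A residual path from \<open>Z\<close> to the sink would leave \<open>Z\<close> along an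
  edge of positive capacity, but such edges end in vertices that cannot reach the sink. The
  induction runs along the search list.\<close>

lemma cutside_closed:
  assumes inv: "finv (A, S)" and Z: "Z \<subseteq> X"
    and cl: "\<And>v w. v \<in> Z \<Longrightarrow> w \<in> Y \<Longrightarrow> 0 < c v w \<Longrightarrow> w \<in> Z \<union> cutside A"
  shows "Z \<subseteq> cutside A"
proof -
  \<comment> \<open>Across a pair of capacity 0 no net flow can run in either direction, so it
    admits no residual arc.\<close>
  have pos: "0 < c a b" if "resid es A a b" for a b
  proof (rule ccontr)
    assume "\<not> 0 < c a b"
    then have "c a b = 0" "c b a = 0" using ccap_sym[of es a b] by auto
    moreover have "netf A b a \<le> int (c b a)" using inv by (auto simp: finv_def)
    ultimately show False using that by (simp add: resid_def)
  qed
  have "Z \<inter> fst ` set L = {}" if "rok A L" "set L \<subseteq> set (reach es xs u A)" for L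
    using that
  proof (induction L)
    case (Cons e L)
    have "fst e \<notin> Z"
    proof
      assume e: "fst e \<in> Z"
      have 0: "0 < c (fst e) (snd e)" using Cons.prems by (intro pos) simp
      have ok: "rok A L" using Cons.prems by simp
      have "snd e = u \<or> snd e \<in> fst ` set L" using Cons.prems by simp
      then have se: "snd e \<in> Y" "snd e \<notin> cutside A"
        using rok_fst[OF ok] Cons.prems(2) u by (auto simp: cutside_def)
      then have "snd e \<in> Z" using cl[OF e _ 0] by blast
      then show False using \<open>snd e = u \<or> snd e \<in> fst ` set L\<close> Cons u Z by auto
    qed
    then show ?case using Cons by auto
  qed simp
  from this[OF reach_props(1)] show ?thesis using Z by (auto simp: cutside_def)
qed

end

lemma sum_delta_diff:
  assumes "a \<in> Y" "b \<in> Y" "finite Y"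
  shows "(\<Sum>w\<in>Y. (if v = a then if w = b then 1 else 0 else 0) - (if v = b then if w = a then 1 else 0 else 0))
    = (if v = a then 1 else 0) - (if v = b then 1 else 0 :: int)"
  using assms by (simp add: sum_subtractf)

text \<open>Induction on the total supply, peeling off one unit path at a time. Circulations may be
  left over, which is why the arc counts are bounded rather than determined.\<close>

lemma flow_decomp:
  fixes \<phi> :: "'a \<Rightarrow> 'a \<Rightarrow> int" and d :: "'a \<Rightarrow> nat"
  assumes X: "finite X" "u \<notin> X" and anti: "\<And>a b. \<phi> a b = - \<phi> b a"
    and cons: "\<And>v. v \<in> X \<Longrightarrow> (\<Sum>w\<in>insert u X. \<phi> v w) = int (d v)"
  shows "\<exists>qs. (\<forall>q\<in>set qs. q \<noteq> [] \<and> distinct q \<and> hd q \<in> X \<and> last q = u \<and> set q \<subseteq> insert u X) \<and>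
    (\<forall>v\<in>X. length (filter (\<lambda>q. hd q = v) qs) = d v) \<and>
    (\<forall>a b. int (length (filter (\<lambda>q. (a, b) \<in> arcs q) qs)) \<le> max 0 (\<phi> a b))"
  using anti cons
proof (induction "sum d X" arbitrary: d \<phi>)
  case 0
  then have "\<forall>v\<in>X. d v = 0" using X(1) by (metis sum_eq_0_iff)
  then show ?case by (intro exI[of _ "[]"]) simp
next
  case (Suc n)
  let ?Y = "insert u X"
  obtain v0 where v0: "v0 \<in> X" "0 < d v0" using Suc.hyps(2) X by (metis gr0I nat.distinct(1) sum.neutral)
  define R where "R = {(a, b). a \<in> X \<and> b \<in> ?Y \<and> 0 < \<phi> a b}"
  \<comment> \<open>Otherwise the set reachable from \<open>v0\<close> along positive arcs lies in
    \<open>X\<close> and sends nothing out, although its supplies have a positive sum.\<close>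
  have "(v0, u) \<in> R\<^sup>*"
  proof (rule ccontr)
    assume nu: "(v0, u) \<notin> R\<^sup>*"
    define Q where "Q = {x. (v0, x) \<in> R\<^sup>*}"
    have QX: "Q \<subseteq> X"
    proof
      fix x assume "x \<in> Q"
      then have "(v0, x) \<in> R\<^sup>*" by (simp add: Q_def)
      then show "x \<in> X"
      proof (cases rule: rtranclE)
        case base
        then show ?thesis using v0 by simp
      next
        case (step y)
        then show ?thesis using nu \<open>(v0, x) \<in> R\<^sup>*\<close> by (auto simp: R_def)
      qed
    qed
    have fQ: "finite Q" using QX X finite_subset by blast
    have "(\<Sum>v\<in>Q. int (d v)) = (\<Sum>v\<in>Q. \<Sum>w\<in>?Y. \<phi> v w)"
      using QX Suc.prems(2) by (intro sum.cong) auto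
    also have "\<dots> = (\<Sum>v\<in>Q. (\<Sum>w\<in>?Y - Q. \<phi> v w) + (\<Sum>w\<in>Q. \<phi> v w))"
      using QX X by (intro sum.cong refl sum.subset_diff) auto
    also have "\<dots> = (\<Sum>v\<in>Q. \<Sum>w\<in>?Y - Q. \<phi> v w) + (\<Sum>v\<in>Q. \<Sum>w\<in>Q. \<phi> v w)" by (rule sum.distrib)
    also have "(\<Sum>v\<in>Q. \<Sum>w\<in>Q. \<phi> v w) = 0"
    proof -
      have "(\<Sum>v\<in>Q. \<Sum>w\<in>Q. \<phi> v w) = (\<Sum>v\<in>Q. \<Sum>w\<in>Q. - \<phi> w v)"
        by (intro sum.cong refl Suc.prems(1))
      also have "\<dots> = - (\<Sum>v\<in>Q. \<Sum>w\<in>Q. \<phi> w v)" by (simp only: sum_negf)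
      also have "(\<Sum>v\<in>Q. \<Sum>w\<in>Q. \<phi> w v) = (\<Sum>v\<in>Q. \<Sum>w\<in>Q. \<phi> v w)" by (rule sum.swap)
      finally show ?thesis by simp
    qed
    also have "(\<Sum>v\<in>Q. \<Sum>w\<in>?Y - Q. \<phi> v w) \<le> 0"
    proof (intro sum_nonpos)
      fix v w assume vw: "v \<in> Q" "w \<in> ?Y - Q"
      show "\<phi> v w \<le> 0"
      proof (rule ccontr)
        assume "\<not> \<phi> v w \<le> 0"
        then have "(v, w) \<in> R" using vw QX by (auto simp: R_def)
        then have "w \<in> Q" using vw(1) by (auto simp: Q_def intro: rtrancl_into_rtrancl)
        then show False using vw by simp
      qed
    qed
    finally have "(\<Sum>v\<in>Q. int (d v)) \<le> 0" by simp
    moreover have "v0 \<in> Q" by (simp add: Q_def)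
    then have "int (d v0) \<le> (\<Sum>v\<in>Q. int (d v))" using fQ by (intro member_le_sum) auto
    ultimately show False using v0 by simp
  qed
  from rtrancl_path[OF this] obtain p where p: "p \<noteq> []" "distinct p" "hd p = v0" "last p = u" "arcs p \<subseteq> R" by blast
  have setp: "set p \<subseteq> ?Y" using set_arcs[OF p(1)] p(3,5) v0 by (auto simp: R_def)
  define \<psi> where "\<psi> a b = \<phi> a b - (if (a, b) \<in> arcs p then 1 else 0) + (if (b, a) \<in> arcs p then 1 else 0)" for a b
  define d' where "d' v = (if v = v0 then d v - 1 else d v)" for v
  have anti': "\<psi> a b = - \<psi> b a" for a b using Suc.prems(1)[of a b] by (simp add: \<psi>_def)
  have bal: "(\<Sum>w\<in>?Y. (if (v, w) \<in> arcs q then 1 else 0) - (if (w, v) \<in> arcs q then 1 else 0 :: int))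
      = (if v = hd q then 1 else 0) - (if v = last q then 1 else 0)"
    if "distinct q" "set q \<subseteq> ?Y" "q \<noteq> []" for q v
    using that
  proof (induction q rule: induct_list012)
    case (3 a b q)
    have ab: "(a, b) \<notin> arcs (b # q)" "(b, a) \<notin> arcs (b # q)" using 3(3) arcs_in_set[of _ _ "b # q"] by force+
    have ne: "a \<noteq> b" using 3(3) by auto
    have "(\<Sum>w\<in>?Y. (if (v, w) \<in> arcs (a # b # q) then 1 else 0) - (if (w, v) \<in> arcs (a # b # q) then 1 else 0 :: int))
        = (\<Sum>w\<in>?Y. ((if (v, w) \<in> arcs (b # q) then 1 else 0) - (if (w, v) \<in> arcs (b # q) then 1 else 0))
            + ((if v = a then if w = b then 1 else 0 else 0) - (if v = b then if w = a then 1 else 0 else 0)))"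
      using ab ne by (intro sum.cong refl) auto
    also have "\<dots> = (if v = b then 1 else 0) - (if v = last (b # q) then 1 else 0)
        + ((if v = a then 1 else 0) - (if v = b then 1 else 0))"
    proof -
      have abY: "a \<in> ?Y" "b \<in> ?Y" "finite ?Y" using 3(4) X by auto
      have "(\<Sum>w\<in>?Y. (if v = a then if w = b then 1 else 0 else 0) - (if v = b then if w = a then 1 else 0 else 0))
          = (if v = a then 1 else 0) - (if v = b then 1 else 0 :: int)"
        using abY by (rule sum_delta_diff)
      moreover have "(\<Sum>w\<in>?Y. (if (v, w) \<in> arcs (b # q) then 1 else 0) - (if (w, v) \<in> arcs (b # q) then 1 else 0 :: int))
          = (if v = b then 1 else 0) - (if v = last (b # q) then 1 else 0)"
        using 3(2)[of] 3(3,4) by (simp only: distinct.simps set_simps insert_subset list.sel list.simps if_True) auto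
      ultimately show ?thesis unfolding sum.distrib by (simp only:)
    qed
    finally show ?case by simp
  qed simp_all
  have cons': "(\<Sum>w\<in>?Y. \<psi> v w) = int (d' v)" if "v \<in> X" for v
  proof -
    have "(\<Sum>w\<in>?Y. \<psi> v w) = (\<Sum>w\<in>?Y. \<phi> v w) - (\<Sum>w\<in>?Y. (if (v, w) \<in> arcs p then 1 else 0) - (if (w, v) \<in> arcs p then 1 else 0))"
      unfolding \<psi>_def sum_subtractf[symmetric] by (intro sum.cong) auto
    also have "\<dots> = int (d v) - (if v = v0 then 1 else 0)"
      using Suc.prems(2)[OF that] bal[OF p(2) setp p(1)] p(3,4) that X by auto
    finally show ?thesis using v0 by (auto simp: d'_def)
  qed
  have "sum d X = Suc (sum d' X)"
  proof -
    have "sum d X = d v0 + sum d (X - {v0})" "sum d' X = d' v0 + sum d' (X - {v0})"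
      by (rule sum.remove[OF X(1) v0(1)])+
    moreover have "sum d (X - {v0}) = sum d' (X - {v0})" by (intro sum.cong) (auto simp: d'_def)
    moreover have "d v0 = Suc (d' v0)" using v0 by (simp add: d'_def)
    ultimately show ?thesis by linarith
  qed
  then have "n = sum d' X" using Suc.hyps(2) by simp
  from Suc.hyps(1)[OF this anti' cons'] obtain qs where qs:
    "\<forall>q\<in>set qs. q \<noteq> [] \<and> distinct q \<and> hd q \<in> X \<and> last q = u \<and> set q \<subseteq> ?Y"
    "\<forall>v\<in>X. length (filter (\<lambda>q. hd q = v) qs) = d' v"
    "\<forall>a b. int (length (filter (\<lambda>q. (a, b) \<in> arcs q) qs)) \<le> max 0 (\<psi> a b)" by blast
  \<comment> \<open>On an arc of \<open>p\<close> the positive value drops by one; the reverse value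
    is negative and rises by one, so it stays at most 0 and admits no path.\<close>
  have "int (length (filter (\<lambda>q. (a, b) \<in> arcs q) (p # qs))) \<le> max 0 (\<phi> a b)" for a b
  proof -
    have "(b, a) \<in> arcs p \<Longrightarrow> \<phi> b a > 0" "(a, b) \<in> arcs p \<Longrightarrow> \<phi> a b > 0" using p(5) by (auto simp: R_def)
    then show ?thesis using qs(3)[rule_format, of a b] Suc.prems(1)[of a b] by (auto simp: \<psi>_def split: if_splits)
  qed
  moreover have "length (filter (\<lambda>q. hd q = v) (p # qs)) = d v" if "v \<in> X" for v
    using qs(2) that v0 p(3) by (auto simp: d'_def)
  ultimately show ?case using qs(1) p setp v0 by (intro exI[of _ "p # qs"]) auto
qed

lemma (in network) mf_paths:
  assumes N: "sum s X \<le> length N"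
  defines "S \<equiv> snd (mf es sl u N)"
  shows "\<exists>qs. length qs = length S \<and> (\<forall>q\<in>set qs. q \<noteq> [] \<and> distinct q \<and> hd q \<in> X \<and> last q = u \<and> set q \<subseteq> Y) \<and>
    (\<forall>v\<in>X. length (filter (\<lambda>q. hd q = v) qs) = vcount S v) \<and>
    (\<forall>a b. length (filter (\<lambda>q. {a, b} \<in> path_edges q) qs) \<le> c a b)"
proof -
  obtain A where AS: "mf es sl u N = (A, S)" unfolding S_def by (cases "mf es sl u N") auto
  have inv: "finv (A, S)" using mf_stable(1)[OF N] AS by simp
  have "\<exists>qs. (\<forall>q\<in>set qs. q \<noteq> [] \<and> distinct q \<and> hd q \<in> X \<and> last q = u \<and> set q \<subseteq> Y) \<and>
    (\<forall>v\<in>X. length (filter (\<lambda>q. hd q = v) qs) = vcount S v) \<and>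
    (\<forall>a b. int (length (filter (\<lambda>q. (a, b) \<in> arcs q) qs)) \<le> max 0 (netf A a b))"
  proof (rule flow_decomp)
    fix v assume "v \<in> X"
    then show "(\<Sum>w\<in>Y. netf A v w) = int (vcount S v)" using inv by (subst sum_netf) (auto simp: finv_def)
  qed (use u in auto)
  then obtain qs where qs: "\<forall>q\<in>set qs. q \<noteq> [] \<and> distinct q \<and> hd q \<in> X \<and> last q = u \<and> set q \<subseteq> Y"
    "\<forall>v\<in>X. length (filter (\<lambda>q. hd q = v) qs) = vcount S v"
    "\<forall>a b. int (length (filter (\<lambda>q. (a, b) \<in> arcs q) qs)) \<le> max 0 (netf A a b)" by blast
  \<comment> \<open>At most one of two opposite net flows is positive, so the two directions
    together use an undirected edge no more often than its capacity allows.\<close>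
  have "length (filter (\<lambda>q. {a, b} \<in> path_edges q) qs) \<le> c a b" for a b
  proof -
    have "length (filter (\<lambda>q. {a, b} \<in> path_edges q) qs)
        \<le> length (filter (\<lambda>q. (a, b) \<in> arcs q) qs) + length (filter (\<lambda>q. (b, a) \<in> arcs q) qs)"
      by (induction qs) (auto simp: path_edges_arcs doubleton_eq_iff)
    moreover have "int (length (filter (\<lambda>q. (a, b) \<in> arcs q) qs)) \<le> max 0 (netf A a b)"
      "int (length (filter (\<lambda>q. (b, a) \<in> arcs q) qs)) \<le> max 0 (netf A b a)" using qs(3) by blast+
    moreover have "netf A a b \<le> int (c a b)" "netf A b a \<le> int (c a b)" using inv ccap_sym[of es a b] unfolding finv_def fst_conv by metis+
    ultimately show ?thesis by linarith
  qed
  moreover have "length qs = length S"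
  proof -
    have "length qs = (\<Sum>v\<in>X. length (filter (\<lambda>q. hd q = v) qs))"
      using qs(1)
    proof (induction qs)
      case (Cons q qs)
      have "(\<Sum>v\<in>X. length (filter (\<lambda>q. hd q = v) (q # qs))) = (\<Sum>v\<in>X. (if v = hd q then 1 else 0) + length (filter (\<lambda>q. hd q = v) qs))"
        by (intro sum.cong refl) auto
      then show ?case using Cons by (simp add: sum.distrib)
    qed simp
    also have "\<dots> = (\<Sum>v\<in>X. vcount S v)" using qs(2) by (intro sum.cong) auto
    also have "\<dots> = length S" using inv by (simp add: sum_vcount finv_def)
    finally show ?thesis .
  qed
  ultimately show ?thesis using qs by blast
qed

section \<open>The decomposition algorithm as functions on lists\<close>

section \<open>The algorithm\<close>

definition inside :: "'a list \<Rightarrow> 'a list \<Rightarrow> bool" where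
  "inside p S \<longleftrightarrow> (\<forall>v\<in>set p. v \<in> set S)"

definition wsum :: "('a list \<times> nat) list \<Rightarrow> nat" where
  "wsum A = sum_list (map snd A)"

text \<open>The marginal of \<open>v\<close> under the flow \<open>A\<close>, multiplied by the
  common denominator of the weights.\<close>

definition endw :: "('a list \<times> nat) list \<Rightarrow> 'a \<Rightarrow> nat" where
  "endw A v = wsum (filter (\<lambda>e. v = hd (fst e) \<or> v = last (fst e)) A)"

text \<open>The cone without its parent adhesion, cut down to the part \<open>P\<close>; a node is
  represented by the pair of its cone and its adhesion.\<close>

definition alpha :: "'a list \<times> 'a list \<Rightarrow> 'a list \<Rightarrow> 'a list" where
  "alpha n P = filter (\<lambda>v. v \<in> set P \<and> v \<notin> set (snd n)) (fst n)"

definition adh :: "'a list \<times> 'a list \<Rightarrow> 'a list \<Rightarrow> 'a list" where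
  "adh n P = filter (\<lambda>u. u \<in> set P) (snd n)"

definition bdp :: "('a list \<times> nat) list \<Rightarrow> 'a list \<times> 'a list \<Rightarrow> 'a list \<Rightarrow> ('a list \<times> nat) list" where
  "bdp A n P = filter (\<lambda>e. inside (fst e) (alpha n P)) A"

definition units :: "'a list \<Rightarrow> ('a \<times> 'a \<times> nat) list \<Rightarrow> bool list" where
  "units vs es = map (\<lambda>_. True) vs @ map (\<lambda>_. True) es @ map (\<lambda>_. True) vs @ map (\<lambda>_. True) es"

text \<open>With \<open>k = q * K\<close> and X twice the weight of the paths, a unit of the rounded
  network is worth X/(qK) of flow. As q = 4rd, full supplies stand for 1/(4r) of the marginals, the
  amount in the definition of safe nodes.\<close>

definition capl :: "nat \<Rightarrow> nat \<Rightarrow> ('a \<times> 'a \<times> nat) list \<Rightarrow> ('a \<times> 'a \<times> nat) list" where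
  "capl k X es = map (\<lambda>e. (fst e, fst (snd e), (snd (snd e) * k) div X)) es"

definition supl :: "nat \<Rightarrow> nat \<Rightarrow> ('a list \<times> nat) list \<Rightarrow> 'a list \<Rightarrow> ('a \<times> nat) list" where
  "supl k X bd al = map (\<lambda>v. (v, (k * endw bd v) div X)) al"

text \<open>Supplies and capacities are scaled so that the whole demand amounts to \<open>K = length (units vs es)\<close>
  units, twice the number of vertices and edges: rounding down then loses at most \<open>K / 2\<close> units on
  any cut, and the augmentations are so few that they can be done one unit at a time.\<close>

definition trials :: "'a list \<Rightarrow> ('a \<times> 'a \<times> nat) list \<Rightarrow> nat \<Rightarrow> 'a list \<Rightarrow> 'a list \<Rightarrow> ('a list \<times> nat) list
    \<Rightarrow> ('a \<times> ('a \<times> 'a) list \<times> 'a list) list" where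
  "trials vs es q al bl bd = map (\<lambda>u. (u, mf (capl (q * length (units vs es)) (2 * wsum bd) es)
      (supl (length (units vs es)) (2 * wsum bd) bd al) u (units vs es))) bl"

text \<open>\<open>length bl\<close> is the number s of sinks: if every value stays below K/(3s),
  the values sum to less than K/3, which is what \<open>sparse\<close> needs.\<close>

definition links where
  "links vs es q al bl bd = filter (\<lambda>e. length (units vs es) \<le> 3 * length bl * length (snd (snd e))) (trials vs es q al bl bd)"

text \<open>Without sinks the condition is void and all of \<open>al\<close> is taken; at adhesion
  size 0 whole cones are cut off in this way.\<close>

definition cutset where
  "cutset vs es q al bl bd = filter (\<lambda>v. \<forall>e\<in>set (trials vs es q al bl bd).
     v \<notin> set (map fst (reach (capl (q * length (units vs es)) (2 * wsum bd) es) al (fst e) (fst (snd e))))) al"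

definition prodl :: "'b list \<Rightarrow> 'c list \<Rightarrow> ('b \<times> 'c) list" where
  "prodl ns L = concat (map (\<lambda>n. map (\<lambda>P. (n, P)) L) ns)"

definition unlinked where
  "unlinked vs es q s A e \<longleftrightarrow> length (adh (fst e) (snd e)) = s \<and> bdp A (fst e) (snd e) \<noteq> [] \<and>
     links vs es q (alpha (fst e) (snd e)) (adh (fst e) (snd e)) (bdp A (fst e) (snd e)) = []"

definition cutoff where
  "cutoff S st = (S # fst st, map (filter (\<lambda>v. v \<notin> set S)) (fst (snd st)),
     filter (\<lambda>e. inside (fst e) S \<or> (\<forall>v\<in>set (fst e). v \<notin> set S)) (snd (snd st)))"

text \<open>\<open>ns\<close> lists descendants first and \<open>prodl\<close> varies the part
  faster than the node, so the first hit belongs to a node none of whose predecessors in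
  \<open>ns\<close> has an unlinked cone.\<close>

definition cutstep where
  "cutstep vs es q ns s st = (case filter (unlinked vs es q s (snd (snd st))) (prodl ns (fst (snd st))) of
      [] \<Rightarrow> st
    | e # _ \<Rightarrow> cutoff (cutset vs es q (alpha (fst e) (snd e)) (adh (fst e) (snd e)) (bdp (snd (snd st)) (fst e) (snd e))) st)"

text \<open>Each cut moves a nonempty set out of the live parts, so one round per vertex leaves no
  unlinked cone in a live part.\<close>

definition splitup where
  "splitup vs es q ns s parts A = fold (\<lambda>_. cutstep vs es q ns s) vs ([], parts, A)"

definition badp where
  "badp ns s parts e \<longleftrightarrow> (\<exists>n\<in>set ns. \<exists>P\<in>set parts. length (adh n P) = s \<and> inside (fst e) (alpha n P))"

definition stage' where
  "stage' ns r s st =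
     (if wsum (snd (snd st)) \<le> r * wsum (filter (badp ns s (fst st @ fst (snd st))) (snd (snd st)))
      then (s, fst st @ fst (snd st), snd (snd st), True)
      else (s - 1, fst st @ fst (snd st), filter (\<lambda>e. \<not> badp ns s (fst st @ fst (snd st)) e) (snd (snd st)), False))"

text \<open>The state consists of the current adhesion size, the parts, the surviving flow paths with their
  weights, and a flag that stops the iteration.\<close>

definition stage where
  "stage vs es q ns r st = (if snd (snd (snd st)) then st else
     stage' ns r (fst st) (splitup vs es q ns (fst st) (fst (snd st)) (fst (snd (snd st)))))"

definition pickstep where
  "pickstep vs es q s A e picks =
     (if length (adh (fst e) (snd e)) = s \<and> bdp A (fst e) (snd e) \<noteq> [] \<and>
         (\<forall>k\<in>set picks. \<forall>v\<in>set (alpha (fst e) (snd e)). v \<notin> set (fst k))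
      then case links vs es q (alpha (fst e) (snd e)) (adh (fst e) (snd e)) (bdp A (fst e) (snd e)) of
             [] \<Rightarrow> picks
           | l # _ \<Rightarrow> (alpha (fst e) (snd e), fst l, snd (snd l), bdp A (fst e) (snd e)) # picks
      else picks)"

text \<open>Reversing puts ancestors first, so the greedy choice of disjoint cones consists of
  maximal ones.\<close>

definition picks where
  "picks vs es q ns s parts A = fold (pickstep vs es q s A) (rev (prodl ns parts)) []"

text \<open>Numerator of the weight; the denominator is 3qK. A unit issued at \<open>y\<close> in a
  cone of demand X is worth X/(qK), and a third of it is credited to \<open>y\<close> and to its
  partner.\<close>

definition pickw :: "('a list \<times> 'a \<times> 'a list \<times> ('a list \<times> nat) list) list \<Rightarrow> 'a \<Rightarrow> nat" where
  "pickw ks v = sum_list (map (\<lambda>k. 2 * wsum (snd (snd (snd k))) *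
     length (filter (\<lambda>y. \<exists>e\<in>set (snd (snd (snd k))). (v = hd (fst e) \<or> v = last (fst e)) \<and> (y = hd (fst e) \<or> y = last (fst e)))
       (fst (snd (snd k))))) ks)"

text \<open>Every vertex outside the selected cones becomes the sink of a part of its own, joined by
  the cones linked to it.\<close>

definition outA where
  "outA vs d ks = map (\<lambda>u. map (\<lambda>v. (v, pickw ks v, d)) (u # concat (map fst (filter (\<lambda>k. fst (snd k) = u) ks))))
     (filter (\<lambda>u. \<forall>k\<in>set ks. u \<notin> set (fst k)) vs)"

definition thru :: "('a list \<times> nat) list \<Rightarrow> 'a list \<Rightarrow> 'a \<Rightarrow> ('a list \<times> nat) list" where
  "thru A P z = filter (\<lambda>e. z \<in> set (fst e) \<and> inside (fst e) P) A"

text \<open>Some vertex of the bag met by all paths inside \<open>P\<close> carries its share of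
  them; the best vertex of \<open>P\<close> does at least as well and spares locating the
  bag.\<close>

definition hub :: "('a list \<times> nat) list \<Rightarrow> 'a list \<Rightarrow> 'a" where
  "hub A P = hd (filter (\<lambda>z. \<forall>y\<in>set P. wsum (thru A P y) \<le> wsum (thru A P z)) P)"

definition outB where
  "outB d parts A = map (\<lambda>P. map (\<lambda>v. (v, endw (thru A P (hub A P)) v, d)) P) (filter (\<lambda>P. P \<noteq> []) parts)"

definition finalB where
  "finalB d st = outB d (fst st @ fst (snd st)) (snd (snd st))"

definition final where
  "final vs es q ns d st = (if snd (snd (snd st))
     then outA vs (3 * q * length (units vs es)) (picks vs es q ns (fst st) (fst (snd st)) (fst (snd (snd st))))
     else finalB d (splitup vs es q ns 0 (fst (snd st)) (fst (snd (snd st)))))"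

text \<open>No adhesion has more than \<open>length vs\<close> vertices, so this is a valid initial
  size, and \<open>length vs\<close> stages bring it down to 0 unless one of them stops.\<close>

definition solve where
  "solve vs es fs ns r d = final vs es (4 * r * d) ns d
     (fold (\<lambda>_. stage vs es (4 * r * d) ns r) vs (length vs, [vs], fs, False))"

section \<open>Minimum cuts for several sinks combine into one sparse set\<close>

section \<open>Sparse cuts\<close>

definition cutcap :: "('a \<times> 'a \<times> nat) list \<Rightarrow> 'a set \<Rightarrow> 'a set \<Rightarrow> nat" where
  "cutcap es S T = sum_list (map (\<lambda>(a, b, c). if (a \<in> S \<and> b \<in> T) \<or> (b \<in> S \<and> a \<in> T) then c else 0) es)"

lemma cutcap_ccap:
  assumes "finite S" "finite T" "S \<inter> T = {}"
  shows "(\<Sum>v\<in>S. \<Sum>w\<in>T. ccap es v w) = cutcap es S T"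
proof (induction es)
  case Nil
  then show ?case by (simp add: ccap_def cutcap_def)
next
  case (Cons e es)
  obtain a b c where e: "e = (a, b, c)" by (cases e)
  have "(\<Sum>v\<in>S. \<Sum>w\<in>T. if (a = v \<and> b = w) \<or> (a = w \<and> b = v) then c else 0)
      = (if (a \<in> S \<and> b \<in> T) \<or> (b \<in> S \<and> a \<in> T) then c else 0)"
  proof -
    have "(\<Sum>v\<in>S. \<Sum>w\<in>T. if (a = v \<and> b = w) \<or> (a = w \<and> b = v) then c else 0)
        = (\<Sum>v\<in>S. \<Sum>w\<in>T. (if v = a then if w = b then c else 0 else 0) + (if v = b then if w = a then c else 0 else 0))"
      using assms(3) by (intro sum.cong refl) auto
    also have "\<dots> = (\<Sum>v\<in>S. (if v = a then if b \<in> T then c else 0 else 0) + (if v = b then if a \<in> T then c else 0 else 0))"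
      using assms(2) by (intro sum.cong refl) (auto simp: sum.distrib)
    also have "\<dots> = (if a \<in> S then if b \<in> T then c else 0 else 0) + (if b \<in> S then if a \<in> T then c else 0 else 0)"
      using assms(1) by (simp add: sum.distrib)
    finally show ?thesis using assms(3) by auto
  qed
  then show ?case using Cons by (simp add: e ccap_def cutcap_def sum.distrib)
qed

lemma wsum_simps [simp]: "wsum [] = 0" "wsum (e # A) = snd e + wsum A" "wsum (A @ B) = wsum A + wsum B"
  by (simp_all add: wsum_def)

lemma wsum_split: "wsum A = wsum (filter Q A) + wsum (filter (\<lambda>e. \<not> Q e) A)"
  by (induction A) auto

lemma wsum_filter_mono: "(\<And>e. e \<in> set A \<Longrightarrow> Q e \<Longrightarrow> R e) \<Longrightarrow> wsum (filter Q A) \<le> wsum (filter R A)"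
  by (induction A) auto

lemma endw_Cons: "endw (e # A) v = (if v = hd (fst e) \<or> v = last (fst e) then snd e else 0) + endw A v"
  by (simp add: endw_def)

lemma endw_filter_le: "endw (filter Q A) v \<le> endw A v"
  by (induction A) (auto simp: endw_Cons)

lemma sum_endw_Cons:
  assumes "finite U" "hd (fst e) \<noteq> last (fst e)"
  shows "(\<Sum>v\<in>U. endw (e # A) v) = (if hd (fst e) \<in> U then snd e else 0) + (if last (fst e) \<in> U then snd e else 0) + (\<Sum>v\<in>U. endw A v)"
proof -
  have "(\<Sum>v\<in>U. endw (e # A) v) = (\<Sum>v\<in>U. (if v = hd (fst e) then snd e else 0) + (if v = last (fst e) then snd e else 0) + endw A v)"
    using assms(2) by (intro sum.cong refl) (auto simp: endw_Cons)
  then show ?thesis using assms(1) by (simp add: sum.distrib)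
qed

lemma sum_endw:
  assumes "finite U" "\<And>e. e \<in> set A \<Longrightarrow> hd (fst e) \<noteq> last (fst e)" "\<And>e. e \<in> set A \<Longrightarrow> ends (fst e) \<subseteq> U"
  shows "(\<Sum>v\<in>U. endw A v) = 2 * wsum A"
  using assms(2,3)
proof (induction A)
  case (Cons e A)
  have "hd (fst e) \<noteq> last (fst e)" using Cons.prems by simp
  from sum_endw_Cons[OF assms(1) this] show ?case using Cons by simp
qed (simp add: endw_def)

lemma sum_endw_le:
  assumes "finite U" "\<And>e. e \<in> set A \<Longrightarrow> hd (fst e) \<noteq> last (fst e)"
  shows "(\<Sum>v\<in>U. endw A v) \<le> 2 * wsum A"
  using assms(2)
proof (induction A)
  case (Cons e A)
  have "hd (fst e) \<noteq> last (fst e)" using Cons.prems by simp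
  from sum_endw_Cons[OF assms(1) this] show ?case using Cons by simp
qed (simp add: endw_def)

lemma sum_le_sum_UN:
  fixes h :: "'b \<Rightarrow> nat"
  assumes "finite T" "finite I" "\<And>i. i \<in> I \<Longrightarrow> finite (R i)" "T \<subseteq> (\<Union>i\<in>I. R i)"
  shows "(\<Sum>w\<in>T. h w) \<le> (\<Sum>i\<in>I. \<Sum>w\<in>R i. h w)"
  using assms(2-4,1)
proof (induction I arbitrary: T rule: finite_induct)
  case (insert i I)
  have "(\<Sum>w\<in>T. h w) = (\<Sum>w\<in>T - R i. h w) + (\<Sum>w\<in>T \<inter> R i. h w)"
    using insert.prems(3) by (metis sum.Int_Diff add.commute)
  moreover have "(\<Sum>w\<in>T \<inter> R i. h w) \<le> (\<Sum>w\<in>R i. h w)" using insert.prems by (intro sum_mono2) auto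
  moreover have "(\<Sum>w\<in>T - R i. h w) \<le> (\<Sum>i\<in>I. \<Sum>w\<in>R i. h w)" using insert.prems by (intro insert.IH) auto
  ultimately show ?case using insert.hyps by simp
qed simp

lemma le_div_mult_add: "0 < X \<Longrightarrow> (a :: nat) \<le> X * (a div X) + X"
  by (metis add_left_mono less_imp_le mod_less_divisor mult_div_mod_eq)

text \<open>The rounding budget: the cuts cost less than K/3 units and rounding hides at most K/2,
  together less than K.\<close>

lemma half_less: "a \<le> F \<Longrightarrow> 3 * F < k \<Longrightarrow> k = 2 * m \<Longrightarrow> a + m < (k :: nat)"
  by linarith

lemma scaled_less:
  fixes l F k :: nat
  assumes "3 * l * F + l \<le> l * k" "l \<noteq> 0" shows "3 * F < k"
proof -
  have "l * (3 * F + 1) \<le> l * k" using assms(1) by (simp add: algebra_simps)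
  then show ?thesis using assms(2) by (metis Suc_eq_plus1 Suc_le_eq mult_le_cancel1 not_gr0)
qed

locale linkage =
  fixes vs :: "'a list" and es :: "('a \<times> 'a \<times> nat) list" and q :: nat
    and al bl :: "'a list" and bd :: "('a list \<times> nat) list"
  assumes dal: "distinct al" and dbl: "distinct bl" and disj: "set al \<inter> set bl = {}"
    and alvs: "length al \<le> length vs"
    and bdpos: "0 < wsum bd"
    and bdends: "e \<in> set bd \<Longrightarrow> hd (fst e) \<noteq> last (fst e) \<and> ends (fst e) \<subseteq> set al"
begin

abbreviation "K \<equiv> length (units vs es)"
abbreviation "X \<equiv> 2 * wsum bd"
definition "sply v = K * endw bd v div X"
abbreviation "ces \<equiv> capl (q * K) X es"
abbreviation "res u \<equiv> mf ces (supl K X bd al) u (units vs es)"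

lemma K: "K = 2 * (length vs + length es)" by (simp add: units_def)

lemma Xpos: "0 < X" using bdpos by simp

lemma supl: "supl K X bd al = map (\<lambda>v. (v, sply v)) al"
  by (simp add: supl_def sply_def)

lemma X: "(\<Sum>v\<in>set al. endw bd v) = X"
  using bdends by (intro sum_endw) auto

lemma sply_total: "sum sply (set al) \<le> K"
proof -
  have "X * sum sply (set al) \<le> (\<Sum>v\<in>set al. K * endw bd v)"
    unfolding sum_distrib_left by (intro sum_mono) (simp add: sply_def)
  also have "\<dots> = K * X" using X by (simp flip: sum_distrib_left)
  finally show ?thesis using Xpos by (simp add: mult.commute)
qed

lemma net: "u \<in> set bl \<Longrightarrow> network al u"
  using dal disj by unfold_locales auto

definition side :: "'a \<Rightarrow> 'a set" where "side u = set al - fst ` set (reach ces al u (fst (res u)))"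

lemma cutset: "set (cutset vs es q al bl bd) = {v\<in>set al. \<forall>u\<in>set bl. v \<in> side u}"
  by (auto simp: cutset_def trials_def side_def)

lemma value_eq:
  assumes "u \<in> set bl"
  shows "length (snd (res u)) = (\<Sum>v\<in>side u. \<Sum>w\<in>insert u (set al) - side u. ccap ces v w) + (\<Sum>v\<in>set al - side u. sply v)"
  using network.mf_cut[OF net[OF assms], where s = sply and N = "units vs es" and es = ces] sply_total
  unfolding supl side_def by (simp add: network.cutside_def[OF net[OF assms]])

text \<open>The cut set is contained in the side of every sink, so the closure condition passes to
  each side, where \<open>cutside_closed\<close> applies.\<close>

lemma closed:
  assumes Z: "Z \<subseteq> set al" and cl: "\<And>v w. v \<in> Z \<Longrightarrow> w \<in> set al \<union> set bl \<Longrightarrow> 0 < ccap ces v w \<Longrightarrow> w \<in> Z \<union> set (cutset vs es q al bl bd)"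
  shows "Z \<subseteq> set (cutset vs es q al bl bd)"
proof -
  have "Z \<subseteq> side u" if u: "u \<in> set bl" for u
  proof -
    note n = net[OF u]
    obtain A S where AS: "res u = (A, S)" by (cases "res u")
    have side: "side u = network.cutside ces al u A" by (simp add: side_def network.cutside_def[OF n] AS)
    have fi: "network.finv ces al u sply (A, S)"
      using network.mf_stable(1)[OF n, where s = sply and N = "units vs es" and es = ces] sply_total AS unfolding supl by simp
    have *: "w \<in> Z \<union> network.cutside ces al u A" if "v \<in> Z" "w \<in> insert u (set al)" "0 < ccap ces v w" for v w
      using cl[of v w] that u unfolding cutset side[symmetric] by auto
    show ?thesis unfolding side using network.cutside_closed[OF n fi Z *] .
  qed
  then show ?thesis using Z unfolding cutset by auto
qed

text \<open>Add up the minimum cuts of all sinks. Every edge from \<open>S\<close> to the rest and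
  every supply outside \<open>S\<close> is paid for in at least one of them, so together they cost
  at most the sum of the flow values, less than K/3. Rounding hides at most one unit per vertex and
  edge, K/2 in all. Cut edges and outside demand thus stay below the whole demand K, and cancelling
  the outside demand leaves the demand of \<open>S\<close>.\<close>

lemma sparse:
  assumes no: "links vs es q al bl bd = []"
  defines "S \<equiv> set (cutset vs es q al bl bd)"
  shows "q * cutcap es S (set al \<union> set bl - S) < (\<Sum>v\<in>S. endw bd v)"
proof -
  let ?F = "\<Sum>u\<in>set bl. length (snd (res u))"
  let ?T = "set al \<union> set bl - S"
  have S: "S \<subseteq> set al" "\<And>u. u \<in> set bl \<Longrightarrow> S \<subseteq> side u" "\<And>v. v \<in> set al - S \<Longrightarrow> \<exists>u\<in>set bl. v \<notin> side u"
    unfolding S_def cutset by auto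
  have fS: "finite S" using S(1) finite_subset by blast
  have sal: "side u \<subseteq> set al" for u by (auto simp: side_def)
  have fs: "finite (side u)" for u using sal finite_subset by blast
  have Kpos: "0 < K"
  proof -
    have "al \<noteq> []"
    proof
      assume "al = []"
      then have "bd = []" using bdends by (cases bd) auto
      then show False using bdpos by simp
    qed
    then show ?thesis using alvs by (cases al) (auto simp: K)
  qed
  \<comment> \<open>Each of the values is below K/(3 \<open>length bl\<close>); without sinks the
    sum is 0 and K is positive.\<close>
  have F: "3 * ?F < K"
  proof (cases "bl = []")
    case False
    have "3 * length bl * length (snd (res u)) + 1 \<le> K" if "u \<in> set bl" for u
      using no that by (auto simp: links_def trials_def filter_empty_conv)
    then have "(\<Sum>u\<in>set bl. 3 * length bl * length (snd (res u)) + 1) \<le> (\<Sum>u\<in>set bl. K)" by (intro sum_mono) auto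
    then have "3 * length bl * ?F + length bl \<le> length bl * K"
      using dbl by (simp only: sum.distrib sum_distrib_left[symmetric] sum_constant distinct_card mult_1_right of_nat_id)
    then show ?thesis by (rule scaled_less) (use False in simp)
  qed (use Kpos in simp)
  have c1: "cutcap ces S ?T \<le> (\<Sum>u\<in>set bl. \<Sum>v\<in>side u. \<Sum>w\<in>insert u (set al) - side u. ccap ces v w)"
  proof -
    have "cutcap ces S ?T = (\<Sum>v\<in>S. \<Sum>w\<in>?T. ccap ces v w)" using fS by (subst cutcap_ccap) auto
    also have "\<dots> \<le> (\<Sum>v\<in>S. \<Sum>u\<in>set bl. \<Sum>w\<in>insert u (set al) - side u. ccap ces v w)"
    proof (intro sum_mono sum_le_sum_UN)
      \<comment> \<open>A sink lies outside its own side; any other vertex of the target is outside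
        some side because it is not in \<open>S\<close>.\<close>
      show "?T \<subseteq> (\<Union>u\<in>set bl. insert u (set al) - side u)"
      proof
        fix w assume w: "w \<in> ?T"
        show "w \<in> (\<Union>u\<in>set bl. insert u (set al) - side u)"
        proof (cases "w \<in> set bl")
          case True
          then have "w \<notin> side w" using sal[of w] disj by auto
          then show ?thesis using True by auto
        next
          case False
          then have "w \<in> set al - S" using w by auto
          then show ?thesis using S(3)[of w] by auto
        qed
      qed
    qed auto
    also have "\<dots> = (\<Sum>u\<in>set bl. \<Sum>v\<in>S. \<Sum>w\<in>insert u (set al) - side u. ccap ces v w)" by (rule sum.swap)
    also have "\<dots> \<le> (\<Sum>u\<in>set bl. \<Sum>v\<in>side u. \<Sum>w\<in>insert u (set al) - side u. ccap ces v w)"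
      using S(2) fs by (intro sum_mono sum_mono2) auto
    finally show ?thesis .
  qed
  have c2: "(\<Sum>v\<in>set al - S. sply v) \<le> (\<Sum>u\<in>set bl. \<Sum>v\<in>set al - side u. sply v)"
    using S(3) by (intro sum_le_sum_UN) auto
  have FF: "cutcap ces S ?T + (\<Sum>v\<in>set al - S. sply v) \<le> ?F"
    using c1 c2 value_eq by (simp add: sum.distrib)
  \<comment> \<open>Rounding down loses less than one unit per entry of \<open>es\<close>; on the
    scale of this inequality a unit is \<open>X\<close>.\<close>
  have d1: "K * (q * cutcap es S ?T) \<le> X * (cutcap ces S ?T + length es)"
  proof -
    have "K * (q * sum_list (map (\<lambda>(a, b, c). if (a \<in> S \<and> b \<in> ?T) \<or> (b \<in> S \<and> a \<in> ?T) then c else 0) el))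
       \<le> X * (sum_list (map (\<lambda>(a, b, c). if (a \<in> S \<and> b \<in> ?T) \<or> (b \<in> S \<and> a \<in> ?T) then c * (q * K) div X else 0) el) + length el)" for el :: "('a \<times> 'a \<times> nat) list"
    proof (induction el)
      case (Cons e el)
      obtain a b c where e: "e = (a, b, c)" by (cases e)
      have "K * (q * c) \<le> X * (c * (q * K) div X) + X"
        using le_div_mult_add[OF Xpos, of "c * (q * K)"] by (simp only: mult_ac)
      then show ?case using Cons by (auto simp: e algebra_simps)
    qed simp
    note 1 = this[of es]
    have 2: "cutcap ces S ?T = sum_list (map (\<lambda>(a, b, c). if (a \<in> S \<and> b \<in> ?T) \<or> (b \<in> S \<and> a \<in> ?T) then c * (q * K) div X else 0) es)"
      by (simp only: cutcap_def capl_def map_map o_def split_def fst_conv snd_conv)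
    show ?thesis unfolding 2 unfolding cutcap_def by (rule 1)
  qed
  have d2: "(\<Sum>v\<in>set al - S. K * endw bd v) \<le> X * ((\<Sum>v\<in>set al - S. sply v) + length vs)"
  proof -
    have "K * endw bd v \<le> X * sply v + X" for v
      unfolding sply_def by (rule le_div_mult_add[OF Xpos])
    then have "(\<Sum>v\<in>set al - S. K * endw bd v) \<le> (\<Sum>v\<in>set al - S. X * sply v + X)" by (intro sum_mono)
    also have "\<dots> = X * ((\<Sum>v\<in>set al - S. sply v) + card (set al - S))"
      by (simp add: sum.distrib sum_distrib_left algebra_simps)
    also have "card (set al - S) \<le> length vs"
      using alvs card_length[of al] card_mono[of "set al" "set al - S"] by simp
    finally show ?thesis by simp
  qed
  have d3: "K * X = K * (\<Sum>v\<in>S. endw bd v) + (\<Sum>v\<in>set al - S. K * endw bd v)"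
  proof -
    have "sum (endw bd) S + sum (endw bd) (set al - S) = X"
      using X sum.subset_diff[OF S(1), of "endw bd"] by simp
    from arg_cong[OF this, of "\<lambda>x. K * x"] show ?thesis by (simp only: distrib_left sum_distrib_left)
  qed
  have "K * (q * cutcap es S ?T) + K * X < K * (\<Sum>v\<in>S. endw bd v) + K * X"
  proof -
    have "K * (q * cutcap es S ?T) + K * X \<le> X * (cutcap ces S ?T + length es) + K * (\<Sum>v\<in>S. endw bd v)
        + X * ((\<Sum>v\<in>set al - S. sply v) + length vs)" using d1 d2 d3 by linarith
    also have "\<dots> = X * (cutcap ces S ?T + (\<Sum>v\<in>set al - S. sply v) + (length vs + length es)) + K * (\<Sum>v\<in>S. endw bd v)"
      by (simp add: algebra_simps)
    also have "\<dots> < X * K + K * (\<Sum>v\<in>S. endw bd v)"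
    proof -
      have "cutcap ces S ?T + (\<Sum>v\<in>set al - S. sply v) + (length vs + length es) < K" by (rule half_less[OF FF F K])
      then show ?thesis using Xpos by simp
    qed
    finally show ?thesis by (simp add: mult_ac add_ac)
  qed
  then show ?thesis using Kpos by simp
qed

lemma link_paths:
  assumes "l \<in> set (links vs es q al bl bd)"
  obtains qs where "fst l \<in> set bl" "K \<le> 3 * length bl * length (snd (snd l))" "length qs = length (snd (snd l))"
    "\<And>p. p \<in> set qs \<Longrightarrow> p \<noteq> [] \<and> distinct p \<and> hd p \<in> set al \<and> last p = fst l \<and> set p \<subseteq> insert (fst l) (set al)"
    "\<And>v. length (filter (\<lambda>p. hd p = v) qs) = vcount (snd (snd l)) v"
    "\<And>v. vcount (snd (snd l)) v \<le> sply v"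
    "\<And>a b. length (filter (\<lambda>p. {a, b} \<in> path_edges p) qs) \<le> ccap ces a b"
    "set (snd (snd l)) \<subseteq> set al"
proof -
  have l: "fst l \<in> set bl" "K \<le> 3 * length bl * length (snd (snd l))" "snd l = res (fst l)"
    using assms by (auto simp: links_def trials_def)
  note n = net[OF l(1)]
  obtain qs where qs: "length qs = length (snd (snd l))"
    "\<forall>p\<in>set qs. p \<noteq> [] \<and> distinct p \<and> hd p \<in> set al \<and> last p = fst l \<and> set p \<subseteq> insert (fst l) (set al)"
    "\<forall>v\<in>set al. length (filter (\<lambda>p. hd p = v) qs) = vcount (snd (snd l)) v"
    "\<forall>a b. length (filter (\<lambda>p. {a, b} \<in> path_edges p) qs) \<le> ccap ces a b"
    using network.mf_paths[OF n, where s = sply and N = "units vs es" and es = ces] sply_total l(3) unfolding supl by auto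
  have fi: "network.finv ces al (fst l) sply (snd l)"
    using network.mf_stable(1)[OF n, where s = sply and N = "units vs es" and es = ces] sply_total l(3) unfolding supl by simp
  then have sa: "set (snd (snd l)) \<subseteq> set al" "\<forall>v\<in>set al. vcount (snd (snd l)) v \<le> sply v"
    by (auto simp: network.finv_def[OF n])
  have v0: "vcount (snd (snd l)) v = 0" if "v \<notin> set al" for v using that sa(1) by (auto simp: vcount_def filter_empty_conv)
  have "length (filter (\<lambda>p. hd p = v) qs) = vcount (snd (snd l)) v" for v
  proof (cases "v \<in> set al")
    case False
    then have "filter (\<lambda>p. hd p = v) qs = []" using qs(2) by (auto simp: filter_empty_conv)
    then show ?thesis using v0[OF False] by simp
  qed (use qs in auto)
  moreover have "vcount (snd (snd l)) v \<le> sply v" for v using sa(2) v0[of v] by (cases "v \<in> set al") auto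
  ultimately show ?thesis using that[of qs] l qs sa by blast
qed

end

section \<open>Refining the partition at one adhesion size\<close>

section \<open>Cutting off unlinked cones\<close>

lemma filter_prodl_first:
  assumes "filter Q (prodl ns L) = e # rest"
  obtains i where "i < length ns" "fst e = ns ! i" "snd e \<in> set L" "Q e" "\<And>j P. j < i \<Longrightarrow> P \<in> set L \<Longrightarrow> \<not> Q (ns ! j, P)"
  using assms
proof (induction ns arbitrary: thesis)
  case Nil
  then show ?case by (simp add: prodl_def)
next
  case (Cons n ns)
  have pr: "prodl (n # ns) L = map (\<lambda>P. (n, P)) L @ prodl ns L" by (simp add: prodl_def)
  show ?case
  proof (cases "filter Q (map (\<lambda>P. (n, P)) L)")
    case Nil
    then have no: "\<not> Q (n, P)" if "P \<in> set L" for P using that by (auto simp: filter_empty_conv)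
    have "filter Q (prodl ns L) = e # rest" using Cons.prems(2) Nil by (simp add: pr)
    with Cons.IH obtain i where i: "i < length ns" "fst e = ns ! i" "snd e \<in> set L" "Q e"
      "\<And>j P. j < i \<Longrightarrow> P \<in> set L \<Longrightarrow> \<not> Q (ns ! j, P)" by blast
    have nth: "\<not> Q ((n # ns) ! j, P)" if "j < Suc i" "P \<in> set L" for j P using that no i(5) by (cases j) auto
    show ?thesis by (rule Cons.prems(1)[of "Suc i"]) (use i nth in simp_all)
  next
    case (Cons e' l)
    then have "e = e'" using Cons.prems(2) by (simp add: pr)
    then have "e \<in> set (filter Q (map (\<lambda>P. (n, P)) L))" using Cons by simp
    then have "fst e = n" "snd e \<in> set L" "Q e" by auto
    then show ?thesis by (intro Cons.prems(1)[of 0]) auto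
  qed
qed

lemma arcs_cross: "p \<noteq> [] \<Longrightarrow> set p \<inter> S \<noteq> {} \<Longrightarrow> \<not> set p \<subseteq> S \<Longrightarrow> \<exists>(a, b)\<in>arcs p. (a \<in> S) \<noteq> (b \<in> S)"
proof (induction p rule: induct_list012)
  case (3 x y p)
  show ?case
  proof (cases "(x \<in> S) = (y \<in> S)")
    case True
    then have "set (y # p) \<inter> S \<noteq> {}" "\<not> set (y # p) \<subseteq> S" using 3(4,5) by auto
    then show ?thesis using 3(2) by auto
  qed auto
qed auto

lemma inside_iff: "inside p S \<longleftrightarrow> set p \<subseteq> set S" by (auto simp: inside_def)

lemma cutcap_mono:
  assumes "\<And>a b k. (a, b, k) \<in> set es \<Longrightarrow> a \<in> S \<and> b \<in> T \<or> b \<in> S \<and> a \<in> T \<Longrightarrow> a \<in> S' \<and> b \<in> T' \<or> b \<in> S' \<and> a \<in> T'"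
  shows "cutcap es S T \<le> cutcap es S' T'"
  unfolding cutcap_def
proof (rule sum_list_mono)
  fix x assume x: "x \<in> set es"
  obtain a b k where abk: "x = (a, b, k)" by (cases x)
  show "(case x of (a, b, c) \<Rightarrow> if a \<in> S \<and> b \<in> T \<or> b \<in> S \<and> a \<in> T then c else 0)
      \<le> (case x of (a, b, c) \<Rightarrow> if a \<in> S' \<and> b \<in> T' \<or> b \<in> S' \<and> a \<in> T' then c else 0)"
    using assms[of a b k] x unfolding abk by auto
qed

lemma ccap_pos: "0 < ccap es a b \<Longrightarrow> \<exists>k. (a, b, k) \<in> set es \<or> (b, a, k) \<in> set es"
  by (induction es) (auto simp: ccap_def split: if_splits)

text \<open>The list \<open>ns\<close> contains the pairs of cone and parent adhesion of all tree nodes, descendants first.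
  The weights of \<open>fs\<close> have the common denominator \<open>d\<close>.\<close>

locale edpcore =
  fixes vs :: "'a list" and es :: "('a \<times> 'a \<times> nat) list" and fs :: "('a list \<times> nat) list"
    and ns :: "('a list \<times> 'a list) list" and r d :: nat and M :: "'a set set" and l1 l2 :: nat
  assumes dvs: "distinct vs" and es: "(a, b, k) \<in> set es \<Longrightarrow> a \<noteq> b \<and> a \<in> set vs \<and> b \<in> set vs"
    and des: "distinct (map (\<lambda>(a, b, k). {a, b}) es)"
    and dfs: "distinct (map fst fs)"
    and fs: "e \<in> set fs \<Longrightarrow> 0 < snd e \<and> is_path (set vs) ((\<lambda>(a, b, k). {a, b}) ` set es) (fst e) \<and> ends (fst e) \<in> M"
    and M: "simple_graph (set vs) M" "disjoint M"
    and cap: "(a, b, k) \<in> set es \<Longrightarrow> wsum (filter (\<lambda>e. {a, b} \<in> path_edges (fst e)) fs) \<le> d * k"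
    and d: "0 < d" and r: "2 \<le> r"
    and ns: "n \<in> set ns \<Longrightarrow> distinct (fst n) \<and> distinct (snd n) \<and> set (snd n) \<subseteq> set (fst n) \<and> set (fst n) \<subseteq> set vs \<and> length (snd n) \<le> r"
    and edge: "n \<in> set ns \<Longrightarrow> (a, b, k) \<in> set es \<or> (b, a, k) \<in> set es \<Longrightarrow> a \<in> set (fst n) - set (snd n) \<Longrightarrow> b \<in> set (fst n)"
    and lam: "i < j \<Longrightarrow> j < length ns \<Longrightarrow> (set (fst (ns ! i)) - set (snd (ns ! i))) \<inter> (set (fst (ns ! j)) - set (snd (ns ! j))) \<noteq> {}
      \<Longrightarrow> set (fst (ns ! i)) - set (snd (ns ! i)) \<subseteq> set (fst (ns ! j)) - set (snd (ns ! j))"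
    and adhs: "i < length ns \<Longrightarrow> j < length ns \<Longrightarrow> set (snd (ns ! j)) \<inter> (set (fst (ns ! i)) - set (snd (ns ! i))) \<noteq> {}
      \<Longrightarrow> j < i \<and> set (fst (ns ! j)) - set (snd (ns ! j)) \<subseteq> set (fst (ns ! i)) - set (snd (ns ! i))"
    and bags: "i < length ns \<Longrightarrow> \<exists>W. finite W \<and> card W \<le> r \<and>
      (\<forall>e\<in>set fs. set (fst e) \<subseteq> set (fst (ns ! i)) \<longrightarrow> set (fst e) \<inter> W = {} \<longrightarrow>
        (\<exists>j<i. set (fst e) \<subseteq> set (fst (ns ! j)) - set (snd (ns ! j))))"
    and rootn: "\<exists>n\<in>set ns. set (fst n) = set vs \<and> snd n = []"
    and unsafe: "n \<in> set ns \<Longrightarrow> S \<subseteq> set (fst n) - set (snd n) \<Longrightarrow>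
      4 * r * d * cutcap es S (set vs - S) < (\<Sum>v\<in>S. endw fs v) \<Longrightarrow> length (snd n) \<le> l1"
    and bad: "n \<in> set ns \<Longrightarrow> e \<in> set fs \<Longrightarrow> set (fst e) \<subseteq> set (fst n) - set (snd n) \<Longrightarrow> length (snd n) \<le> l2"
begin

abbreviation "V \<equiv> set vs"
abbreviation "E \<equiv> (\<lambda>(a, b, k). {a, b}) ` set es"
abbreviation "q \<equiv> 4 * r * d"

definition sub :: "('a list \<times> nat) list \<Rightarrow> ('a list \<times> nat) list \<Rightarrow> bool" where
  "sub A B \<longleftrightarrow> (\<exists>Q. A = filter Q B)"

lemma sub_refl: "sub A A" unfolding sub_def by (rule exI[of _ "\<lambda>_. True"]) simp
lemma sub_filter: "sub A B \<Longrightarrow> sub (filter Q A) B" unfolding sub_def by (auto simp: filter_filter)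
lemma sub_trans: "sub A B \<Longrightarrow> sub B C \<Longrightarrow> sub A C" unfolding sub_def by (auto simp: filter_filter)
lemma sub_set: "sub A B \<Longrightarrow> set A \<subseteq> set B" unfolding sub_def by auto
lemma sub_endw: "sub A B \<Longrightarrow> endw A v \<le> endw B v" unfolding sub_def using endw_filter_le by auto

lemma path_facts:
  assumes "e \<in> set fs"
  shows "fst e \<noteq> []" "distinct (fst e)" "set (fst e) \<subseteq> V" "path_edges (fst e) \<subseteq> E" "hd (fst e) \<noteq> last (fst e)"
    "ends (fst e) \<in> M" "0 < snd e" "hd (fst e) \<in> set (fst e)" "last (fst e) \<in> set (fst e)"
proof -
  show *: "fst e \<noteq> []" "distinct (fst e)" "set (fst e) \<subseteq> V" "path_edges (fst e) \<subseteq> E" "ends (fst e) \<in> M" "0 < snd e"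
    using fs[OF assms] by (auto simp: is_path_def)
  then obtain a b where "a \<noteq> b" "ends (fst e) = {a, b}" using M by (auto simp: simple_graph_def)
  then show "hd (fst e) \<noteq> last (fst e)" by (metis doubleton_eq_iff insert_absorb2)
  show "hd (fst e) \<in> set (fst e)" "last (fst e) \<in> set (fst e)" using * by auto
qed

definition pok :: "'a list list \<Rightarrow> ('a list \<times> nat) list \<Rightarrow> bool" where
  "pok ps A \<longleftrightarrow> distinct (concat ps) \<and> set (concat ps) = V \<and> (\<forall>e\<in>set A. \<exists>P\<in>set ps. inside (fst e) P)"

lemma pok_disjoint: "pok ps A \<Longrightarrow> P \<in> set ps \<Longrightarrow> Q \<in> set ps \<Longrightarrow> x \<in> set P \<Longrightarrow> x \<in> set Q \<Longrightarrow> P = Q"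
  unfolding pok_def distinct_concat_iff by (metis disjoint_iff)

text \<open>Counting only adhesion vertices inside the part makes this stable under refining parts
  and deleting paths.\<close>

definition small :: "nat \<Rightarrow> 'a list list \<Rightarrow> ('a list \<times> nat) list \<Rightarrow> bool" where
  "small s ps A \<longleftrightarrow> (\<forall>n\<in>set ns. \<forall>P\<in>set ps. s < length (adh n P) \<longrightarrow> bdp A n P = [])"

abbreviation "lk A n P \<equiv> links vs es q (alpha n P) (adh n P) (bdp A n P)"
abbreviation "cs A n P \<equiv> cutset vs es q (alpha n P) (adh n P) (bdp A n P)"

lemma set_alpha: "set (alpha n P) = (set (fst n) - set (snd n)) \<inter> set P" by (auto simp: alpha_def)
lemma set_adh: "set (adh n P) = set (snd n) \<inter> set P" by (auto simp: adh_def)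
lemma set_bdp: "set (bdp A n P) = {e\<in>set A. set (fst e) \<subseteq> set (alpha n P)}" by (auto simp: bdp_def inside_iff)

lemma linkage:
  assumes "n \<in> set ns" "bdp A n P \<noteq> []" "set A \<subseteq> set fs"
  shows "linkage vs (alpha n P) (adh n P) (bdp A n P)"
proof
  show "set (alpha n P) \<inter> set (adh n P) = {}" by (auto simp: set_alpha set_adh)
  show "distinct (adh n P)" "distinct (alpha n P)" using ns[OF assms(1)] by (auto simp: alpha_def adh_def)
  then have "length (alpha n P) = card (set (alpha n P))" by (simp only: distinct_card)
  also have "\<dots> \<le> card V" using ns[OF assms(1)] by (intro card_mono) (auto simp: set_alpha)
  finally show "length (alpha n P) \<le> length vs" using dvs by (simp add: distinct_card)
  obtain e l where el: "bdp A n P = e # l" using assms(2) by (cases "bdp A n P") auto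
  then have "e \<in> set fs" using assms(3) set_bdp[of A n P] by auto
  then show "0 < wsum (bdp A n P)" using path_facts(7) el by simp
  show "hd (fst e) \<noteq> last (fst e) \<and> ends (fst e) \<subseteq> set (alpha n P)" if "e \<in> set (bdp A n P)" for e
    using that assms(3) path_facts(5,8,9)[of e] by (auto simp: set_bdp)
qed

text \<open>Every removed path uses an edge between \<open>S\<close> and the rest of
  \<open>P\<close>; its weight is charged there, and an edge carries at most \<open>d\<close> times
  its capacity.\<close>

lemma removed_weight:
  assumes A: "set A \<subseteq> set fs" "sub A fs" and R: "\<And>e. e \<in> set A \<Longrightarrow> R e \<Longrightarrow> set (fst e) \<subseteq> set P \<and> set (fst e) \<inter> S \<noteq> {} \<and> \<not> set (fst e) \<subseteq> S"
  shows "wsum (filter R A) \<le> d * cutcap es S (set P - S)"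
proof -
  let ?T = "set P - S"
  let ?x = "\<lambda>(a, b, k). (a \<in> S \<and> b \<in> ?T) \<or> (b \<in> S \<and> a \<in> ?T)"
  let ?h = "\<lambda>A (a, b, k). if ?x (a, b, k) then wsum (filter (\<lambda>e. {a, b} \<in> path_edges (fst e)) A) else 0"
  have "wsum (filter R A) \<le> sum_list (map (?h A) es)" using A(1) R
  proof (induction A)
    case (Cons e A)
    have IH: "wsum (filter R A) \<le> sum_list (map (?h A) es)" using Cons by auto
    let ?g = "\<lambda>(a, b, k). if ?x (a, b, k) \<and> {a, b} \<in> path_edges (fst e) then snd e else 0"
    have "sum_list (map (?h (e # A)) es) = sum_list (map (\<lambda>x. ?g x + ?h A x) es)"
      by (intro arg_cong[where f = sum_list] map_cong refl) (auto split: prod.splits)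
    also have "\<dots> = sum_list (map ?g es) + sum_list (map (?h A) es)" by (rule sum_list_addf)
    finally have eq: "sum_list (map (?h (e # A)) es) = sum_list (map ?g es) + sum_list (map (?h A) es)" .
    have "snd e \<le> sum_list (map ?g es)" if "R e"
    proof -
      have ef: "e \<in> set fs" using Cons.prems by simp
      have Re: "set (fst e) \<subseteq> set P \<and> set (fst e) \<inter> S \<noteq> {} \<and> \<not> set (fst e) \<subseteq> S" using Cons.prems that by simp
      then obtain a b where ab: "(a, b) \<in> arcs (fst e)" "(a \<in> S) \<noteq> (b \<in> S)"
        using arcs_cross[OF path_facts(1)[OF ef], of S] by blast
      have "{a, b} \<in> path_edges (fst e)" using ab(1) by (auto simp: path_edges_arcs)
      then have "{a, b} \<in> E" using path_facts(4)[OF ef] by blast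
      then obtain x where x: "x \<in> set es" "{a, b} = {fst x, fst (snd x)}" by auto
      have "a \<in> set P" "b \<in> set P" using arcs_in_set[OF ab(1)] Re by auto
      then have "?g x = snd e" using x(2) ab \<open>{a, b} \<in> path_edges (fst e)\<close>
        by (cases x) (auto simp: doubleton_eq_iff insert_commute)
      moreover have "?g x \<le> sum_list (map ?g es)" using x(1) by (intro member_le_sum_list) auto
      ultimately show ?thesis by simp
    qed
    then show ?case using IH eq by auto
  qed simp
  also have "\<dots> \<le> sum_list (map (\<lambda>(a, b, k). d * (if ?x (a, b, k) then k else 0)) es)"
  proof (rule sum_list_mono)
    fix x assume x: "x \<in> set es"
    obtain a b k where xe: "x = (a, b, k)" by (cases x)
    obtain Q where "A = filter Q fs" using A(2) by (auto simp: sub_def)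
    then have "wsum (filter (\<lambda>e. {a, b} \<in> path_edges (fst e)) A) \<le> wsum (filter (\<lambda>e. {a, b} \<in> path_edges (fst e)) fs)"
      by (simp only: filter_filter) (rule wsum_filter_mono, blast)
    also have "\<dots> \<le> d * k" using cap x xe by simp
    finally show "?h A x \<le> (\<lambda>(a, b, k). d * (if ?x (a, b, k) then k else 0)) x" by (simp add: xe)
  qed
  also have "\<dots> = d * cutcap es S ?T"
    unfolding cutcap_def sum_list_const_mult[symmetric] by (intro arg_cong[where f = sum_list] map_cong refl) auto
  finally show ?thesis .
qed

lemma nbr:
  assumes "n \<in> set ns" "v \<in> set (alpha n P)" "w \<in> set P" "(v, w, k) \<in> set es \<or> (w, v, k) \<in> set es"
  shows "w \<in> set (alpha n P) \<union> set (adh n P)"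
  using edge[OF assms(1,4)] assms(2,3) by (auto simp: set_alpha set_adh)

lemma cutset_sub: "set (cutset vs es q al bl bd) \<subseteq> set al" by (auto simp: cutset_def)

text \<open>Inside \<open>P\<close> the neighbours of a cone lie in the cone or in its adhesion, so
  the boundary of the cut set is the one that \<open>sparse\<close> measures.\<close>

lemma sparse_cut:
  assumes n: "n \<in> set ns" and A: "sub A fs" and bd: "bdp A n P \<noteq> []" and no: "lk A n P = []"
  shows "q * cutcap es (set (cs A n P)) (set P - set (cs A n P)) < (\<Sum>v\<in>set (cs A n P). endw A v)"
proof -
  interpret linkage vs es q "alpha n P" "adh n P" "bdp A n P"
    by (rule linkage[OF n bd sub_set[OF A]])
  let ?S = "set (cs A n P)"
  have S: "?S \<subseteq> set (alpha n P)" by (rule cutset_sub)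
  have "cutcap es ?S (set P - ?S) \<le> cutcap es ?S (set (alpha n P) \<union> set (adh n P) - ?S)"
    using S nbr[OF n] by (intro cutcap_mono) blast
  then have "q * cutcap es ?S (set P - ?S) \<le> q * cutcap es ?S (set (alpha n P) \<union> set (adh n P) - ?S)" by simp
  also have "\<dots> < (\<Sum>v\<in>?S. endw (bdp A n P) v)" by (rule sparse[OF no])
  also have "\<dots> \<le> (\<Sum>v\<in>?S. endw A v)" by (intro sum_mono) (simp add: bdp_def endw_filter_le)
  finally show ?thesis .
qed

text \<open>A cone whose adhesion has been cut off completely is cut off as well. Its linkage therefore does
  not change, so that parts that have been cut off need not be examined again.\<close>

lemma cut_closed:
  assumes n: "n \<in> set ns" and A: "sub A fs" and bd: "bdp A n P \<noteq> []" and m: "m \<in> set ns"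
    and sub: "set (alpha m P) \<subseteq> set (alpha n P)" "set (adh m P) \<subseteq> set (cs A n P)"
  shows "set (alpha m P) \<subseteq> set (cs A n P)"
proof -
  interpret linkage vs es q "alpha n P" "adh n P" "bdp A n P"
    by (rule linkage[OF n bd sub_set[OF A]])
  show ?thesis
  proof (rule closed[OF sub(1)])
    fix v w assume vw: "v \<in> set (alpha m P)" "w \<in> set (alpha n P) \<union> set (adh n P)" "0 < ccap ces v w"
    have "w \<in> set P" using vw(2) by (auto simp: set_alpha set_adh)
    moreover have "\<exists>k. (v, w, k) \<in> set es \<or> (w, v, k) \<in> set es"
      using ccap_pos[OF vw(3)] by (auto simp: capl_def)
    ultimately show "w \<in> set (alpha m P) \<union> set (cs A n P)" using nbr[OF m vw(1)] sub(2) by blast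
  qed
qed

definition linked :: "nat \<Rightarrow> 'a list list \<Rightarrow> ('a list \<times> nat) list \<Rightarrow> bool" where
  "linked s ps A \<longleftrightarrow> (\<forall>n\<in>set ns. \<forall>P\<in>set ps. length (adh n P) = s \<longrightarrow> bdp A n P \<noteq> [] \<longrightarrow> lk A n P \<noteq> [])"

definition hit :: "'a list list \<Rightarrow> ('a list \<times> nat) list \<Rightarrow> bool" where
  "hit ps A \<longleftrightarrow> (\<forall>P\<in>set ps. \<exists>W. finite W \<and> card W \<le> r \<and> (\<forall>e\<in>set A. inside (fst e) P \<longrightarrow> set (fst e) \<inter> W \<noteq> {}))"

text \<open>The last conjunct charges the lost weight to the path ends inside finished parts. At
  size 0 there are no sinks and no linkage to preserve; instead the paths of a finished part all
  meet a set of at most \<open>r\<close> vertices, and nothing is lost.\<close>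

definition linv :: "nat \<Rightarrow> ('a list \<times> nat) list \<Rightarrow> 'a list list \<times> 'a list list \<times> ('a list \<times> nat) list \<Rightarrow> bool" where
  "linv s A0 st \<longleftrightarrow> (case st of (dn, lv, A) \<Rightarrow> pok (dn @ lv) A \<and> sub A A0 \<and> small s (dn @ lv) A \<and>
     (0 < s \<longrightarrow> linked s dn A) \<and> (s = 0 \<longrightarrow> hit dn A \<and> wsum A = wsum A0) \<and>
     4 * r * wsum A0 \<le> 4 * r * wsum A + (\<Sum>v\<in>set (concat dn). endw A0 v))"

lemma bdp_mono:
  assumes "bdp A' m S \<noteq> []" "set A' \<subseteq> set A" "set S \<subseteq> set P"
  shows "bdp A m P \<noteq> []"
proof -
  obtain e where "e \<in> set (bdp A' m S)" using assms(1) by (meson list.set_sel(1))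
  then have "e \<in> set (bdp A m P)" using assms(2,3) by (auto simp: set_bdp set_alpha)
  then show ?thesis by auto
qed

lemma adh_mono: "set S \<subseteq> set P \<Longrightarrow> length (adh m S) \<le> length (adh m P)"
  and adh_filter: "set S \<subseteq> set P \<Longrightarrow> adh m S = filter (\<lambda>u. u \<in> set S) (adh m P)"
proof -
  assume "set S \<subseteq> set P"
  then show "adh m S = filter (\<lambda>u. u \<in> set S) (adh m P)" by (auto simp: adh_def filter_filter intro!: filter_cong)
  then show "length (adh m S) \<le> length (adh m P)" by simp
qed

lemma links_nil: "links vs es q al [] bd = []" by (simp add: links_def trials_def)

lemma cutset_nil: "cutset vs es q al [] bd = al" by (simp add: cutset_def trials_def)

text \<open>The delicate point is that the new part \<open>S\<close> is linked itself. A node m with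
  s adhesion vertices in \<open>S\<close> lies below n and precedes it. As its adhesion in
  \<open>P\<close> has at most s vertices, all of it lies in \<open>S\<close>; by
  \<open>cut_closed\<close> its cone in \<open>P\<close> lies in \<open>S\<close> too. So m sees the
  same linkage in \<open>S\<close> as in \<open>P\<close>, and it was linked there, being earlier
  than the first unlinked node.\<close>

lemma cut_step:
  assumes inv: "linv s A0 (dn, lv, A)" and A0: "sub A0 fs"
    and i: "i < length ns" "n = ns ! i" and P: "P \<in> set lv" and un: "unlinked vs es q s A (n, P)"
    and first: "\<And>j P. j < i \<Longrightarrow> P \<in> set lv \<Longrightarrow> \<not> unlinked vs es q s A (ns ! j, P)"
  shows "linv s A0 (cutoff (cs A n P) (dn, lv, A)) \<and> cs A n P \<noteq> []"
proof -
  define S where "S = cs A n P"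
  define keep where "keep e \<longleftrightarrow> inside (fst e) S \<or> (\<forall>v\<in>set (fst e). v \<notin> set S)" for e :: "'a list \<times> nat"
  define A' where "A' = filter keep A"
  define lv' where "lv' = map (filter (\<lambda>v. v \<notin> set S)) lv"
  have cut: "cutoff (cs A n P) (dn, lv, A) = (S # dn, lv', A')"
    by (simp add: cutoff_def S_def keep_def[abs_def] A'_def lv'_def)
  have iv: "pok (dn @ lv) A" "sub A A0" "small s (dn @ lv) A" "0 < s \<Longrightarrow> linked s dn A" "s = 0 \<Longrightarrow> hit dn A \<and> wsum A = wsum A0"
    "4 * r * wsum A0 \<le> 4 * r * wsum A + (\<Sum>v\<in>set (concat dn). endw A0 v)" using inv by (auto simp: linv_def)
  have nn: "n \<in> set ns" using i by simp
  have u: "length (adh n P) = s" "bdp A n P \<noteq> []" "lk A n P = []" using un by (auto simp: unlinked_def)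
  have Af: "sub A fs" using sub_trans[OF iv(2) A0] .
  have Afs: "set A \<subseteq> set fs" using sub_set[OF Af] .
  have Sal: "set S \<subseteq> set (alpha n P)" unfolding S_def by (rule cutset_sub)
  then have SP: "set S \<subseteq> set P" by (auto simp: set_alpha)
  have dS: "distinct S" using ns[OF nn] by (simp add: S_def cutset_def alpha_def)
  have sp: "q * cutcap es (set S) (set P - set S) < (\<Sum>v\<in>set S. endw A v)"
    unfolding S_def by (rule sparse_cut[OF nn Af u(2,3)])
  have Sne: "S \<noteq> []" using sp by auto
  have conc: "concat ((S # dn) @ lv') = S @ concat dn @ filter (\<lambda>v. v \<notin> set S) (concat lv)"
    by (simp add: lv'_def filter_concat)
  have Slv: "set S \<subseteq> set (concat lv)" using SP P by auto
  have disj: "set (concat dn) \<inter> set (concat lv) = {}" "distinct (concat dn)" "distinct (concat lv)"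
    using iv(1) by (auto simp: pok_def)
  have part: "\<exists>Q\<in>set (S # dn @ lv'). inside (fst e) Q" if e: "e \<in> set A'" for e
  proof (cases "inside (fst e) S")
    case False
    then have av: "\<forall>v\<in>set (fst e). v \<notin> set S" using e by (auto simp: A'_def keep_def)
    have "e \<in> set A" using e by (simp add: A'_def)
    then obtain Q where Q: "Q \<in> set (dn @ lv)" "inside (fst e) Q" using iv(1) unfolding pok_def by blast
    show ?thesis
    proof (cases "Q \<in> set dn")
      case False
      then have "filter (\<lambda>v. v \<notin> set S) Q \<in> set lv'" using Q by (auto simp: lv'_def)
      moreover have "inside (fst e) (filter (\<lambda>v. v \<notin> set S) Q)" using Q av by (auto simp: inside_def)
      ultimately show ?thesis by auto
    qed (use Q in auto)
  qed auto
  have pok': "pok ((S # dn) @ lv') A'"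
    unfolding pok_def conc
  proof (intro conjI)
    show "distinct (S @ concat dn @ filter (\<lambda>v. v \<notin> set S) (concat lv))" using dS disj Slv by auto
    show "set (S @ concat dn @ filter (\<lambda>v. v \<notin> set S) (concat lv)) = V" using iv(1) Slv by (auto simp: pok_def)
    show "\<forall>e\<in>set A'. \<exists>P\<in>set ((S # dn) @ lv'). inside (fst e) P" using part by simp
  qed
  have sub': "sub A' A0" unfolding A'_def by (rule sub_filter[OF iv(2)])
  have A'A: "set A' \<subseteq> set A" by (auto simp: A'_def)
  have parent: "\<exists>Q\<in>set (dn @ lv). set T \<subseteq> set Q" if "T \<in> set ((S # dn) @ lv')" for T
    using that SP P by (auto simp: lv'_def)
  have small': "small s ((S # dn) @ lv') A'"
    unfolding small_def
  proof (intro ballI impI, rule ccontr)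
    fix m T assume mT: "m \<in> set ns" "T \<in> set ((S # dn) @ lv')" "s < length (adh m T)" "bdp A' m T \<noteq> []"
    obtain Q where Q: "Q \<in> set (dn @ lv)" "set T \<subseteq> set Q" using parent[OF mT(2)] by blast
    have "s < length (adh m Q)" using adh_mono[OF Q(2), of m] mT(3) by simp
    then show False using iv(3) bdp_mono[OF mT(4) A'A Q(2)] mT(1) Q(1) by (auto simp: small_def)
  qed
  \<comment> \<open>Finished parts are disjoint from the live ones, so a cut leaves their paths, and
    with them their linkages, unchanged.\<close>
  have bdT: "bdp A' m T = bdp A m T" if "T \<in> set dn" for m T
  proof -
    have "set T \<subseteq> set (concat dn)" using that by auto
    then have dTS: "set T \<inter> set S = {}" using disj(1) Slv by blast
    have "keep e" if "inside (fst e) (alpha m T)" for e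
    proof -
      have "set (fst e) \<subseteq> set T" using that unfolding inside_iff set_alpha by blast
      then show ?thesis using dTS unfolding keep_def by blast
    qed
    then show ?thesis unfolding bdp_def A'_def filter_filter by (intro filter_cong refl) blast
  qed
  have linked': "linked s (S # dn) A'" if s: "0 < s"
    unfolding linked_def
  proof (intro ballI impI)
    fix m T assume mT: "m \<in> set ns" "T \<in> set (S # dn)" "length (adh m T) = s" "bdp A' m T \<noteq> []"
    show "lk A' m T \<noteq> []"
    proof (cases "T \<in> set dn")
      case True
      then show ?thesis using iv(4)[OF s] mT bdT[OF True, of m] by (auto simp: linked_def)
    next
      case False
      then have T: "T = S" using mT(2) by simp
      obtain j where j: "j < length ns" "m = ns ! j" using mT(1) by (metis in_set_conv_nth)
      have "adh m S \<noteq> []" using mT(3) s T by auto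
      then obtain x where "x \<in> set (adh m S)" by (meson list.set_sel(1))
      then have "x \<in> set (snd m) \<inter> (set (fst n) - set (snd n))" using Sal by (auto simp: set_alpha set_adh)
      then have "set (snd m) \<inter> (set (fst n) - set (snd n)) \<noteq> {}" by blast
      then have ji: "j < i" "set (fst m) - set (snd m) \<subseteq> set (fst n) - set (snd n)" using adhs[OF i(1) j(1)] i j by auto
      have bm: "bdp A m P \<noteq> []" using bdp_mono[OF mT(4) A'A] SP T by simp
      have le: "length (adh m P) \<le> s" 
      proof (rule ccontr)
        assume "\<not> length (adh m P) \<le> s"
        then show False using iv(3) mT(1) P bm by (auto simp: small_def)
      qed
      have af: "adh m S = filter (\<lambda>u. u \<in> set S) (adh m P)" by (rule adh_filter[OF SP])
      have all: "\<forall>u\<in>set (adh m P). u \<in> set S"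
      proof (rule ccontr)
        assume "\<not> (\<forall>u\<in>set (adh m P). u \<in> set S)"
        then obtain x where "x \<in> set (adh m P)" "\<not> x \<in> set S" by blast
        then have "length (adh m S) < length (adh m P)"
          unfolding af by (rule length_filter_less[where P = "\<lambda>u. u \<in> set S"])
        then show False using le mT(3) T by simp
      qed
      then have adeq: "adh m S = adh m P" unfolding af by (rule filter_True)
      have "set (alpha m P) \<subseteq> set (alpha n P)" using ji(2) by (auto simp: set_alpha)
      then have alS: "set (alpha m P) \<subseteq> set S"
        unfolding S_def by (rule cut_closed[OF nn Af u(2) mT(1)]) (use all S_def in auto)
      have aleq: "alpha m S = alpha m P"
        using alS SP by (auto simp: alpha_def intro!: filter_cong)
      have bdeq: "bdp A' m S = bdp A m P"
      proof -
        have "keep e" if "inside (fst e) (alpha m P)" for e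
          using that alS by (auto simp: keep_def inside_iff)
        then show ?thesis unfolding bdp_def A'_def aleq filter_filter by (intro filter_cong refl) blast
      qed
      have "\<not> unlinked vs es q s A (m, P)" using first[OF ji(1) P] j by simp
      then show ?thesis using T adeq aleq bdeq bm mT(3) by (auto simp: unlinked_def)
    qed
  qed
  define R where "R e \<longleftrightarrow> \<not> keep e" for e
  have Rprop: "set (fst e) \<subseteq> set P \<and> set (fst e) \<inter> set S \<noteq> {} \<and> \<not> set (fst e) \<subseteq> set S" if eR: "e \<in> set A" "R e" for e
  proof -
    obtain x where x: "x \<in> set (fst e)" "x \<in> set S" "\<not> set (fst e) \<subseteq> set S" using eR(2) by (auto simp: R_def keep_def inside_iff)
    obtain Q where Q: "Q \<in> set (dn @ lv)" "inside (fst e) Q" using iv(1) eR(1) unfolding pok_def by blast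
    have "Q = P" using pok_disjoint[OF iv(1) Q(1), of P x] P x SP Q(2) by (auto simp: inside_iff)
    then show ?thesis using Q x by (auto simp: inside_iff)
  qed
  have rem: "wsum (filter R A) \<le> d * cutcap es (set S) (set P - set S)"
    by (rule removed_weight[OF Afs Af Rprop])
  have Wsplit: "wsum A = wsum A' + wsum (filter R A)" unfolding A'_def R_def by (rule wsum_split)
  \<comment> \<open>\<open>q = 4 * r * d\<close> is the product of the factor of the charge and the
    common denominator, so sparsity pays for the removed weight exactly in the form of the
    invariant.\<close>
  have loss: "4 * r * wsum A \<le> 4 * r * wsum A' + (\<Sum>v\<in>set S. endw A0 v)"
  proof -
    have "4 * r * wsum (filter R A) \<le> 4 * r * (d * cutcap es (set S) (set P - set S))" using rem by (rule mult_left_mono) simp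
    also have "\<dots> = q * cutcap es (set S) (set P - set S)" by (simp add: mult_ac)
    also have "\<dots> \<le> (\<Sum>v\<in>set S. endw A v)" using sp by simp
    also have "\<dots> \<le> (\<Sum>v\<in>set S. endw A0 v)" using sub_endw[OF iv(2)] by (intro sum_mono)
    finally show ?thesis unfolding Wsplit by (simp add: distrib_left)
  qed
  have zero: "hit (S # dn) A' \<and> wsum A' = wsum A0" if s: "s = 0"
  proof -
    have ad: "adh n P = []" using u(1) s by simp
    \<comment> \<open>Without sinks the whole cone is cut off; no edge leaves it inside
      \<open>P\<close>, hence no weight is lost.\<close>
    have Seq: "S = alpha n P" by (simp add: S_def ad cutset_nil)
    have "cutcap es (set S) (set P - set S) \<le> cutcap es {} {}"
      using nbr[OF nn, of _ P] by (intro cutcap_mono) (auto simp: Seq ad)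
    then have "cutcap es (set S) (set P - set S) = 0" by (simp add: cutcap_def case_prod_unfold)
    then have "wsum A' = wsum A0" using rem Wsplit iv(5)[OF s] by simp
    moreover have "\<exists>W. finite W \<and> card W \<le> r \<and> (\<forall>e\<in>set A'. inside (fst e) S \<longrightarrow> set (fst e) \<inter> W \<noteq> {})"
    proof -
      obtain W where W: "finite W" "card W \<le> r" "\<forall>e\<in>set fs. set (fst e) \<subseteq> set (fst (ns ! i)) \<longrightarrow> set (fst e) \<inter> W = {} \<longrightarrow>
        (\<exists>j<i. set (fst e) \<subseteq> set (fst (ns ! j)) - set (snd (ns ! j)))" using bags[OF i(1)] by blast
      \<comment> \<open>A path avoiding the bag lies in a cone that comes earlier. By
        \<open>small\<close> the adhesion of that cone is empty in \<open>P\<close>, so it is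
        unlinked at size 0 and would have been chosen before \<open>n\<close>.\<close>
      have "set (fst e) \<inter> W \<noteq> {}" if e: "e \<in> set A'" "inside (fst e) S" for e
      proof
        assume "set (fst e) \<inter> W = {}"
        moreover have "set (fst e) \<subseteq> set (fst n)" using e(2) Sal by (auto simp: inside_iff set_alpha)
        moreover have "e \<in> set fs" using e A'A Afs by auto
        ultimately obtain j where j: "j < i" "set (fst e) \<subseteq> set (fst (ns ! j)) - set (snd (ns ! j))" using W(3) i by auto
        have "e \<in> set (bdp A (ns ! j) P)" using e A'A j SP by (auto simp: set_bdp set_alpha inside_iff)
        then have b: "bdp A (ns ! j) P \<noteq> []" by auto
        then have "adh (ns ! j) P = []" using iv(3) P j i s by (auto simp: small_def)
        then have "unlinked vs es q s A (ns ! j, P)" using b s by (simp add: unlinked_def links_nil)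
        then show False using first[OF j(1) P] by simp
      qed
      then show ?thesis using W by blast
    qed
    moreover have "\<exists>W. finite W \<and> card W \<le> r \<and> (\<forall>e\<in>set A'. inside (fst e) T \<longrightarrow> set (fst e) \<inter> W \<noteq> {})" if "T \<in> set dn" for T
      using iv(5)[OF s] that A'A unfolding hit_def by (meson subsetD)
    ultimately show ?thesis by (auto simp: hit_def)
  qed
  have "set S \<inter> set (concat dn) = {}" using disj(1) Slv by auto
  then have "(\<Sum>v\<in>set (concat (S # dn)). endw A0 v) = (\<Sum>v\<in>set S. endw A0 v) + (\<Sum>v\<in>set (concat dn). endw A0 v)"
    by (simp add: sum.union_disjoint)
  then have "4 * r * wsum A0 \<le> 4 * r * wsum A' + (\<Sum>v\<in>set (concat (S # dn)). endw A0 v)" using loss iv(6) by linarith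
  then show ?thesis unfolding cut linv_def using pok' sub' small' linked' zero Sne S_def by simp
qed

lemma splitup:
  assumes A0: "sub A0 fs" and p: "pok ps A0" and sm: "small s ps A0"
  obtains dn lv A where "splitup vs es q ns s ps A0 = (dn, lv, A)" "linv s A0 (dn, lv, A)"
    "\<And>n P. n \<in> set ns \<Longrightarrow> P \<in> set lv \<Longrightarrow> \<not> unlinked vs es q s A (n, P)"
proof -
  let ?F = "cutstep vs es q ns s"
  have step: "?F st = st \<and> (\<forall>n\<in>set ns. \<forall>P\<in>set (fst (snd st)). \<not> unlinked vs es q s (snd (snd st)) (n, P))
      \<or> linv s A0 (?F st) \<and> length (concat (fst st)) < length (concat (fst (?F st)))" if inv: "linv s A0 st" for st
  proof -
    obtain dn lv A where st: "st = (dn, lv, A)" by (cases st)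
    show ?thesis
    proof (cases "filter (unlinked vs es q s A) (prodl ns lv)")
      case Nil
      then have "\<not> unlinked vs es q s A (n, P)" if "n \<in> set ns" "P \<in> set lv" for n P
        using that by (auto simp: filter_empty_conv prodl_def)
      then show ?thesis using Nil by (auto simp: st cutstep_def)
    next
      case (Cons e l)
      from filter_prodl_first[OF this] obtain i where i: "i < length ns" "fst e = ns ! i" "snd e \<in> set lv" "unlinked vs es q s A e"
        "\<And>j P. j < i \<Longrightarrow> P \<in> set lv \<Longrightarrow> \<not> unlinked vs es q s A (ns ! j, P)" by blast
      have "linv s A0 (cutoff (cs A (fst e) (snd e)) (dn, lv, A)) \<and> cs A (fst e) (snd e) \<noteq> []"
        by (rule cut_step[OF inv[unfolded st] A0 i(1) i(2) i(3) _ i(5)]) (simp_all add: i(4))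
      moreover have "?F st = cutoff (cs A (fst e) (snd e)) (dn, lv, A)" by (simp add: st cutstep_def Cons)
      ultimately show ?thesis by (simp add: st cutoff_def)
    qed
  qed
  have init: "linv s A0 ([], ps, A0)"
    using p sm sub_refl by (simp add: linv_def linked_def hit_def)
  have "?F ((?F ^^ length vs) ([], ps, A0)) = (?F ^^ length vs) ([], ps, A0) \<and> linv s A0 ((?F ^^ length vs) ([], ps, A0))"
  proof (rule funpow_stable[where m = "\<lambda>st. length (concat (fst st))" and Inv = "linv s A0" and N = "length vs"])
    fix st assume inv: "linv s A0 st"
    obtain dn lv A where st: "st = (dn, lv, A)" by (cases st)
    have d: "distinct (concat dn)" "set (concat dn) \<subseteq> V" using inv by (auto simp: linv_def pok_def st)
    show "length (concat (fst st)) \<le> length vs"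
      using card_mono[OF _ d(2)] d(1) dvs by (simp add: distinct_card[symmetric] st del: length_concat set_concat)
    show "?F st = st \<or> length (concat (fst st)) < length (concat (fst (?F st)))" using step[OF inv] by auto
    show "linv s A0 (?F st)" using step[OF inv] inv by auto
  qed (use init in auto)
  then have st: "?F (splitup vs es q ns s ps A0) = splitup vs es q ns s ps A0" "linv s A0 (splitup vs es q ns s ps A0)"
    by (auto simp: splitup_def fold_const)
  show ?thesis
    by (rule that[of "fst (splitup vs es q ns s ps A0)" "fst (snd (splitup vs es q ns s ps A0))" "snd (snd (splitup vs es q ns s ps A0))"])
      (use step[OF st(2)] st in auto)
qed

lemma adh_vs: "n \<in> set ns \<Longrightarrow> adh n vs = snd n"
  using ns[of n] by (auto simp: adh_def filter_id_conv)

text \<open>With the single part \<open>vs\<close> adhesions are complete and boundaries are taken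
  in the whole graph, which is the situation \<open>unsafe\<close> speaks about.\<close>

lemma splitup_trivial:
  assumes A0: "sub A0 fs" and s: "l1 < s"
  shows "splitup vs es q ns s [vs] A0 = ([], [vs], A0)"
proof -
  have "\<not> unlinked vs es q s A0 (n, vs)" if n: "n \<in> set ns" for n
  proof
    assume u: "unlinked vs es q s A0 (n, vs)"
    let ?S = "set (cs A0 n vs)"
    have "q * cutcap es ?S (V - ?S) < (\<Sum>v\<in>?S. endw A0 v)"
      by (rule sparse_cut[OF n A0]) (use u in \<open>auto simp: unlinked_def\<close>)
    also have "\<dots> \<le> (\<Sum>v\<in>?S. endw fs v)" using sub_endw[OF A0] by (intro sum_mono)
    finally have *: "q * cutcap es ?S (V - ?S) < (\<Sum>v\<in>?S. endw fs v)" .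
    have "?S \<subseteq> set (fst n) - set (snd n)" using cutset_sub[of "alpha n vs" "adh n vs" "bdp A0 n vs"] by (auto simp: set_alpha)
    then have "length (snd n) \<le> l1" using unsafe[OF n _ *] by simp
    moreover have "length (snd n) = s" using u n by (simp add: unlinked_def adh_vs)
    ultimately show False using s by simp
  qed
  then have "filter (unlinked vs es q s A0) (prodl ns [vs]) = []" by (auto simp: filter_empty_conv prodl_def)
  then have F: "cutstep vs es q ns s ([], [vs], A0) = ([], [vs], A0)" by (simp add: cutstep_def)
  have "(cutstep vs es q ns s ^^ k) ([], [vs], A0) = ([], [vs], A0)" for k by (induction k) (auto simp: F)
  then show ?thesis by (simp add: splitup_def fold_const)
qed

text \<open>The finished parts are disjoint and a path has two ends, so the charge is at most twice
  the weight: a loss of 2/(4r), weakened here to 1/r.\<close>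

lemma split_loss:
  assumes A0: "sub A0 fs" and inv: "linv s A0 (dn, lv, A)"
  shows "(1 - 1 / r) * wsum A0 \<le> real (wsum A)"
proof -
  have "set A0 \<subseteq> set fs" by (rule sub_set[OF A0])
  then have "(\<Sum>v\<in>set (concat dn). endw A0 v) \<le> 2 * wsum A0" using path_facts(5) by (intro sum_endw_le) auto
  then have "4 * r * wsum A0 \<le> 4 * r * wsum A + 2 * wsum A0" using inv by (simp add: linv_def)
  then have "real (4 * r * wsum A0) \<le> real (4 * r * wsum A + 2 * wsum A0)" by (simp only: of_nat_le_iff)
  then have "2 * real r * wsum A0 \<le> 2 * real r * wsum A + wsum A0" by simp
  then have "2 * real r * wsum A0 \<le> 2 * real r * wsum A + 2 * wsum A0" by linarith
  then show ?thesis using r by (simp add: field_simps)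
qed

section \<open>The invariant over decreasing adhesion sizes\<close>

section \<open>The stages\<close>

definition rho :: real where "rho = 1 - 1 / real r"

lemma rho: "0 \<le> rho" "rho \<le> 1" using r by (auto simp: rho_def)

text \<open>A running state at \<open>s\<close> has dealt with all sizes above \<open>s\<close>;
  truncated subtraction makes the exponents count only those that are at most \<open>l1\<close> or
  \<open>l2\<close>. The clause \<open>ps = [vs]\<close> records that nothing has been cut yet, the
  premise of \<open>splitup_trivial\<close>.\<close>

definition sinv :: "nat \<times> 'a list list \<times> ('a list \<times> nat) list \<times> bool \<Rightarrow> bool" where
  "sinv st \<longleftrightarrow> (case st of (s, ps, A, stop) \<Rightarrow> pok ps A \<and> sub A fs \<and>
     (if stop then 0 < s \<and> linked s ps A \<and> wsum A \<le> r * wsum (filter (badp ns s ps) A) \<and> rho ^ (l1 + l2) * wsum fs \<le> wsum A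
      else small s ps A \<and> (l1 \<le> s \<longrightarrow> ps = [vs]) \<and> rho ^ ((l1 - s) + (l2 - s)) * wsum fs \<le> wsum A))"

lemma stage_step:
  assumes inv: "sinv (s, ps, A, False)" and s: "0 < s"
  shows "sinv (stage vs es q ns r (s, ps, A, False)) \<and>
    (\<not> snd (snd (snd (stage vs es q ns r (s, ps, A, False)))) \<longrightarrow> fst (stage vs es q ns r (s, ps, A, False)) = s - 1)"
proof -
  have iv: "pok ps A" "sub A fs" "small s ps A" "l1 \<le> s \<Longrightarrow> ps = [vs]" "rho ^ ((l1 - s) + (l2 - s)) * wsum fs \<le> wsum A"
    using inv by (auto simp: sinv_def)
  from splitup[OF iv(2,1,3)] obtain dn lv A1 where sp: "splitup vs es q ns s ps A = (dn, lv, A1)" "linv s A (dn, lv, A1)"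
    and nl: "\<And>n P. n \<in> set ns \<Longrightarrow> P \<in> set lv \<Longrightarrow> \<not> unlinked vs es q s A1 (n, P)" by blast
  let ?ps = "dn @ lv"
  have l: "pok ?ps A1" "sub A1 A" "small s ?ps A1" "linked s dn A1" using sp(2) s by (auto simp: linv_def)
  have A1f: "sub A1 fs" by (rule sub_trans[OF l(2) iv(2)])
  have lk: "linked s ?ps A1"
    unfolding linked_def
  proof (intro ballI impI)
    fix n P assume nP: "n \<in> set ns" "P \<in> set ?ps" "length (adh n P) = s" "bdp A1 n P \<noteq> []"
    show "lk A1 n P \<noteq> []"
    proof (cases "P \<in> set dn")
      case True
      then show ?thesis using l(4) nP unfolding linked_def by blast
    next
      case False
      then show ?thesis using nl[OF nP(1), of P] nP by (simp add: unlinked_def)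
    qed
  qed
  have triv: "?ps = [vs] \<and> A1 = A" if "l1 < s" using splitup_trivial[OF iv(2) that] sp iv(4) that by simp
  \<comment> \<open>Cutting adds the factor for the size \<open>s\<close> itself:
    \<open>Suc l1 - s\<close> is \<open>l1 - s + 1\<close> for \<open>s \<le> l1\<close> and 0
    otherwise.\<close>
  have W1: "rho ^ ((Suc l1 - s) + (l2 - s)) * wsum fs \<le> wsum A1"
  proof (cases "l1 < s")
    case True
    then show ?thesis using triv iv(5) by simp
  next
    case False
    then have "Suc l1 - s + (l2 - s) = Suc ((l1 - s) + (l2 - s))" by simp
    then have "rho ^ ((Suc l1 - s) + (l2 - s)) * wsum fs = rho * (rho ^ ((l1 - s) + (l2 - s)) * wsum fs)" by (simp add: mult.assoc)
    also have "\<dots> \<le> rho * wsum A" using iv(5) rho by (intro mult_left_mono) auto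
    also have "\<dots> \<le> wsum A1" using split_loss[OF iv(2) sp(2)] by (simp add: rho_def)
    finally show ?thesis .
  qed
  let ?B = "filter (badp ns s ?ps) A1"
  let ?A2 = "filter (\<lambda>e. \<not> badp ns s ?ps e) A1"
  have st: "stage vs es q ns r (s, ps, A, False) = (if wsum A1 \<le> r * wsum ?B then (s, ?ps, A1, True) else (s - 1, ?ps, ?A2, False))"
    by (simp add: stage_def stage'_def sp)
  show ?thesis
  proof (cases "wsum A1 \<le> r * wsum ?B")
    case True
    \<comment> \<open>As \<open>s\<close> is positive, stopping in this stage has used at most
      \<open>l1 + l2\<close> factors.\<close>
    have "rho ^ (l1 + l2) * wsum fs \<le> rho ^ ((Suc l1 - s) + (l2 - s)) * wsum fs"
      using rho s by (intro mult_right_mono power_decreasing) auto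
    then show ?thesis using True W1 lk l A1f s by (simp add: st sinv_def)
  next
    case False
    have "small (s - 1) ?ps ?A2"
      unfolding small_def
    proof (intro ballI impI, rule ccontr)
      fix n P assume nP: "n \<in> set ns" "P \<in> set ?ps" "s - 1 < length (adh n P)" "bdp ?A2 n P \<noteq> []"
      have "bdp A1 n P \<noteq> []" by (rule bdp_mono[OF nP(4)]) auto
      then have "\<not> s < length (adh n P)" using l(3) nP by (auto simp: small_def)
      then have "length (adh n P) = s" using nP(3) s by simp
      moreover obtain e where "e \<in> set (bdp ?A2 n P)" using nP(4) by (meson list.set_sel(1))
      ultimately show False using nP(1,2) by (auto simp: bdp_def badp_def)
    qed
    moreover have "pok ?ps ?A2" using l(1) by (auto simp: pok_def)
    moreover have "sub ?A2 fs" by (rule sub_filter[OF A1f])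
    moreover have "rho ^ ((l1 - (s - 1)) + (l2 - (s - 1))) * wsum fs \<le> wsum ?A2"
    proof (cases "l2 < s")
      case True
      have "\<not> badp ns s ?ps e" if "e \<in> set A1" for e
      proof
        assume "badp ns s ?ps e"
        then obtain n P where nP: "n \<in> set ns" "P \<in> set ?ps" "length (adh n P) = s" "inside (fst e) (alpha n P)"
          by (auto simp: badp_def)
        have "set (fst e) \<subseteq> set (fst n) - set (snd n)" using nP(4) by (auto simp: inside_iff set_alpha)
        then have "length (snd n) \<le> l2" using bad[OF nP(1), of e] that sub_set[OF A1f] by auto
        moreover have "length (adh n P) \<le> length (snd n)" by (simp add: adh_def)
        ultimately show False using True nP by simp
      qed
      then have "?A2 = A1" by (simp add: filter_id_conv)
      moreover have "(l1 - (s - 1)) + (l2 - (s - 1)) = (Suc l1 - s) + (l2 - s)" using True s by simp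
      ultimately show ?thesis using W1 by simp
    next
      case l2: False
      have "real r * wsum ?B \<le> wsum A1" using False by (metis less_imp_le not_le of_nat_le_iff of_nat_mult)
      then have "wsum ?B \<le> wsum A1 / real r" using r by (simp add: field_simps)
      moreover have "real (wsum A1) = wsum ?B + wsum ?A2" using wsum_split[of A1 "badp ns s ?ps"] by (simp flip: of_nat_add)
      ultimately have "rho * wsum A1 \<le> wsum ?A2" by (simp add: rho_def left_diff_distrib)
      moreover have e: "(l1 - (s - 1)) + (l2 - (s - 1)) = Suc ((Suc l1 - s) + (l2 - s))" using l2 s by simp
      have "rho ^ ((l1 - (s - 1)) + (l2 - (s - 1))) * wsum fs = rho * (rho ^ ((Suc l1 - s) + (l2 - s)) * wsum fs)" unfolding e by (simp add: mult.assoc)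
      moreover have "\<dots> \<le> rho * wsum A1" using W1 rho by (intro mult_left_mono) auto
      ultimately show ?thesis by linarith
    qed
    moreover have "?ps = [vs]" if "l1 \<le> s - 1" using triv that s by simp
    ultimately show ?thesis using False by (simp add: st sinv_def)
  qed
qed

lemma stages:
  defines "fin \<equiv> fold (\<lambda>_. stage vs es q ns r) vs (length vs, [vs], fs, False)"
  shows "sinv fin" "\<not> snd (snd (snd fin)) \<Longrightarrow> fst fin = 0"
proof -
  let ?F = "stage vs es q ns r" let ?i = "(length vs, [vs], fs, False)"
  have 0: "sinv ?i"
  proof -
    have "pok [vs] fs" using dvs path_facts(3) by (auto simp: pok_def inside_iff)
    moreover have "small (length vs) [vs] fs"
      unfolding small_def
    proof (intro ballI impI)
      fix n P assume n: "n \<in> set ns" "P \<in> set [vs]" "length vs < length (adh n P)"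
      have "length (snd n) \<le> length vs" 
      proof -
        have "card (set (snd n)) \<le> card V" using ns[OF n(1)] by (intro card_mono) auto
        then show ?thesis using ns[OF n(1)] dvs by (simp add: distinct_card)
      qed
      then show "bdp fs n P = []" using n by (simp add: adh_vs)
    qed
    moreover have "rho ^ ((l1 - length vs) + (l2 - length vs)) * wsum fs \<le> 1 * real (wsum fs)"
      using rho by (intro mult_right_mono power_le_one) auto
    ultimately show ?thesis using sub_refl by (simp add: sinv_def)
  qed
  have "sinv ((?F ^^ k) ?i) \<and> (\<not> snd (snd (snd ((?F ^^ k) ?i))) \<longrightarrow> fst ((?F ^^ k) ?i) = length vs - k)" if "k \<le> length vs" for k
    using that
  proof (induction k)
    case (Suc k)
    obtain s ps A stop where st: "(?F ^^ k) ?i = (s, ps, A, stop)" by (metis prod_cases4)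
    have IH: "sinv (s, ps, A, stop)" "\<not> stop \<Longrightarrow> s = length vs - k" using Suc st by auto
    show ?case
    proof (cases stop)
      case True
      then have "?F (s, ps, A, stop) = (s, ps, A, stop)" by (simp add: stage_def)
      then show ?thesis using IH True by (simp add: st)
    next
      case False
      then have "0 < s" "sinv (s, ps, A, False)" using IH Suc.prems by auto
      from stage_step[OF this(2,1)] show ?thesis using IH(2) False by (simp add: st)
    qed
  qed (use 0 in simp)
  from this[of "length vs"] show "sinv fin" "\<not> snd (snd (snd fin)) \<Longrightarrow> fst fin = 0"
    by (auto simp: fin_def fold_const)
qed

end

section \<open>From final states to parts, weights and sink flows\<close>

section \<open>Output\<close>

lemma wsum_cover:
  assumes "\<And>e. e \<in> set A \<Longrightarrow> Q e \<Longrightarrow> \<exists>x\<in>set xs. R x e"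
  shows "wsum (filter Q A) \<le> (\<Sum>x\<leftarrow>xs. wsum (filter (R x) A))"
  using assms
proof (induction A)
  case (Cons e A)
  have "(\<Sum>x\<leftarrow>xs. wsum (filter (R x) (e # A))) = (\<Sum>x\<leftarrow>xs. (if R x e then snd e else 0) + wsum (filter (R x) A))"
    by (intro arg_cong[where f = sum_list] map_cong refl) auto
  also have "\<dots> = (\<Sum>x\<leftarrow>xs. if R x e then snd e else 0) + (\<Sum>x\<leftarrow>xs. wsum (filter (R x) A))" by (rule sum_list_addf)
  finally have 1: "(\<Sum>x\<leftarrow>xs. wsum (filter (R x) (e # A))) = (\<Sum>x\<leftarrow>xs. if R x e then snd e else 0) + (\<Sum>x\<leftarrow>xs. wsum (filter (R x) A))" .
  have IH: "wsum (filter Q A) \<le> (\<Sum>x\<leftarrow>xs. wsum (filter (R x) A))" using Cons by simp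
  show ?case
  proof (cases "Q e")
    case True
    then obtain x where x: "x \<in> set xs" "R x e" using Cons.prems[of e] by (meson list.set_intros(1))
    have "(if R x e then snd e else 0) \<le> (\<Sum>x\<leftarrow>xs. if R x e then snd e else 0)" using x(1) by (intro member_le_sum_list) auto
    then show ?thesis unfolding 1 using IH True x by simp
  qed (use IH 1 in simp)
qed simp

lemma distinct_concat_map:
  assumes "distinct us" "\<And>u. u \<in> set us \<Longrightarrow> distinct (U u)" "\<And>u u'. u \<in> set us \<Longrightarrow> u' \<in> set us \<Longrightarrow> u \<noteq> u' \<Longrightarrow> set (U u) \<inter> set (U u') = {}"
  shows "distinct (concat (map U us))"
  using assms
proof (induction us)
  case (Cons u us)
  have "set (U u) \<inter> set (U u') = {}" if "u' \<in> set us" for u'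
    using Cons.prems(1) Cons.prems(3)[of u u'] that by auto
  then show ?case using Cons by (auto simp: disjoint_iff)
qed simp

text \<open>The heads of the decomposed paths and the recorded sources agree as multisets, so every
  predicate on sources has the same count in both.\<close>

lemma length_filter_hd:
  assumes "\<And>v. length (filter (\<lambda>p. hd p = v) qs) = vcount S v"
  shows "length (filter (\<lambda>p. Z (hd p)) qs) = length (filter Z S)"
proof -
  have "count (mset (map hd qs)) v = count (mset S) v" for v
  proof -
    have "length (filter ((=) v) (map hd qs)) = length (filter (\<lambda>p. hd p = v) qs)"
      by (simp add: filter_map o_def eq_commute[of v])
    moreover have "length (filter ((=) v) S) = vcount S v" unfolding vcount_def by (metis (mono_tags, lifting))
    ultimately show ?thesis using assms[of v] by (simp only: count_mset count_list_eq_length_filter)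
  qed
  then have "mset (map hd qs) = mset S" by (simp add: multiset_eq_iff)
  then have "size (filter_mset Z (mset (map hd qs))) = size (filter_mset Z (mset S))" by simp
  then have "length (filter Z (map hd qs)) = length (filter Z S)" by (metis mset_filter size_mset)
  then show ?thesis by (simp add: filter_map o_def)
qed

lemma real_sum_list: "real (\<Sum>x\<leftarrow>xs. f x) = (\<Sum>x\<leftarrow>xs. real (f x))"
  by (induction xs) auto

lemma entries_zero:
  "F \<notin> (\<lambda>(a, b, k). {a, b}) ` set l \<Longrightarrow> sum_list (map (\<lambda>(a, b, k). if {a, b} = F then k else 0) l) = (0 :: nat)"
proof (induction l)
  case (Cons e l)
  obtain a b k where e: "e = (a, b, k)" by (cases e)
  have "{a, b} \<noteq> F" using Cons.prems by (force simp: e)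
  then show ?case using Cons by (simp add: e)
qed simp

context edpcore
begin

text \<open>An edge occurs once in the list, so the sum has a single term for it.\<close>

definition ecap :: "'a set \<Rightarrow> nat" where
  "ecap e = sum_list (map (\<lambda>(a, b, k). if {a, b} = e then k else 0) es)"

lemma ecap: "(a, b, k) \<in> set es \<Longrightarrow> ecap {a, b} = k"
proof -
  assume "(a, b, k) \<in> set es"
  moreover have "sum_list (map (\<lambda>(a, b, k). if {a, b} = {x, y} then k else 0) el) = k"
    if "(x, y, k) \<in> set el" "distinct (map (\<lambda>(a, b, k). {a, b}) el)" for x y k and el :: "('a \<times> 'a \<times> nat) list"
    using that
  proof (induction el)
    case (Cons e el)
    note z = entries_zero
    obtain a b k' where e: "e = (a, b, k')" by (cases e)
    show ?case
    proof (cases "(x, y, k) \<in> set el")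
      case True
      then have "{x, y} \<in> (\<lambda>(a, b, k). {a, b}) ` set el" by force
      moreover have "{a, b} \<notin> (\<lambda>(a, b, k). {a, b}) ` set el" using Cons.prems(2) by (simp add: e)
      ultimately have "{a, b} \<noteq> {x, y}" by metis
      then show ?thesis using Cons True by (simp add: e)
    next
      case False
      then have "(x, y, k) = e" using Cons.prems(1) by simp
      then show ?thesis using z[of "{x, y}" el] Cons.prems(2) by (auto simp: e)
    qed
  qed simp
  ultimately show ?thesis using des by (simp add: ecap_def)
qed

lemma ccap_scaled:
  assumes "(a, b, k) \<in> set es" shows "ccap (capl x X es) a b = k * x div X"
proof -
  have "ccap (capl x X es) a b = sum_list (map (\<lambda>(u, v, c). if {u, v} = {a, b} then c * x div X else 0) es)"
    unfolding ccap_def capl_def map_map by (intro arg_cong[where f = sum_list] map_cong refl) (auto simp: doubleton_eq_iff)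
  moreover have "sum_list (map (\<lambda>(u, v, c). if {u, v} = {a, b} then c * x div X else 0) es) = k * x div X"
  proof -
    have "sum_list (map (\<lambda>(u, v, c). if {u, v} = {a, b} then c * x div X else 0) el)
       = sum_list (map (\<lambda>(u, v, c). if {u, v} = {a, b} then c else 0) el) * x div X"
      if "distinct (map (\<lambda>(a, b, k). {a, b}) el)" for el :: "('a \<times> 'a \<times> nat) list"
      using that
    proof (induction el)
      case (Cons e el)
      obtain u v c where e: "e = (u, v, c)" by (cases e)
      note z = entries_zero[where F = "{a, b}"]
      have IH: "(\<Sum>(u, v, c)\<leftarrow>el. if {u, v} = {a, b} then c * x div X else 0) =
          (\<Sum>(u, v, c)\<leftarrow>el. if {u, v} = {a, b} then c else 0) * x div X" using Cons by simp
      show ?case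
      proof (cases "{u, v} = {a, b}")
        case True
        then have "{a, b} \<notin> (\<lambda>(a, b, k). {a, b}) ` set el" using Cons.prems by (simp add: e)
        from z[OF this] have "(\<Sum>(u, v, c)\<leftarrow>el. if {u, v} = {a, b} then c else 0) = 0" .
        then show ?thesis unfolding e list.map sum_list.Cons IH prod.case True
          by (simp only: if_True simp_thms mult_zero_left div_0 add_0_right)
      next
        case False
        then show ?thesis unfolding e list.map sum_list.Cons IH prod.case by simp
      qed
    qed simp
    from this[OF des] show ?thesis using ecap[OF assms] by (simp add: ecap_def)
  qed
  ultimately show ?thesis by simp
qed

definition wn :: "'a list \<Rightarrow> nat" where "wn p = (case map_of fs p of Some w \<Rightarrow> w | None \<Rightarrow> 0)"

lemma wn: "e \<in> set fs \<Longrightarrow> wn (fst e) = snd e"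
  using map_of_is_SomeI[OF dfs, of "fst e" "snd e"] by (simp add: wn_def)

lemma wsum_wn:
  assumes "sub A fs" shows "wsum A = (\<Sum>p\<in>fst ` set A. wn p)"
proof -
  have dA: "distinct A" "inj_on fst (set A)"
    using assms dfs by (auto simp: sub_def distinct_map intro: inj_on_subset)
  have "wsum A = (\<Sum>e\<in>set A. snd e)" using dA by (simp add: wsum_def sum_list_distinct_conv_sum_set)
  also have "\<dots> = (\<Sum>e\<in>set A. wn (fst e))" using sub_set[OF assms] wn by (intro sum.cong) auto
  also have "\<dots> = (\<Sum>p\<in>fst ` set A. wn p)" using dA by (simp add: sum.reindex)
  finally show ?thesis .
qed

lemma match: "e \<in> set fs \<Longrightarrow> m \<in> M \<Longrightarrow> x \<in> ends (fst e) \<Longrightarrow> x \<in> m \<Longrightarrow> ends (fst e) = m"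
  using M(2) path_facts(6)[of e] by (metis IntI disjointD empty_iff)

text \<open>Weights vanish off the terminals of the part, so their sum over \<open>U\<close> equals
  the sum over the terminals and pieces can be added up as a partition of the vertices.\<close>

definition piece :: "'a list \<Rightarrow> ('a \<Rightarrow> nat) \<Rightarrow> nat \<Rightarrow> bool" where
  "piece U h dd \<longleftrightarrow> 0 < dd \<and> U \<noteq> [] \<and>
     (\<forall>u v. {u, v} \<in> M \<longrightarrow> {u, v} \<subseteq> set U \<longrightarrow> h u = h v) \<and>
     (\<forall>v\<in>set U. h v \<noteq> 0 \<longrightarrow> (\<exists>m\<in>M. m \<subseteq> set U \<and> v \<in> m)) \<and>
     (\<exists>z\<in>set U. \<exists>g. feasible_flow (set U) (induced_edges E (set U)) ecap g \<and>
        (\<forall>p. g p \<noteq> 0 \<longrightarrow> last p = z \<and> (\<exists>m\<in>M. m \<subseteq> set U \<and> hd p \<in> m)) \<and>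
        (\<forall>v\<in>set U. flow_sum g (\<lambda>p. hd p = v) = real (h v) / real dd))"

lemma induced_path:
  assumes "e \<in> set fs" "set (fst e) \<subseteq> U" shows "is_path U (induced_edges E U) (fst e)"
proof -
  have "F \<subseteq> set (fst e)" if "F \<in> path_edges (fst e)" for F using that arcs_in_set[of _ _ "fst e"] by (auto simp: path_edges_arcs)
  then show ?thesis using path_facts(1,2,4)[OF assms(1)] assms(2) by (auto simp: is_path_def induced_edges_def)
qed

lemma path_capacity:
  assumes A: "sub A fs" and e: "F \<in> E"
  shows "(\<Sum>p\<in>{p \<in> fst ` set A. F \<in> path_edges p}. real (wn p) / d) \<le> real (ecap F)"
proof -
  obtain a b k where abk: "(a, b, k) \<in> set es" "F = {a, b}" using e by auto
  have s: "sub (filter (\<lambda>e. F \<in> path_edges (fst e)) A) fs" by (rule sub_filter[OF A])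
  have "{p \<in> fst ` set A. F \<in> path_edges p} = fst ` set (filter (\<lambda>e. F \<in> path_edges (fst e)) A)" by auto
  then have "(\<Sum>p\<in>{p \<in> fst ` set A. F \<in> path_edges p}. real (wn p)) = real (wsum (filter (\<lambda>e. F \<in> path_edges (fst e)) A))"
    using wsum_wn[OF s] by simp
  also have "\<dots> \<le> real (wsum (filter (\<lambda>e. F \<in> path_edges (fst e)) fs))"
  proof -
    obtain Q where "A = filter Q fs" using A by (auto simp: sub_def)
    then show ?thesis by (simp only: filter_filter of_nat_le_iff) (rule wsum_filter_mono, blast)
  qed
  also have "\<dots> \<le> real (d * k)" using cap[OF abk(1)] abk(2) by (simp only: of_nat_le_iff)
  finally have "(\<Sum>p\<in>{p \<in> fst ` set A. F \<in> path_edges p}. real (wn p)) \<le> d * real k" by simp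
  then show ?thesis using d ecap[OF abk(1)] abk(2) by (simp add: sum_divide_distrib[symmetric] field_simps)
qed

lemma endw_wn:
  assumes "sub A fs" shows "endw A v = (\<Sum>p\<in>{p \<in> fst ` set A. v \<in> ends p}. wn p)"
proof -
  have "{p \<in> fst ` set A. v \<in> ends p} = fst ` set (filter (\<lambda>e. v = hd (fst e) \<or> v = last (fst e)) A)" by auto
  then show ?thesis unfolding endw_def using wsum_wn[OF sub_filter[OF assms]] by simp
qed

lemma endw_pair:
  assumes "set A \<subseteq> set fs" "{u, v} \<in> M" shows "endw A u = endw A v"
proof -
  have "(u = hd (fst e) \<or> u = last (fst e)) = (v = hd (fst e) \<or> v = last (fst e))" if "e \<in> set A" for e
  proof -
    have "e \<in> set fs" using that assms by auto
    then show ?thesis using match[OF _ assms(2), of e u] match[OF _ assms(2), of e v] by blast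
  qed
  then have "filter (\<lambda>e. u = hd (fst e) \<or> u = last (fst e)) A = filter (\<lambda>e. v = hd (fst e) \<or> v = last (fst e)) A"
    by (intro filter_cong refl)
  then show ?thesis by (simp only: endw_def)
qed

lemma endw_pos: "endw A v \<noteq> 0 \<Longrightarrow> \<exists>e\<in>set A. v \<in> ends (fst e)"
  by (induction A) (auto simp: endw_Cons endw_def split: if_splits)

lemma thru_sub: "sub A fs \<Longrightarrow> sub (thru A P z) fs" unfolding thru_def by (rule sub_filter)

lemma hub:
  assumes "P \<noteq> []" shows "hub A P \<in> set P" "\<And>y. y \<in> set P \<Longrightarrow> wsum (thru A P y) \<le> wsum (thru A P (hub A P))"
proof -
  let ?T = "\<lambda>y. wsum (thru A P y)"
  have "Max (?T ` set P) \<in> ?T ` set P" using assms by (intro Max_in) auto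
  then obtain z where z: "z \<in> set P" "?T z = Max (?T ` set P)" by auto
  have "?T y \<le> ?T z" if "y \<in> set P" for y unfolding z(2) using that by (intro Max_ge) auto
  with z(1) obtain z where "z \<in> set P" "\<forall>y\<in>set P. ?T y \<le> ?T z" by blast
  then have "filter (\<lambda>z. \<forall>y\<in>set P. ?T y \<le> ?T z) P \<noteq> []" by (auto simp: filter_empty_conv)
  then have "hub A P \<in> set (filter (\<lambda>z. \<forall>y\<in>set P. ?T y \<le> ?T z) P)" unfolding hub_def by (rule hd_in_set)
  then show "hub A P \<in> set P" "\<And>y. y \<in> set P \<Longrightarrow> ?T y \<le> ?T (hub A P)" by auto
qed

lemma piece_hub:
  assumes A: "sub A fs" and P: "P \<noteq> []"
  shows "piece P (endw (thru A P (hub A P))) d"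
proof -
  let ?z = "hub A P" let ?U = "set P" let ?B = "filter (\<lambda>e. inside (fst e) P) A"
  let ?PA = "fst ` set ?B"
  have B: "sub ?B fs" by (rule sub_filter[OF A])
  have Bf: "set ?B \<subseteq> set fs" by (rule sub_set[OF B])
  have T: "thru A P ?z = filter (\<lambda>e. ?z \<in> set (fst e)) ?B" by (auto simp: thru_def filter_filter intro!: filter_cong)
  have Tf: "set (thru A P ?z) \<subseteq> set fs" using Bf T by auto
  obtain g where g: "feasible_flow ?U (induced_edges E ?U) ecap g" "\<And>p. g p \<noteq> 0 \<Longrightarrow> last p = ?z \<and> (\<exists>q\<in>?PA. hd p \<in> ends q)"
    "\<And>v. flow_sum g (\<lambda>p. hd p = v) = (\<Sum>p\<in>{p\<in>?PA. ?z \<in> set p \<and> v \<in> ends p}. real (wn p) / d)"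
  proof (rule sink_flow_through[where A = ?PA and U = ?U and E = "induced_edges E ?U" and c = ecap and z = ?z and w = "\<lambda>p. real (wn p) / d"])
    show "is_path ?U (induced_edges E ?U) p" if "p \<in> ?PA" for p using that Bf by (auto simp: inside_iff intro!: induced_path)
    show "hd p \<noteq> last p" if "p \<in> ?PA" for p using that Bf path_facts(5) by auto
    show "(\<Sum>p\<in>{p \<in> ?PA. e \<in> path_edges p}. real (wn p) / d) \<le> real (ecap e)" if "e \<in> induced_edges E ?U" for e
      using path_capacity[OF B, of e] that by (simp add: induced_edges_def)
  qed (use that in auto)
  have val: "flow_sum g (\<lambda>p. hd p = v) = real (endw (thru A P ?z) v) / d" for v
  proof -
    have "{p\<in>?PA. ?z \<in> set p \<and> v \<in> ends p} = {p\<in>fst ` set (thru A P ?z). v \<in> ends p}" unfolding T by auto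
    then show ?thesis unfolding g(3) endw_wn[OF thru_sub[OF A]] by (simp add: sum_divide_distrib)
  qed
  have inM: "\<exists>m\<in>M. m \<subseteq> ?U \<and> v \<in> m" if "e \<in> set ?B" "v \<in> ends (fst e)" for e v
  proof (intro bexI conjI)
    have "e \<in> set fs" using that Bf by auto
    note p = path_facts(6,8,9)[OF this]
    show "ends (fst e) \<in> M" by (rule p(1))
    show "ends (fst e) \<subseteq> ?U" using p(2,3) that(1) by (auto simp: inside_iff)
  qed (use that in auto)
  have "\<exists>m\<in>M. m \<subseteq> ?U \<and> v \<in> m" if v: "endw (thru A P ?z) v \<noteq> 0" for v
  proof -
    obtain e where "e \<in> set (thru A P ?z)" "v \<in> ends (fst e)" using endw_pos[OF v] by blast
    then show ?thesis unfolding T using inM[of e v] by auto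
  qed
  moreover have "endw (thru A P ?z) u = endw (thru A P ?z) v" if "{u, v} \<in> M" for u v by (rule endw_pair[OF Tf that])
  moreover have "last p = ?z \<and> (\<exists>m\<in>M. m \<subseteq> ?U \<and> hd p \<in> m)" if p: "g p \<noteq> 0" for p
  proof -
    obtain e where "e \<in> set ?B" "hd p \<in> ends (fst e)" using g(2)[OF p] by blast
    then show ?thesis using g(2)[OF p] inM by blast
  qed
  ultimately show ?thesis unfolding piece_def using d P hub(1)[OF P, of A] g(1) val by blast
qed

definition result :: "('a list \<times> ('a \<Rightarrow> nat) \<times> nat) list \<Rightarrow> bool" where
  "result L \<longleftrightarrow> distinct (concat (map fst L)) \<and> set (concat (map fst L)) = V \<and>
     (\<forall>(U, h, dd)\<in>set L. piece U h dd) \<and>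
     rho ^ (l1 + l2) * wsum fs / (9 * real r ^ 3 * d) \<le> (\<Sum>(U, h, dd)\<leftarrow>L. \<Sum>v\<in>set U. real (h v) / real dd)"

abbreviation render :: "('a list \<times> ('a \<Rightarrow> nat) \<times> nat) list \<Rightarrow> ('a \<times> nat \<times> nat) list list" where
  "render L \<equiv> map (\<lambda>(U, h, dd). map (\<lambda>v. (v, h v, dd)) U) L"

text \<open>At most \<open>r\<close> vertices meet all paths inside a part, so the best of them, and
  a fortiori the hub, carries a fraction 1/r of these paths. Counting both ends this yields 2/r of
  the flow, far above the required bound.\<close>

lemma outB:
  assumes p: "pok ps A" and A: "sub A fs" and h: "hit ps A" and W: "rho ^ (l1 + l2) * wsum fs \<le> wsum A"
  shows "\<exists>L. outB d ps A = render L \<and> result L"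
proof -
  let ?ps = "filter (\<lambda>P. P \<noteq> []) ps"
  let ?h = "\<lambda>P. endw (thru A P (hub A P))"
  let ?L = "map (\<lambda>P. (P, ?h P, d)) ?ps"
  have r1: "outB d ps A = render ?L" by (simp add: outB_def)
  have conc: "concat (map fst ?L) = concat ps" by (induction ps) auto
  have Af: "set A \<subseteq> set fs" by (rule sub_set[OF A])
  have one: "wsum (filter (\<lambda>e. inside (fst e) P) A) \<le> r * wsum (thru A P (hub A P))" if P: "P \<in> set ?ps" for P
  proof -
    obtain W where Wp: "finite W" "card W \<le> r" "\<forall>e\<in>set A. inside (fst e) P \<longrightarrow> set (fst e) \<inter> W \<noteq> {}"
      using h P unfolding hit_def by auto
    obtain xs where xs: "set xs = W \<inter> set P" "distinct xs" using finite_distinct_list[of "W \<inter> set P"] by auto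
    have "wsum (filter (\<lambda>e. inside (fst e) P) A) \<le> (\<Sum>x\<leftarrow>xs. wsum (filter (\<lambda>e. x \<in> set (fst e) \<and> inside (fst e) P) A))"
    proof (rule wsum_cover)
      fix e assume e: "e \<in> set A" "inside (fst e) P"
      then obtain x where "x \<in> set (fst e)" "x \<in> W" using Wp(3) by blast
      then show "\<exists>x\<in>set xs. x \<in> set (fst e) \<and> inside (fst e) P" using e(2) xs(1) by (auto simp: inside_iff)
    qed
    also have "\<dots> \<le> (\<Sum>x\<leftarrow>xs. wsum (thru A P (hub A P)))"
      using hub(2)[of P] P xs(1) by (intro sum_list_mono) (auto simp: thru_def)
    also have "\<dots> = length xs * wsum (thru A P (hub A P))" by (simp add: sum_list_triv)
    also have "length xs \<le> r" using xs Wp card_mono[of W "W \<inter> set P"] by (simp add: distinct_card[symmetric])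
    finally show ?thesis by simp
  qed
  have "wsum (filter (\<lambda>_. True) A) \<le> (\<Sum>P\<leftarrow>?ps. wsum (filter (\<lambda>e. inside (fst e) P) A))"
  proof (rule wsum_cover)
    fix e assume e: "e \<in> set A"
    obtain P where "P \<in> set ps" "inside (fst e) P" using p e unfolding pok_def by blast
    moreover have "P \<noteq> []" using calculation(2) path_facts(8)[of e] Af e by (auto simp: inside_iff)
    ultimately show "\<exists>x\<in>set ?ps. inside (fst e) x" by auto
  qed
  also have "\<dots> \<le> (\<Sum>P\<leftarrow>?ps. r * wsum (thru A P (hub A P)))" using one by (intro sum_list_mono) auto
  finally have "wsum A \<le> (\<Sum>P\<leftarrow>?ps. r * wsum (thru A P (hub A P)))" by simp
  then have "real (wsum A) \<le> real (\<Sum>P\<leftarrow>?ps. r * wsum (thru A P (hub A P)))" by (simp only: of_nat_le_iff)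
  also have "\<dots> = (\<Sum>P\<leftarrow>?ps. real r * wsum (thru A P (hub A P)))" by (simp add: real_sum_list)
  also have "\<dots> = r * (\<Sum>P\<leftarrow>?ps. real (wsum (thru A P (hub A P))))" by (simp add: sum_list_const_mult)
  finally have W2: "real (wsum A) \<le> r * (\<Sum>P\<leftarrow>?ps. real (wsum (thru A P (hub A P))))" .
  have val: "(\<Sum>(U, h, dd)\<leftarrow>?L. \<Sum>v\<in>set U. real (h v) / real dd) = 2 / d * (\<Sum>P\<leftarrow>?ps. real (wsum (thru A P (hub A P))))"
  proof -
    have "(\<Sum>v\<in>set P. real (?h P v) / d) = 2 / d * real (wsum (thru A P (hub A P)))" for P
    proof -
      have "(\<Sum>v\<in>set P. ?h P v) = 2 * wsum (thru A P (hub A P))"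
      proof (rule sum_endw)
        fix e assume "e \<in> set (thru A P (hub A P))"
        then have e: "e \<in> set fs" "set (fst e) \<subseteq> set P" using Af by (auto simp: thru_def inside_iff)
        show "hd (fst e) \<noteq> last (fst e)" "ends (fst e) \<subseteq> set P" using path_facts(5,8,9)[OF e(1)] e(2) by auto
      qed simp
      then have "(\<Sum>v\<in>set P. real (?h P v)) = 2 * real (wsum (thru A P (hub A P)))" by (simp flip: of_nat_sum)
      then show ?thesis by (simp add: sum_divide_distrib[symmetric])
    qed
    then show ?thesis unfolding map_map o_def prod.case by (simp only: sum_list_const_mult)
  qed
  let ?v = "\<Sum>P\<leftarrow>?ps. real (wsum (thru A P (hub A P)))"
  have "rho ^ (l1 + l2) * wsum fs / (9 * real r ^ 3 * d) \<le> wsum A / (9 * real r ^ 3 * d)"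
    using W by (intro divide_right_mono) auto
  also have "\<dots> \<le> r * ?v / (9 * real r ^ 3 * d)" using W2 by (intro divide_right_mono) auto
  also have "\<dots> \<le> 2 / d * ?v"
  proof -
    have "0 \<le> ?v" by (intro sum_list_nonneg) auto
    moreover have "real r \<le> 2 * (9 * real r ^ 3)"
    proof -
      have "real r * 1 \<le> real r * real r ^ 2" using r by (intro mult_left_mono) (auto simp: one_le_power)
      then show ?thesis by (simp add: power3_eq_cube power2_eq_square)
    qed
    ultimately have "real r * ?v \<le> 2 * (9 * real r ^ 3) * ?v" by (rule mult_right_mono[rotated])
    then show ?thesis using d r by (simp add: field_simps)
  qed
  finally have "rho ^ (l1 + l2) * wsum fs / (9 * real r ^ 3 * d) \<le> (\<Sum>(U, h, dd)\<leftarrow>?L. \<Sum>v\<in>set U. real (h v) / real dd)"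
    unfolding val .
  moreover have "\<forall>(U, h, dd)\<in>set ?L. piece U h dd" using piece_hub[OF A] by auto
  ultimately have "result ?L" unfolding result_def conc using p by (simp only: pok_def simp_thms)
  then show ?thesis using r1 by blast
qed

section \<open>Greedy selection of maximal linked cones\<close>

subsection \<open>Linked cones\<close>

text \<open>The bound \<open>i\<close> on the position records that selected cones do not precede
  the present node in the descendants-first order, which is the direction in which
  \<open>lam\<close> applies.\<close>

definition pick :: "nat \<Rightarrow> nat \<Rightarrow> 'a list list \<Rightarrow> ('a list \<times> nat) list \<Rightarrow> 'a list \<times> 'a \<times> 'a list \<times> ('a list \<times> nat) list \<Rightarrow> bool" where
  "pick i s ps A k \<longleftrightarrow> (\<exists>j P l. i \<le> j \<and> j < length ns \<and> P \<in> set ps \<and> length (adh (ns ! j) P) = s \<and>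
     bdp A (ns ! j) P \<noteq> [] \<and> l \<in> set (lk A (ns ! j) P) \<and> k = (alpha (ns ! j) P, fst l, snd (snd l), bdp A (ns ! j) P))"

definition kinv :: "nat \<Rightarrow> nat \<Rightarrow> 'a list list \<Rightarrow> ('a list \<times> nat) list \<Rightarrow> ('a list \<times> 'a \<times> 'a list \<times> ('a list \<times> nat) list) list \<Rightarrow> bool" where
  "kinv i s ps A ks \<longleftrightarrow> distinct (concat (map fst ks)) \<and> (\<forall>k\<in>set ks. pick i s ps A k)"

definition covered where
  "covered s A n P ks \<longleftrightarrow> (length (adh n P) = s \<longrightarrow> bdp A n P \<noteq> [] \<longrightarrow> (\<exists>k\<in>set ks. set (alpha n P) \<subseteq> set (fst k)))"

lemma alpha_distinct: "n \<in> set ns \<Longrightarrow> distinct (alpha n P)"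
  using ns[of n] by (simp add: alpha_def)

text \<open>If the cone at \<open>i\<close> meets a selected one, both belong to the same part and
  the selected one stands at some \<open>j \<ge> i\<close>; laminarity makes it a superset, so a
  rejected cone is covered.\<close>

lemma pickstep:
  assumes p: "pok ps A" and lkd: "linked s ps A" and i: "i < length ns" and P: "P \<in> set ps" and k: "kinv i s ps A ks"
  shows "kinv i s ps A (pickstep vs es q s A (ns ! i, P) ks) \<and> set ks \<subseteq> set (pickstep vs es q s A (ns ! i, P) ks) \<and>
    covered s A (ns ! i) P (pickstep vs es q s A (ns ! i, P) ks)"
proof (cases "length (adh (ns ! i) P) = s \<and> bdp A (ns ! i) P \<noteq> []")
  case False
  then show ?thesis using k by (auto simp: pickstep_def covered_def)
next
  case True
  show ?thesis
  proof (cases "\<forall>k\<in>set ks. \<forall>v\<in>set (alpha (ns ! i) P). v \<notin> set (fst k)")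
    case free: True
    have nn: "ns ! i \<in> set ns" using i by simp
    have "lk A (ns ! i) P \<noteq> []" using lkd True P nn by (auto simp: linked_def)
    then obtain l ls where l: "lk A (ns ! i) P = l # ls" by (cases "lk A (ns ! i) P") auto
    let ?k = "(alpha (ns ! i) P, fst l, snd (snd l), bdp A (ns ! i) P)"
    have st: "pickstep vs es q s A (ns ! i, P) ks = ?k # ks" using True free by (simp add: pickstep_def l)
    have "pick i s ps A ?k" unfolding pick_def using i P True l by (intro exI[of _ i] exI[of _ P] exI[of _ l]) simp
    moreover have "distinct (concat (map fst (?k # ks)))"
      using k free alpha_distinct[OF nn] by (auto simp: kinv_def)
    ultimately have "kinv i s ps A (?k # ks)" using k by (simp add: kinv_def)
    then show ?thesis unfolding st by (auto simp: covered_def)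
  next
    case False
    then have st: "pickstep vs es q s A (ns ! i, P) ks = ks" by (auto simp: pickstep_def)
    obtain k x where kx: "k \<in> set ks" "x \<in> set (alpha (ns ! i) P)" "x \<in> set (fst k)" using False by blast
    then obtain j P' where j: "i \<le> j" "j < length ns" "P' \<in> set ps" "fst k = alpha (ns ! j) P'" using k by (auto simp: kinv_def pick_def)
    have "P' = P" using pok_disjoint[OF p j(3) P, of x] kx j(4) by (simp add: set_alpha)
    have "set (alpha (ns ! i) P) \<subseteq> set (fst k)"
    proof (cases "i = j")
      case True
      then show ?thesis using j \<open>P' = P\<close> by simp
    next
      case False
      have "x \<in> (set (fst (ns ! i)) - set (snd (ns ! i))) \<inter> (set (fst (ns ! j)) - set (snd (ns ! j)))"
        using kx(2,3) j(4) by (auto simp: set_alpha)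
      then have "set (fst (ns ! i)) - set (snd (ns ! i)) \<subseteq> set (fst (ns ! j)) - set (snd (ns ! j))"
        using lam[of i j] False j by auto
      then show ?thesis unfolding j(4) \<open>P' = P\<close> set_alpha by blast
    qed
    then show ?thesis unfolding st using k kx(1) by (auto simp: covered_def)
  qed
qed

lemma covered_mono: "covered s A n P ks \<Longrightarrow> set ks \<subseteq> set ks' \<Longrightarrow> covered s A n P ks'"
  unfolding covered_def by blast

lemma pick_row:
  assumes p: "pok ps A" and lkd: "linked s ps A" and i: "i < length ns" and L: "set L \<subseteq> set ps" and k: "kinv i s ps A ks"
  shows "kinv i s ps A (fold (pickstep vs es q s A) (map (\<lambda>P. (ns ! i, P)) L) ks) \<and>
    set ks \<subseteq> set (fold (pickstep vs es q s A) (map (\<lambda>P. (ns ! i, P)) L) ks) \<and>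
    (\<forall>P\<in>set L. covered s A (ns ! i) P (fold (pickstep vs es q s A) (map (\<lambda>P. (ns ! i, P)) L) ks))"
  using L k
proof (induction L arbitrary: ks)
  case (Cons P L)
  let ?ks = "pickstep vs es q s A (ns ! i, P) ks"
  have 1: "kinv i s ps A ?ks \<and> set ks \<subseteq> set ?ks \<and> covered s A (ns ! i) P ?ks"
    by (rule pickstep[OF p lkd i]) (use Cons.prems in auto)
  then have "kinv i s ps A ?ks" by blast
  from Cons.IH[OF _ this] have 2: "kinv i s ps A (fold (pickstep vs es q s A) (map (\<lambda>P. (ns ! i, P)) L) ?ks) \<and>
    set ?ks \<subseteq> set (fold (pickstep vs es q s A) (map (\<lambda>P. (ns ! i, P)) L) ?ks) \<and>
    (\<forall>P\<in>set L. covered s A (ns ! i) P (fold (pickstep vs es q s A) (map (\<lambda>P. (ns ! i, P)) L) ?ks))"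
    using Cons.prems by simp
  have "covered s A (ns ! i) P (fold (pickstep vs es q s A) (map (\<lambda>P. (ns ! i, P)) L) ?ks)"
    by (rule covered_mono[of s A "ns ! i" P ?ks]) (use 1 2 in blast)+
  then show ?case using 1 2 by auto
qed simp

lemma picks:
  assumes p: "pok ps A" and lkd: "linked s ps A"
  shows "kinv 0 s ps A (picks vs es q ns s ps A)" "n \<in> set ns \<Longrightarrow> P \<in> set ps \<Longrightarrow> covered s A n P (picks vs es q ns s ps A)"
proof -
  let ?f = "\<lambda>i. fold (pickstep vs es q s A) (rev (prodl (drop i ns) ps)) []"
  have "kinv i s ps A (?f i) \<and> (\<forall>j<length ns. i \<le> j \<longrightarrow> (\<forall>P\<in>set ps. covered s A (ns ! j) P (?f i)))" if "i \<le> length ns" for i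
    using that
  proof (induction "length ns - i" arbitrary: i)
    case 0
    then show ?case by (simp add: prodl_def kinv_def)
  next
    case (Suc m)
    then have i: "i < length ns" by simp
    have IH: "kinv (Suc i) s ps A (?f (Suc i)) \<and> (\<forall>j<length ns. Suc i \<le> j \<longrightarrow> (\<forall>P\<in>set ps. covered s A (ns ! j) P (?f (Suc i))))"
      using Suc by simp
    have "prodl (drop i ns) ps = map (\<lambda>P. (ns ! i, P)) ps @ prodl (drop (Suc i) ns) ps"
      by (simp add: Cons_nth_drop_Suc[OF i, symmetric] prodl_def)
    then have f: "?f i = fold (pickstep vs es q s A) (map (\<lambda>P. (ns ! i, P)) (rev ps)) (?f (Suc i))"
      by (simp add: rev_map)
    have "pick i s ps A k" if "pick (Suc i) s ps A k" for k
      using that unfolding pick_def by (metis Suc_leD)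
    then have k: "kinv i s ps A (?f (Suc i))" using IH unfolding kinv_def by blast
    from pick_row[OF p lkd i _ this, of "rev ps"] have row: "kinv i s ps A (?f i)" "set (?f (Suc i)) \<subseteq> set (?f i)"
      "\<forall>P\<in>set ps. covered s A (ns ! i) P (?f i)" unfolding f by auto
    have "covered s A (ns ! j) P (?f i)" if "j < length ns" "i \<le> j" "P \<in> set ps" for j P
    proof (cases "i = j")
      case False
      then have "covered s A (ns ! j) P (?f (Suc i))" using IH that by simp
      then show ?thesis by (rule covered_mono[OF _ row(2)])
    qed (use row(3) that in auto)
    then show ?case using row(1) by blast
  qed
  from this[of 0] have "kinv 0 s ps A (picks vs es q ns s ps A)" "\<forall>j<length ns. \<forall>P\<in>set ps. covered s A (ns ! j) P (picks vs es q ns s ps A)"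
    by (auto simp: picks_def)
  then show "kinv 0 s ps A (picks vs es q ns s ps A)" "n \<in> set ns \<Longrightarrow> P \<in> set ps \<Longrightarrow> covered s A n P (picks vs es q ns s ps A)"
    by (auto simp: in_set_conv_nth[of n])
qed

end

lemma distinct_concat_uniq:
  assumes "distinct (concat (map f ks))" "k \<in> set ks" "k' \<in> set ks" "x \<in> set (f k)" "x \<in> set (f k')"
  shows "k = k'"
  using assms by (induction ks) auto

lemma distinct_of_concat: "distinct (concat (map f ks)) \<Longrightarrow> (\<And>k. k \<in> set ks \<Longrightarrow> f k \<noteq> []) \<Longrightarrow> distinct ks"
proof (induction ks)
  case (Cons k ks)
  have "k \<notin> set ks"
  proof
    assume "k \<in> set ks"
    moreover obtain x where "x \<in> set (f k)" using Cons.prems(2)[of k] by (meson list.set_intros(1) list.set_sel(1))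
    ultimately show False using Cons.prems(1) by auto
  qed
  then show ?case using Cons by auto
qed simp

text \<open>For families over disjoint cones, where a given vertex or edge concerns at most one
  member.\<close>

lemma sum_le_single:
  fixes f :: "'b \<Rightarrow> real"
  assumes "finite S" "0 \<le> B" "\<And>k. k \<in> S \<Longrightarrow> f k \<le> B" "\<And>k k'. k \<in> S \<Longrightarrow> k' \<in> S \<Longrightarrow> f k \<noteq> 0 \<Longrightarrow> f k' \<noteq> 0 \<Longrightarrow> k = k'"
  shows "sum f S \<le> B"
proof (cases "\<exists>k\<in>S. f k \<noteq> 0")
  case True
  then obtain k where k: "k \<in> S" "f k \<noteq> 0" by blast
  have "sum f S = sum f {k}" using assms(1,4) k by (intro sum.mono_neutral_right) auto
  then show ?thesis using assms(3) k by simp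
next
  case False
  then have "sum f S = 0" by (intro sum.neutral) blast
  then show ?thesis using assms(2) by simp
qed

lemma sum_concat_map:
  fixes f :: "'b \<Rightarrow> real"
  shows "distinct (concat (map U us)) \<Longrightarrow> (\<Sum>u\<leftarrow>us. \<Sum>v\<in>set (U u). f v) = (\<Sum>v\<in>set (concat (map U us)). f v)"
proof (induction us)
  case (Cons u us)
  have "set (U u) \<inter> set (concat (map U us)) = {}" using Cons.prems by simp
  then have "(\<Sum>v\<in>set (U u) \<union> set (concat (map U us)). f v) = (\<Sum>v\<in>set (U u). f v) + (\<Sum>v\<in>set (concat (map U us)). f v)"
    by (intro sum.union_disjoint) auto
  moreover have "set (concat (map U (u # us))) = set (U u) \<union> set (concat (map U us))" by simp
  ultimately show ?case using Cons by simp
qed simp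

lemma double_count:
  assumes "finite V" "\<And>y. y \<in> set st \<Longrightarrow> 2 \<le> card {v\<in>V. R v y}"
  shows "2 * length st \<le> (\<Sum>v\<in>V. length (filter (R v) st))"
  using assms(2)
proof (induction st)
  case (Cons y st)
  have "(\<Sum>v\<in>V. length (filter (R v) (y # st))) = (\<Sum>v\<in>V. (if R v y then 1 else 0) + length (filter (R v) st))"
    by (intro sum.cong) auto
  also have "\<dots> = card {v\<in>V. R v y} + (\<Sum>v\<in>V. length (filter (R v) st))"
    using assms(1) by (simp add: sum.distrib sum.inter_filter[symmetric])
  finally show ?case using Cons by force
qed simp

context edpcore
begin

abbreviation "KK \<equiv> length (units vs es)"
abbreviation "bdk k \<equiv> snd (snd (snd k))"
abbreviation "stk k \<equiv> fst (snd (snd k))"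

text \<open>The bounds on the unit paths with the rounding multiplied out, so that only true demands
  and capacities occur from here on.\<close>

definition route_ok :: "nat \<Rightarrow> 'a list \<times> 'a \<times> 'a list \<times> ('a list \<times> nat) list \<Rightarrow> 'a list list \<Rightarrow> bool" where
  "route_ok s k qs \<longleftrightarrow> KK \<le> 3 * s * length (stk k) \<and> length qs = length (stk k) \<and>
     (\<forall>p\<in>set qs. p \<noteq> [] \<and> distinct p \<and> hd p \<in> set (fst k) \<and> last p = fst (snd k) \<and> set p \<subseteq> insert (fst (snd k)) (set (fst k)) \<and> path_edges p \<subseteq> E) \<and>
     (\<forall>v. length (filter (\<lambda>p. hd p = v) qs) = vcount (stk k) v) \<and>
     (\<forall>v. vcount (stk k) v * (2 * wsum (bdk k)) \<le> KK * endw (bdk k) v) \<and>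
     (\<forall>(a, b, c)\<in>set es. length (filter (\<lambda>p. {a, b} \<in> path_edges p) qs) * (2 * wsum (bdk k)) \<le> c * (q * KK)) \<and>
     set (stk k) \<subseteq> set (fst k)"

lemma pick_route:
  assumes A: "sub A fs" and k: "pick i s ps A k"
  shows "\<exists>qs. route_ok s k qs"
proof -
  obtain j P l where j: "j < length ns" "P \<in> set ps" "length (adh (ns ! j) P) = s" "bdp A (ns ! j) P \<noteq> []"
    "l \<in> set (lk A (ns ! j) P)" "k = (alpha (ns ! j) P, fst l, snd (snd l), bdp A (ns ! j) P)"
    using k by (auto simp: pick_def)
  interpret linkage vs es q "alpha (ns ! j) P" "adh (ns ! j) P" "bdp A (ns ! j) P"
    by (rule linkage[OF nth_mem[OF j(1)] j(4) sub_set[OF A]])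
  obtain qs where qs0: "fst l \<in> set (adh (ns ! j) P)" and qs: "KK \<le> 3 * length (adh (ns ! j) P) * length (snd (snd l))" "length qs = length (snd (snd l))"
    "\<And>p. p \<in> set qs \<Longrightarrow> p \<noteq> [] \<and> distinct p \<and> hd p \<in> set (alpha (ns ! j) P) \<and> last p = fst l \<and> set p \<subseteq> insert (fst l) (set (alpha (ns ! j) P))"
    "\<And>v. length (filter (\<lambda>p. hd p = v) qs) = vcount (snd (snd l)) v"
    "\<And>v. vcount (snd (snd l)) v \<le> sply v"
    "\<And>a b. length (filter (\<lambda>p. {a, b} \<in> path_edges p) qs) \<le> ccap ces a b"
    "set (snd (snd l)) \<subseteq> set (alpha (ns ! j) P)"
    by (rule link_paths[OF j(5)]) (rule that)
  have pe: "path_edges p \<subseteq> E" if p: "p \<in> set qs" for p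
  proof
    fix F assume "F \<in> path_edges p"
    then obtain a b where ab: "F = {a, b}" "{a, b} \<in> path_edges p" by (auto simp: path_edges_arcs)
    then have "p \<in> set (filter (\<lambda>p. {a, b} \<in> path_edges p) qs)" using p by simp
    then have "0 < length (filter (\<lambda>p. {a, b} \<in> path_edges p) qs)" by (rule length_pos_if_in_set)
    then have "0 < ccap ces a b" using qs(6)[of a b] by (rule less_le_trans)
    then have "\<exists>c. (a, b, c) \<in> set ces \<or> (b, a, c) \<in> set ces" by (rule ccap_pos)
    then have "\<exists>c. (a, b, c) \<in> set es \<or> (b, a, c) \<in> set es" by (auto simp: capl_def)
    then have "{a, b} \<in> E \<or> {b, a} \<in> E" by force
    then show "F \<in> E" unfolding ab(1) by (simp only: insert_commute[of b a] disj_absorb)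
  qed
  have sup: "vcount (snd (snd l)) v * X \<le> KK * endw (bdp A (ns ! j) P) v" for v
  proof -
    have "vcount (snd (snd l)) v * X \<le> (KK * endw (bdp A (ns ! j) P) v div X) * X" using qs(5)[of v] unfolding sply_def by (rule mult_le_mono1)
    also have "\<dots> \<le> KK * endw (bdp A (ns ! j) P) v" by (rule div_times_less_eq_dividend)
    finally show ?thesis .
  qed
  have ed: "length (filter (\<lambda>p. {a, b} \<in> path_edges p) qs) * X \<le> c * (q * KK)" if abc: "(a, b, c) \<in> set es" for a b c
  proof -
    have "length (filter (\<lambda>p. {a, b} \<in> path_edges p) qs) * X \<le> (c * (q * KK) div X) * X"
      using qs(6)[of a b] unfolding ccap_scaled[OF abc] by (rule mult_le_mono1)
    also have "\<dots> \<le> c * (q * KK)" by (rule div_times_less_eq_dividend)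
    finally show ?thesis .
  qed
  have "route_ok s k qs"
    unfolding route_ok_def j(6) fst_conv snd_conv
  proof (intro conjI ballI allI)
    show "case x of (a, b, c) \<Rightarrow> length (filter (\<lambda>p. {a, b} \<in> path_edges p) qs) * X \<le> c * (q * KK)" if "x \<in> set es" for x
      using that ed by (cases x) auto
  qed (use qs pe sup j(3) in auto)
  then show ?thesis by blast
qed

text \<open>The cones with sink \<open>u\<close> are disjoint, so each vertex and each edge is used
  by the routes of one cone only and the routes can be superposed. \<open>sym_sink\<close> then
  makes the weights equal within pairs.\<close>

lemma outA_piece:
  assumes p: "pok ps A" and A: "sub A fs" and k: "kinv 0 s ps A ks" and u: "u \<in> V" "\<And>k. k \<in> set ks \<Longrightarrow> u \<notin> set (fst k)"
  shows "piece (u # concat (map fst (filter (\<lambda>k. fst (snd k) = u) ks))) (pickw ks) (3 * q * KK)"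
proof -
  define ksu where "ksu = filter (\<lambda>k. fst (snd k) = u) ks"
  define U where "U = insert u (\<Union>k\<in>set ksu. set (fst k))"
  have Uset: "set (u # concat (map fst ksu)) = U" by (auto simp: U_def)
  have kd: "distinct (concat (map fst ks))" and kp: "\<And>k. k \<in> set ks \<Longrightarrow> pick 0 s ps A k" using k by (auto simp: kinv_def)
  have uniq: "k = k'" if "k \<in> set ks" "k' \<in> set ks" "x \<in> set (fst k)" "x \<in> set (fst k')" for k k' x
    using distinct_concat_uniq[OF kd that] .
  have bd: "bdk k = filter (\<lambda>e. inside (fst e) (fst k)) A" "bdk k \<noteq> []" if "k \<in> set ks" for k
    using kp[OF that] by (auto simp: pick_def bdp_def)
  have Af: "set A \<subseteq> set fs" by (rule sub_set[OF A])
  have subset_ks: "set ksu \<subseteq> set ks" by (auto simp: ksu_def)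
  have "\<forall>k\<in>set ks. \<exists>qs. route_ok s k qs" using pick_route[OF A kp] by blast
  from bchoice[OF this] obtain Q where Q: "\<And>k. k \<in> set ks \<Longrightarrow> route_ok s k (Q k)" by blast
  define BB where "BB = filter (\<lambda>e. \<exists>k\<in>set ksu. inside (fst e) (fst k)) A"
  have BBs: "sub BB fs" unfolding BB_def by (rule sub_filter[OF A])
  have BBf: "set BB \<subseteq> set fs" by (rule sub_set[OF BBs])
  have BBk: "\<exists>k\<in>set ksu. e \<in> set (bdk k) \<and> set (fst e) \<subseteq> set (fst k)" if e: "e \<in> set BB" for e
  proof -
    obtain k where kk: "k \<in> set ksu" "inside (fst e) (fst k)" "e \<in> set A" using e unfolding BB_def by auto
    have "e \<in> set (bdk k)" unfolding bd(1)[OF subsetD[OF subset_ks kk(1)]] using kk by simp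
    then show ?thesis using kk(1,2) unfolding inside_iff by blast
  qed
  have bdBB: "set (bdk k) \<subseteq> set BB" if kk: "k \<in> set ksu" for k
    unfolding bd(1)[OF subsetD[OF subset_ks kk]] BB_def using kk by auto
  let ?A = "fst ` set BB" let ?E = "induced_edges E U" let ?w = "\<lambda>p. real (wn p) / d"
  define X where "X k = 2 * wsum (bdk k)" for k :: "'a list \<times> 'a \<times> 'a list \<times> ('a list \<times> nat) list"
  have Xpos: "0 < X k" if k: "k \<in> set ks" for k
  proof -
    obtain e l where "bdk k = e # l" using bd(2)[OF k] by (cases "bdk k") auto
    moreover have "e \<in> set (bdk k)" using calculation by simp
    then have "e \<in> set fs" unfolding bd(1)[OF k] using Af by auto
    ultimately show ?thesis using path_facts(7)[of e] by (simp add: X_def)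
  qed
  \<comment> \<open>The worth of one unit in cone \<open>k\<close> in terms of the original
    flow.\<close>
  define wt where "wt k = real (X k) / real (q * KK)" for k
  define J where "J = (SIGMA k:set ksu. {..<length (Q k)})"
  define pa where "pa j = Q (fst j) ! snd j" for j :: "('a list \<times> 'a \<times> 'a list \<times> ('a list \<times> nat) list) \<times> nat"
  have Kpos: "0 < KK" using u(1) by (auto simp: units_def)
  have qpos: "0 < q" using r d by simp
  have Jsum: "(\<Sum>j\<in>{j\<in>J. \<Phi> (pa j)}. wt (fst j)) = (\<Sum>k\<in>set ksu. real (length (filter \<Phi> (Q k))) * wt k)" for \<Phi>
  proof -
    have "{j\<in>J. \<Phi> (pa j)} = (SIGMA k:set ksu. {i. i < length (Q k) \<and> \<Phi> (Q k ! i)})" by (auto simp: J_def pa_def)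
    then have "(\<Sum>j\<in>{j\<in>J. \<Phi> (pa j)}. wt (fst j)) = (\<Sum>k\<in>set ksu. \<Sum>i\<in>{i. i < length (Q k) \<and> \<Phi> (Q k ! i)}. wt k)"
      by (subst sum.Sigma) (auto simp: split_def)
    then show ?thesis by (simp add: length_filter_conv_card)
  qed
  have Jpath: "pa j \<in> set (Q (fst j)) \<and> fst j \<in> set ksu" if "j \<in> J" for j using that by (auto simp: J_def pa_def)
  have Qp: "p' \<noteq> [] \<and> distinct p' \<and> hd p' \<in> set (fst k) \<and> last p' = u \<and> set p' \<subseteq> insert u (set (fst k)) \<and> path_edges p' \<subseteq> E"
    if kk: "k \<in> set ksu" "p' \<in> set (Q k)" for k p'
  proof -
    have "k \<in> set ks" "fst (snd k) = u" using kk(1) by (auto simp: ksu_def)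
    then show ?thesis using Q[of k] kk(2) unfolding route_ok_def by blast
  qed
  have pe_set: "F \<subseteq> set p'" if "F \<in> path_edges p'" for F and p' :: "'a list" using that arcs_in_set[of _ _ p'] by (auto simp: path_edges_arcs)
  have endpos: "\<exists>e\<in>set (bdk k). hd p' \<in> ends (fst e)" if kk: "k \<in> set ksu" "p' \<in> set (Q k)" for k p'
  proof -
    have ks: "k \<in> set ks" using kk subset_ks by auto
    have "p' \<in> set (filter (\<lambda>x. hd x = hd p') (Q k))" using kk by simp
    then have "0 < length (filter (\<lambda>x. hd x = hd p') (Q k))" by (rule length_pos_if_in_set)
    then have "0 < vcount (stk k) (hd p')" using Q[OF ks] unfolding route_ok_def by simp
    then have "0 < vcount (stk k) (hd p') * (2 * wsum (bdk k))" using Xpos[OF ks] by (simp add: X_def)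
    also have "\<dots> \<le> KK * endw (bdk k) (hd p')" using Q[OF ks] unfolding route_ok_def by blast
    finally have "0 < KK * endw (bdk k) (hd p')" .
    then show ?thesis using endw_pos[of "bdk k" "hd p'"] by simp
  qed
  \<comment> \<open>The scaling by \<open>4 * r\<close> leaves each end at most half of the flow of
    its pair, as \<open>sym_sink\<close> demands.\<close>
  have dj: "1 / real q \<le> 1 / (2 * real d)" using r d by (simp add: field_simps)
  have half: "(\<Sum>j\<in>{j\<in>J. hd (pa j) = v}. wt (fst j)) \<le> (\<Sum>p\<in>{p\<in>?A. v \<in> ends p}. ?w p) / 2" for v
  proof -
    have R: "(\<Sum>p\<in>{p\<in>?A. v \<in> ends p}. ?w p) = real (endw BB v) / d"
      unfolding endw_wn[OF BBs] by (simp add: sum_divide_distrib)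
    have cnt: "length (filter (\<lambda>x. hd x = v) (Q k)) = vcount (stk k) v" "vcount (stk k) v * X k \<le> KK * endw (bdk k) v" "set (stk k) \<subseteq> set (fst k)"
      if "k \<in> set ksu" for k using Q[of k] that subset_ks unfolding route_ok_def X_def by auto
    have "(\<Sum>k\<in>set ksu. real (length (filter (\<lambda>x. hd x = v) (Q k))) * wt k) \<le> real (endw BB v) / d / 2"
    proof (rule sum_le_single)
      fix k assume kk: "k \<in> set ksu"
      have "real (vcount (stk k) v) * wt k = real (vcount (stk k) v * X k) / real (q * KK)" by (simp add: wt_def)
      also have "\<dots> \<le> real (KK * endw (bdk k) v) / real (q * KK)" using cnt(2)[OF kk] by (intro divide_right_mono) (simp_all only: of_nat_le_iff of_nat_0_le_iff)
      also have "\<dots> = real (endw (bdk k) v) * (1 / real q)" using Kpos by simp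
      also have "\<dots> \<le> real (endw BB v) * (1 / (2 * real d))"
      proof (intro mult_mono dj)
        have eqv: "inside (fst e) (fst k) = ((\<exists>k\<in>set ksu. inside (fst e) (fst k)) \<and> inside (fst e) (fst k))" for e :: "'a list \<times> nat"
          using kk by (intro iffI conjI bexI[of _ k]) simp_all
        have kin: "k \<in> set ks" by (rule subsetD[OF subset_ks kk])
        have "bdk k = filter (\<lambda>e. (\<exists>k\<in>set ksu. inside (fst e) (fst k)) \<and> inside (fst e) (fst k)) A"
          unfolding bd(1)[OF kin] by (rule filter_cong[OF refl eqv])
        also have "\<dots> = filter (\<lambda>e. inside (fst e) (fst k)) BB" unfolding BB_def by (rule filter_filter[symmetric])
        finally have "bdk k = filter (\<lambda>e. inside (fst e) (fst k)) BB" .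
        then show "real (endw (bdk k) v) \<le> real (endw BB v)" using endw_filter_le[of _ BB v] by (simp only: of_nat_le_iff)
      qed auto
      finally show "real (length (filter (\<lambda>x. hd x = v) (Q k))) * wt k \<le> real (endw BB v) / d / 2" using cnt(1)[OF kk] by simp
    next
      fix k k' assume kk: "k \<in> set ksu" "k' \<in> set ksu" "real (length (filter (\<lambda>x. hd x = v) (Q k))) * wt k \<noteq> 0" "real (length (filter (\<lambda>x. hd x = v) (Q k'))) * wt k' \<noteq> 0"
      then have "vcount (stk k) v \<noteq> 0" "vcount (stk k') v \<noteq> 0" using cnt(1) by auto
      then have "v \<in> set (stk k)" "v \<in> set (stk k')" by (auto simp: vcount_def filter_empty_conv)
      then show "k = k'" using uniq[of k k' v] cnt(3) kk subset_ks by blast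
    qed auto
    then show ?thesis unfolding R Jsum[where \<Phi> = "\<lambda>x. hd x = v"] .
  qed
  have capJ: "(\<Sum>j\<in>{j\<in>J. F \<in> path_edges (pa j)}. wt (fst j)) \<le> real (ecap F)" if F: "F \<in> ?E" for F
  proof -
    obtain a b c where abc: "(a, b, c) \<in> set es" "F = {a, b}" using F by (auto simp: induced_edges_def)
    have "(\<Sum>k\<in>set ksu. real (length (filter (\<lambda>x. F \<in> path_edges x) (Q k))) * wt k) \<le> real (ecap F)"
    proof (rule sum_le_single)
      fix k assume kk: "k \<in> set ksu"
      then have "route_ok s k (Q k)" using Q subset_ks by blast
      then have le: "length (filter (\<lambda>x. {a, b} \<in> path_edges x) (Q k)) * X k \<le> c * (q * KK)" using abc(1) unfolding route_ok_def X_def by blast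
      have "real (length (filter (\<lambda>x. F \<in> path_edges x) (Q k))) * wt k = real (length (filter (\<lambda>x. {a, b} \<in> path_edges x) (Q k)) * X k) / real (q * KK)"
        by (simp add: wt_def abc(2))
      also have "\<dots> \<le> real (c * (q * KK)) / real (q * KK)" using le by (intro divide_right_mono) (simp_all only: of_nat_le_iff of_nat_0_le_iff)
      also have "\<dots> = real c" using Kpos qpos by simp
      finally show "real (length (filter (\<lambda>x. F \<in> path_edges x) (Q k))) * wt k \<le> real (ecap F)" using ecap[OF abc(1)] abc(2) by simp
    next
      fix k k' assume kk: "k \<in> set ksu" "k' \<in> set ksu" "real (length (filter (\<lambda>x. F \<in> path_edges x) (Q k))) * wt k \<noteq> 0" "real (length (filter (\<lambda>x. F \<in> path_edges x) (Q k'))) * wt k' \<noteq> 0"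
      then have "filter (\<lambda>x. F \<in> path_edges x) (Q k) \<noteq> []" "filter (\<lambda>x. F \<in> path_edges x) (Q k') \<noteq> []" by auto
      then obtain x x' where x: "x \<in> set (Q k)" "F \<in> path_edges x" "x' \<in> set (Q k')" "F \<in> path_edges x'" by (auto simp: filter_empty_conv)
      \<comment> \<open>The two ends of an edge differ, so one of them is not \<open>u\<close>; it
        belongs to a single cone.\<close>
      have "F \<subseteq> insert u (set (fst k))" "F \<subseteq> insert u (set (fst k'))"
        using Qp[OF kk(1) x(1)] Qp[OF kk(2) x(3)] pe_set[OF x(2)] pe_set[OF x(4)] by blast+
      moreover have "a \<noteq> b" using es[OF abc(1)] by simp
      ultimately obtain y where "y \<in> set (fst k)" "y \<in> set (fst k')" using abc(2) by blast
      then show "k = k'" using uniq[of k k' y] kk subset_ks by blast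
    qed auto
    then show ?thesis unfolding Jsum[where \<Phi> = "\<lambda>x. F \<in> path_edges x"] .
  qed
  have inU: "set (fst k) \<subseteq> U" if "k \<in> set ksu" for k using that by (auto simp: U_def)
  obtain g where g: "feasible_flow U ?E ecap g" "\<And>p. g p \<noteq> 0 \<Longrightarrow> last p = u \<and> (\<exists>p'\<in>?A. hd p \<in> ends p')"
    "\<And>v. flow_sum g (\<lambda>p. hd p = v) = (\<Sum>j\<in>{j\<in>J. \<exists>p\<in>?A. v \<in> ends p \<and> hd (pa j) \<in> ends p}. wt (fst j)) / 3"
  proof (rule sym_sink[where A = ?A and U = U and E = ?E and w = ?w and J = J and wt = "\<lambda>j. wt (fst j)" and q = pa and u = u and c = ecap])
    show "is_path U ?E p'" if "p' \<in> ?A" for p'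
    proof -
      obtain e where e: "e \<in> set BB" "p' = fst e" using \<open>p' \<in> ?A\<close> by auto
      then have "set (fst e) \<subseteq> U" using BBk[OF e(1)] inU by blast
      then show ?thesis using e BBf induced_path[of e U] by auto
    qed
    show "hd p' \<noteq> last p'" "0 < ?w p'" if "p' \<in> ?A" for p' using that BBf path_facts(5,7) wn d by auto
    show "ends p' = ends p''" if pp: "p' \<in> ?A" "p'' \<in> ?A" "ends p' \<inter> ends p'' \<noteq> {}" for p' p''
    proof -
      obtain e e' x where e: "e \<in> set fs" "p' = fst e" "e' \<in> set fs" "p'' = fst e'" "x \<in> ends p'" "x \<in> ends p''" using pp BBf by blast
      then show ?thesis using match[OF e(1) path_facts(6)[OF e(3)], of x] by simp
    qed
    show "finite J" by (auto simp: J_def)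
    show "0 \<le> wt (fst j)" for j by (simp add: wt_def)
    show "is_path U ?E (pa j)" "last (pa j) = u" if j: "j \<in> J" for j
    proof -
      note Qj = Qp[of "fst j" "pa j"] 
      have "set (pa j) \<subseteq> insert u (set (fst (fst j)))" using Qj Jpath[OF j] by blast
      then have "set (pa j) \<subseteq> U" using Jpath[OF j] inU[of "fst j"] unfolding U_def by blast
      moreover have "path_edges (pa j) \<subseteq> ?E" using Qj Jpath[OF j] calculation pe_set[of _ "pa j"] unfolding induced_edges_def by blast
      ultimately show "is_path U ?E (pa j)" "last (pa j) = u" using Qj Jpath[OF j] unfolding is_path_def by blast+
    qed
    show "\<exists>p\<in>?A. hd (pa j) \<in> ends p" if "j \<in> J" for j
      using endpos[of "fst j" "pa j"] Jpath[OF that] bdBB[of "fst j"] by blast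
    show "(\<Sum>p\<in>{p\<in>?A. e \<in> path_edges p}. ?w p) \<le> real (ecap e)" if "e \<in> ?E" for e
      using path_capacity[OF BBs, of e] that by (simp add: induced_edges_def)
  qed (use half capJ that in auto)
  define N where "N k v = length (filter (\<lambda>y. \<exists>e\<in>set (bdk k). (v = hd (fst e) \<or> v = last (fst e)) \<and> (y = hd (fst e) \<or> y = last (fst e))) (stk k))" for k :: "'a list \<times> 'a \<times> 'a list \<times> ('a list \<times> nat) list" and v
  have nonempty: "fst k \<noteq> []" if k1: "k \<in> set ks" for k
  proof -
    obtain e where e: "e \<in> set (bdk k)" using bd(2)[OF k1] by (meson list.set_sel(1))
    then have "e \<in> set fs" "inside (fst e) (fst k)" using bd(1)[OF k1] Af by auto
    then show ?thesis using path_facts(8)[of e] by (auto simp: inside_iff)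
  qed
  have dks: "distinct ks" by (rule distinct_of_concat[OF kd nonempty])
  have bdin: "v \<in> set (fst k)" if "k \<in> set ks" "e \<in> set (bdk k)" "v = hd (fst e) \<or> v = last (fst e)" for k e v
  proof -
    have "e \<in> set fs" "set (fst e) \<subseteq> set (fst k)" using that bd(1)[OF that(1)] Af by (auto simp: inside_iff)
    then show ?thesis using path_facts(8,9)[of e] that(3) by auto
  qed
  \<comment> \<open>A vertex of \<open>U\<close> other than \<open>u\<close> is in exactly one
    selected cone, and that cone has sink \<open>u\<close>; \<open>u\<close> itself is in none.
    Cones with other sinks therefore contribute nothing on \<open>U\<close>.\<close>
  have pw: "pickw ks v = (\<Sum>k\<in>set ksu. X k * N k v)" if v: "v \<in> U" for v
  proof -
    have "pickw ks v = (\<Sum>k\<in>set ks. X k * N k v)"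
      unfolding pickw_def X_def N_def using dks by (simp add: sum_list_distinct_conv_sum_set)
    also have "\<dots> = (\<Sum>k\<in>set ksu. X k * N k v)"
    proof (rule sum.mono_neutral_right)
      show "\<forall>k\<in>set ks - set ksu. X k * N k v = 0"
      proof
        fix k assume kk: "k \<in> set ks - set ksu"
        have False if e: "e \<in> set (bdk k)" "v = hd (fst e) \<or> v = last (fst e)" for e
        proof -
          have vk: "v \<in> set (fst k)" using bdin[of k e v] kk e by blast
          then have "v \<noteq> u" using u(2) kk by blast
          then obtain k' where "k' \<in> set ksu" "v \<in> set (fst k')" using v by (auto simp: U_def)
          then show False using uniq[of k k' v] vk kk subset_ks by blast
        qed
        then have "N k v = 0" unfolding N_def by (simp add: filter_empty_conv) blast
        then show "X k * N k v = 0" by simp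
      qed
    qed (use subset_ks in auto)
    finally show ?thesis .
  qed
  have val: "flow_sum g (\<lambda>p. hd p = v) = real (pickw ks v) / real (3 * q * KK)" if v: "v \<in> U" for v
  proof -
    have "length (filter (\<lambda>x. \<exists>p\<in>?A. v \<in> ends p \<and> hd x \<in> ends p) (Q k)) = N k v" if kk: "k \<in> set ksu" for k
    proof -
      have ks: "k \<in> set ks" using kk subset_ks by auto
      have "(\<exists>p\<in>?A. v \<in> ends p \<and> hd x \<in> ends p) \<longleftrightarrow> (\<exists>e\<in>set (bdk k). (v = hd (fst e) \<or> v = last (fst e)) \<and> (hd x = hd (fst e) \<or> hd x = last (fst e)))"
        if x: "x \<in> set (Q k)" for x
      proof
        assume "\<exists>p\<in>?A. v \<in> ends p \<and> hd x \<in> ends p"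
        then obtain e where e: "e \<in> set BB" "v \<in> ends (fst e)" "hd x \<in> ends (fst e)" by blast
        obtain k' where k': "k' \<in> set ksu" "e \<in> set (bdk k')" using BBk[OF e(1)] by blast
        have "hd x \<in> set (fst k')" using bdin[of k' e "hd x"] k' subset_ks e(3) by blast
        moreover have "hd x \<in> set (fst k)" using Qp[OF kk x] by blast
        ultimately have "k' = k" using uniq[of k' k "hd x"] k'(1) ks subset_ks by blast
        then show "\<exists>e\<in>set (bdk k). (v = hd (fst e) \<or> v = last (fst e)) \<and> (hd x = hd (fst e) \<or> hd x = last (fst e))" using k' e by blast
      next
        assume "\<exists>e\<in>set (bdk k). (v = hd (fst e) \<or> v = last (fst e)) \<and> (hd x = hd (fst e) \<or> hd x = last (fst e))"
        then show "\<exists>p\<in>?A. v \<in> ends p \<and> hd x \<in> ends p" using bdBB[OF kk] by blast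
      qed
      then have "length (filter (\<lambda>x. \<exists>p\<in>?A. v \<in> ends p \<and> hd x \<in> ends p) (Q k))
          = length (filter (\<lambda>x. \<exists>e\<in>set (bdk k). (v = hd (fst e) \<or> v = last (fst e)) \<and> (hd x = hd (fst e) \<or> hd x = last (fst e))) (Q k))"
        by (intro arg_cong[where f = length] filter_cong refl)
      also have "\<dots> = N k v" unfolding N_def
      proof (rule length_filter_hd[where Z = "\<lambda>y. \<exists>e\<in>set (bdk k). (v = hd (fst e) \<or> v = last (fst e)) \<and> (y = hd (fst e) \<or> y = last (fst e))"])
        show "length (filter (\<lambda>p. hd p = w) (Q k)) = vcount (stk k) w" for w using Q[OF ks] unfolding route_ok_def by blast
      qed
      finally show ?thesis .
    qed
    then have "flow_sum g (\<lambda>p. hd p = v) = (\<Sum>k\<in>set ksu. real (N k v) * wt k) / 3"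
      unfolding g(3) Jsum[where \<Phi> = "\<lambda>x. \<exists>p\<in>?A. v \<in> ends p \<and> hd x \<in> ends p"] by (intro arg_cong[where f = "\<lambda>x. x / 3"] sum.cong refl) simp
    also have "\<dots> = (\<Sum>k\<in>set ksu. real (X k * N k v)) / real (3 * q * KK)"
      unfolding wt_def sum_divide_distrib by (intro sum.cong refl) (simp add: mult_ac)
    also have "\<dots> = real (pickw ks v) / real (3 * q * KK)" unfolding pw[OF v] by simp
    finally show ?thesis .
  qed
  have inM: "\<exists>m\<in>M. m \<subseteq> U \<and> v \<in> m" if e: "e \<in> set BB" "v \<in> ends (fst e)" for e v
  proof (intro bexI conjI)
    have ef: "e \<in> set fs" using e BBf by auto
    note pf = path_facts(6,8,9)[OF ef]
    show "ends (fst e) \<in> M" by (rule pf(1))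
    have "set (fst e) \<subseteq> U" using BBk[OF e(1)] inU by blast
    then show "ends (fst e) \<subseteq> U" using pf(2,3) by auto
  qed (use e in auto)
  have nz: "\<exists>m\<in>M. m \<subseteq> U \<and> v \<in> m" if v: "v \<in> U" "pickw ks v \<noteq> 0" for v
  proof -
    obtain k where kk: "k \<in> set ksu" "N k v \<noteq> 0"
    proof -
      have "\<exists>k\<in>set ksu. X k * N k v \<noteq> 0" using v(2) unfolding pw[OF v(1)] by (meson sum.neutral)
      then show ?thesis using that by auto
    qed
    then obtain e where "e \<in> set (bdk k)" "v \<in> ends (fst e)" unfolding N_def by (auto simp: filter_empty_conv)
    then show ?thesis using inM bdBB[OF kk(1)] by blast
  qed
  have pairs: "pickw ks a = pickw ks b" if ab: "{a, b} \<in> M" for a b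
  proof -
    have "((a = hd (fst e) \<or> a = last (fst e)) \<and> Y) = ((b = hd (fst e) \<or> b = last (fst e)) \<and> Y)" if "k \<in> set ks" "e \<in> set (bdk k)" for k e Y
    proof -
      have ef: "e \<in> set fs" using that bd(1)[OF that(1)] Af by auto
      show ?thesis using match[OF ef ab, of a] match[OF ef ab, of b] by blast
    qed
    then show ?thesis unfolding pickw_def
      by (intro arg_cong[where f = sum_list] map_cong refl arg_cong2[where f = "(*)"] arg_cong[where f = length] filter_cong bex_cong)
  qed
  have flow: "\<forall>p. g p \<noteq> 0 \<longrightarrow> last p = u \<and> (\<exists>m\<in>M. m \<subseteq> U \<and> hd p \<in> m)"
  proof (intro allI impI)
    fix p assume p: "g p \<noteq> 0"
    then obtain e where "e \<in> set BB" "hd p \<in> ends (fst e)" using g(2)[OF p] by blast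
    then show "last p = u \<and> (\<exists>m\<in>M. m \<subseteq> U \<and> hd p \<in> m)" using g(2)[OF p] inM by blast
  qed
  have "0 < 3 * q * KK" using Kpos qpos by simp
  moreover have "u \<in> U" by (simp add: U_def)
  ultimately show ?thesis unfolding piece_def ksu_def[symmetric] Uset using pairs nz g(1) flow val by blast
qed

lemma outA:
  assumes p: "pok ps A" and A: "sub A fs" and lkd: "linked s ps A" and s: "0 < s"
    and bad: "wsum A \<le> r * wsum (filter (badp ns s ps) A)" and W: "rho ^ (l1 + l2) * wsum fs \<le> wsum A"
  defines "ks \<equiv> picks vs es q ns s ps A"
  shows "\<exists>L. outA vs (3 * q * KK) ks = render L \<and> result L"
proof -
  have k: "kinv 0 s ps A ks" unfolding ks_def by (rule picks(1)[OF p lkd])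
  have cov: "covered s A n P ks" if "n \<in> set ns" "P \<in> set ps" for n P unfolding ks_def by (rule picks(2)[OF p lkd that])
  have kd: "distinct (concat (map fst ks))" and kp: "\<And>k. k \<in> set ks \<Longrightarrow> pick 0 s ps A k" using k by (auto simp: kinv_def)
  have uniq: "k = k'" if "k \<in> set ks" "k' \<in> set ks" "x \<in> set (fst k)" "x \<in> set (fst k')" for k k' x
    using distinct_concat_uniq[OF kd that] .
  have Af: "set A \<subseteq> set fs" by (rule sub_set[OF A])
  have bd: "bdk k = filter (\<lambda>e. inside (fst e) (fst k)) A" "bdk k \<noteq> []" if "k \<in> set ks" for k
    using kp[OF that] by (auto simp: pick_def bdp_def)
  have nonempty: "fst k \<noteq> []" if k1: "k \<in> set ks" for k
  proof -
    obtain e where e: "e \<in> set (bdk k)" using bd(2)[OF k1] by (meson list.set_sel(1))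
    then have "e \<in> set fs" "inside (fst e) (fst k)" using bd(1)[OF k1] Af by auto
    then show ?thesis using path_facts(8)[of e] by (auto simp: inside_iff)
  qed
  have kV: "set (fst k) \<subseteq> V" if k1: "k \<in> set ks" for k
  proof -
    obtain j P where "j < length ns" "fst k = alpha (ns ! j) P" using kp[OF k1] by (auto simp: pick_def)
    then show ?thesis using ns[OF nth_mem[of j ns]] by (auto simp: set_alpha)
  qed
  \<comment> \<open>A sink inside a selected cone \<open>k'\<close> would put the whole cone of
    \<open>k\<close> into \<open>k'\<close>. Selected cones are disjoint, so the two coincide, but a
    cone avoids its own adhesion.\<close>
  have snk: "fst (snd k) \<in> V" "fst (snd k) \<notin> set (fst k')" if kk: "k \<in> set ks" "k' \<in> set ks" for k k'
  proof -
    obtain j P l where j: "j < length ns" "P \<in> set ps" "bdp A (ns ! j) P \<noteq> []"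
      "l \<in> set (lk A (ns ! j) P)" "k = (alpha (ns ! j) P, fst l, snd (snd l), bdp A (ns ! j) P)" using kp[OF kk(1)] by (auto simp: pick_def)
    obtain j' P' where j': "j' < length ns" "P' \<in> set ps" "fst k' = alpha (ns ! j') P'" using kp[OF kk(2)] by (auto simp: pick_def)
    have u: "fst l \<in> set (adh (ns ! j) P)" using j(4) by (auto simp: links_def trials_def)
    then show "fst (snd k) \<in> V" using ns[OF nth_mem[OF j(1)]] j(5) by (auto simp: set_adh)
    show "fst (snd k) \<notin> set (fst k')"
    proof
      assume "fst (snd k) \<in> set (fst k')"
      then have u': "fst l \<in> set (alpha (ns ! j') P')" using j(5) j'(3) by simp
      have "P = P'" using pok_disjoint[OF p j(2) j'(2), of "fst l"] u u' by (auto simp: set_adh set_alpha)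
      have "fst l \<in> set (snd (ns ! j)) \<inter> (set (fst (ns ! j')) - set (snd (ns ! j')))" using u u' by (auto simp: set_adh set_alpha)
      then have "set (fst (ns ! j)) - set (snd (ns ! j)) \<subseteq> set (fst (ns ! j')) - set (snd (ns ! j'))" using adhs[OF j'(1) j(1)] by blast
      then have sub: "set (fst k) \<subseteq> set (fst k')" unfolding j'(3) j(5) fst_conv set_alpha \<open>P = P'\<close> by blast
      obtain x where "x \<in> set (fst k)" using nonempty[OF kk(1)] by (meson list.set_sel(1))
      then have "k = k'" using uniq[OF kk] sub by blast
      then have "fst l \<in> set (alpha (ns ! j) P)" using u' j'(3) j(5) by (metis fst_conv)
      then show False using u by (simp add: set_alpha set_adh)
    qed
  qed
  define us where "us = filter (\<lambda>u. \<forall>k\<in>set ks. u \<notin> set (fst k)) vs"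
  define U where "U u = u # concat (map fst (filter (\<lambda>k. fst (snd k) = u) ks))" for u
  let ?L = "map (\<lambda>u. (U u, pickw ks, 3 * q * KK)) us"
  have r1: "outA vs (3 * q * KK) ks = render ?L" by (simp add: outA_def us_def U_def o_def)
  have setU: "x \<in> set (U u) \<longleftrightarrow> x = u \<or> (\<exists>k\<in>set ks. fst (snd k) = u \<and> x \<in> set (fst k))" for x u
    unfolding U_def set_simps set_concat set_map set_filter by blast
  have us: "u \<in> set us \<longleftrightarrow> u \<in> V \<and> (\<forall>k\<in>set ks. u \<notin> set (fst k))" for u by (auto simp: us_def)
  have dU: "distinct (concat (map U us))"
  proof (rule distinct_concat_map)
    show "distinct us" using dvs by (simp add: us_def)
    show "distinct (U u)" if u: "u \<in> set us" for u
    proof -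
      have "distinct (concat (map fst (filter Q l)))" if "distinct (concat (map fst l))"
        for Q and l :: "('a list \<times> 'a \<times> 'a list \<times> ('a list \<times> nat) list) list" using that by (induction l) auto
      then have "distinct (concat (map fst (filter (\<lambda>k. fst (snd k) = u) ks)))" using kd by blast
      moreover have "u \<notin> set (concat (map fst (filter (\<lambda>k. fst (snd k) = u) ks)))" using u us by auto
      ultimately show ?thesis by (simp add: U_def)
    qed
    show "set (U u) \<inter> set (U u') = {}" if uu: "u \<in> set us" "u' \<in> set us" "u \<noteq> u'" for u u'
    proof (rule ccontr)
      assume "set (U u) \<inter> set (U u') \<noteq> {}"
      then obtain x where x: "x \<in> set (U u)" "x \<in> set (U u')" by blast
      show False
      proof (cases "\<exists>k\<in>set ks. x \<in> set (fst k)")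
        case True
        then have "x \<noteq> u" "x \<noteq> u'" using uu us by blast+
        then obtain k k' where "k \<in> set ks" "fst (snd k) = u" "x \<in> set (fst k)" "k' \<in> set ks" "fst (snd k') = u'" "x \<in> set (fst k')"
          using x unfolding setU by blast
        then show False using uniq[of k k' x] uu(3) by blast
      next
        case False
        then show False using x uu(3) unfolding setU by blast
      qed
    qed
  qed
  have cU: "set (concat (map U us)) = V"
  proof
    show "set (concat (map U us)) \<subseteq> V"
    proof
      fix x assume "x \<in> set (concat (map U us))"
      then obtain u where "u \<in> set us" "x \<in> set (U u)" by auto
      then show "x \<in> V" unfolding setU us using kV by blast
    qed
    show "V \<subseteq> set (concat (map U us))"
    proof
      fix x assume x: "x \<in> V"
      show "x \<in> set (concat (map U us))"
      proof (cases "\<exists>k\<in>set ks. x \<in> set (fst k)")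
        case True
        then obtain k where kk: "k \<in> set ks" "x \<in> set (fst k)" by blast
        have "fst (snd k) \<in> set us" unfolding us using snk kk(1) by blast
        moreover have "x \<in> set (U (fst (snd k)))" unfolding setU using kk by blast
        ultimately show ?thesis by auto
      next
        case False
        then have "x \<in> set us" "x \<in> set (U x)" unfolding us setU using x by blast+
        then show ?thesis by auto
      qed
    qed
  qed
  have conc: "map fst ?L = map U us" by simp
  have pieces: "\<forall>(U, h, dd)\<in>set ?L. piece U h dd"
  proof
    fix x assume "x \<in> set ?L"
    then obtain u where u: "u \<in> set us" "x = (U u, pickw ks, 3 * q * KK)" by auto
    have "piece (U u) (pickw ks) (3 * q * KK)" unfolding U_def by (rule outA_piece[OF p A k]) (use u(1) us in blast)+
    then show "case x of (U, h, dd) \<Rightarrow> piece U h dd" using u(2) by simp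
  qed
  define PV where "PV = (\<Sum>v\<in>V. pickw ks v)"
  have val: "(\<Sum>(U, h, dd)\<leftarrow>?L. \<Sum>v\<in>set U. real (h v) / real dd) = real PV / real (3 * q * KK)"
  proof -
    have "(\<Sum>(U, h, dd)\<leftarrow>?L. \<Sum>v\<in>set U. real (h v) / real dd) = (\<Sum>u\<leftarrow>us. \<Sum>v\<in>set (U u). real (pickw ks v) / real (3 * q * KK))"
      by (simp only: map_map o_def prod.case)
    also have "\<dots> = (\<Sum>v\<in>V. real (pickw ks v) / real (3 * q * KK))" using sum_concat_map[OF dU] cU by simp
    also have "\<dots> = real PV / real (3 * q * KK)" unfolding PV_def of_nat_sum sum_divide_distrib ..
    finally show ?thesis .
  qed
  \<comment> \<open>At least K/(3s) units are issued in the cone; each is counted at both ends of a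
    pair, with the factor \<open>2 * wsum (bdk k)\<close>.\<close>
  have one: "4 * KK * wsum (bdk k) \<le> 3 * s * (\<Sum>v\<in>V. 2 * wsum (bdk k) *
     length (filter (\<lambda>y. \<exists>e\<in>set (bdk k). (v = hd (fst e) \<or> v = last (fst e)) \<and> (y = hd (fst e) \<or> y = last (fst e))) (stk k)))" if kk: "k \<in> set ks" for k
  proof -
    obtain qs where qs: "route_ok s k qs" using pick_route[OF A kp[OF kk]] by blast
    have e1: "KK \<le> 3 * s * length (stk k)" using qs unfolding route_ok_def by blast
    let ?R = "\<lambda>v y. \<exists>e\<in>set (bdk k). (v = hd (fst e) \<or> v = last (fst e)) \<and> (y = hd (fst e) \<or> y = last (fst e))"
    have e2: "2 * length (stk k) \<le> (\<Sum>v\<in>V. length (filter (?R v) (stk k)))"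
    proof (rule double_count)
      fix y assume y: "y \<in> set (stk k)"
      have "0 < wsum (bdk k)"
      proof -
        obtain e l where el: "bdk k = e # l" using bd(2)[OF kk] by (cases "bdk k") auto
        then have "e \<in> set (bdk k)" by simp
        then have "e \<in> set fs" unfolding bd(1)[OF kk] using Af by auto
        then show ?thesis using path_facts(7)[of e] el by simp
      qed
      moreover have "0 < vcount (stk k) y" using y by (auto simp: vcount_def filter_empty_conv)
      ultimately have "0 < vcount (stk k) y * (2 * wsum (bdk k))" by simp
      also have "\<dots> \<le> KK * endw (bdk k) y" using qs unfolding route_ok_def by blast
      finally have "endw (bdk k) y \<noteq> 0" by simp
      from endw_pos[OF this] obtain e where e: "e \<in> set (bdk k)" "y \<in> ends (fst e)" by blast
      then have ef: "e \<in> set fs" unfolding bd(1)[OF kk] using Af by auto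
      have "hd (fst e) \<in> V" "last (fst e) \<in> V" using path_facts(3,8,9)[OF ef] by auto
      then have "ends (fst e) \<subseteq> {v\<in>V. ?R v y}" using e by blast
      then have "card (ends (fst e)) \<le> card {v\<in>V. ?R v y}" by (intro card_mono) auto
      then show "2 \<le> card {v\<in>V. ?R v y}" using path_facts(5)[OF ef] by simp
    qed simp
    have "4 * KK * wsum (bdk k) \<le> 4 * (3 * s * length (stk k)) * wsum (bdk k)" using e1 by (intro mult_le_mono) auto
    also have "\<dots> = 3 * s * (2 * wsum (bdk k) * (2 * length (stk k)))" by simp
    also have "\<dots> \<le> 3 * s * (2 * wsum (bdk k) * (\<Sum>v\<in>V. length (filter (?R v) (stk k))))" using e2 by (intro mult_le_mono) auto
    finally show ?thesis unfolding sum_distrib_left .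
  qed
  have PVge: "4 * KK * (\<Sum>k\<leftarrow>ks. wsum (bdk k)) \<le> 3 * s * PV"
  proof -
    have "4 * KK * (\<Sum>k\<leftarrow>ks. wsum (bdk k)) = (\<Sum>k\<leftarrow>ks. 4 * KK * wsum (bdk k))" by (rule sum_list_const_mult[symmetric])
    also have "\<dots> \<le> (\<Sum>k\<leftarrow>ks. 3 * s * (\<Sum>v\<in>V. 2 * wsum (bdk k) *
     length (filter (\<lambda>y. \<exists>e\<in>set (bdk k). (v = hd (fst e) \<or> v = last (fst e)) \<and> (y = hd (fst e) \<or> y = last (fst e))) (stk k))))"
      by (rule sum_list_mono) (rule one)
    also have "\<dots> = 3 * s * PV"
    proof -
      have sw: "(\<Sum>k\<leftarrow>l. \<Sum>v\<in>V. f k v) = (\<Sum>v\<in>V. \<Sum>k\<leftarrow>l. f k v)" for f :: "'c \<Rightarrow> 'a \<Rightarrow> nat" and l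
        by (induction l) (auto simp: sum.distrib)
      show ?thesis unfolding PV_def pickw_def sum_list_const_mult sw ..
    qed
    finally show ?thesis .
  qed
  have badle: "wsum (filter (badp ns s ps) A) \<le> (\<Sum>k\<leftarrow>ks. wsum (bdk k))"
  proof -
    have "wsum (filter (badp ns s ps) A) \<le> (\<Sum>k\<leftarrow>ks. wsum (filter (\<lambda>e. inside (fst e) (fst k)) A))"
    proof (rule wsum_cover)
      fix e assume e: "e \<in> set A" "badp ns s ps e"
      then obtain n P where nP: "n \<in> set ns" "P \<in> set ps" "length (adh n P) = s" "inside (fst e) (alpha n P)" unfolding badp_def by blast
      have "e \<in> set (bdp A n P)" using e nP by (auto simp: bdp_def)
      then have "bdp A n P \<noteq> []" by auto
      then obtain k where "k \<in> set ks" "set (alpha n P) \<subseteq> set (fst k)" using cov[OF nP(1,2)] nP(3) unfolding covered_def by blast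
      then show "\<exists>k\<in>set ks. inside (fst e) (fst k)" using nP(4) unfolding inside_iff by blast
    qed
    also have "\<dots> = (\<Sum>k\<leftarrow>ks. wsum (bdk k))"
      using bd(1) by (intro arg_cong[where f = sum_list] map_cong refl) simp
    finally show ?thesis .
  qed
  have main: "4 * KK * wsum A \<le> 3 * r * r * PV"
  proof (cases "ks = []")
    case True
    then show ?thesis using badle bad by simp
  next
    case False
    then obtain k where "k \<in> set ks" by (meson list.set_sel(1))
    from kp[OF this] obtain j P where "j < length ns" "length (adh (ns ! j) P) = s" unfolding pick_def by blast
    then have sr: "s \<le> r" using ns[OF nth_mem[of j ns]] length_filter_le[of "\<lambda>u. u \<in> set P" "snd (ns ! j)"] by (simp add: adh_def)
    have "4 * KK * wsum A \<le> 4 * KK * (r * (\<Sum>k\<leftarrow>ks. wsum (bdk k)))"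
      using bad badle by (intro mult_le_mono2) (meson le_trans mult_le_mono2)
    also have "\<dots> = r * (4 * KK * (\<Sum>k\<leftarrow>ks. wsum (bdk k)))" by simp
    also have "\<dots> \<le> r * (3 * s * PV)" using PVge by (rule mult_le_mono2)
    also have "\<dots> \<le> r * (3 * r * PV)" using sr by (intro mult_le_mono) auto
    finally show ?thesis by (simp add: mult_ac)
  qed
  have "rho ^ (l1 + l2) * wsum fs / (9 * real r ^ 3 * d) \<le> real PV / real (3 * q * KK)"
  proof (cases "KK = 0")
    case True
    then have "vs = []" by (simp add: units_def)
    then have "fs = []" using path_facts(3,8) by (cases fs) auto
    then show ?thesis by simp
  next
    case False
    have "real (4 * KK * wsum A) \<le> real (3 * r * r * PV)" using main by (simp only: of_nat_le_iff)
    then have m: "4 * real KK * wsum A \<le> 3 * real r * r * PV" by simp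
    have "rho ^ (l1 + l2) * wsum fs / (9 * real r ^ 3 * d) \<le> wsum A / (9 * real r ^ 3 * d)" using W by (intro divide_right_mono) auto
    \<comment> \<open>Here 36 is 4 times 9, matched by 3 \<open>r * r\<close> from
      \<open>main\<close> over the output denominator 3qK = 12rdK.\<close>
    also have "\<dots> = (4 * real KK * wsum A) / (36 * real r ^ 3 * d * KK)" using False by simp
    also have "\<dots> \<le> (3 * real r * r * PV) / (36 * real r ^ 3 * d * KK)" using m by (intro divide_right_mono) auto
    also have "\<dots> = real PV / real (3 * q * KK)" using r d by (simp add: power3_eq_cube field_simps)
    finally show ?thesis .
  qed
  then have "result ?L" unfolding result_def conc using dU cU pieces val by (simp only: simp_thms)
  then show ?thesis using r1 by blast
qed

theorem solve_result: "\<exists>L. solve vs es fs ns r d = render L \<and> result L"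
proof -
  define fin where "fin = fold (\<lambda>_. stage vs es q ns r) vs (length vs, [vs], fs, False)"
  obtain s ps A stop where fin4: "fin = (s, ps, A, stop)" by (metis prod_cases4)
  have inv: "sinv (s, ps, A, stop)" and s0: "\<not> stop \<Longrightarrow> s = 0" using stages fin4 by (auto simp: fin_def)
  have sol: "solve vs es fs ns r d = final vs es q ns d (s, ps, A, stop)" using fin4 by (simp only: solve_def fin_def)
  show ?thesis
  proof (cases stop)
    case True
    then have "pok ps A" "sub A fs" "linked s ps A" "0 < s" "wsum A \<le> r * wsum (filter (badp ns s ps) A)" "rho ^ (l1 + l2) * wsum fs \<le> wsum A"
      using inv by (auto simp: sinv_def)
    from outA[OF this] show ?thesis unfolding sol final_def using True by simp
  next
    case False
    then have iv: "pok ps A" "sub A fs" "small 0 ps A" "rho ^ (l1 + l2) * wsum fs \<le> wsum A"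
      using inv s0 by (auto simp: sinv_def)
    from splitup[OF iv(2,1,3)] obtain dn lv A1 where sp: "splitup vs es q ns 0 ps A = (dn, lv, A1)" "linv 0 A (dn, lv, A1)"
      and nl: "\<And>n P. n \<in> set ns \<Longrightarrow> P \<in> set lv \<Longrightarrow> \<not> unlinked vs es q 0 A1 (n, P)" by blast
    have l: "pok (dn @ lv) A1" "sub A1 A" "hit dn A1" "wsum A1 = wsum A" using sp(2) by (auto simp: linv_def)
    obtain n where n: "n \<in> set ns" "set (fst n) = V" "snd n = []" using rootn by blast
    \<comment> \<open>The cone of the root is everything and its adhesion is empty, so a live part
      containing a path would still be unlinked.\<close>
    have empty: "\<not> inside (fst e) P" if eP: "e \<in> set A1" "P \<in> set lv" for e P
    proof
      assume "inside (fst e) P"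
      moreover have "set P \<subseteq> V" using l(1) eP(2) by (auto simp: pok_def)
      ultimately have "e \<in> set (bdp A1 n P)" using eP n by (auto simp: set_bdp set_alpha inside_iff)
      then have "bdp A1 n P \<noteq> []" by auto
      moreover have "adh n P = []" using n by (simp add: adh_def)
      ultimately show False using nl[OF n(1) eP(2)] by (simp add: unlinked_def links_nil)
    qed
    have "hit (dn @ lv) A1"
      unfolding hit_def
    proof
      fix P assume P: "P \<in> set (dn @ lv)"
      show "\<exists>W. finite W \<and> card W \<le> r \<and> (\<forall>e\<in>set A1. inside (fst e) P \<longrightarrow> set (fst e) \<inter> W \<noteq> {})"
      proof (cases "P \<in> set dn")
        case True
        then show ?thesis using l(3) unfolding hit_def by blast
      next
        case False
        then have "P \<in> set lv" using P by simp
        then show ?thesis using empty by (intro exI[of _ "{}"]) auto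
      qed
    qed
    moreover have "sub A1 fs" by (rule sub_trans[OF l(2) iv(2)])
    moreover have "rho ^ (l1 + l2) * wsum fs \<le> wsum A1" using iv(4) l(4) by simp
    ultimately have "\<exists>L. outB d (dn @ lv) A1 = render L \<and> result L" by (intro outB[OF l(1)])
    then show ?thesis unfolding sol final_def finalB_def using False sp by simp
  qed
qed

end

section \<open>Laminarity of cones in a rooted tree decomposition\<close>

section \<open>Tree decompositions\<close>

locale tdec =
  fixes I :: "('a, 't) edp"
  assumes valid: "valid_input I"
begin

abbreviation "R \<equiv> parent_rel I"
abbreviation "V \<equiv> verts I"
abbreviation "E \<equiv> edges I"
abbreviation "T \<equiv> nodes I"

lemma tree: "finite T" "root I \<in> T" "R \<subseteq> T \<times> T" "t \<in> T \<Longrightarrow> (t, root I) \<in> R\<^sup>*"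
  using valid by (auto simp: valid_input_def tree_decomposition_def rooted_tree_def)

lemma bags: "t \<in> T \<Longrightarrow> bag I t \<subseteq> V" "v \<in> V \<Longrightarrow> \<exists>t\<in>T. v \<in> bag I t" "e \<in> E \<Longrightarrow> \<exists>t\<in>T. e \<subseteq> bag I t"
  "t \<in> T \<Longrightarrow> card (bag I t) \<le> width_bound I"
  using valid by (auto simp: valid_input_def tree_decomposition_def)

lemma graph: "finite V" "e \<in> E \<Longrightarrow> \<exists>u v. u \<in> V \<and> v \<in> V \<and> u \<noteq> v \<and> e = {u, v}" "simple_graph V (pairs I)" "disjoint (pairs I)"
  using valid by (auto simp: valid_input_def maxedp_instance_def simple_graph_def)

lemma connected:
  "s \<in> T \<Longrightarrow> t \<in> T \<Longrightarrow> v \<in> bag I s \<Longrightarrow> v \<in> bag I t \<Longrightarrow>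
    (s, t) \<in> ((R \<union> R\<inverse>) \<inter> nodes_at I v \<times> nodes_at I v)\<^sup>*"
proof -
  assume a: "s \<in> T" "t \<in> T" "v \<in> bag I s" "v \<in> bag I t"
  then have "v \<in> V" using bags(1) by blast
  moreover have "s \<in> nodes_at I v" "t \<in> nodes_at I v" using a by (auto simp: nodes_at_def)
  ultimately show ?thesis using valid unfolding valid_input_def tree_decomposition_def by blast
qed

lemma R_iff: "(s, t) \<in> R \<longleftrightarrow> s \<in> T \<and> s \<noteq> root I \<and> t = parent I s" by (auto simp: parent_rel_def)

lemma parent_T: "s \<in> T \<Longrightarrow> s \<noteq> root I \<Longrightarrow> parent I s \<in> T"
  using tree(3) R_iff[of s "parent I s"] by blast

lemma iter_rtrancl: "(t, s) \<in> R\<^sup>* \<Longrightarrow> \<exists>k. (parent I ^^ k) t = s \<and> (\<forall>i<k. (parent I ^^ i) t \<noteq> root I)"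
proof (induction rule: rtrancl_induct)
  case base
  show ?case by (intro exI[of _ 0]) simp
next
  case (step y z)
  then obtain k where k: "(parent I ^^ k) t = y" "\<forall>i<k. (parent I ^^ i) t \<noteq> root I" by blast
  have "y \<noteq> root I" "z = parent I y" using step(2) R_iff by auto
  then show ?case using k by (intro exI[of _ "Suc k"]) (auto simp: less_Suc_eq)
qed

definition dep :: "'t \<Rightarrow> nat" where "dep t = (LEAST k. (parent I ^^ k) t = root I)"

lemma dep_root [simp]: "dep (root I) = 0"
  unfolding dep_def by (rule Least_equality) auto

lemma dep_parent:
  assumes "t \<in> T" "t \<noteq> root I" shows "dep t = Suc (dep (parent I t))"
proof -
  obtain k where k: "(parent I ^^ k) t = root I" using iter_rtrancl[OF tree(4)[OF assms(1)]] by blast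
  have "dep t = Suc (LEAST m. (parent I ^^ Suc m) t = root I)"
    unfolding dep_def by (rule Least_Suc[where P = "\<lambda>k. (parent I ^^ k) t = root I", OF k]) (use assms in simp)
  then show ?thesis by (simp add: dep_def funpow_swap1)
qed

lemma desc_dep: "(s, t) \<in> R\<^sup>* \<Longrightarrow> dep t \<le> dep s \<and> (dep t = dep s \<longrightarrow> s = t)"
proof (induction rule: rtrancl_induct)
  case (step y z)
  have "dep y = Suc (dep z)" using step(2) dep_parent R_iff by auto
  then show ?case using step by auto
qed simp

lemma desc_T: "(s, t) \<in> R\<^sup>* \<Longrightarrow> s \<in> T \<Longrightarrow> t \<in> T"
  by (induction rule: rtrancl_induct) (use tree(3) in auto)

lemma desc_parent: "(s, t) \<in> R\<^sup>* \<Longrightarrow> s \<noteq> t \<Longrightarrow> s \<in> T \<and> s \<noteq> root I \<and> (parent I s, t) \<in> R\<^sup>*"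
  by (erule converse_rtranclE) (auto simp: R_iff)

lemma desc_linear: "(s, t) \<in> R\<^sup>* \<Longrightarrow> (s, t') \<in> R\<^sup>* \<Longrightarrow> dep t' \<le> dep t \<Longrightarrow> (t, t') \<in> R\<^sup>*"
proof (induction rule: converse_rtrancl_induct)
  case (step y z)
  show ?case
  proof (cases "y = t'")
    case True
    have "dep y = Suc (dep z)" using step(1) dep_parent R_iff by auto
    moreover have "dep t \<le> dep z" using desc_dep[OF step(2)] by simp
    ultimately show ?thesis using step True by simp
  next
    case False
    then have "(z, t') \<in> R\<^sup>*" using desc_parent[OF step(4) False] step(1) R_iff by auto
    then show ?thesis using step by simp
  qed
qed simp

text \<open>The ancestors of \<open>t\<close> have pairwise different depths, so there are
  \<open>dep t + 1\<close> of them.\<close>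

lemma dep_bound: "t \<in> T \<Longrightarrow> dep t < card T"
proof -
  assume t: "t \<in> T"
  let ?f = "\<lambda>i. (parent I ^^ i) t"
  have *: "?f i \<in> T \<and> dep (?f i) = dep t - i" if "i \<le> dep t" for i
    using that
  proof (induction i)
    case (Suc i)
    then have IH: "?f i \<in> T" "dep (?f i) = dep t - i" "0 < dep (?f i)" by auto
    then have nr: "?f i \<noteq> root I" by auto
    show ?case using dep_parent[OF IH(1) nr] parent_T[OF IH(1) nr] IH(2) by simp
  qed (use t in simp)
  have "inj_on ?f {..dep t}"
  proof (rule inj_onI)
    fix i j assume ij: "i \<in> {..dep t}" "j \<in> {..dep t}" "?f i = ?f j"
    then have "dep t - i = dep t - j" using *[of i] *[of j] by auto
    then show "i = j" using ij by auto
  qed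
  moreover have "?f ` {..dep t} \<subseteq> T" using * by auto
  ultimately have "card {..dep t} \<le> card T" using card_inj_on_le tree(1) by blast
  then show ?thesis by simp
qed

abbreviation "C \<equiv> cone I"
abbreviation "B \<equiv> parent_adhesion I"

lemma cone_iff: "v \<in> C t \<longleftrightarrow> (\<exists>s\<in>T. (s, t) \<in> R\<^sup>* \<and> v \<in> bag I s)" by (auto simp: cone_def)

text \<open>The nodes whose bags contain \<open>v\<close> are connected. A walk among them that
  leaves the subtree of \<open>t\<close> steps from \<open>t\<close> to its parent, so both bags
  contain \<open>v\<close>.\<close>

lemma outside_in_adhesion:
  assumes v: "v \<in> C t" and s': "s' \<in> T" "v \<in> bag I s'" "(s', t) \<notin> R\<^sup>*"
  shows "v \<in> B t"
proof -
  obtain s where s: "s \<in> T" "(s, t) \<in> R\<^sup>*" "v \<in> bag I s" using v cone_iff by blast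
  have "(s', t) \<in> R\<^sup>* \<or> v \<in> B t" using connected[OF s(1) s'(1) s(3) s'(2)]
  proof (induction rule: rtrancl_induct)
    case base
    then show ?case using s by blast
  next
    case (step y z)
    have yz: "y \<in> nodes_at I v" "z \<in> nodes_at I v" "(y, z) \<in> R \<or> (z, y) \<in> R" using step(2) by auto
    show ?case
    proof (cases "v \<in> B t")
      case False
      then have yt: "(y, t) \<in> R\<^sup>*" using step(3) by blast
      from yz(3) show ?thesis
      proof
        assume "(z, y) \<in> R"
        then show ?thesis using yt by (meson converse_rtrancl_into_rtrancl)
      next
        assume "(y, z) \<in> R"
        then have y: "y \<in> T" "y \<noteq> root I" "z = parent I y" using R_iff by auto
        show ?thesis
        proof (cases "y = t")
          case True
          then have "v \<in> B t" using y yz by (auto simp: parent_adhesion_def nodes_at_def)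
          then show ?thesis by blast
        next
          case False
          then show ?thesis using desc_parent[OF yt False] y by simp
        qed
      qed
    qed simp
  qed
  then show ?thesis using s'(3) by blast
qed

lemma B_sub: "t \<in> T \<Longrightarrow> B t \<subseteq> bag I t" by (auto simp: parent_adhesion_def)

lemma bag_cone: "t \<in> T \<Longrightarrow> bag I t \<subseteq> C t" using cone_iff by blast

lemma cone_V: "C t \<subseteq> V" using bags(1) cone_iff by blast

lemma cone_root: "C (root I) = V" using cone_V cone_iff bags(2) tree(4) by blast

lemma cone_edge:
  assumes "{a, b} \<in> E" "a \<in> C t - B t" shows "b \<in> C t"
proof -
  obtain s where s: "s \<in> T" "{a, b} \<subseteq> bag I s" using bags(3)[OF assms(1)] by blast
  have "(s, t) \<in> R\<^sup>*" using outside_in_adhesion[of a t s] assms(2) s by blast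
  then show ?thesis using s cone_iff by blast
qed

text \<open>A vertex in the adhesion of \<open>t\<close> lies in the bag of the parent of
  \<open>t\<close>, which is outside the subtree of \<open>s\<close>. If it is in the cone of
  \<open>s\<close>, it is therefore in the adhesion of \<open>s\<close> as well.\<close>

lemma nested:
  assumes "(s, t) \<in> R\<^sup>*" "s \<in> T" shows "C s - B s \<subseteq> C t - B t"
proof
  fix y assume y: "y \<in> C s - B s"
  obtain w where "w \<in> T" "(w, s) \<in> R\<^sup>*" "y \<in> bag I w" using y cone_iff by blast
  then have "y \<in> C t" using assms(1) rtrancl_trans[of w s R t] cone_iff by blast
  moreover have "y \<notin> B t"
  proof
    assume yB: "y \<in> B t"
    have t: "t \<noteq> root I" "y \<in> bag I (parent I t)" using yB by (auto simp: parent_adhesion_def split: if_splits)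
    have tT: "t \<in> T" using desc_T assms by blast
    have "(parent I t, s) \<notin> R\<^sup>*"
    proof
      assume "(parent I t, s) \<in> R\<^sup>*"
      then have "dep t \<le> dep (parent I t)" using desc_dep[OF rtrancl_trans[OF _ assms(1)]] by blast
      then show False using dep_parent[OF tT t(1)] by simp
    qed
    then have "y \<in> B s" using outside_in_adhesion[of y s "parent I t"] y parent_T[OF tT t(1)] t(2) by blast
    then show False using y by blast
  qed
  ultimately show "y \<in> C t - B t" by blast
qed

text \<open>A bag containing the common vertex lies below \<open>s\<close>, and also below
  \<open>t\<close> because the vertex avoids the adhesion of \<open>t\<close>. The ancestors of a
  node form a chain, ordered by depth.\<close>

lemma laminar:
  assumes st: "s \<in> T" "t \<in> T" and x: "x \<in> (C s - B s) \<inter> (C t - B t)" and d: "dep t \<le> dep s"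
  shows "C s - B s \<subseteq> C t - B t"
proof -
  obtain y where y: "y \<in> T" "(y, s) \<in> R\<^sup>*" "x \<in> bag I y" using x cone_iff by blast
  have "(y, t) \<in> R\<^sup>*" using outside_in_adhesion[of x t y] x y by blast
  then have "(s, t) \<in> R\<^sup>*" using desc_linear[OF y(2) _ d] by blast
  then show ?thesis using nested st by blast
qed

text \<open>The vertex is in the bags of \<open>s\<close> and of its parent, and both nodes lie
  below \<open>t\<close> since it avoids the adhesion of \<open>t\<close>; so \<open>s\<close> is
  strictly below \<open>t\<close>.\<close>

lemma adhesion_inside:
  assumes st: "s \<in> T" "t \<in> T" and x: "x \<in> B s \<inter> (C t - B t)"
  shows "dep t < dep s \<and> C s - B s \<subseteq> C t - B t"
proof -
  have s: "s \<noteq> root I" "x \<in> bag I s" "x \<in> bag I (parent I s)" using x by (auto simp: parent_adhesion_def split: if_splits)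
  have pT: "parent I s \<in> T" by (rule parent_T[OF st(1) s(1)])
  have "(s, t) \<in> R\<^sup>*" "(parent I s, t) \<in> R\<^sup>*" using outside_in_adhesion[of x t s] outside_in_adhesion[of x t "parent I s"] x st s pT by blast+
  then show ?thesis using nested[OF _ st(1)] desc_dep[of "parent I s" t] dep_parent[OF st(1) s(1)] by auto
qed

text \<open>The adhesion of a child is contained in the bag of \<open>t\<close>, so a path avoiding
  this bag cannot leave the cone of the child in which it starts.\<close>

lemma avoid_bag:
  assumes t: "t \<in> T" and p: "is_path V E p" "set p \<subseteq> C t" "set p \<inter> bag I t = {}"
  shows "\<exists>c\<in>T. dep t < dep c \<and> set p \<subseteq> C c - B c"
proof -
  have ne: "p \<noteq> []" using p(1) by (simp add: is_path_def)
  then have "hd p \<in> set p" by simp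
  then have h: "hd p \<in> C t" "hd p \<notin> bag I t" using p by blast+
  then obtain s where s: "s \<in> T" "(s, t) \<in> R\<^sup>*" "hd p \<in> bag I s" using cone_iff by blast
  have "s \<noteq> t" using s h by blast
  then obtain c where c: "(s, c) \<in> R\<^sup>*" "(c, t) \<in> R" using s(2) by (metis rtranclE)
  have cT: "c \<in> T" "c \<noteq> root I" "parent I c = t" using c(2) R_iff by auto
  have Bc: "B c \<subseteq> bag I t" using cT by (auto simp: parent_adhesion_def)
  have st: "b \<in> C c - B c" if "a \<in> C c - B c" "(a, b) \<in> arcs p" for a b
  proof -
    have "{a, b} \<in> E" using that(2) p(1) by (auto simp: is_path_def path_edges_arcs)
    then have "b \<in> C c" using cone_edge that(1) by blast
    moreover have "b \<in> set p" using arcs_in_set that(2) by fast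
    ultimately show ?thesis using p(3) Bc by blast
  qed
  have hc: "hd p \<in> C c - B c" using s c(1) h(2) Bc cone_iff by blast
  have "x \<in> C c - B c" if "(hd p, x) \<in> (arcs p)\<^sup>*" for x using that
    by (induction rule: rtrancl_induct) (use hc st in blast)+
  moreover have "(hd p, x) \<in> (arcs p)\<^sup>*" if x: "x \<in> set p" for x
  proof -
    obtain ys zs where yz: "p = ys @ x # zs" using x by (auto simp: in_set_conv_decomp)
    have "arcs (ys @ [x]) \<subseteq> arcs p"
    proof (cases zs)
      case (Cons z l)
      then show ?thesis using arcs_append[of "ys @ [x]" zs] yz by auto
    qed (use yz in simp)
    moreover have "(hd (ys @ [x]), last (ys @ [x])) \<in> (arcs (ys @ [x]))\<^sup>*" by (rule hd_last_rtrancl) simp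
    moreover have "hd (ys @ [x]) = hd p" using yz by (cases ys) auto
    ultimately show ?thesis using rtrancl_mono by (metis last_snoc subsetD)
  qed
  ultimately have "set p \<subseteq> C c - B c" by blast
  moreover have "dep t < dep c" using dep_parent[OF cT(1,2)] cT(3) by simp
  ultimately show ?thesis using cT(1) by blast
qed

lemma max_adhesion_ge: "t \<in> T \<Longrightarrow> Q t \<Longrightarrow> card (B t) \<le> max_adhesion I Q"
proof -
  assume a: "t \<in> T" "Q t"
  have "{card (B t) |t. t \<in> T \<and> Q t} \<subseteq> (\<lambda>t. card (B t)) ` T" by auto
  then have "finite {card (B t) |t. t \<in> T \<and> Q t}" using tree(1) finite_subset by blast
  then show ?thesis unfolding max_adhesion_def using a by (intro Max_ge) auto
qed

end

section \<open>Cones, adhesions and depth order computed from the node list\<close>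

section \<open>Preparing the input\<close>

definition par :: "('t \<times> 't \<times> 'a list) list \<Rightarrow> 't \<Rightarrow> 't \<Rightarrow> 't" where
  "par ts rt t = (case filter (\<lambda>e. fst e = t) ts of [] \<Rightarrow> rt | e # _ \<Rightarrow> fst (snd e))"

text \<open>Climbing halts at the root, so \<open>length ts\<close> rounds cover every depth; the
  list has one entry more than the depth.\<close>

definition ancs :: "('t \<times> 't \<times> 'a list) list \<Rightarrow> 't \<Rightarrow> 't \<Rightarrow> 't list" where
  "ancs ts rt t = snd (fold (\<lambda>_ s. if fst s = rt then s else (par ts rt (fst s), par ts rt (fst s) # snd s)) ts (t, [t]))"

definition conel :: "'a list \<Rightarrow> ('t \<times> 't \<times> 'a list) list \<Rightarrow> 't \<Rightarrow> 't \<Rightarrow> 'a list" where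
  "conel vs ts rt t = filter (\<lambda>v. \<exists>s\<in>set ts. t \<in> set (ancs ts rt (fst s)) \<and> v \<in> set (snd (snd s))) vs"

definition adhl :: "('t \<times> 't \<times> 'a list) list \<Rightarrow> 't \<Rightarrow> 't \<times> 't \<times> 'a list \<Rightarrow> 'a list" where
  "adhl ts rt e = (if fst e = rt then [] else
     filter (\<lambda>v. \<exists>s\<in>set ts. fst s = fst (snd e) \<and> v \<in> set (snd (snd s))) (snd (snd e)))"

text \<open>A bucket sort: the counter starts at the number of nodes, which no list of ancestors
  exceeds in length, and runs down, so the deepest nodes come first.\<close>

definition bydepth :: "('t \<times> 't \<times> 'a list) list \<Rightarrow> 't \<Rightarrow> ('t \<times> 't \<times> 'a list) list" where
  "bydepth ts rt = snd (fold (\<lambda>_ s. (fst s - 1, snd s @ filter (\<lambda>e. length (ancs ts rt (fst e)) = fst s) ts)) ts (length ts, []))"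

definition conelist :: "'a list \<Rightarrow> ('t \<times> 't \<times> 'a list) list \<Rightarrow> 't \<Rightarrow> ('a list \<times> 'a list) list" where
  "conelist vs ts rt = map (\<lambda>e. (conel vs ts rt (fst e), adhl ts rt e)) (bydepth ts rt)"

locale tree_lists = tdec I for I :: "('a, 't) edp" +
  fixes vs :: "'a list" and ts :: "('t \<times> 't \<times> 'a list) list"
  assumes vs: "distinct vs" "set vs = verts I"
    and ts: "distinct (map fst ts)" "fst ` set ts = nodes I"
      "(t, s, b) \<in> set ts \<Longrightarrow> parent I t = s \<and> distinct b \<and> set b = bag I t"
begin

abbreviation "rt \<equiv> root I"

lemma ts_e: "e \<in> set ts \<Longrightarrow> fst e \<in> T \<and> fst (snd e) = parent I (fst e) \<and> distinct (snd (snd e)) \<and> set (snd (snd e)) = bag I (fst e)"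
  using ts(2) ts(3)[of "fst e" "fst (snd e)" "snd (snd e)"] by auto

lemma par: "t \<in> T \<Longrightarrow> par ts rt t = parent I t"
proof -
  assume "t \<in> T"
  then obtain e where "e \<in> set ts" "fst e = t" using ts(2) by (metis imageE)
  then have ne: "filter (\<lambda>e. fst e = t) ts \<noteq> []" by (auto simp: filter_empty_conv)
  then obtain e' l where el: "filter (\<lambda>e. fst e = t) ts = e' # l" by (meson neq_Nil_conv)
  then have "e' \<in> set (filter (\<lambda>e. fst e = t) ts)" by simp
  then have "e' \<in> set ts" "fst e' = t" by auto
  then show ?thesis using ts_e[of e'] by (simp add: par_def el)
qed

lemma ancs:
  assumes t: "t \<in> T"
  shows "set (ancs ts rt t) = {s. (t, s) \<in> R\<^sup>*}" "length (ancs ts rt t) = Suc (dep t)"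
proof -
  let ?F = "\<lambda>s. if fst s = rt then s else (par ts rt (fst s), par ts rt (fst s) # snd s)"
  have "fst ((?F ^^ k) (t, [t])) \<in> T \<and> set (snd ((?F ^^ k) (t, [t]))) \<subseteq> {s. (t, s) \<in> R\<^sup>*} \<and>
     fst ((?F ^^ k) (t, [t])) \<in> set (snd ((?F ^^ k) (t, [t]))) \<and>
     {s. (t, s) \<in> R\<^sup>*} \<subseteq> set (snd ((?F ^^ k) (t, [t]))) \<union> {s. (fst ((?F ^^ k) (t, [t])), s) \<in> R\<^sup>*} \<and>
     length (snd ((?F ^^ k) (t, [t]))) + dep (fst ((?F ^^ k) (t, [t]))) = Suc (dep t) \<and>
     dep (fst ((?F ^^ k) (t, [t]))) = dep t - k" for k
  proof (induction k)
    case (Suc k)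
    obtain c l where cl: "(?F ^^ k) (t, [t]) = (c, l)" by (cases "(?F ^^ k) (t, [t])")
    have IH: "c \<in> T" "set l \<subseteq> {s. (t, s) \<in> R\<^sup>*}" "c \<in> set l" "{s. (t, s) \<in> R\<^sup>*} \<subseteq> set l \<union> {s. (c, s) \<in> R\<^sup>*}"
      "length l + dep c = Suc (dep t)" "dep c = dep t - k" using Suc by (auto simp: cl)
    show ?case
    proof (cases "c = rt")
      case True
      then show ?thesis using IH by (simp add: cl)
    next
      case False
      have cp: "(c, parent I c) \<in> R" using R_iff IH(1) False by auto
      have "(t, c) \<in> R\<^sup>*" using IH(2,3) by blast
      then have tp: "(t, parent I c) \<in> R\<^sup>*" using cp by (meson rtrancl_into_rtrancl)
      have "(c, s) \<in> R\<^sup>* \<Longrightarrow> s = c \<or> (parent I c, s) \<in> R\<^sup>*" for s using desc_parent[of c s] by blast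
      then have "{s. (t, s) \<in> R\<^sup>*} \<subseteq> insert (parent I c) (set l) \<union> {s. (parent I c, s) \<in> R\<^sup>*}" using IH(3,4) by blast
      moreover have "dep c = Suc (dep (parent I c))" by (rule dep_parent[OF IH(1) False])
      ultimately show ?thesis using IH False tp parent_T[OF IH(1) False] by (simp add: cl par)
    qed
  qed (use t in auto)
  note 0 = this[of "length ts"]
  have len: "length ts = card T" using distinct_card[OF ts(1)] ts(2) by simp
  obtain c l where cl: "(?F ^^ length ts) (t, [t]) = (c, l)" by (cases "(?F ^^ length ts) (t, [t])")
  note * = 0[unfolded cl fst_conv snd_conv]
  have "dep c = 0" using * dep_bound[OF t] len by simp
  moreover have cT: "c \<in> T" using * by simp
  ultimately have crt: "c = rt" using dep_parent[of c] by auto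
  have "(rt, s) \<in> R\<^sup>* \<Longrightarrow> s = rt" for s using desc_parent[of rt s] by blast
  then have "set l = {s. (t, s) \<in> R\<^sup>*}" using * crt by auto
  moreover have "length l = Suc (dep t)" using * crt by simp
  moreover have "ancs ts rt t = l" unfolding ancs_def fold_const using cl by simp
  ultimately show "set (ancs ts rt t) = {s. (t, s) \<in> R\<^sup>*}" "length (ancs ts rt t) = Suc (dep t)" by auto
qed

lemma conel: "e \<in> set ts \<Longrightarrow> set (conel vs ts rt (fst e)) = C (fst e)"
proof -
  assume e: "e \<in> set ts"
  have "v \<in> set (conel vs ts rt (fst e)) \<longleftrightarrow> v \<in> C (fst e)" for v
  proof -
    have "v \<in> set (conel vs ts rt (fst e)) \<longleftrightarrow> v \<in> V \<and> (\<exists>s\<in>set ts. (fst s, fst e) \<in> R\<^sup>* \<and> v \<in> bag I (fst s))"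
    proof -
      have "fst e \<in> set (ancs ts rt (fst s)) \<and> v \<in> set (snd (snd s)) \<longleftrightarrow> (fst s, fst e) \<in> R\<^sup>* \<and> v \<in> bag I (fst s)" if "s \<in> set ts" for s
        using ts_e[OF that] ancs(1)[of "fst s"] by simp
      then show ?thesis unfolding conel_def set_filter mem_Collect_eq vs(2) by (simp cong: bex_cong)
    qed
    also have "\<dots> \<longleftrightarrow> v \<in> V \<and> (\<exists>s\<in>T. (s, fst e) \<in> R\<^sup>* \<and> v \<in> bag I s)" unfolding ts(2)[symmetric] by blast
    also have "\<dots> \<longleftrightarrow> v \<in> C (fst e)" unfolding cone_iff using bags(1) by blast
    finally show ?thesis .
  qed
  then show ?thesis by blast
qed

lemma adhl: "e \<in> set ts \<Longrightarrow> set (adhl ts rt e) = B (fst e) \<and> distinct (adhl ts rt e)"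
proof -
  assume e: "e \<in> set ts"
  note te = ts_e[OF e]
  show ?thesis
  proof (cases "fst e = rt")
    case True
    then show ?thesis by (simp add: adhl_def parent_adhesion_def)
  next
    case False
    have "parent I (fst e) \<in> T" using parent_T te False by blast
    then obtain s where s: "s \<in> set ts" "fst s = parent I (fst e)" using ts(2) by (metis imageE)
    have "(\<exists>s\<in>set ts. fst s = fst (snd e) \<and> v \<in> set (snd (snd s))) \<longleftrightarrow> v \<in> bag I (parent I (fst e))" for v
    proof
      assume "\<exists>s\<in>set ts. fst s = fst (snd e) \<and> v \<in> set (snd (snd s))"
      then obtain x where x: "x \<in> set ts" "fst x = fst (snd e)" "v \<in> set (snd (snd x))" by blast
      then show "v \<in> bag I (parent I (fst e))" using ts_e[OF x(1)] te by simp
    next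
      assume "v \<in> bag I (parent I (fst e))"
      then show "\<exists>s\<in>set ts. fst s = fst (snd e) \<and> v \<in> set (snd (snd s))"
        using s ts_e[OF s(1)] te by (intro bexI[OF _ s(1)]) simp
    qed
    then show ?thesis using False te by (auto simp: adhl_def parent_adhesion_def)
  qed
qed

lemma bydepth: "set (bydepth ts rt) = set ts" "sorted_wrt (\<lambda>e e'. dep (fst e') \<le> dep (fst e)) (bydepth ts rt)"
proof -
  let ?F = "\<lambda>s. (fst s - 1, snd s @ filter (\<lambda>e. length (ancs ts rt (fst e)) = fst s) ts)"
  have len: "length ts = card T" using distinct_card[OF ts(1)] ts(2) by simp
  have "fst ((?F ^^ k) (length ts, [])) = length ts - k \<and> set (snd ((?F ^^ k) (length ts, []))) = {e\<in>set ts. length ts - k < Suc (dep (fst e))} \<and>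
    sorted_wrt (\<lambda>e e'. dep (fst e') \<le> dep (fst e)) (snd ((?F ^^ k) (length ts, [])))" if "k \<le> length ts" for k
    using that
  proof (induction k)
    case 0
    have "\<not> length ts < Suc (dep (fst e))" if "e \<in> set ts" for e
      using dep_bound[of "fst e"] ts_e[OF that] len by simp
    then show ?case by auto
  next
    case (Suc k)
    obtain c l where cl: "(?F ^^ k) (length ts, []) = (c, l)" by (cases "(?F ^^ k) (length ts, [])")
    have IH: "c = length ts - k" "set l = {e\<in>set ts. length ts - k < Suc (dep (fst e))}" "sorted_wrt (\<lambda>e e'. dep (fst e') \<le> dep (fst e)) l"
      using Suc.IH[unfolded cl fst_conv snd_conv] Suc.prems by simp_all
    let ?l = "filter (\<lambda>e. length (ancs ts rt (fst e)) = c) ts"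
    have "length (ancs ts rt (fst e)) = Suc (dep (fst e))" if "e \<in> set ts" for e using ancs(2) ts_e[OF that] by blast
    then have sl: "set ?l = {e\<in>set ts. Suc (dep (fst e)) = c}" by auto
    have F: "(?F ^^ Suc k) (length ts, []) = (c - 1, l @ ?l)" by (simp only: funpow.simps o_apply cl fst_conv snd_conv)
    have "sorted_wrt (\<lambda>e e'. dep (fst e') \<le> dep (fst e)) ?l" 
    proof (rule sorted_wrt_mono_rel[of _ "\<lambda>_ _. True"])
      fix x y assume "x \<in> set ?l" "y \<in> set ?l"
      then show "dep (fst y) \<le> dep (fst x)" unfolding sl by simp
    qed (simp add: sorted_wrt_true)
    moreover have "dep (fst e') \<le> dep (fst e)" if "e \<in> set l" "e' \<in> set ?l" for e e' using that unfolding sl unfolding IH(1,2) by auto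
    ultimately have "sorted_wrt (\<lambda>e e'. dep (fst e') \<le> dep (fst e)) (l @ ?l)" using IH(3) by (auto simp: sorted_wrt_append)
    moreover have "set (l @ ?l) = {e\<in>set ts. length ts - Suc k < Suc (dep (fst e))}"
      unfolding set_append sl unfolding IH(1,2) using Suc.prems by auto
    ultimately show ?case unfolding F using IH(1) by simp
  qed
  from this[of "length ts"] show "set (bydepth ts rt) = set ts" "sorted_wrt (\<lambda>e e'. dep (fst e') \<le> dep (fst e)) (bydepth ts rt)"
    unfolding bydepth_def fold_const by auto
qed

end

section \<open>Instances as data for the algorithm; sparse sets refute safety\<close>

section \<open>Correctness for instances\<close>

text \<open>All of \<open>linked_partition\<close> except the final inequality. Rounding an
  irrational flow changes only the inequality, so it is kept apart.\<close>

definition sinks :: "('a, 't) edp \<Rightarrow> nat \<Rightarrow> (nat \<Rightarrow> 'a set) \<Rightarrow> (nat \<Rightarrow> 'a \<Rightarrow> real) \<Rightarrow> bool" where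
  "sinks I q U \<pi> \<longleftrightarrow>
     (\<forall>i<q. U i \<noteq> {}) \<and> disjoint_family_on U {..<q} \<and> (\<Union>i<q. U i) = verts I \<and>
     (\<forall>i<q. \<forall>v\<in>U i. 0 \<le> \<pi> i v) \<and>
     (\<forall>i<q. \<forall>u v. {u, v} \<in> pairs_in I (U i) \<longrightarrow> \<pi> i u = \<pi> i v) \<and>
     (\<forall>i<q. \<exists>z\<in>U i. \<exists>g.
        feasible_flow (U i) (induced_edges (edges I) (U i)) (cap I) g \<and>
        (\<forall>p. g p \<noteq> 0 \<longrightarrow> hd p \<in> terminals_in I (U i) \<and> last p = z) \<and>
        (\<forall>v\<in>terminals_in I (U i). flow_sum g (\<lambda>p. hd p = v) = \<pi> i v)) \<and>
     (\<forall>i<q. flow_well_linked (U i) (induced_edges (edges I) (U i)) (cap I)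
               (terminals_in I (U i)) (\<pi> i))"

definition sink_partition :: "('a, 't) edp \<Rightarrow> nat \<Rightarrow> (nat \<Rightarrow> 'a set) \<Rightarrow> (nat \<Rightarrow> 'a \<Rightarrow> real) \<Rightarrow> real \<Rightarrow> bool" where
  "sink_partition I q U \<pi> x \<longleftrightarrow> sinks I q U \<pi> \<and> x \<le> (\<Sum>i<q. sum (\<pi> i) (terminals_in I (U i)))"

definition loss :: "('a, 't) edp \<Rightarrow> real" where
  "loss I = (1 - 1 / real (width_bound I)) ^ (max_adhesion I (\<lambda>t. \<not> safe I t) + max_adhesion I (\<lambda>t. \<not> good I t))"

lemma linked_partition_iff:
  "linked_partition I q U \<pi> \<longleftrightarrow> sink_partition I q U \<pi> (1 / (12 * real (width_bound I) ^ 3) * loss I * flow_value (verts I) (flow I))"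
  unfolding linked_partition_def sink_partition_def sinks_def loss_def by (simp only: mult.assoc conj_assoc)

lemma distinct_concat_nth:
  "distinct (concat xs) \<Longrightarrow> i < length xs \<Longrightarrow> j < length xs \<Longrightarrow> i \<noteq> j \<Longrightarrow> set (xs ! i) \<inter> set (xs ! j) = {}"
proof (induction xs arbitrary: i j)
  case (Cons x xs)
  have *: "set x \<inter> set (xs ! k) = {}" if "k < length xs" for k
  proof -
    have "set (xs ! k) \<subseteq> set (concat xs)" using nth_mem[OF that] by auto
    moreover have "set x \<inter> set (concat xs) = {}" using Cons.prems(1) by simp
    ultimately show ?thesis by blast
  qed
  show ?case
  proof (cases i)
    case 0
    then obtain k where "j = Suc k" using Cons.prems by (cases j) auto
    then show ?thesis using * 0 Cons.prems by simp
  next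
    case (Suc i')
    show ?thesis
    proof (cases j)
      case 0
      then show ?thesis using * Suc Cons.prems by (simp add: Int_commute)
    next
      case j: (Suc j')
      then show ?thesis using Cons.IH[of i' j'] Cons.prems Suc by simp
    qed
  qed
qed simp

locale edp_lists = tree_lists I vs ts for I :: "('a, 't) edp" and vs ts +
  fixes es :: "('a \<times> 'a \<times> nat) list" and fs :: "('a list \<times> nat) list" and d :: nat
  assumes es: "distinct (map (\<lambda>(a, b, k). {a, b}) es)" "(\<lambda>(a, b, k). {a, b}) ` set es = edges I"
      "(a, b, k) \<in> set es \<Longrightarrow> cap I {a, b} = k"
    and fs: "distinct (map fst fs)" "fst ` set fs = {p. flow I p \<noteq> 0}" "e \<in> set fs \<Longrightarrow> flow I (fst e) = real (snd e) / real d"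
    and d: "0 < d" and r: "2 \<le> width_bound I"
begin

abbreviation "r \<equiv> width_bound I"
abbreviation "ns \<equiv> conelist vs ts (root I)"
abbreviation "l1 \<equiv> max_adhesion I (\<lambda>t. \<not> safe I t)"
abbreviation "l2 \<equiv> max_adhesion I (\<lambda>t. \<not> good I t)"

lemma flow_facts: "feasible_flow V E (cap I) (flow I)" "flow I p \<noteq> 0 \<Longrightarrow> {hd p, last p} \<in> pairs I"
  using valid by (auto simp: valid_input_def fractional_solution_def)

lemma flow_sum_list: "flow_sum (flow I) Q = real (wsum (filter (\<lambda>e. Q (fst e)) fs)) / real d"
proof -
  let ?A = "filter (\<lambda>e. Q (fst e)) fs"
  have i: "inj_on fst (set ?A)" "distinct ?A" using fs(1) by (auto simp: distinct_map intro: inj_on_subset)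
  have "{p. flow I p \<noteq> 0 \<and> Q p} = fst ` set ?A"
  proof -
    have "{p. flow I p \<noteq> 0 \<and> Q p} = {p \<in> fst ` set fs. Q p}" unfolding fs(2) by blast
    then show ?thesis by auto
  qed
  then have "flow_sum (flow I) Q = (\<Sum>e\<in>set ?A. flow I (fst e))" unfolding flow_sum_def using i(1) by (simp add: sum.reindex)
  also have "\<dots> = (\<Sum>e\<in>set ?A. real (snd e) / real d)" by (intro sum.cong refl fs(3)) auto
  also have "\<dots> = (\<Sum>e\<in>set ?A. real (snd e)) / real d" by (simp add: sum_divide_distrib)
  also have "(\<Sum>e\<in>set ?A. real (snd e)) = real (wsum ?A)"
    unfolding wsum_def using i(2) by (simp add: sum_list_distinct_conv_sum_set)
  finally show ?thesis .
qed

lemma marginal_list: "marginal (flow I) v = real (endw fs v) / real d"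
  unfolding marginal_def flow_sum_list endw_def by (simp only: eq_commute[of v])

lemma node:
  assumes "i < length ns"
  shows "set (fst (ns ! i)) = C (fst (bydepth ts (root I) ! i))" "set (snd (ns ! i)) = B (fst (bydepth ts (root I) ! i))"
    "distinct (snd (ns ! i))" "distinct (fst (ns ! i))" "fst (bydepth ts (root I) ! i) \<in> T"
proof -
  let ?e = "bydepth ts (root I) ! i"
  have i: "i < length (bydepth ts (root I))" using assms by (simp add: conelist_def)
  then have e: "?e \<in> set ts" using bydepth(1) nth_mem by blast
  have n: "ns ! i = (conel vs ts (root I) (fst ?e), adhl ts (root I) ?e)" using i by (simp add: conelist_def)
  show "set (fst (ns ! i)) = C (fst ?e)" "set (snd (ns ! i)) = B (fst ?e)" "distinct (snd (ns ! i))" "fst ?e \<in> T"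
    unfolding n fst_conv snd_conv using conel[OF e] adhl[OF e] ts_e[OF e] by blast+
  show "distinct (fst (ns ! i))" unfolding n using vs(1) by (simp add: conel_def)
qed

lemma depth_mono: "i < j \<Longrightarrow> j < length ns \<Longrightarrow> dep (fst (bydepth ts (root I) ! j)) \<le> dep (fst (bydepth ts (root I) ! i))"
  using sorted_wrt_nth_less[OF bydepth(2)] by (simp add: conelist_def)

text \<open>A safe node would route 1/(4r) of every marginal in \<open>S\<close> to the adhesion,
  which lies outside \<open>S\<close>. All this flow crosses the boundary of \<open>S\<close>, whose
  capacity is too small for it.\<close>

lemma sparse_unsafe:
  assumes t: "t \<in> T" and S: "S \<subseteq> C t - B t" and less: "4 * r * d * cutcap es S (V - S) < (\<Sum>v\<in>S. endw fs v)"
  shows "\<not> safe I t"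
proof
  assume "safe I t"
  then obtain g where g: "feasible_flow (C t) (cone_edges I t) (cap I) g" "\<And>p. g p \<noteq> 0 \<Longrightarrow> last p \<in> B t"
    "\<And>z. z \<in> C t \<Longrightarrow> 1 / (4 * real r) * marginal (flow I) z \<le> flow_sum g (\<lambda>p. hd p = z)"
    unfolding safe_def by blast
  have fC: "finite (C t)" using cone_V graph(1) finite_subset by blast
  have fS: "finite S" using S fC finite_subset by blast
  define G where "G = {p. g p \<noteq> 0}"
  have fG: "finite G" unfolding G_def by (rule feasible_finite[OF fC g(1)])
  have g0: "0 \<le> g p" for p using g(1) by (simp add: feasible_flow_def)
  have des: "distinct es" using es(1) by (simp add: distinct_map)
  let ?x = "\<lambda>(a, b, k). (a \<in> S \<and> b \<in> V - S) \<or> (b \<in> S \<and> a \<in> V - S)"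
  let ?pe = "\<lambda>(a, b, k). {a, b}"
  have cross: "g p \<le> (\<Sum>x\<in>set es. if ?x x \<and> ?pe x \<in> path_edges p then g p else 0)" if p: "p \<in> G" "hd p \<in> S" for p
  proof -
    have path: "is_path (C t) (cone_edges I t) p" using g(1) p(1) by (simp add: feasible_flow_def G_def)
    have ne: "p \<noteq> []" using path by (simp add: is_path_def)
    have "last p \<in> B t" using g(2) p(1) by (simp add: G_def)
    then have "last p \<notin> S" using S by blast
    then have "\<not> set p \<subseteq> S" using last_in_set[OF ne] by blast
    moreover have "set p \<inter> S \<noteq> {}" using hd_in_set[OF ne] p(2) by blast
    ultimately obtain a b where ab: "(a, b) \<in> arcs p" "(a \<in> S) \<noteq> (b \<in> S)" using arcs_cross[OF ne] by blast
    have pe: "{a, b} \<in> path_edges p" using ab(1) by (auto simp: path_edges_arcs)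
    then have "{a, b} \<in> E" using path by (auto simp: is_path_def cone_edges_def induced_edges_def)
    then have "{a, b} \<in> ?pe ` set es" using es(2) by simp
    then obtain x where x: "{a, b} = ?pe x" "x \<in> set es" by (rule imageE)
    have "a \<in> V" "b \<in> V" using arcs_in_set[OF ab(1)] path cone_V by (auto simp: is_path_def)
    then have "?x x" using x(1) ab(2) by (cases x) (auto simp: doubleton_eq_iff)
    then have "(if ?x x \<and> ?pe x \<in> path_edges p then g p else 0) = g p" using x(1) pe by simp
    moreover have "(if ?x x \<and> ?pe x \<in> path_edges p then g p else 0) \<le> (\<Sum>x\<in>set es. if ?x x \<and> ?pe x \<in> path_edges p then g p else 0)"
      using x(2) g0 by (intro member_le_sum) auto
    ultimately show ?thesis by simp
  qed
  have "(\<Sum>z\<in>S. flow_sum g (\<lambda>p. hd p = z)) = (\<Sum>z\<in>S. \<Sum>p\<in>G. if hd p = z then g p else 0)"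
    using flow_sum_finite[of g] fG by (simp add: G_def)
  also have "\<dots> = (\<Sum>p\<in>G. \<Sum>z\<in>S. if hd p = z then g p else 0)" by (rule sum.swap)
  also have "\<dots> = (\<Sum>p\<in>G. if hd p \<in> S then g p else 0)" using fS by (intro sum.cong refl) simp
  also have "\<dots> \<le> (\<Sum>p\<in>G. \<Sum>x\<in>set es. if ?x x \<and> ?pe x \<in> path_edges p then g p else 0)"
    using cross g0 by (intro sum_mono) (auto intro!: sum_nonneg)
  also have "\<dots> = (\<Sum>x\<in>set es. \<Sum>p\<in>G. if ?x x \<and> ?pe x \<in> path_edges p then g p else 0)" by (rule sum.swap)
  also have "\<dots> \<le> (\<Sum>x\<in>set es. real (if ?x x then snd (snd x) else 0))"
  proof (rule sum_mono)
    fix x assume x: "x \<in> set es"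
    obtain a b k where abk: "x = (a, b, k)" by (cases x)
    have fl: "(\<Sum>p\<in>G. if {a, b} \<in> path_edges p then g p else 0) \<le> real k"
    proof (cases "{a, b} \<in> cone_edges I t")
      case True
      then have "flow_sum g (\<lambda>p. {a, b} \<in> path_edges p) \<le> real (cap I {a, b})" using g(1) by (simp add: feasible_flow_def)
      then show ?thesis using es(3) x abk flow_sum_finite[of g] fG by (simp add: G_def)
    next
      case False
      \<comment> \<open>Edges that do not belong to the graph of the node carry none of the flow
        \<open>g\<close>.\<close>
      have "{a, b} \<notin> path_edges p" if "p \<in> G" for p using that g(1) False by (auto simp: feasible_flow_def G_def is_path_def)
      then have "(\<Sum>p\<in>G. if {a, b} \<in> path_edges p then g p else 0) = 0" by (intro sum.neutral) auto
      then show ?thesis by simp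
    qed
    show "(\<Sum>p\<in>G. if ?x x \<and> ?pe x \<in> path_edges p then g p else 0) \<le> real (if ?x x then snd (snd x) else 0)"
    proof (cases "?x x")
      case True
      then show ?thesis using fl unfolding abk by simp
    next
      case False
      then show ?thesis unfolding abk by (simp only: if_False False simp_thms) simp
    qed
  qed
  also have "\<dots> = real (cutcap es S (V - S))"
  proof -
    have "cutcap es S (V - S) = (\<Sum>x\<in>set es. if ?x x then snd (snd x) else 0)"
      unfolding cutcap_def sum_list_distinct_conv_sum_set[OF des] by (simp only: split_def)
    then show ?thesis by (simp only: of_nat_sum)
  qed
  finally have up: "(\<Sum>z\<in>S. flow_sum g (\<lambda>p. hd p = z)) \<le> real (cutcap es S (V - S))" .
  have "(\<Sum>z\<in>S. 1 / (4 * real r) * marginal (flow I) z) \<le> (\<Sum>z\<in>S. flow_sum g (\<lambda>p. hd p = z))"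
    using S g(3) by (intro sum_mono) blast
  then have "(\<Sum>z\<in>S. real (endw fs z) / (4 * real r * real d)) \<le> real (cutcap es S (V - S))" using up by (simp add: marginal_list)
  then have "(\<Sum>z\<in>S. real (endw fs z)) / (4 * real r * real d) \<le> real (cutcap es S (V - S))" by (simp add: sum_divide_distrib)
  then have "(\<Sum>z\<in>S. real (endw fs z)) \<le> 4 * real r * real d * real (cutcap es S (V - S))" using r d by (simp add: field_simps)
  then have "real (\<Sum>z\<in>S. endw fs z) \<le> real (4 * r * d * cutcap es S (V - S))" by simp
  then have "(\<Sum>z\<in>S. endw fs z) \<le> 4 * r * d * cutcap es S (V - S)" by (simp only: of_nat_le_iff)
  then show False using less by simp
qed

text \<open>The nodes are sorted by decreasing depth, so comparisons of depth in the tree become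
  comparisons of list positions.\<close>

lemma core: "edpcore vs es fs ns r d (pairs I) l1 l2"
proof
  show "distinct vs" by (rule vs(1))
  show "distinct (map (\<lambda>(a, b, k). {a, b}) es)" by (rule es(1))
  show "distinct (map fst fs)" by (rule fs(1))
  show "0 < d" "2 \<le> r" by (rule d, rule r)
  show "simple_graph (set vs) (pairs I)" "disjoint (pairs I)" using graph(3,4) vs(2) by auto
  show "a \<noteq> b \<and> a \<in> set vs \<and> b \<in> set vs" if "(a, b, k) \<in> set es" for a b k
  proof -
    have "{a, b} \<in> E" unfolding es(2)[symmetric] using that by force
    from graph(2)[OF this] show ?thesis unfolding vs(2) by (auto simp: doubleton_eq_iff)
  qed
  show "0 < snd e \<and> is_path (set vs) ((\<lambda>(a, b, k). {a, b}) ` set es) (fst e) \<and> ends (fst e) \<in> pairs I" if e: "e \<in> set fs" for e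
  proof -
    have nz: "flow I (fst e) \<noteq> 0" using fs(2) e by blast
    then have "0 < snd e" using fs(3)[OF e] by (cases "snd e") auto
    then show ?thesis using nz flow_facts unfolding es(2) vs(2) by (simp add: feasible_flow_def)
  qed
  show "wsum (filter (\<lambda>e. {a, b} \<in> path_edges (fst e)) fs) \<le> d * k" if abk: "(a, b, k) \<in> set es" for a b k
  proof -
    have "{a, b} \<in> E" unfolding es(2)[symmetric] using abk by force
    then have "flow_sum (flow I) (\<lambda>p. {a, b} \<in> path_edges p) \<le> real k" using flow_facts(1) es(3)[OF abk] by (auto simp: feasible_flow_def)
    then have "real (wsum (filter (\<lambda>e. {a, b} \<in> path_edges (fst e)) fs)) \<le> real (d * k)" unfolding flow_sum_list using d by (simp add: field_simps)
    then show ?thesis by (simp only: of_nat_le_iff)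
  qed
  show "distinct (fst n) \<and> distinct (snd n) \<and> set (snd n) \<subseteq> set (fst n) \<and> set (fst n) \<subseteq> set vs \<and> length (snd n) \<le> r" if n: "n \<in> set ns" for n
  proof -
    obtain i where i: "i < length ns" "n = ns ! i" using n by (metis in_set_conv_nth)
    define e where "e = bydepth ts (root I) ! i"
    have e: "set (fst n) = C (fst e)" "set (snd n) = B (fst e)" "distinct (snd n)" "distinct (fst n)" "fst e \<in> T" using node[OF i(1)] unfolding i(2) e_def by auto
    have "length (snd n) = card (B (fst e))" using e(2,3) by (metis distinct_card)
    also have "\<dots> \<le> card (bag I (fst e))" using B_sub[OF e(5)] bags(1)[OF e(5)] graph(1) by (meson card_mono finite_subset)
    also have "\<dots> \<le> r" by (rule bags(4)[OF e(5)])
    finally show ?thesis using e B_sub[OF e(5)] bag_cone[OF e(5)] cone_V vs(2) by blast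
  qed
  show "b \<in> set (fst n)" if n: "n \<in> set ns" "(a, b, k) \<in> set es \<or> (b, a, k) \<in> set es" "a \<in> set (fst n) - set (snd n)" for n a b k
  proof -
    obtain i where i: "i < length ns" "n = ns ! i" using n(1) by (metis in_set_conv_nth)
    define e where "e = bydepth ts (root I) ! i"
    have e: "set (fst n) = C (fst e)" "set (snd n) = B (fst e)" using node[OF i(1)] unfolding i(2) e_def by auto
    have "{a, b} \<in> E \<or> {b, a} \<in> E" unfolding es(2)[symmetric] using n(2) by force
    then have "{a, b} \<in> E" by (simp only: insert_commute[of b a] disj_absorb)
    then show ?thesis using cone_edge n(3) unfolding e by blast
  qed
  show "set (fst (ns ! i)) - set (snd (ns ! i)) \<subseteq> set (fst (ns ! j)) - set (snd (ns ! j))"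
    if ij: "i < j" "j < length ns" "(set (fst (ns ! i)) - set (snd (ns ! i))) \<inter> (set (fst (ns ! j)) - set (snd (ns ! j))) \<noteq> {}" for i j
  proof -
    have il: "i < length ns" using ij by simp
    define e where "e = bydepth ts (root I) ! i"
    have e: "e = bydepth ts (root I) ! i" "set (fst (ns ! i)) = C (fst e)" "set (snd (ns ! i)) = B (fst e)" "fst e \<in> T" using node[OF il] unfolding e_def by auto
    define e' where "e' = bydepth ts (root I) ! j"
    have e': "e' = bydepth ts (root I) ! j" "set (fst (ns ! j)) = C (fst e')" "set (snd (ns ! j)) = B (fst e')" "fst e' \<in> T" using node[OF ij(2)] unfolding e'_def by auto
    obtain x where "x \<in> (C (fst e) - B (fst e)) \<inter> (C (fst e') - B (fst e'))" using ij(3) unfolding e e' by blast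
    from laminar[OF e(4) e'(4) this] show ?thesis using depth_mono[OF ij(1,2)] unfolding e(2,3) e'(2,3) unfolding e(1) e'(1) by blast
  qed
  show "j < i \<and> set (fst (ns ! j)) - set (snd (ns ! j)) \<subseteq> set (fst (ns ! i)) - set (snd (ns ! i))"
    if ij: "i < length ns" "j < length ns" "set (snd (ns ! j)) \<inter> (set (fst (ns ! i)) - set (snd (ns ! i))) \<noteq> {}" for i j
  proof -
    define e where "e = bydepth ts (root I) ! i"
    have e: "e = bydepth ts (root I) ! i" "set (fst (ns ! i)) = C (fst e)" "set (snd (ns ! i)) = B (fst e)" "fst e \<in> T" using node[OF ij(1)] unfolding e_def by auto
    define e' where "e' = bydepth ts (root I) ! j"
    have e': "e' = bydepth ts (root I) ! j" "set (fst (ns ! j)) = C (fst e')" "set (snd (ns ! j)) = B (fst e')" "fst e' \<in> T" using node[OF ij(2)] unfolding e'_def by auto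
    obtain x where "x \<in> B (fst e') \<inter> (C (fst e) - B (fst e))" using ij(3) unfolding e e' by blast
    from adhesion_inside[OF e'(4) e(4) this] have ad: "dep (fst e) < dep (fst e')" "C (fst e') - B (fst e') \<subseteq> C (fst e) - B (fst e)" by auto
    have "j < i"
    proof (rule ccontr)
      assume "\<not> j < i"
      then have "i = j \<or> i < j" by auto
      then have "dep (fst e') \<le> dep (fst e)" using depth_mono[of i j] ij(2) unfolding e(1) e'(1) by auto
      then show False using ad by simp
    qed
    then show ?thesis using ad(2) unfolding e(2,3) e'(2,3) by blast
  qed
  show "\<exists>W. finite W \<and> card W \<le> r \<and>
      (\<forall>e\<in>set fs. set (fst e) \<subseteq> set (fst (ns ! i)) \<longrightarrow> set (fst e) \<inter> W = {} \<longrightarrow>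
        (\<exists>j<i. set (fst e) \<subseteq> set (fst (ns ! j)) - set (snd (ns ! j))))" if i: "i < length ns" for i
  proof -
    define e where "e = bydepth ts (root I) ! i"
    have e: "e = bydepth ts (root I) ! i" "set (fst (ns ! i)) = C (fst e)" "fst e \<in> T" using node[OF i] unfolding e_def by auto
    have fin: "finite (bag I (fst e))" using bags(1)[OF e(3)] graph(1) finite_subset by blast
    have "\<exists>j<i. set (fst x) \<subseteq> set (fst (ns ! j)) - set (snd (ns ! j))"
      if x: "x \<in> set fs" "set (fst x) \<subseteq> set (fst (ns ! i))" "set (fst x) \<inter> bag I (fst e) = {}" for x
    proof -
      have nz: "flow I (fst x) \<noteq> 0" using fs(2) x(1) by blast
      then have path: "is_path V E (fst x)" using flow_facts(1) by (simp add: feasible_flow_def)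
      obtain c where c: "c \<in> T" "dep (fst e) < dep c" "set (fst x) \<subseteq> C c - B c"
        using avoid_bag[OF e(3) path] x(2,3) unfolding e(2) by blast
      obtain e' where e': "e' \<in> set ts" "c = fst e'" using c(1) ts(2) by (metis imageE)
      then obtain j where j: "j < length (bydepth ts (root I))" "e' = bydepth ts (root I) ! j" using bydepth(1) by (metis in_set_conv_nth)
      have jl: "j < length ns" using j(1) by (simp add: conelist_def)
      have ji: "j < i"
      proof (rule ccontr)
        assume "\<not> j < i"
        then have "i = j \<or> i < j" by auto
        then have "dep (fst e') \<le> dep (fst e)" using depth_mono[of i j] jl unfolding e(1) j(2) by auto
        then show False using c(2) e'(2) by simp
      qed
      have "set (fst (ns ! j)) = C c" "set (snd (ns ! j)) = B c" using node(1,2)[OF jl] j(2) e'(2) by auto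
      then show ?thesis using ji c(3) by metis
    qed
    then show ?thesis using fin bags(4)[OF e(3)] by (intro exI[of _ "bag I (fst e)"]) blast
  qed
  show "\<exists>n\<in>set ns. set (fst n) = set vs \<and> snd n = []"
  proof -
    obtain e where e: "e \<in> set ts" "fst e = root I" using tree(2) ts(2) by (metis imageE)
    have "e \<in> set (bydepth ts (root I))" using e(1) bydepth(1) by simp
    then have "(conel vs ts (root I) (fst e), adhl ts (root I) e) \<in> set ns"
      unfolding conelist_def set_map by (rule rev_image_eqI) (rule refl)
    moreover have "set (conel vs ts (root I) (fst e)) = set vs" using conel[OF e(1)] e(2) cone_root vs(2) by simp
    moreover have "adhl ts (root I) e = []" using e(2) by (simp add: adhl_def)
    ultimately show ?thesis by force
  qed
  show "length (snd n) \<le> l1" if n: "n \<in> set ns" "S \<subseteq> set (fst n) - set (snd n)" "4 * r * d * cutcap es S (set vs - S) < (\<Sum>v\<in>S. endw fs v)" for n S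
  proof -
    obtain i where i: "i < length ns" "n = ns ! i" using n(1) by (metis in_set_conv_nth)
    define e where "e = bydepth ts (root I) ! i"
    have e: "set (fst n) = C (fst e)" "set (snd n) = B (fst e)" "distinct (snd n)" "fst e \<in> T" using node[OF i(1)] unfolding i(2) e_def by auto
    have "\<not> safe I (fst e)" by (rule sparse_unsafe[OF e(4)]) (use n(2,3) vs(2) e in auto)
    then have "card (B (fst e)) \<le> l1" by (rule max_adhesion_ge[OF e(4)])
    then show ?thesis using e(2,3) by (metis distinct_card)
  qed
  show "length (snd n) \<le> l2" if n: "n \<in> set ns" "x \<in> set fs" "set (fst x) \<subseteq> set (fst n) - set (snd n)" for n x
  proof -
    obtain i where i: "i < length ns" "n = ns ! i" using n(1) by (metis in_set_conv_nth)
    define e where "e = bydepth ts (root I) ! i"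
    have e: "set (fst n) = C (fst e)" "set (snd n) = B (fst e)" "distinct (snd n)" "fst e \<in> T" using node[OF i(1)] unfolding i(2) e_def by auto
    have nz: "flow I (fst x) \<noteq> 0" using fs(2) n(2) by blast
    then have "fst x \<noteq> []" using flow_facts(1) by (simp add: feasible_flow_def is_path_def)
    then have "hd (fst x) \<in> C (fst e)" "set (fst x) \<inter> B (fst e) = {}" using n(3) hd_in_set[of "fst x"] unfolding e by blast+
    then have "\<not> good I (fst e)" unfolding good_def using nz by blast
    then have "card (B (fst e)) \<le> l2" by (rule max_adhesion_ge[OF e(4)])
    then show ?thesis using e(2,3) by (metis distinct_card)
  qed
qed

lemma flow_value_list: "flow_value V (flow I) = real (wsum fs) / real d"
proof -
  interpret c: edpcore vs es fs ns r d "pairs I" l1 l2 by (rule core)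
  have "(\<Sum>v\<in>set vs. endw fs v) = 2 * wsum fs"
  proof (rule sum_endw)
    fix e assume "e \<in> set fs"
    note p = c.path_facts(3,5,8,9)[OF this]
    show "hd (fst e) \<noteq> last (fst e)" "ends (fst e) \<subseteq> set vs" using p by auto
  qed simp
  then have "(\<Sum>v\<in>V. real (endw fs v)) = 2 * real (wsum fs)" unfolding vs(2) by (simp flip: of_nat_sum)
  then show ?thesis unfolding flow_value_def marginal_list by (simp add: sum_divide_distrib[symmetric])
qed

lemma solve_sink_partition:
  "\<exists>L. solve vs es fs ns r d = map (\<lambda>(U, h, dd). map (\<lambda>v. (v, h v, dd)) U) L \<and> (\<forall>(U, h, dd)\<in>set L. distinct U \<and> 0 < dd) \<and>
     sink_partition I (length L) (\<lambda>i. set (fst (L ! i))) (\<lambda>i v. real (fst (snd (L ! i)) v) / real (snd (snd (L ! i))))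
       (1 / (9 * real r ^ 3) * loss I * flow_value V (flow I))"
proof -
  interpret c: edpcore vs es fs ns r d "pairs I" l1 l2 by (rule core)
  obtain L where L: "solve vs es fs ns r d = map (\<lambda>(U, h, dd). map (\<lambda>v. (v, h v, dd)) U) L" "c.result L"
    using c.solve_result by blast
  have res: "distinct (concat (map fst L))" "set (concat (map fst L)) = V" "\<forall>(U, h, dd)\<in>set L. c.piece U h dd"
    "c.rho ^ (l1 + l2) * wsum fs / (9 * real r ^ 3 * d) \<le> (\<Sum>(U, h, dd)\<leftarrow>L. \<Sum>v\<in>set U. real (h v) / real dd)"
    using L(2) vs(2) unfolding c.result_def by auto
  let ?q = "length L" let ?U = "\<lambda>i. set (fst (L ! i))" let ?p = "\<lambda>i v. real (fst (snd (L ! i)) v) / real (snd (snd (L ! i)))"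
  have pc: "c.piece (fst (L ! i)) (fst (snd (L ! i))) (snd (snd (L ! i)))" if i: "i < ?q" for i
    using res(3) nth_mem[OF i] by (cases "L ! i") auto
  have UV: "?U i \<subseteq> V" if i: "i < ?q" for i using res(2) nth_mem[OF i] by auto
  have tm: "v \<in> terminals_in I U \<longleftrightarrow> (\<exists>m\<in>pairs I. m \<subseteq> U \<and> v \<in> m)" for v U by (auto simp: terminals_in_def pairs_in_def)
  have one: "\<exists>z\<in>?U i. \<exists>g. feasible_flow (?U i) (induced_edges E (?U i)) (cap I) g \<and>
        (\<forall>p. g p \<noteq> 0 \<longrightarrow> hd p \<in> terminals_in I (?U i) \<and> last p = z) \<and>
        (\<forall>v\<in>terminals_in I (?U i). flow_sum g (\<lambda>p. hd p = v) = ?p i v)" if i: "i < ?q" for i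
  proof -
    from pc[OF i] obtain z g where zg: "z \<in> ?U i" "feasible_flow (?U i) (induced_edges E (?U i)) c.ecap g"
      "\<forall>p. g p \<noteq> 0 \<longrightarrow> last p = z \<and> (\<exists>m\<in>pairs I. m \<subseteq> ?U i \<and> hd p \<in> m)"
      "\<forall>v\<in>?U i. flow_sum g (\<lambda>p. hd p = v) = ?p i v" unfolding c.piece_def es(2) by blast
    have "c.ecap e = cap I e" if eE: "e \<in> E" for e
    proof -
      have "e \<in> (\<lambda>(a, b, k). {a, b}) ` set es" using es(2) eE by simp
      then obtain x where x: "e = (\<lambda>(a, b, k). {a, b}) x" "x \<in> set es" by (rule imageE)
      obtain a b k where abk: "x = (a, b, k)" by (cases x)
      have "(a, b, k) \<in> set es" "e = {a, b}" using x unfolding abk by auto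
      then show ?thesis using c.ecap[of a b k] es(3)[of a b k] by simp
    qed
    then have "feasible_flow (?U i) (induced_edges E (?U i)) (cap I) g" using zg(2) by (simp add: feasible_flow_def induced_edges_def)
    moreover have "\<forall>p. g p \<noteq> 0 \<longrightarrow> hd p \<in> terminals_in I (?U i) \<and> last p = z" using zg(3) tm by blast
    moreover have "\<forall>v\<in>terminals_in I (?U i). flow_sum g (\<lambda>p. hd p = v) = ?p i v" using zg(4) tm by blast
    ultimately show ?thesis using zg(1) by blast
  qed
  have lp: "sinks I ?q ?U ?p"
    unfolding sinks_def
  proof (intro conjI allI impI)
    fix i assume i: "i < ?q"
    show "?U i \<noteq> {}" using pc[OF i] by (simp add: c.piece_def)
    show "?p i u = ?p i v" if "{u, v} \<in> pairs_in I (?U i)" for u v using pc[OF i] that by (simp add: c.piece_def pairs_in_def)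
    show "\<forall>v\<in>?U i. 0 \<le> ?p i v" by simp
    show "\<exists>z\<in>?U i. \<exists>g. feasible_flow (?U i) (induced_edges E (?U i)) (cap I) g \<and>
        (\<forall>p. g p \<noteq> 0 \<longrightarrow> hd p \<in> terminals_in I (?U i) \<and> last p = z) \<and>
        (\<forall>v\<in>terminals_in I (?U i). flow_sum g (\<lambda>p. hd p = v) = ?p i v)" by (rule one[OF i])
    from one[OF i] obtain z g where zg: "feasible_flow (?U i) (induced_edges E (?U i)) (cap I) g"
      "\<And>p. g p \<noteq> 0 \<Longrightarrow> hd p \<in> terminals_in I (?U i) \<and> last p = z"
      "\<And>v. v \<in> terminals_in I (?U i) \<Longrightarrow> flow_sum g (\<lambda>p. hd p = v) = ?p i v" by blast
    show "flow_well_linked (?U i) (induced_edges E (?U i)) (cap I) (terminals_in I (?U i)) (?p i)"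
      by (rule well_linked_of_sink_flow[OF _ _ zg]) (use tm in auto)
  next
    show "disjoint_family_on ?U {..<?q}"
      unfolding disjoint_family_on_def using distinct_concat_nth[OF res(1)] by simp
    show "(\<Union>i<?q. ?U i) = V"
    proof -
      have "set L = (\<lambda>i. L ! i) ` {..<?q}" by (simp add: set_conv_nth lessThan_def setcompr_eq_image)
      then have "(\<Union>i<?q. ?U i) = (\<Union>x\<in>set L. set (fst x))" by simp
      then show ?thesis using res(2) by simp
    qed
  qed
  \<comment> \<open>\<open>piece\<close> makes the weights vanish off the terminals, so enlarging
    the range of summation to whole parts is harmless.\<close>
  have sums: "(\<Sum>(U, h, dd)\<leftarrow>L. \<Sum>v\<in>set U. real (h v) / real dd) = (\<Sum>i<?q. sum (?p i) (terminals_in I (?U i)))"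
  proof -
    have "(\<Sum>(U, h, dd)\<leftarrow>L. \<Sum>v\<in>set U. real (h v) / real dd) = (\<Sum>i<?q. sum (?p i) (?U i))"
      by (simp add: sum_list_sum_nth split_def atLeast0LessThan)
    also have "\<dots> = (\<Sum>i<?q. sum (?p i) (terminals_in I (?U i)))"
    proof (rule sum.cong[OF refl], rule sum.mono_neutral_right)
      fix i assume "i \<in> {..<?q}"
      then have i: "i < ?q" by simp
      show "terminals_in I (?U i) \<subseteq> ?U i" using tm by blast
      show "\<forall>v\<in>?U i - terminals_in I (?U i). ?p i v = 0"
      proof
        fix v assume v: "v \<in> ?U i - terminals_in I (?U i)"
        have "\<forall>v\<in>?U i. fst (snd (L ! i)) v \<noteq> 0 \<longrightarrow> (\<exists>m\<in>pairs I. m \<subseteq> ?U i \<and> v \<in> m)"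
          using pc[OF i] unfolding c.piece_def by blast
        moreover have "\<not> (\<exists>m\<in>pairs I. m \<subseteq> ?U i \<and> v \<in> m)" using v tm[of v "?U i"] by blast
        ultimately have "fst (snd (L ! i)) v = 0" using v by blast
        then show "?p i v = 0" by simp
      qed
    qed simp
    finally show ?thesis .
  qed
  have "1 / (9 * real r ^ 3) * loss I * flow_value V (flow I) = c.rho ^ (l1 + l2) * wsum fs / (9 * real r ^ 3 * d)"
    unfolding flow_value_list loss_def c.rho_def by simp
  then have "sink_partition I ?q ?U ?p (1 / (9 * real r ^ 3) * loss I * flow_value V (flow I))"
    unfolding sink_partition_def using lp res(4) sums by simp
  moreover have "\<forall>(U, h, dd)\<in>set L. distinct U \<and> 0 < dd"
  proof
    fix x assume x: "x \<in> set L"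
    have "distinct (fst x)" using res(1) x by (auto simp: distinct_concat_iff)
    moreover have "0 < snd (snd x)" using res(3) x by (cases x) (auto simp: c.piece_def)
    ultimately show "case x of (U, h, dd) \<Rightarrow> distinct U \<and> 0 < dd" by (cases x) auto
  qed
  ultimately show ?thesis using L(1) by blast
qed

end

section \<open>Size bounds and polynomial time for the functions of the algorithm\<close>

section \<open>Running time\<close>

text \<open>Programs have a single argument, so a curried function is treated as a function of a
  tuple; these rules substitute polynomial-time terms for its components.\<close>

lemma pt2: "ptime (\<lambda>z. f (fst z) (snd z)) \<Longrightarrow> ptime a \<Longrightarrow> ptime b \<Longrightarrow> ptime (\<lambda>x. f (a x) (b x))"
  using pt_comp[OF _ pt_pair, of "\<lambda>z. f (fst z) (snd z)" a b] by simp

lemma pt3: "ptime (\<lambda>z. f (fst z) (fst (snd z)) (snd (snd z))) \<Longrightarrow> ptime a \<Longrightarrow> ptime b \<Longrightarrow> ptime c \<Longrightarrow> ptime (\<lambda>x. f (a x) (b x) (c x))"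
  using pt_comp[OF _ pt_pair[OF _ pt_pair], of "\<lambda>z. f (fst z) (fst (snd z)) (snd (snd z))" a b c] by simp

lemma pt4: "ptime (\<lambda>z. f (fst z) (fst (snd z)) (fst (snd (snd z))) (snd (snd (snd z)))) \<Longrightarrow> ptime a \<Longrightarrow> ptime b \<Longrightarrow> ptime c \<Longrightarrow> ptime d
    \<Longrightarrow> ptime (\<lambda>x. f (a x) (b x) (c x) (d x))"
  using pt_comp[OF _ pt_pair[OF _ pt_pair[OF _ pt_pair]], of "\<lambda>z. f (fst z) (fst (snd z)) (fst (snd (snd z))) (snd (snd (snd z)))" a b c d] by simp

lemma pt5: "ptime (\<lambda>z. f (fst z) (fst (snd z)) (fst (snd (snd z))) (fst (snd (snd (snd z)))) (snd (snd (snd (snd z)))))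
    \<Longrightarrow> ptime a \<Longrightarrow> ptime b \<Longrightarrow> ptime c \<Longrightarrow> ptime d \<Longrightarrow> ptime e \<Longrightarrow> ptime (\<lambda>x. f (a x) (b x) (c x) (d x) (e x))"
  using pt_comp[OF _ pt_pair[OF _ pt_pair[OF _ pt_pair[OF _ pt_pair]]],
    of "\<lambda>z. f (fst z) (fst (snd z)) (fst (snd (snd z))) (fst (snd (snd (snd z)))) (snd (snd (snd (snd z))))" a b c d e] by simp

lemma pt6: "ptime (\<lambda>z. f (fst z) (fst (snd z)) (fst (snd (snd z))) (fst (snd (snd (snd z)))) (fst (snd (snd (snd (snd z))))) (snd (snd (snd (snd (snd z))))))
    \<Longrightarrow> ptime a \<Longrightarrow> ptime b \<Longrightarrow> ptime c \<Longrightarrow> ptime d \<Longrightarrow> ptime e \<Longrightarrow> ptime g \<Longrightarrow> ptime (\<lambda>x. f (a x) (b x) (c x) (d x) (e x) (g x))"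
  using pt_comp[OF _ pt_pair[OF _ pt_pair[OF _ pt_pair[OF _ pt_pair[OF _ pt_pair]]]],
    of "\<lambda>z. f (fst z) (fst (snd z)) (fst (snd (snd z))) (fst (snd (snd (snd z)))) (fst (snd (snd (snd (snd z))))) (snd (snd (snd (snd (snd z)))))" a b c d e g] by simp

lemma pt7: "ptime (\<lambda>z. f (fst z) (fst (snd z)) (fst (snd (snd z))) (fst (snd (snd (snd z)))) (fst (snd (snd (snd (snd z))))) (fst (snd (snd (snd (snd (snd z)))))) (snd (snd (snd (snd (snd (snd z)))))))
    \<Longrightarrow> ptime a \<Longrightarrow> ptime b \<Longrightarrow> ptime c \<Longrightarrow> ptime d \<Longrightarrow> ptime e \<Longrightarrow> ptime g \<Longrightarrow> ptime h \<Longrightarrow> ptime (\<lambda>x. f (a x) (b x) (c x) (d x) (e x) (g x) (h x))"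
  using pt_comp[OF _ pt_pair[OF _ pt_pair[OF _ pt_pair[OF _ pt_pair[OF _ pt_pair[OF _ pt_pair]]]]],
    of "\<lambda>z. f (fst z) (fst (snd z)) (fst (snd (snd z))) (fst (snd (snd (snd z)))) (fst (snd (snd (snd (snd z))))) (fst (snd (snd (snd (snd (snd z)))))) (snd (snd (snd (snd (snd (snd z))))))" a b c d e g h] by simp

lemma pt_null: "ptime xs \<Longrightarrow> ptime (\<lambda>x. xs x = [])"
proof -
  assume "ptime xs"
  then have "ptime (\<lambda>x. case xs x of [] \<Rightarrow> True | y # ys \<Rightarrow> False)" by (intro pt_case_list pt_const)
  moreover have "(case l of [] \<Rightarrow> True | y # ys \<Rightarrow> False) = (l = [])" for l :: "'b list" by (cases l) auto
  ultimately show ?thesis by simp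
qed

lemma pt_hd: "ptime xs \<Longrightarrow> ptime (\<lambda>x. hd (xs x))"
proof -
  assume "ptime xs"
  then have "ptime (\<lambda>x. case xs x of [] \<Rightarrow> hd [] | y # ys \<Rightarrow> y)" by (intro pt_case_list pt_const pt_fst pt_snd pt_id)
  moreover have "(case l of [] \<Rightarrow> hd [] | y # ys \<Rightarrow> y) = hd l" for l :: "'b list" by (cases l) auto
  ultimately show ?thesis by simp
qed

lemma pt_last: "ptime xs \<Longrightarrow> ptime (\<lambda>x. last (xs x))"
proof -
  assume "ptime xs"
  then have "ptime (\<lambda>x. case rev (xs x) of [] \<Rightarrow> last [] | y # ys \<Rightarrow> y)" by (intro pt_case_list pt_const pt_fst pt_snd pt_id pt_rev)
  moreover have "(case rev l of [] \<Rightarrow> last [] | y # ys \<Rightarrow> y) = last l" for l :: "'b list" by (cases l rule: rev_cases) auto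
  ultimately show ?thesis by simp
qed

lemmas pti = pt_null pt_hd pt_last pt_intros pt_case_list

lemma sz_pair [simp]: "sz (a, b) = 1 + sz a + sz b" by simp
lemma sz_fst: "sz (fst p) \<le> sz p" by (cases p) simp
lemma sz_snd: "sz (snd p) \<le> sz p" by (cases p) simp
lemma floorlog_2_0 [simp]: "floorlog 2 0 = 0" by (simp add: floorlog_def)
lemma sz_Nil: "sz [] = 1" by simp

lemma sz_filter: "sz (filter P xs) \<le> sz xs" by (induction xs) auto

lemma sz_map_filter: "sz (map (filter P) xs) \<le> sz xs"
proof (induction xs)
  case (Cons x xs)
  then show ?case using sz_filter[of P x] by simp
qed simp

lemma sz_fold_add:
  assumes "\<And>v st. v \<in> set xs \<Longrightarrow> sz (f v st) \<le> sz st + c"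
  shows "sz (fold f xs st) \<le> sz st + length xs * c"
  using assms
proof (induction xs arbitrary: st)
  case (Cons x xs)
  have "sz (fold f xs (f x st)) \<le> sz (f x st) + length xs * c" using Cons by simp
  also have "sz (f x st) \<le> sz st + c" using Cons.prems by simp
  finally show ?case by simp
qed simp

lemma sz_fold_add':
  assumes "\<And>v st. v \<in> set xs \<Longrightarrow> sz (f v st) \<le> sz st + c" "length xs \<le> k"
  shows "sz (fold f xs st) \<le> sz st + k * c"
proof -
  have "sz (fold f xs st) \<le> sz st + length xs * c" by (rule sz_fold_add) (rule assms(1))
  also have "\<dots> \<le> sz st + k * c" using assms(2) by simp
  finally show ?thesis .
qed

lemmas polys = polyb_add polyb_mult polyb_const polyb_id

lemma pt_ccap0: "ptime (\<lambda>z :: (nat \<times> nat \<times> nat) list \<times> nat \<times> nat. ccap (fst z) (fst (snd z)) (snd (snd z)))"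
  unfolding ccap_def split_def by (intro pti)
lemmas pt_ccap = pt3[OF pt_ccap0]

lemma pt_acount0: "ptime (\<lambda>z :: (nat \<times> nat) list \<times> nat \<times> nat. acount (fst z) (fst (snd z)) (snd (snd z)))"
  unfolding acount_def split_def by (intro pti)
lemmas pt_acount = pt3[OF pt_acount0]

lemma pt_vcount0: "ptime (\<lambda>z :: nat list \<times> nat. vcount (fst z) (snd z))"
  unfolding vcount_def by (intro pti)
lemmas pt_vcount = pt2[OF pt_vcount0]

lemma pt_resid0: "ptime (\<lambda>z :: (nat \<times> nat \<times> nat) list \<times> (nat \<times> nat) list \<times> nat \<times> nat. resid (fst z) (fst (snd z)) (fst (snd (snd z))) (snd (snd (snd z))))"
  unfolding resid_def by (intro pti pt_ccap pt_acount)
lemmas pt_resid = pt4[OF pt_resid0]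

lemma pt_rstep0: "ptime (\<lambda>z :: (nat \<times> nat \<times> nat) list \<times> nat list \<times> nat \<times> (nat \<times> nat) list \<times> nat \<times> (nat \<times> nat) list.
    rstep (fst z) (fst (snd z)) (fst (snd (snd z))) (fst (snd (snd (snd z)))) (fst (snd (snd (snd (snd z))))) (snd (snd (snd (snd (snd z))))))"
  unfolding rstep_def by (intro pti pt_resid)
lemmas pt_rstep = pt6[OF pt_rstep0]

lemma sz_rstep: "sz (rstep es xs u A v L) \<le> sz L + (2 + sz v + (sz u + sz xs))" for xs :: "nat list" and u :: nat
proof (cases "filter (\<lambda>w. w \<in> set (u # map fst L) \<and> resid es A v w) (u # xs)")
  case (Cons w ws)
  have "w \<in> set (filter (\<lambda>w. w \<in> set (u # map fst L) \<and> resid es A v w) (u # xs))" unfolding Cons by simp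
  then have "w = u \<or> w \<in> set xs" unfolding set_filter set_simps by blast
  then have "sz w \<le> sz u + sz xs" using sz_mem[of w xs] by auto
  then show ?thesis unfolding rstep_def Cons by simp
qed (simp add: rstep_def)

lemma sz_rpass: "sz (rpass es xs u A L) \<le> sz L + sz xs * (2 + sz xs + (sz u + sz xs))" for xs :: "nat list" and u :: nat
  unfolding rpass_def
proof (rule sz_fold_add'[OF _ length_le_sz])
  fix v st assume "v \<in> set xs"
  then have "sz v \<le> sz xs" by (rule sz_mem)
  then show "sz (rstep es xs u A v st) \<le> sz st + (2 + sz xs + (sz u + sz xs))" using sz_rstep[of es xs u A v st] by linarith
qed

lemma pt_rpass0: "ptime (\<lambda>z :: (nat \<times> nat \<times> nat) list \<times> nat list \<times> nat \<times> (nat \<times> nat) list \<times> (nat \<times> nat) list.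
    rpass (fst z) (fst (snd z)) (fst (snd (snd z))) (fst (snd (snd (snd z)))) (snd (snd (snd (snd z)))))"
  unfolding rpass_def
proof (rule pt_fold[where q = "\<lambda>s. 2 + s + (s + s)"])
  fix e :: "(nat \<times> nat \<times> nat) list \<times> nat list \<times> nat \<times> (nat \<times> nat) list \<times> (nat \<times> nat) list" and a :: nat and st
  have "sz (fst (snd e)) \<le> sz e" "sz (fst (snd (snd e))) \<le> sz e" by (meson sz_fst sz_snd le_trans)+
  then show "sz (rstep (fst e) (fst (snd e)) (fst (snd (snd e))) (fst (snd (snd (snd e)))) a st) \<le> sz st + (2 + (sz e + sz a) + ((sz e + sz a) + (sz e + sz a)))"
    using sz_rstep[of "fst e" "fst (snd e)" "fst (snd (snd e))" "fst (snd (snd (snd e)))" a st] by linarith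
qed (intro pti pt_rstep polys)+
lemmas pt_rpass = pt5[OF pt_rpass0]

lemma sz_reach: "sz (reach es xs u A) \<le> 1 + sz xs * (sz xs * (2 + sz xs + (sz u + sz xs)))" for xs :: "nat list" and u :: nat
  unfolding reach_def using sz_fold_add'[OF _ length_le_sz, where st = "[] :: (nat \<times> nat) list" and f = "\<lambda>_. rpass es xs u A" and xs = xs] sz_rpass
  by (metis sz_Nil)

lemma pt_reach0: "ptime (\<lambda>z :: (nat \<times> nat \<times> nat) list \<times> nat list \<times> nat \<times> (nat \<times> nat) list.
    reach (fst z) (fst (snd z)) (fst (snd (snd z))) (snd (snd (snd z))))"
  unfolding reach_def
proof (rule pt_fold[where q = "\<lambda>s. s * (2 + s + (s + s))"])
  fix e :: "(nat \<times> nat \<times> nat) list \<times> nat list \<times> nat \<times> (nat \<times> nat) list" and a :: nat and st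
  have 1: "sz (fst (snd e)) \<le> sz e + sz a" "sz (fst (snd (snd e))) \<le> sz e + sz a" by (meson sz_fst sz_snd le_trans le_add1)+
  have "sz (rpass (fst e) (fst (snd e)) (fst (snd (snd e))) (snd (snd (snd e))) st)
    \<le> sz st + sz (fst (snd e)) * (2 + sz (fst (snd e)) + (sz (fst (snd (snd e))) + sz (fst (snd e))))" by (rule sz_rpass)
  also have "\<dots> \<le> sz st + (sz e + sz a) * (2 + (sz e + sz a) + ((sz e + sz a) + (sz e + sz a)))"
    using 1 by (intro add_mono mult_mono order_refl) auto
  finally show "sz (rpass (fst e) (fst (snd e)) (fst (snd (snd e))) (snd (snd (snd e))) st) \<le> \<dots>" .
qed (intro pti pt_rpass polys)+
lemmas pt_reach = pt4[OF pt_reach0]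

lemma sz_route_step: "sz (if fst e = fst s then (snd e, e # snd s) else s) \<le> sz s + (2 + sz e + sz e)" for e :: "nat \<times> nat" and s :: "nat \<times> (nat \<times> nat) list"
  by (cases e; cases s) simp

lemma pt_route0: "ptime (\<lambda>z :: (nat \<times> nat) list \<times> nat. route (fst z) (snd z))"
  unfolding route_def
proof (rule pt_snd, rule pt_fold[where q = "\<lambda>s. 2 + s + s"])
  fix e :: "(nat \<times> nat) list \<times> nat" and a :: "nat \<times> nat" and st :: "nat \<times> (nat \<times> nat) list"
  show "sz (if fst a = fst st then (snd a, a # snd st) else st) \<le> sz st + (2 + (sz e + sz a) + (sz e + sz a))"
    using sz_route_step[of a st] by linarith
qed (intro pti polys)+
lemmas pt_route = pt2[OF pt_route0]

lemma sz_route: "sz (route L v) \<le> 2 + sz v + sz L * (2 + sz L + sz L)" for v :: nat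
proof -
  let ?f = "\<lambda>e s. if fst e = fst s then (snd e, e # snd s) else s"
  have "sz (fold ?f L (v, [])) \<le> sz (v, [] :: (nat \<times> nat) list) + sz L * (2 + sz L + sz L)"
  proof (rule sz_fold_add'[OF _ length_le_sz])
    fix e st assume "e \<in> set L"
    then have "sz e \<le> sz L" by (rule sz_mem)
    then show "sz (?f e st) \<le> sz st + (2 + sz L + sz L)" using sz_route_step[of e st] by linarith
  qed
  then show ?thesis unfolding route_def using sz_snd[of "fold ?f L (v, [])"] by (simp add: sz_Nil)
qed

text \<open>\<open>rbound\<close> bounds the search list and \<open>abound\<close> the growth by one
  augmentation. Both depend on the supplies and the sink alone, not on the current flow, as
  \<open>pt_fold\<close> requires.\<close>

definition rbound :: "nat \<Rightarrow> nat" where "rbound s = 1 + s * (s * (2 + s + (s + s)))"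
definition abound :: "nat \<Rightarrow> nat" where "abound s = 3 + s + s + rbound s * (2 + rbound s + rbound s)"

lemma polyb_abound: "polyb abound" unfolding abound_def rbound_def by (intro polys)

lemma rbound_mono: "s \<le> t \<Longrightarrow> rbound s \<le> rbound t" unfolding rbound_def by (intro add_mono mult_mono) auto
lemma abound_mono: "s \<le> t \<Longrightarrow> abound s \<le> abound t" unfolding abound_def using rbound_mono by (intro add_mono mult_mono) auto

lemma sz_map_fst: "sz (map fst l) \<le> sz l" by (induction l) auto

lemma sz_augment: "sz (augment es sl u st) \<le> sz st + abound (sz sl + sz u)" for u :: nat and sl :: "(nat \<times> nat) list"
proof (cases "filter (\<lambda>e. fst e \<in> set (map fst (reach es (map fst sl) u (fst st))) \<and> vcount (snd st) (fst e) < snd e) sl")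
  case (Cons e l)
  let ?s = "sz sl + sz u" let ?L = "reach es (map fst sl) u (fst st)"
  have "e \<in> set (filter (\<lambda>e. fst e \<in> set (map fst (reach es (map fst sl) u (fst st))) \<and> vcount (snd st) (fst e) < snd e) sl)" unfolding Cons by simp
  then have "e \<in> set sl" by simp
  then have e: "sz (fst e) \<le> ?s" using sz_mem[of e sl] sz_fst[of e] by linarith
  have "sz ?L \<le> 1 + sz (map fst sl) * (sz (map fst sl) * (2 + sz (map fst sl) + (sz u + sz (map fst sl))))" by (rule sz_reach)
  also have "\<dots> \<le> rbound ?s" unfolding rbound_def using sz_map_fst[of sl] by (intro add_mono mult_mono order_refl) auto
  finally have L: "sz ?L \<le> rbound ?s" .
  have "sz (route ?L (fst e)) \<le> 2 + sz (fst e) + sz ?L * (2 + sz ?L + sz ?L)" by (rule sz_route)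
  also have "\<dots> \<le> 2 + ?s + rbound ?s * (2 + rbound ?s + rbound ?s)" using e L by (intro add_mono mult_mono order_refl) auto
  finally have R: "sz (route ?L (fst e)) \<le> 2 + ?s + rbound ?s * (2 + rbound ?s + rbound ?s)" .
  have "augment es sl u st = (route ?L (fst e) @ fst st, fst e # snd st)" unfolding augment_def Cons by simp
  moreover have "sz (route ?L (fst e) @ fst st) \<le> sz (route ?L (fst e)) + sz (fst st)" by (rule sz_append)
  moreover have "sz st = 1 + sz (fst st) + sz (snd st)" by (cases st) simp
  moreover have "sz (fst e # snd st) = 1 + sz (fst e) + sz (snd st)" by simp
  ultimately have "sz (augment es sl u st) \<le> sz st + (1 + sz (fst e) + sz (route ?L (fst e)))" by simp
  then show ?thesis unfolding abound_def using R e by linarith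
qed (simp add: augment_def)

lemma pt_augment0: "ptime (\<lambda>z :: (nat \<times> nat \<times> nat) list \<times> (nat \<times> nat) list \<times> nat \<times> (nat \<times> nat) list \<times> nat list.
    augment (fst z) (fst (snd z)) (fst (snd (snd z))) (snd (snd (snd z))))"
  unfolding augment_def by (intro pti pt_reach pt_vcount pt_route)
lemmas pt_augment = pt4[OF pt_augment0]

lemma pt_mf0: "ptime (\<lambda>z :: (nat \<times> nat \<times> nat) list \<times> (nat \<times> nat) list \<times> nat \<times> bool list.
    mf (fst z) (fst (snd z)) (fst (snd (snd z))) (snd (snd (snd z))))"
  unfolding mf_def
proof (rule pt_fold[where q = "\<lambda>s. abound (s + s)"])
  fix e :: "(nat \<times> nat \<times> nat) list \<times> (nat \<times> nat) list \<times> nat \<times> bool list" and a :: bool and st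
  have "sz (fst (snd e)) \<le> sz e" "sz (fst (snd (snd e))) \<le> sz e" by (meson sz_fst sz_snd le_trans)+
  then have "abound (sz (fst (snd e)) + sz (fst (snd (snd e)))) \<le> abound ((sz e + sz a) + (sz e + sz a))" by (intro abound_mono) linarith
  then show "sz (augment (fst e) (fst (snd e)) (fst (snd (snd e))) st) \<le> sz st + abound ((sz e + sz a) + (sz e + sz a))"
    using sz_augment[of "fst e" "fst (snd e)" "fst (snd (snd e))" st] by linarith
  show "polyb (\<lambda>s. abound (s + s))" by (rule polyb_comp[OF polyb_abound]) (intro polys)
qed (intro pti pt_augment)+
lemmas pt_mf = pt4[OF pt_mf0]

lemma pt_inside0: "ptime (\<lambda>z :: nat list \<times> nat list. inside (fst z) (snd z))"
  unfolding inside_def by (intro pti)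
lemmas pt_inside = pt2[OF pt_inside0]

lemma pt_wsum0: "ptime (\<lambda>z :: (nat list \<times> nat) list. wsum z)"
  unfolding wsum_def by (intro pti)
lemmas pt_wsum = pt_comp[OF pt_wsum0]

lemma pt_endw0: "ptime (\<lambda>z :: (nat list \<times> nat) list \<times> nat. endw (fst z) (snd z))"
  unfolding endw_def by (intro pti pt_wsum)
lemmas pt_endw = pt2[OF pt_endw0]

lemma pt_alpha0: "ptime (\<lambda>z :: (nat list \<times> nat list) \<times> nat list. alpha (fst z) (snd z))"
  unfolding alpha_def by (intro pti)
lemmas pt_alpha = pt2[OF pt_alpha0]

lemma pt_adh0: "ptime (\<lambda>z :: (nat list \<times> nat list) \<times> nat list. adh (fst z) (snd z))"
  unfolding adh_def by (intro pti)
lemmas pt_adh = pt2[OF pt_adh0]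

lemma pt_bdp0: "ptime (\<lambda>z :: (nat list \<times> nat) list \<times> (nat list \<times> nat list) \<times> nat list. bdp (fst z) (fst (snd z)) (snd (snd z)))"
  unfolding bdp_def by (intro pti pt_inside pt_alpha)
lemmas pt_bdp = pt3[OF pt_bdp0]

lemma pt_units0: "ptime (\<lambda>z :: nat list \<times> (nat \<times> nat \<times> nat) list. units (fst z) (snd z))"
  unfolding units_def by (intro pti)
lemmas pt_units = pt2[OF pt_units0]

lemma pt_capl0: "ptime (\<lambda>z :: nat \<times> nat \<times> (nat \<times> nat \<times> nat) list. capl (fst z) (fst (snd z)) (snd (snd z)))"
  unfolding capl_def by (intro pti)
lemmas pt_capl = pt3[OF pt_capl0]

lemma pt_supl0: "ptime (\<lambda>z :: nat \<times> nat \<times> (nat list \<times> nat) list \<times> nat list. supl (fst z) (fst (snd z)) (fst (snd (snd z))) (snd (snd (snd z))))"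
  unfolding supl_def by (intro pti pt_endw)
lemmas pt_supl = pt4[OF pt_supl0]

lemma pt_trials0: "ptime (\<lambda>z :: nat list \<times> (nat \<times> nat \<times> nat) list \<times> nat \<times> nat list \<times> nat list \<times> (nat list \<times> nat) list.
    trials (fst z) (fst (snd z)) (fst (snd (snd z))) (fst (snd (snd (snd z)))) (fst (snd (snd (snd (snd z))))) (snd (snd (snd (snd (snd z))))))"
  unfolding trials_def by (intro pti pt_mf pt_capl pt_supl pt_units pt_wsum)
lemmas pt_trials = pt6[OF pt_trials0]

lemma pt_links0: "ptime (\<lambda>z :: nat list \<times> (nat \<times> nat \<times> nat) list \<times> nat \<times> nat list \<times> nat list \<times> (nat list \<times> nat) list.
    links (fst z) (fst (snd z)) (fst (snd (snd z))) (fst (snd (snd (snd z)))) (fst (snd (snd (snd (snd z))))) (snd (snd (snd (snd (snd z))))))"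
  unfolding links_def by (intro pti pt_trials pt_units)
lemmas pt_links = pt6[OF pt_links0]

lemma pt_cutset0: "ptime (\<lambda>z :: nat list \<times> (nat \<times> nat \<times> nat) list \<times> nat \<times> nat list \<times> nat list \<times> (nat list \<times> nat) list.
    cutset (fst z) (fst (snd z)) (fst (snd (snd z))) (fst (snd (snd (snd z)))) (fst (snd (snd (snd (snd z))))) (snd (snd (snd (snd (snd z))))))"
  unfolding cutset_def by (intro pti pt_trials pt_units pt_reach pt_capl pt_wsum)
lemmas pt_cutset = pt6[OF pt_cutset0]

lemma pt_prodl0: "ptime (\<lambda>z :: (nat list \<times> nat list) list \<times> nat list list. prodl (fst z) (snd z))"
  unfolding prodl_def by (intro pti)
lemmas pt_prodl = pt2[OF pt_prodl0]

lemma pt_unlinked0: "ptime (\<lambda>z :: nat list \<times> (nat \<times> nat \<times> nat) list \<times> nat \<times> nat \<times> (nat list \<times> nat) list \<times> (nat list \<times> nat list) \<times> nat list.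
    unlinked (fst z) (fst (snd z)) (fst (snd (snd z))) (fst (snd (snd (snd z)))) (fst (snd (snd (snd (snd z))))) (snd (snd (snd (snd (snd z))))))"
  unfolding unlinked_def by (intro pti pt_adh pt_bdp pt_links pt_alpha)
lemmas pt_unlinked = pt6[OF pt_unlinked0]

lemma pt_cutoff0: "ptime (\<lambda>z :: nat list \<times> nat list list \<times> nat list list \<times> (nat list \<times> nat) list. cutoff (fst z) (snd z))"
  unfolding cutoff_def by (intro pti pt_inside)
lemmas pt_cutoff = pt2[OF pt_cutoff0]

lemma pt_cutstep0: "ptime (\<lambda>z :: nat list \<times> (nat \<times> nat \<times> nat) list \<times> nat \<times> (nat list \<times> nat list) list \<times> nat \<times> nat list list \<times> nat list list \<times> (nat list \<times> nat) list.
    cutstep (fst z) (fst (snd z)) (fst (snd (snd z))) (fst (snd (snd (snd z)))) (fst (snd (snd (snd (snd z))))) (snd (snd (snd (snd (snd z))))))"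
  unfolding cutstep_def by (intro pti pt_unlinked pt_prodl pt_cutoff pt_cutset pt_alpha pt_adh pt_bdp)
lemmas pt_cutstep = pt6[OF pt_cutstep0]

lemma sz_cutoff: "sz (cutoff S st) \<le> sz st + (1 + sz S)"
proof -
  obtain dn lv A where st: "st = (dn, lv, A)" by (cases st)
  show ?thesis
    using sz_map_filter[of "\<lambda>v. v \<notin> set S" lv] sz_filter[of "\<lambda>e. inside (fst e) S \<or> (\<forall>v\<in>set (fst e). v \<notin> set S)" A]
    by (simp add: st cutoff_def)
qed

text \<open>Everything old is only filtered, and the set cut off is a sublist of a cone from
  \<open>ns\<close>, so the growth per round does not depend on the state.\<close>

lemma sz_cutstep: "sz (cutstep vs es q ns s st) \<le> sz st + (1 + sz ns)" for ns :: "(nat list \<times> nat list) list"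
proof (cases "filter (unlinked vs es q s (snd (snd st))) (prodl ns (fst (snd st)))")
  case (Cons e l)
  let ?S = "cutset vs es q (alpha (fst e) (snd e)) (adh (fst e) (snd e)) (bdp (snd (snd st)) (fst e) (snd e))"
  have "e \<in> set (filter (unlinked vs es q s (snd (snd st))) (prodl ns (fst (snd st))))" unfolding Cons by simp
  then have "fst e \<in> set ns" by (auto simp: prodl_def)
  then have "sz (fst (fst e)) \<le> sz ns" using sz_mem[of "fst e" ns] sz_fst[of "fst e"] by linarith
  moreover have "sz ?S \<le> sz (alpha (fst e) (snd e))" unfolding cutset_def by (rule sz_filter)
  moreover have "sz (alpha (fst e) (snd e)) \<le> sz (fst (fst e))" unfolding alpha_def by (rule sz_filter)
  moreover have "cutstep vs es q ns s st = cutoff ?S st" unfolding cutstep_def Cons by simp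
  ultimately show ?thesis using sz_cutoff[of ?S st] by simp
qed (simp add: cutstep_def)

lemma pt_splitup0: "ptime (\<lambda>z :: nat list \<times> (nat \<times> nat \<times> nat) list \<times> nat \<times> (nat list \<times> nat list) list \<times> nat \<times> nat list list \<times> (nat list \<times> nat) list.
    splitup (fst z) (fst (snd z)) (fst (snd (snd z))) (fst (snd (snd (snd z)))) (fst (snd (snd (snd (snd z)))))
      (fst (snd (snd (snd (snd (snd z)))))) (snd (snd (snd (snd (snd (snd z)))))))"
  unfolding splitup_def
proof (rule pt_fold[where q = "\<lambda>s. 1 + s"])
  fix e :: "nat list \<times> (nat \<times> nat \<times> nat) list \<times> nat \<times> (nat list \<times> nat list) list \<times> nat \<times> nat list list \<times> (nat list \<times> nat) list" and a :: nat and st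
  have "sz (fst (snd (snd (snd e)))) \<le> sz e" by (meson sz_fst sz_snd le_trans)
  then show "sz (cutstep (fst e) (fst (snd e)) (fst (snd (snd e))) (fst (snd (snd (snd e)))) (fst (snd (snd (snd (snd e))))) st) \<le> sz st + (1 + (sz e + sz a))"
    using sz_cutstep[of "fst e" "fst (snd e)" "fst (snd (snd e))" "fst (snd (snd (snd e)))" "fst (snd (snd (snd (snd e))))" st] by linarith
qed (intro pti pt_cutstep polys)+
lemmas pt_splitup = pt7[OF pt_splitup0]

lemma sz_splitup: "sz (splitup vs es q ns s ps A) \<le> sz ([] :: nat list list, ps, A) + sz vs * (1 + sz ns)" for ns :: "(nat list \<times> nat list) list"
  unfolding splitup_def by (rule sz_fold_add'[OF _ length_le_sz]) (rule sz_cutstep)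

lemma pt_badp0: "ptime (\<lambda>z :: (nat list \<times> nat list) list \<times> nat \<times> nat list list \<times> nat list \<times> nat.
    badp (fst z) (fst (snd z)) (fst (snd (snd z))) (snd (snd (snd z))))"
  unfolding badp_def by (intro pti pt_adh pt_inside pt_alpha)
lemmas pt_badp = pt4[OF pt_badp0]

lemma pt_stage'0: "ptime (\<lambda>z :: (nat list \<times> nat list) list \<times> nat \<times> nat \<times> nat list list \<times> nat list list \<times> (nat list \<times> nat) list.
    stage' (fst z) (fst (snd z)) (fst (snd (snd z))) (snd (snd (snd z))))"
  unfolding stage'_def by (intro pti pt_badp pt_wsum)
lemmas pt_stage' = pt4[OF pt_stage'0]

lemma pt_stage0: "ptime (\<lambda>z :: nat list \<times> (nat \<times> nat \<times> nat) list \<times> nat \<times> (nat list \<times> nat list) list \<times> nat \<times> nat \<times> nat list list \<times> (nat list \<times> nat) list \<times> bool.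
    stage (fst z) (fst (snd z)) (fst (snd (snd z))) (fst (snd (snd (snd z)))) (fst (snd (snd (snd (snd z))))) (snd (snd (snd (snd (snd z))))))"
  unfolding stage_def by (intro pti pt_stage' pt_splitup)
lemmas pt_stage = pt6[OF pt_stage0]

text \<open>Parts and paths are rearranged and filtered; only the sets cut off are new. The constant
  6 covers constructors and the flag.\<close>

lemma sz_stage: "sz (stage vs es q ns r st) \<le> sz st + (6 + sz vs * (1 + sz ns))" for ns :: "(nat list \<times> nat list) list"
proof -
  obtain s ps A stop where st: "st = (s, ps, A, stop)" by (metis prod_cases4)
  obtain dn lv A1 where sp: "splitup vs es q ns s ps A = (dn, lv, A1)" by (metis prod_cases3)
  have "sz (dn, lv, A1) \<le> sz ([] :: nat list list, ps, A) + sz vs * (1 + sz ns)" using sz_splitup[of vs es q ns s ps A] unfolding sp .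
  then have 1: "sz dn + sz lv + sz A1 \<le> 1 + sz ps + sz A + sz vs * (1 + sz ns)" by simp
  have 2: "sz (dn @ lv) \<le> sz dn + sz lv" by (rule sz_append)
  have 3: "sz (s - 1) \<le> sz s" by (rule sz_nat_mono) simp
  have 4: "sz True \<le> 3" "sz False \<le> 3" by (simp_all add: floorlog_def)
  have 5: "sz (filter Q A1) \<le> sz A1" for Q by (rule sz_filter)
  show ?thesis
  proof (cases stop)
    case False
    let ?B = "filter (\<lambda>e. \<not> badp ns s (dn @ lv) e) A1"
    have "stage vs es q ns r st = (s, dn @ lv, A1, True) \<or> stage vs es q ns r st = (s - 1, dn @ lv, ?B, False)"
      using False by (simp add: st stage_def stage'_def sp)
    moreover have "sz (s, dn @ lv, A1, True) \<le> sz st + (6 + sz vs * (1 + sz ns))"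
      unfolding st sz_pair using 1 2 4 by linarith
    moreover have "sz (s - 1, dn @ lv, ?B, False) \<le> sz st + (6 + sz vs * (1 + sz ns))"
      unfolding st sz_pair using 1 2 3 4 5[of "\<lambda>e. \<not> badp ns s (dn @ lv) e"] by linarith
    ultimately show ?thesis by metis
  qed (simp add: st stage_def)
qed

lemma pt_candidate0: "ptime (\<lambda>z :: (nat list \<times> (nat \<times> nat \<times> nat) list \<times> nat \<times> (nat list \<times> nat) list) \<times> (nat list \<times> nat list) \<times> nat list.
    case links (fst (fst z)) (fst (snd (fst z))) (fst (snd (snd (fst z)))) (alpha (fst (snd z)) (snd (snd z))) (adh (fst (snd z)) (snd (snd z))) (bdp (snd (snd (snd (fst z)))) (fst (snd z)) (snd (snd z))) of
      [] \<Rightarrow> []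
    | l # _ \<Rightarrow> [(alpha (fst (snd z)) (snd (snd z)), fst l, snd (snd l), bdp (snd (snd (snd (fst z)))) (fst (snd z)) (snd (snd z)))])"
  by (intro pti pt_links pt_alpha pt_adh pt_bdp)

lemma sum4_le: "a \<le> s \<Longrightarrow> b \<le> s \<Longrightarrow> c \<le> s \<Longrightarrow> d \<le> s \<Longrightarrow> 1 + a + (1 + b + (1 + c + d)) + x \<le> 3 + 4 * (s + x) + (s + x)" for a :: nat
  by simp

lemma sum2_le: "a \<le> s \<Longrightarrow> b \<le> s \<Longrightarrow> p \<le> a + b \<Longrightarrow> 1 + p + (1 + p + l) \<le> 1 + c + l + (2 + 2 * ((s + x) + (s + x)))" for a :: nat
  by simp

text \<open>A round adds at most one entry, computed from the parameters and not from the entries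
  collected so far. Isolating it as the function \<open>F\<close> yields the growth bound through
  \<open>ptime_size\<close>.\<close>

lemma pickstep_size:
  obtains p where "polyb p" "\<And>(vs :: nat list) es q s A e ks. sz (pickstep vs es q s A e ks) \<le> sz ks + p (sz (vs, es, q, A) + sz (e :: (nat list \<times> nat list) \<times> nat list))"
proof -
  define F where "F x e = (case links (fst x) (fst (snd x)) (fst (snd (snd x))) (alpha (fst e) (snd e)) (adh (fst e) (snd e)) (bdp (snd (snd (snd x))) (fst e) (snd e)) of
      [] \<Rightarrow> []
    | l # _ \<Rightarrow> [(alpha (fst e) (snd e), fst l, snd (snd l), bdp (snd (snd (snd x))) (fst e) (snd e))])"
    for x :: "nat list \<times> (nat \<times> nat \<times> nat) list \<times> nat \<times> (nat list \<times> nat) list" and e :: "(nat list \<times> nat list) \<times> nat list"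
  have "ptime (\<lambda>z. F (fst z) (snd z))" unfolding F_def by (rule pt_candidate0)
  then obtain p where p: "polyb p" "\<And>x e. sz (F x e) \<le> p (sz x + sz e)" using ptime_size by blast
  have "sz (pickstep vs es q s A e ks) \<le> sz ks + p (sz (vs, es, q, A) + sz e)"
    for vs :: "nat list" and es :: "(nat \<times> nat \<times> nat) list" and q s and A :: "(nat list \<times> nat) list" and e :: "(nat list \<times> nat list) \<times> nat list" and ks
  proof -
    have "pickstep vs es q s A e ks = ks \<or> pickstep vs es q s A e ks = F (vs, es, q, A) e @ ks"
      by (auto simp: pickstep_def F_def split: list.splits)
    moreover have "sz (F (vs, es, q, A) e @ ks) \<le> sz ks + p (sz (vs, es, q, A) + sz e)"
      using sz_append[of "F (vs, es, q, A) e" ks] p(2)[of "(vs, es, q, A)" e] by linarith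
    ultimately show ?thesis by (metis le_add1)
  qed
  then show ?thesis using p(1) that by blast
qed

lemma pt_pickstep0: "ptime (\<lambda>z :: nat list \<times> (nat \<times> nat \<times> nat) list \<times> nat \<times> nat \<times> (nat list \<times> nat) list \<times> ((nat list \<times> nat list) \<times> nat list)
      \<times> (nat list \<times> nat \<times> nat list \<times> (nat list \<times> nat) list) list.
    pickstep (fst z) (fst (snd z)) (fst (snd (snd z))) (fst (snd (snd (snd z)))) (fst (snd (snd (snd (snd z)))))
      (fst (snd (snd (snd (snd (snd z)))))) (snd (snd (snd (snd (snd (snd z)))))))"
  unfolding pickstep_def by (intro pti pt_links pt_alpha pt_adh pt_bdp)
lemmas pt_pickstep = pt7[OF pt_pickstep0]

lemma pt_picks0: "ptime (\<lambda>z :: nat list \<times> (nat \<times> nat \<times> nat) list \<times> nat \<times> (nat list \<times> nat list) list \<times> nat \<times> nat list list \<times> (nat list \<times> nat) list.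
    picks (fst z) (fst (snd z)) (fst (snd (snd z))) (fst (snd (snd (snd z)))) (fst (snd (snd (snd (snd z)))))
      (fst (snd (snd (snd (snd (snd z)))))) (snd (snd (snd (snd (snd (snd z)))))))"
proof -
  obtain p where p: "polyb p" "\<And>vs es q s A e ks. sz (pickstep vs es q s A e ks) \<le> sz ks + p (sz (vs, es, q, A) + sz (e :: (nat list \<times> nat list) \<times> nat list))"
    using pickstep_size by blast
  obtain p' where p': "polyb p'" "mono p'" "\<And>s. p s \<le> p' s" using polyb_mono[OF p(1)] by blast
  show ?thesis
    unfolding picks_def
  proof (rule pt_fold[where q = "\<lambda>s. p' (3 + 4 * s + s)"])
    fix e :: "nat list \<times> (nat \<times> nat \<times> nat) list \<times> nat \<times> (nat list \<times> nat list) list \<times> nat \<times> nat list list \<times> (nat list \<times> nat) list"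
      and a :: "(nat list \<times> nat list) \<times> nat list" and st
    have "sz (fst e) \<le> sz e" "sz (fst (snd e)) \<le> sz e" "sz (fst (snd (snd e))) \<le> sz e" "sz (snd (snd (snd (snd (snd (snd e)))))) \<le> sz e"
      by (meson sz_fst sz_snd le_trans)+
    then have "sz (fst e, fst (snd e), fst (snd (snd e)), snd (snd (snd (snd (snd (snd e)))))) + sz a \<le> 3 + 4 * (sz e + sz a) + (sz e + sz a)"
      unfolding sz_pair by (rule sum4_le)
    then have "p' (sz (fst e, fst (snd e), fst (snd (snd e)), snd (snd (snd (snd (snd (snd e)))))) + sz a) \<le> p' (3 + 4 * (sz e + sz a) + (sz e + sz a))"
      by (rule monoD[OF p'(2)])
    then show "sz (pickstep (fst e) (fst (snd e)) (fst (snd (snd e))) (fst (snd (snd (snd (snd e))))) (snd (snd (snd (snd (snd (snd e)))))) a st)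
        \<le> sz st + p' (3 + 4 * (sz e + sz a) + (sz e + sz a))"
      using p(2)[of "fst e" "fst (snd e)" "fst (snd (snd e))" "fst (snd (snd (snd (snd e))))" "snd (snd (snd (snd (snd (snd e)))))" a st]
        p'(3)[of "sz (fst e, fst (snd e), fst (snd (snd e)), snd (snd (snd (snd (snd (snd e)))))) + sz a"] by linarith
    show "polyb (\<lambda>s. p' (3 + 4 * s + s))" by (rule polyb_comp[OF p'(1)]) (intro polys)
  qed (intro pti pt_pickstep pt_prodl)+
qed
lemmas pt_picks = pt7[OF pt_picks0]

lemma pt_pickw0: "ptime (\<lambda>z :: (nat list \<times> nat \<times> nat list \<times> (nat list \<times> nat) list) list \<times> nat. pickw (fst z) (snd z))"
  unfolding pickw_def by (intro pti pt_wsum)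
lemmas pt_pickw = pt2[OF pt_pickw0]

lemma pt_outA0: "ptime (\<lambda>z :: nat list \<times> nat \<times> (nat list \<times> nat \<times> nat list \<times> (nat list \<times> nat) list) list. outA (fst z) (fst (snd z)) (snd (snd z)))"
  unfolding outA_def by (intro pti pt_pickw)
lemmas pt_outA = pt3[OF pt_outA0]

lemma pt_thru0: "ptime (\<lambda>z :: (nat list \<times> nat) list \<times> nat list \<times> nat. thru (fst z) (fst (snd z)) (snd (snd z)))"
  unfolding thru_def by (intro pti pt_inside)
lemmas pt_thru = pt3[OF pt_thru0]

lemma pt_hub0: "ptime (\<lambda>z :: (nat list \<times> nat) list \<times> nat list. hub (fst z) (snd z))"
  unfolding hub_def by (intro pti pt_thru pt_wsum)
lemmas pt_hub = pt2[OF pt_hub0]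

lemma pt_finalB0: "ptime (\<lambda>z :: nat \<times> nat list list \<times> nat list list \<times> (nat list \<times> nat) list. finalB (fst z) (snd z))"
  unfolding finalB_def outB_def by (intro pti pt_endw pt_thru pt_hub)
lemmas pt_finalB = pt2[OF pt_finalB0]

lemma pt_final0: "ptime (\<lambda>z :: nat list \<times> (nat \<times> nat \<times> nat) list \<times> nat \<times> (nat list \<times> nat list) list \<times> nat \<times> nat \<times> nat list list \<times> (nat list \<times> nat) list \<times> bool.
    final (fst z) (fst (snd z)) (fst (snd (snd z))) (fst (snd (snd (snd z)))) (fst (snd (snd (snd (snd z))))) (snd (snd (snd (snd (snd z))))))"
  unfolding final_def by (intro pti pt_outA pt_picks pt_units pt_finalB pt_splitup)
lemmas pt_final = pt6[OF pt_final0]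

lemma pt_solve0: "ptime (\<lambda>z :: nat list \<times> (nat \<times> nat \<times> nat) list \<times> (nat list \<times> nat) list \<times> (nat list \<times> nat list) list \<times> nat \<times> nat.
    solve (fst z) (fst (snd z)) (fst (snd (snd z))) (fst (snd (snd (snd z)))) (fst (snd (snd (snd (snd z))))) (snd (snd (snd (snd (snd z))))))"
  unfolding solve_def
proof (intro pti pt_final)
  show "ptime (\<lambda>z :: nat list \<times> (nat \<times> nat \<times> nat) list \<times> (nat list \<times> nat) list \<times> (nat list \<times> nat list) list \<times> nat \<times> nat.
    fold (\<lambda>_. stage (fst z) (fst (snd z)) (4 * fst (snd (snd (snd (snd z)))) * snd (snd (snd (snd (snd z))))) (fst (snd (snd (snd z)))) (fst (snd (snd (snd (snd z))))))
      (fst z) (length (fst z), [fst z], fst (snd (snd z)), False))"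
  proof (rule pt_fold[where q = "\<lambda>s. 6 + s * (1 + s)"])
    fix e :: "nat list \<times> (nat \<times> nat \<times> nat) list \<times> (nat list \<times> nat) list \<times> (nat list \<times> nat list) list \<times> nat \<times> nat" and a :: nat
      and st :: "nat \<times> nat list list \<times> (nat list \<times> nat) list \<times> bool"
    have "sz (fst e) \<le> sz e + sz a" "sz (fst (snd (snd (snd e)))) \<le> sz e + sz a" by (meson sz_fst sz_snd le_trans le_add1)+
    then have "sz (fst e) * (1 + sz (fst (snd (snd (snd e))))) \<le> (sz e + sz a) * (1 + (sz e + sz a))" by (intro mult_mono add_mono) auto
    then show "sz (stage (fst e) (fst (snd e)) (4 * fst (snd (snd (snd (snd e)))) * snd (snd (snd (snd (snd e))))) (fst (snd (snd (snd e)))) (fst (snd (snd (snd (snd e))))) st)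
        \<le> sz st + (6 + (sz e + sz a) * (1 + (sz e + sz a)))"
      using sz_stage[of "fst e" "fst (snd e)" "4 * fst (snd (snd (snd (snd e)))) * snd (snd (snd (snd (snd e))))" "fst (snd (snd (snd e)))" "fst (snd (snd (snd (snd e))))" st] by linarith
  qed (intro pti pt_stage polys)+
qed
lemmas pt_solve = pt6[OF pt_solve0]

lemma pt_par0: "ptime (\<lambda>z :: (nat \<times> nat \<times> nat list) list \<times> nat \<times> nat. par (fst z) (fst (snd z)) (snd (snd z)))"
  unfolding par_def by (intro pti)
lemmas pt_par = pt3[OF pt_par0]

lemma sz_par: "sz (par ts rt t) \<le> sz ts + sz rt" for ts :: "(nat \<times> nat \<times> nat list) list"
proof (cases "filter (\<lambda>e. fst e = t) ts")
  case (Cons e l)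
  have "e \<in> set (filter (\<lambda>e. fst e = t) ts)" unfolding Cons by simp
  then have "e \<in> set ts" by simp
  then have "sz e \<le> sz ts" by (rule sz_mem)
  moreover have "sz (fst (snd e)) \<le> sz e" by (meson sz_fst sz_snd le_trans)
  ultimately show ?thesis unfolding par_def Cons by simp
qed (simp add: par_def)

lemma pt_ancs0: "ptime (\<lambda>z :: (nat \<times> nat \<times> nat list) list \<times> nat \<times> nat. ancs (fst z) (fst (snd z)) (snd (snd z)))"
  unfolding ancs_def
proof (rule pt_snd, rule pt_fold[where q = "\<lambda>s. 2 + 2 * (s + s)"])
  fix e :: "(nat \<times> nat \<times> nat list) list \<times> nat \<times> nat" and a :: "nat \<times> nat \<times> nat list" and st :: "nat \<times> nat list"
  have e: "sz (fst e) \<le> sz e" "sz (fst (snd e)) \<le> sz e" by (meson sz_fst sz_snd le_trans)+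
  have p: "sz (par (fst e) (fst (snd e)) (fst st)) \<le> sz (fst e) + sz (fst (snd e))" by (rule sz_par)
  obtain c l where cl: "st = (c, l)" by (cases st)
  have "sz (par (fst e) (fst (snd e)) c, par (fst e) (fst (snd e)) c # l) \<le> sz (c, l) + (2 + 2 * ((sz e + sz a) + (sz e + sz a)))"
    using e p unfolding cl fst_conv sz_pair repr_simps(5) vsize.simps by (rule sum2_le)
  then show "sz (if fst st = fst (snd e) then st else (par (fst e) (fst (snd e)) (fst st), par (fst e) (fst (snd e)) (fst st) # snd st))
      \<le> sz st + (2 + 2 * ((sz e + sz a) + (sz e + sz a)))"
    unfolding cl fst_conv snd_conv by simp
qed (intro pti pt_par polys)+
lemmas pt_ancs = pt3[OF pt_ancs0]

lemma pt_conel0: "ptime (\<lambda>z :: nat list \<times> (nat \<times> nat \<times> nat list) list \<times> nat \<times> nat. conel (fst z) (fst (snd z)) (fst (snd (snd z))) (snd (snd (snd z))))"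
  unfolding conel_def by (intro pti pt_ancs)
lemmas pt_conel = pt4[OF pt_conel0]

lemma pt_adhl0: "ptime (\<lambda>z :: (nat \<times> nat \<times> nat list) list \<times> nat \<times> nat \<times> nat \<times> nat list. adhl (fst z) (fst (snd z)) (snd (snd z)))"
  unfolding adhl_def by (intro pti)
lemmas pt_adhl = pt3[OF pt_adhl0]

lemma pt_bydepth0: "ptime (\<lambda>z :: (nat \<times> nat \<times> nat list) list \<times> nat. bydepth (fst z) (snd z))"
  unfolding bydepth_def
proof (rule pt_snd, rule pt_fold[where q = "\<lambda>s. s"])
  fix e :: "(nat \<times> nat \<times> nat list) list \<times> nat" and a :: "nat \<times> nat \<times> nat list" and st :: "nat \<times> (nat \<times> nat \<times> nat list) list"
  obtain c l where cl: "st = (c, l)" by (cases st)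
  let ?f = "filter (\<lambda>x. length (ancs (fst e) (snd e) (fst x)) = c) (fst e)"
  have "sz (l @ ?f) \<le> sz l + sz ?f" by (rule sz_append)
  moreover have "sz ?f \<le> sz (fst e)" by (rule sz_filter)
  moreover have "sz (fst e) \<le> sz e" by (rule sz_fst)
  moreover have "sz (c - 1) \<le> sz c" by (rule sz_nat_mono) simp
  ultimately show "sz (fst st - 1, snd st @ filter (\<lambda>x. length (ancs (fst e) (snd e) (fst x)) = fst st) (fst e)) \<le> sz st + (sz e + sz a)"
    unfolding cl fst_conv snd_conv sz_pair by linarith
qed (intro pti pt_ancs polys)+
lemmas pt_bydepth = pt2[OF pt_bydepth0]

lemma pt_conelist0: "ptime (\<lambda>z :: nat list \<times> (nat \<times> nat \<times> nat list) list \<times> nat. conelist (fst z) (fst (snd z)) (snd (snd z)))"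
  unfolding conelist_def by (intro pti pt_conel pt_adhl pt_bydepth)
lemmas pt_conelist = pt3[OF pt_conelist0]

text \<open>The product serves as common denominator in place of the least common multiple: it is
  simple to compute and still of polynomial length.\<close>

definition denom :: "('a list \<times> nat \<times> nat) list \<Rightarrow> nat" where
  "denom fs = prod_list (map (\<lambda>e. snd (snd e)) fs)"

definition scaled :: "('a list \<times> nat \<times> nat) list \<Rightarrow> ('a list \<times> nat) list" where
  "scaled fs = map (\<lambda>e. (fst e, fst (snd e) * (denom fs div snd (snd e)))) fs"

text \<open>For \<open>r < 2\<close> the required value is 0, so singletons with zero weights meet
  it.\<close>

definition algo where
  "algo vs es fs ts rt r = (if r < 2 then map (\<lambda>v. [(v, 0, 1)]) vs
     else solve vs es (scaled fs) (conelist vs ts rt) r (denom fs))"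

lemma pt_denom0: "ptime (\<lambda>z :: (nat list \<times> nat \<times> nat) list. denom z)"
  unfolding denom_def by (intro pti)
lemmas pt_denom = pt_comp[OF pt_denom0]

lemma pt_scaled0: "ptime (\<lambda>z :: (nat list \<times> nat \<times> nat) list. scaled z)"
  unfolding scaled_def by (intro pti pt_denom)
lemmas pt_scaled = pt_comp[OF pt_scaled0]

lemma pt_algo: "ptime (\<lambda>z :: nat list \<times> (nat \<times> nat \<times> nat) list \<times> (nat \<times> nat) list \<times> (nat list \<times> nat \<times> nat) list \<times> (nat \<times> nat \<times> nat list) list \<times> nat \<times> nat.
    algo (fst z) (fst (snd z)) (fst (snd (snd (snd z)))) (fst (snd (snd (snd (snd z))))) (fst (snd (snd (snd (snd (snd z)))))) (snd (snd (snd (snd (snd (snd z)))))))"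
  unfolding algo_def by (intro pti pt_solve pt_scaled pt_conelist pt_denom)

section \<open>Degenerate widths, encodings and irrational flows\<close>

section \<open>The theorem\<close>

text \<open>One-vertex bags exclude edges and thereby any flow between distinct vertices. For the
  width bound 0 the required value is 0 by the convention on division by 0.\<close>

lemma linked_partition_small_width:
  assumes valid: "valid_input I" and w: "width_bound I < 2" and vs: "distinct vs" "set vs = verts I"
  shows "linked_partition I (length vs) (\<lambda>i. {vs ! i}) (\<lambda>i v. 0)"
proof -
  interpret tdec I by unfold_locales (rule valid)
  have noterm: "pairs_in I {v} = {}" for v
    using graph(3) by (auto simp: pairs_in_def simple_graph_def)
  then have noterm': "terminals_in I {v} = {}" for v by (simp add: terminals_in_def)
  have rhs: "1 / (12 * real (width_bound I) ^ 3) * loss I * flow_value V (flow I) = 0"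
  proof (cases "width_bound I = 0")
    case False
    then have w1: "width_bound I = 1" using w by simp
    have "E = {}"
    proof (rule ccontr)
      assume "E \<noteq> {}"
      then obtain e where e: "e \<in> E" by blast
      obtain u v where uv: "u \<noteq> v" "e = {u, v}" using graph(2)[OF e] by blast
      obtain t where t: "t \<in> T" "e \<subseteq> bag I t" using bags(3)[OF e] by blast
      have "finite (bag I t)" using bags(1)[OF t(1)] graph(1) finite_subset by blast
      then have "card e \<le> card (bag I t)" using t(2) by (rule card_mono)
      then show False using bags(4)[OF t(1)] w1 uv by simp
    qed
    have "flow I p = 0" for p
    proof (rule ccontr)
      assume nz: "flow I p \<noteq> 0"
      then have p: "is_path V E p" "{hd p, last p} \<in> pairs I"
        using valid by (auto simp: valid_input_def fractional_solution_def feasible_flow_def)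
      then have "hd p \<noteq> last p" using graph(3) by (force simp: simple_graph_def doubleton_eq_iff)
      moreover have "p \<noteq> []" using p(1) by (simp add: is_path_def)
      ultimately obtain x y q where "p = x # y # q" by (metis last.simps list.collapse list.sel(1))
      then have "{x, y} \<in> path_edges p" by (simp add: path_edges_def)
      then show False using p(1) \<open>E = {}\<close> by (auto simp: is_path_def)
    qed
    then have "flow_value V (flow I) = 0" by (simp add: flow_value_def marginal_def flow_sum_def)
    then show ?thesis by simp
  qed simp
  have "sinks I (length vs) (\<lambda>i. {vs ! i}) (\<lambda>i v. 0)"
    unfolding sinks_def noterm noterm'
  proof (intro conjI allI impI)
    show "disjoint_family_on (\<lambda>i. {vs ! i}) {..<length vs}"
      using vs(1) by (auto simp: disjoint_family_on_def nth_eq_iff_index_eq)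
    show "(\<Union>i<length vs. {vs ! i}) = V" unfolding vs(2)[symmetric] by (auto simp: in_set_conv_nth)
    show "\<exists>z\<in>{vs ! i}. \<exists>g. feasible_flow {vs ! i} (induced_edges E {vs ! i}) (cap I) g \<and>
        (\<forall>p. g p \<noteq> 0 \<longrightarrow> hd p \<in> {} \<and> last p = z) \<and> (\<forall>v\<in>{}. flow_sum g (\<lambda>p. hd p = v) = 0)" for i
      by (intro bexI[of _ "vs ! i"] exI[of _ "\<lambda>p. 0"]) auto
    show "flow_well_linked {vs ! i} (induced_edges E {vs ! i}) (cap I) {} (\<lambda>v. 0)" for i
      unfolding flow_well_linked_def by (intro exI[of _ "\<lambda>p. 0"]) auto
  qed auto
  then show ?thesis unfolding linked_partition_iff rhs sink_partition_def by simp
qed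

lemma (in tdec) loss_bounds: "2 \<le> width_bound I \<Longrightarrow> 0 \<le> loss I"
  unfolding loss_def by (intro zero_le_power) (simp add: field_simps)

lemma (in edp_lists) linked_of_sink_partition:
  assumes "sink_partition I q U \<pi> (1 / (9 * real r ^ 3) * loss I * flow_value V (flow I))"
  shows "linked_partition I q U \<pi>"
proof -
  have 0: "0 \<le> loss I * flow_value V (flow I)" using loss_bounds[OF r] by (simp add: flow_value_list)
  have "1 / (12 * real r ^ 3) \<le> 1 / (9 * real r ^ 3)" using r by (intro divide_left_mono) (auto intro!: mult_pos_pos)
  from mult_right_mono[OF this 0] show ?thesis unfolding linked_partition_iff using assms by (simp add: sink_partition_def mult.assoc)
qed

lemma repr_list_eq: "repr = enc_list repr" by (rule ext) (simp add: repr_list_def)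
lemma repr_pair_eq: "repr = enc_pair repr repr" by (rule ext) (auto)
lemma repr_nat_eq: "repr = Num" by (rule ext) simp

lemma repr_outputs: "repr (ps :: (nat \<times> nat \<times> nat) list list) = enc_list (enc_list (enc_pair Num (enc_pair Num Num))) ps"
  unfolding repr_list_eq[where 'a = "(nat \<times> nat \<times> nat) list"] repr_list_eq[where 'a = "nat \<times> nat \<times> nat"]
    repr_pair_eq[where 'a = nat and 'b = "nat \<times> nat"] repr_pair_eq[where 'a = nat and 'b = nat] repr_nat_eq ..

lemma repr_inputs:
  "repr (vs, es, ms, fs, ts, rt, w) = Pair (enc_list Num vs)
           (Pair (enc_list (enc_pair Num (enc_pair Num Num)) es)
           (Pair (enc_list (enc_pair Num Num) ms)
           (Pair (enc_list (enc_pair (enc_list Num) (enc_pair Num Num)) fs)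
           (Pair (enc_list (enc_pair Num (enc_pair Num (enc_list Num))) ts)
           (Pair (Num rt) (Num w))))))"
  for vs :: "nat list" and es :: "(nat \<times> nat \<times> nat) list" and ms :: "(nat \<times> nat) list" and fs :: "(nat list \<times> nat \<times> nat) list"
    and ts :: "(nat \<times> nat \<times> nat list) list" and rt w :: nat
proof -
  have 1: "repr (vs :: nat list) = enc_list Num vs" for vs by (subst repr_list_eq) (simp only: repr_nat_eq)
  have 2: "repr (es :: (nat \<times> nat \<times> nat) list) = enc_list (enc_pair Num (enc_pair Num Num)) es" for es
    by (subst repr_list_eq) (simp only: repr_nat_eq repr_pair_eq[where 'a = nat and 'b = "nat \<times> nat"] repr_pair_eq[where 'a = nat and 'b = nat])
  have 3: "repr (ms :: (nat \<times> nat) list) = enc_list (enc_pair Num Num) ms" for ms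
    by (subst repr_list_eq) (simp only: repr_nat_eq repr_pair_eq[where 'a = nat and 'b = nat])
  have l: "(repr :: nat list \<Rightarrow> val) = enc_list Num" by (rule ext) (rule 1)
  have 4: "repr (fs :: (nat list \<times> nat \<times> nat) list) = enc_list (enc_pair (enc_list Num) (enc_pair Num Num)) fs" for fs
    by (subst repr_list_eq) (simp only: l repr_nat_eq repr_pair_eq[where 'a = "nat list" and 'b = "nat \<times> nat"] repr_pair_eq[where 'a = nat and 'b = nat])
  have 5: "repr (ts :: (nat \<times> nat \<times> nat list) list) = enc_list (enc_pair Num (enc_pair Num (enc_list Num))) ts" for ts
    by (subst repr_list_eq) (simp only: l repr_nat_eq repr_pair_eq[where 'a = nat and 'b = "nat \<times> nat list"] repr_pair_eq[where 'a = nat and 'b = "nat list"])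
  show ?thesis unfolding repr_prod_eq fst_conv snd_conv 1 2 3 4 5 repr_simps(1) ..
qed

lemma denom_dvd: "e \<in> set fs \<Longrightarrow> snd (snd e) dvd denom fs"
  unfolding denom_def by (induction fs) auto

lemma denom_pos: "(\<And>e. e \<in> set fs \<Longrightarrow> 0 < snd (snd e)) \<Longrightarrow> 0 < denom fs"
  unfolding denom_def by (induction fs) auto

lemma algo_correct:
  assumes valid: "valid_input (I :: ('a, 't) edp)"
    and vs: "distinct vs" "set vs = verts I"
    and es: "distinct (map (\<lambda>(u, v, c). {u, v}) es)" "(\<lambda>(u, v, c). {u, v}) ` set es = edges I" "\<forall>(u, v, c) \<in> set es. cap I {u, v} = c"
    and fs: "distinct (map fst fs)" "fst ` set fs = {p. flow I p \<noteq> 0}" "\<forall>(p, a, b) \<in> set fs. 0 < b \<and> flow I p = real a / real b"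
    and ts: "distinct (map fst ts)" "fst ` set ts = nodes I" "\<forall>(t, s, b) \<in> set ts. parent I t = s \<and> distinct b \<and> set b = bag I t"
  shows "\<exists>q U \<pi>. linked_partition I q U \<pi> \<and> length (algo vs es fs ts (root I) (width_bound I)) = q \<and>
    (\<forall>i<q. distinct (map fst (algo vs es fs ts (root I) (width_bound I) ! i)) \<and>
       fst ` set (algo vs es fs ts (root I) (width_bound I) ! i) = U i \<and>
       (\<forall>(v, a, b) \<in> set (algo vs es fs ts (root I) (width_bound I) ! i). 0 < b \<and> \<pi> i v = real a / real b))"
proof (cases "width_bound I < 2")
  case True
  then have "algo vs es fs ts (root I) (width_bound I) = map (\<lambda>v. [(v, 0, 1)]) vs" by (simp add: algo_def)
  then show ?thesis using linked_partition_small_width[OF valid True vs] by (intro exI conjI) auto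
next
  case False
  have fb: "0 < snd (snd e)" "flow I (fst e) = real (fst (snd e)) / real (snd (snd e))" if "e \<in> set fs" for e
    using fs(3) that by (cases e; auto)+
  have d: "0 < denom fs" using fb(1) by (rule denom_pos)
  interpret edp_lists I vs ts es "scaled fs" "denom fs"
  proof unfold_locales
    show "valid_input I" "distinct vs" "set vs = verts I" "distinct (map fst ts)" "fst ` set ts = nodes I"
      "distinct (map (\<lambda>(a, b, k). {a, b}) es)" "(\<lambda>(a, b, k). {a, b}) ` set es = edges I" "0 < denom fs" by fact+
    show "2 \<le> width_bound I" using False by simp
    show "parent I t = s \<and> distinct b \<and> set b = bag I t" if "(t, s, b) \<in> set ts" for t s b using ts(3) that by auto
    show "cap I {a, b} = k" if "(a, b, k) \<in> set es" for a b k using es(3) that by auto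
    have f: "map fst (scaled fs) = map fst fs" by (simp add: scaled_def)
    show "distinct (map fst (scaled fs))" unfolding f by (rule fs(1))
    have "fst ` set (scaled fs) = fst ` set fs" using f by (metis set_map)
    then show "fst ` set (scaled fs) = {p. flow I p \<noteq> 0}" using fs(2) by simp
    show "flow I (fst e) = real (snd e) / real (denom fs)" if "e \<in> set (scaled fs)" for e
    proof -
      obtain e' where e': "e' \<in> set fs" "e = (fst e', fst (snd e') * (denom fs div snd (snd e')))" using \<open>e \<in> set (scaled fs)\<close> by (auto simp: scaled_def)
      obtain k where k: "denom fs = snd (snd e') * k" using denom_dvd[OF e'(1)] by (auto elim: dvdE)
      have "0 < k" using d k by (cases k) auto
      then have "real (fst (snd e')) / real (snd (snd e')) = real (fst (snd e') * (denom fs div snd (snd e'))) / real (denom fs)"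
        using fb(1)[OF e'(1)] unfolding k by simp
      then show ?thesis using fb(2)[OF e'(1)] e'(2) by simp
    qed
  qed
  obtain L where L: "solve vs es (scaled fs) (conelist vs ts (root I)) (width_bound I) (denom fs) = map (\<lambda>(U, h, dd). map (\<lambda>v. (v, h v, dd)) U) L"
    "\<forall>(U, h, dd)\<in>set L. distinct U \<and> 0 < dd"
    "sink_partition I (length L) (\<lambda>i. set (fst (L ! i))) (\<lambda>i v. real (fst (snd (L ! i)) v) / real (snd (snd (L ! i))))
       (1 / (9 * real (width_bound I) ^ 3) * loss I * flow_value (verts I) (flow I))" using solve_sink_partition by blast
  have al: "algo vs es fs ts (root I) (width_bound I) = map (\<lambda>(U, h, dd). map (\<lambda>v. (v, h v, dd)) U) L" using False L(1) by (simp add: algo_def)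
  have D: "distinct (fst (L ! i)) \<and> 0 < snd (snd (L ! i))" if "i < length L" for i
    using L(2) nth_mem[OF that] by (cases "L ! i") auto
  show ?thesis
    unfolding al
  proof (intro exI conjI allI impI)
    show "linked_partition I (length L) (\<lambda>i. set (fst (L ! i))) (\<lambda>i v. real (fst (snd (L ! i)) v) / real (snd (snd (L ! i))))"
      by (rule linked_of_sink_partition[OF L(3)])
    fix i assume i: "i < length L"
    have nth: "map (\<lambda>(U, h, dd). map (\<lambda>v. (v, h v, dd)) U) L ! i = map (\<lambda>v. (v, fst (snd (L ! i)) v, snd (snd (L ! i)))) (fst (L ! i))"
      using i by (simp add: split_def)
    show "distinct (map fst (map (\<lambda>(U, h, dd). map (\<lambda>v. (v, h v, dd)) U) L ! i))"
      "fst ` set (map (\<lambda>(U, h, dd). map (\<lambda>v. (v, h v, dd)) U) L ! i) = set (fst (L ! i))"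
      "\<forall>(v, a, b)\<in>set (map (\<lambda>(U, h, dd). map (\<lambda>v. (v, h v, dd)) U) L ! i).
        0 < b \<and> real (fst (snd (L ! i)) v) / real (snd (snd (L ! i))) = real a / real b"
      unfolding nth using D[OF i] by (auto simp: o_def image_image)
  qed simp
qed

lemma algorithm:
  "\<exists>P c k. \<forall>(I :: (nat, nat) edp) x. valid_input I \<and> encodes_input x I \<longrightarrow>
     (\<exists>y n q U \<pi>. exec P x y n \<and> n \<le> c * vsize x ^ k \<and> encodes_output y q U \<pi> \<and> linked_partition I q U \<pi>)"
proof -
  define F where "F z = algo (fst z) (fst (snd z)) (fst (snd (snd (snd z)))) (fst (snd (snd (snd (snd z))))) (fst (snd (snd (snd (snd (snd z)))))) (snd (snd (snd (snd (snd (snd z))))))"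
    for z :: "nat list \<times> (nat \<times> nat \<times> nat) list \<times> (nat \<times> nat) list \<times> (nat list \<times> nat \<times> nat) list \<times> (nat \<times> nat \<times> nat list) list \<times> nat \<times> nat"
  have "ptime F" unfolding F_def by (rule pt_algo)
  then obtain P p where P: "polyb p" "\<And>z. \<exists>n \<le> p (sz z). exec P (repr z) (repr (F z)) n" unfolding ptime_def by blast
  obtain c k where ck: "\<And>s. p s \<le> c * (s + 1) ^ k" using P(1) unfolding polyb_def by blast
  \<comment> \<open>Sizes are positive, so s + 1 is at most 2s; this removes the shift in
    \<open>polyb\<close>.\<close>
  have poly: "p s \<le> (c * 2 ^ k) * s ^ k" if "0 < s" for s
  proof -
    have "(s + 1) ^ k \<le> (2 * s) ^ k" using that by (intro power_mono) auto
    then have "c * (s + 1) ^ k \<le> c * (2 ^ k * s ^ k)" by (intro mult_le_mono2) (simp add: power_mult_distrib)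
    from le_trans[OF ck this] show ?thesis by (simp only: mult.assoc)
  qed
  have "\<exists>y n q U \<pi>. exec P x y n \<and> n \<le> c * 2 ^ k * vsize x ^ k \<and> encodes_output y q U \<pi> \<and> linked_partition I q U \<pi>"
    if I: "valid_input I" "encodes_input x I" for I :: "(nat, nat) edp" and x
  proof -
    from I(2) obtain vs es ms fs ts where enc:
      "distinct vs" "set vs = verts I"
      "distinct (map (\<lambda>(u, v, c). {u, v}) es)" "(\<lambda>(u, v, c). {u, v}) ` set es = edges I" "\<forall>(u, v, c) \<in> set es. cap I {u, v} = c"
      "distinct (map fst fs)" "fst ` set fs = {p. flow I p \<noteq> 0}" "\<forall>(p, a, b) \<in> set fs. 0 < b \<and> flow I p = real a / real b"
      "distinct (map fst ts)" "fst ` set ts = nodes I" "\<forall>(t, s, b) \<in> set ts. parent I t = s \<and> distinct b \<and> set b = bag I t"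
      and x0: "x = Pair (enc_list Num vs) (Pair (enc_list (enc_pair Num (enc_pair Num Num)) es) (Pair (enc_list (enc_pair Num Num) ms)
           (Pair (enc_list (enc_pair (enc_list Num) (enc_pair Num Num)) fs) (Pair (enc_list (enc_pair Num (enc_pair Num (enc_list Num))) ts)
           (Pair (Num (root I)) (Num (width_bound I)))))))"
      unfolding encodes_input_def by (elim exE conjE) (rule that; assumption)
    have x: "x = repr (vs, es, ms, fs, ts, root I, width_bound I)" unfolding repr_inputs by (rule x0)
    let ?z = "(vs, es, ms, fs, ts, root I, width_bound I)"
    let ?ps = "algo vs es fs ts (root I) (width_bound I)"
    have Fz: "F ?z = ?ps" by (simp add: F_def)
    obtain n where n: "n \<le> p (sz ?z)" "exec P x (repr ?ps) n" using P(2)[of ?z] unfolding x Fz by blast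
    have "n \<le> c * 2 ^ k * vsize x ^ k" using n(1) poly[of "vsize x"] unfolding x by (meson le_trans vsize_pos(1))
    moreover obtain q U \<pi> where "linked_partition I q U \<pi>" "length ?ps = q"
      "\<forall>i<q. distinct (map fst (?ps ! i)) \<and> fst ` set (?ps ! i) = U i \<and> (\<forall>(v, a, b) \<in> set (?ps ! i). 0 < b \<and> \<pi> i v = real a / real b)"
      using algo_correct[OF I(1) enc] by blast
    moreover from this(2,3) have "encodes_output (repr ?ps) q U \<pi>" unfolding encodes_output_def repr_outputs by blast
    ultimately show ?thesis using n(2) by blast
  qed
  then show ?thesis by blast
qed

lemma finite_real_bound:
  fixes h :: "'b \<Rightarrow> real"
  assumes "finite A" obtains N :: nat where "0 < N" "\<And>p. p \<in> A \<Longrightarrow> h p \<le> real N"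
proof -
  obtain N :: nat where N: "(\<Sum>p\<in>A. \<bar>h p\<bar>) \<le> real N" using real_arch_simple by blast
  have "h p \<le> real (Suc N)" if "p \<in> A" for p
  proof -
    have "h p \<le> \<bar>h p\<bar>" by simp
    also have "\<dots> \<le> (\<Sum>p\<in>A. \<bar>h p\<bar>)" using assms that by (intro member_le_sum) auto
    finally show ?thesis using N by simp
  qed
  then show ?thesis using that[of "Suc N"] by blast
qed

text \<open>Rounding the flow down to multiples of \<open>1 / N\<close> costs at most a quarter of it, which the constant
  12 in place of 9 pays for.\<close>

lemma existence:
  assumes valid: "valid_input (I :: ('a, 't) edp)"
  shows "\<exists>q U \<pi>. linked_partition I q U \<pi>"
proof -
  interpret tdec I by unfold_locales (rule valid)
  obtain vs where vs: "distinct vs" "set vs = V" using finite_distinct_list[OF graph(1)] by metis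
  show ?thesis
  proof (cases "width_bound I < 2")
    case True
    from linked_partition_small_width[OF valid this vs] show ?thesis by (intro exI)
  next
    case False
    let ?f = "flow I"
    have feas: "feasible_flow V E (cap I) ?f" and ends: "\<And>p. ?f p \<noteq> 0 \<Longrightarrow> {hd p, last p} \<in> pairs I"
      using valid by (auto simp: valid_input_def fractional_solution_def)
    define A where "A = {p. ?f p \<noteq> 0}"
    have fA: "finite A" unfolding A_def by (rule feasible_finite[OF graph(1) feas])
    have f0: "0 \<le> ?f p" for p using feas by (simp add: feasible_flow_def)
    \<comment> \<open>Every positive weight is then at least 4/N, and rounding down to multiples of
      1/N loses less than 1/N.\<close>
    obtain N :: nat where N: "0 < N" "\<And>p. p \<in> A \<Longrightarrow> 4 / ?f p \<le> real N" by (rule finite_real_bound[OF fA, of "\<lambda>p. 4 / ?f p"]) (rule that)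
    define w where "w p = nat \<lfloor>?f p * real N\<rfloor>" for p
    define f' where "f' p = real (w p) / real N" for p
    have w: "real (w p) \<le> ?f p * real N" for p
    proof -
      have "0 \<le> ?f p * real N" using f0 by simp
      then show ?thesis unfolding w_def by (simp add: of_nat_nat)
    qed
    have le: "f' p \<le> ?f p" for p unfolding f'_def using w[of p] N(1) by (simp add: field_simps)
    have ge: "3 / 4 * ?f p \<le> f' p" for p
    proof (cases "p \<in> A")
      case True
      then have pos: "0 < ?f p" using f0[of p] by (simp add: A_def)
      then have 4: "4 \<le> ?f p * real N" using N(2)[OF True] by (simp add: field_simps)
      have "?f p * real N - 1 \<le> real (w p)" unfolding w_def using 4 by (simp add: of_nat_nat)
      then have "3 / 4 * (?f p * real N) \<le> real (w p)" using 4 by linarith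
      then show ?thesis unfolding f'_def using N(1) by (simp add: field_simps)
    next
      case False
      then have "?f p = 0" by (simp add: A_def)
      then show ?thesis by (simp add: f'_def)
    qed
    have supp: "f' p \<noteq> 0 \<longleftrightarrow> p \<in> A" for p
    proof
      assume "f' p \<noteq> 0"
      moreover have "0 \<le> f' p" by (simp add: f'_def)
      ultimately show "p \<in> A" using le[of p] by (auto simp: A_def)
    next
      assume "p \<in> A"
      then have "0 < ?f p" using f0[of p] by (simp add: A_def)
      then show "f' p \<noteq> 0" using ge[of p] by linarith
    qed
    have fs: "flow_sum f' Q \<le> flow_sum ?f Q" "3 / 4 * flow_sum ?f Q \<le> flow_sum f' Q" for Q
    proof -
      have 1: "{p. f' p \<noteq> 0 \<and> Q p} = {p. ?f p \<noteq> 0 \<and> Q p}" using supp by (auto simp: A_def)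
      show "flow_sum f' Q \<le> flow_sum ?f Q" unfolding flow_sum_def 1 by (intro sum_mono le)
      show "3 / 4 * flow_sum ?f Q \<le> flow_sum f' Q" unfolding flow_sum_def 1 sum_distrib_left by (intro sum_mono ge)
    qed
    define I' where "I' = I\<lparr>flow := f'\<rparr>"
    have I': "verts I' = V" "edges I' = E" "cap I' = cap I" "pairs I' = pairs I" "flow I' = f'" "nodes I' = T" "root I' = root I"
      "parent I' = parent I" "bag I' = bag I" "width_bound I' = width_bound I" by (simp_all add: I'_def)
    have pr: "parent_rel I' = parent_rel I" by (simp add: parent_rel_def I')
    have na: "nodes_at I' = nodes_at I" by (rule ext) (simp add: nodes_at_def I')
    have co: "cone I' = cone I" by (rule ext) (simp add: cone_def I' pr)
    have pa: "parent_adhesion I' = parent_adhesion I" by (rule ext) (simp add: parent_adhesion_def I')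
    have ce: "cone_edges I' = cone_edges I" by (rule ext) (simp add: cone_edges_def I' co pa)
    have feas': "feasible_flow V E (cap I) f'"
      unfolding feasible_flow_def
    proof (intro conjI allI ballI impI)
      show "0 \<le> f' p" for p by (simp add: f'_def)
      show "is_path V E p" if "f' p \<noteq> 0" for p using that feas supp by (simp add: feasible_flow_def A_def)
      show "flow_sum f' (\<lambda>p. e \<in> path_edges p) \<le> real (cap I e)" if "e \<in> E" for e
        using fs(1)[of "\<lambda>p. e \<in> path_edges p"] feas that by (force simp: feasible_flow_def)
    qed
    have valid': "valid_input I'"
    proof -
      have "fractional_solution I'" unfolding fractional_solution_def I' using feas' ends supp by (auto simp: A_def)
      then show ?thesis using valid
        unfolding valid_input_def maxedp_instance_def tree_decomposition_def rooted_tree_def I' pr na by blast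
    qed
    \<comment> \<open>Smaller marginals are easier to route, so a node unsafe in \<open>I'\<close>
      is unsafe in \<open>I\<close>; bad nodes are the same, as the support of the flow is
      unchanged. Hence the factor \<open>loss\<close> can only grow.\<close>
    have safe: "safe I' t" if "safe I t" for t
    proof -
      have m: "1 / (4 * real (width_bound I)) * marginal f' z \<le> 1 / (4 * real (width_bound I)) * marginal ?f z" for z
        unfolding marginal_def by (intro mult_left_mono fs(1)) auto
      show ?thesis using that unfolding safe_def I' co pa ce by (meson m order_trans)
    qed
    have good: "good I' t \<longleftrightarrow> good I t" for t unfolding good_def I' co pa using supp by (simp add: A_def)
    have ma: "max_adhesion I' P \<le> max_adhesion I Q" if PQ: "\<And>t. P t \<Longrightarrow> Q t" for P Q
    proof -
      have fin: "finite {card (B t) |t. t \<in> T \<and> Q t}" using tree(1) by simp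
      show ?thesis unfolding max_adhesion_def I' pa using fin PQ by (intro Max_mono) auto
    qed
    have base: "0 \<le> 1 - 1 / real (width_bound I)" "1 - 1 / real (width_bound I) \<le> 1" using False by auto
    have loss: "loss I \<le> loss I'"
      unfolding loss_def I' using base safe good by (intro power_decreasing add_mono ma) auto
    have val: "3 / 4 * flow_value V ?f \<le> flow_value V f'"
    proof -
      have "3 / 4 * (\<Sum>v\<in>V. marginal ?f v) \<le> (\<Sum>v\<in>V. marginal f' v)"
        unfolding sum_distrib_left marginal_def by (intro sum_mono fs(2))
      then show ?thesis unfolding flow_value_def by linarith
    qed
    have "E \<subseteq> Pow V" using graph(2) by blast
    then have "finite E" using graph(1) by (simp add: finite_subset)
    from finite_distinct_list[OF this] obtain el where el: "distinct el" "set el = E" by blast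
    have "\<forall>e\<in>E. \<exists>ab. {fst ab, snd ab} = e"
    proof
      fix e assume "e \<in> E"
      from graph(2)[OF this] obtain u v where "e = {u, v}" by blast
      then show "\<exists>ab. {fst ab, snd ab} = e" by (intro exI[of _ "(u, v)"]) simp
    qed
    from bchoice[OF this] obtain ab where ab: "\<And>e. e \<in> E \<Longrightarrow> {fst (ab e), snd (ab e)} = e" by blast
    define es where "es = map (\<lambda>e. (fst (ab e), snd (ab e), cap I e)) el"
    have esm: "map (\<lambda>(a, b, k). {a, b}) es = el" unfolding es_def map_map o_def prod.case
      by (rule map_idI, rule ab) (simp add: el(2))
    obtain tl where tl: "distinct tl" "set tl = T" using finite_distinct_list[OF tree(1)] by metis
    have "\<forall>t\<in>T. \<exists>b. distinct b \<and> set b = bag I t"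
    proof
      fix t assume "t \<in> T"
      from finite_distinct_list[OF finite_subset[OF bags(1)[OF this] graph(1)]] show "\<exists>b. distinct b \<and> set b = bag I t" by blast
    qed
    from bchoice[OF this] obtain bl where bl: "\<And>t. t \<in> T \<Longrightarrow> distinct (bl t) \<and> set (bl t) = bag I t" by blast
    define ts where "ts = map (\<lambda>t. (t, parent I t, bl t)) tl"
    have tsm: "map fst ts = tl" by (simp add: ts_def o_def)
    obtain al where al: "distinct al" "set al = A" using finite_distinct_list[OF fA] by metis
    define fl where "fl = map (\<lambda>p. (p, w p)) al"
    have flm: "map fst fl = al" by (simp add: fl_def o_def)
    interpret I': edp_lists I' vs ts es fl N
    proof unfold_locales
      show "valid_input I'" "distinct vs" by fact+
      show "set vs = verts I'" using vs(2) I' by simp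
      show "distinct (map fst ts)" unfolding tsm by (rule tl(1))
      show "fst ` set ts = nodes I'" using tsm tl(2) I'(6) by (metis set_map)
      show "parent I' t = s \<and> distinct b \<and> set b = bag I' t" if "(t, s, b) \<in> set ts" for t s b
        using that bl tl(2) by (auto simp: ts_def I')
      show "distinct (map (\<lambda>(a, b, k). {a, b}) es)" unfolding esm by (rule el(1))
      show "(\<lambda>(a, b, k). {a, b}) ` set es = edges I'" using esm el(2) I'(2) by (metis set_map)
      show "cap I' {a, b} = k" if "(a, b, k) \<in> set es" for a b k using that ab el(2) by (auto simp: es_def I')
      show "distinct (map fst fl)" unfolding flm by (rule al(1))
      show "fst ` set fl = {p. flow I' p \<noteq> 0}" unfolding I'(5) set_map[symmetric] flm al(2) using supp by blast
      show "flow I' (fst e) = real (snd e) / real N" if "e \<in> set fl" for e using that by (auto simp: fl_def I' f'_def)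
      show "0 < N" by (rule N(1))
      show "2 \<le> width_bound I'" using False by (simp add: I')
    qed
    obtain q U \<pi> where lp: "sink_partition I' q U \<pi> (1 / (9 * real (width_bound I') ^ 3) * loss I' * flow_value (verts I') (flow I'))" using I'.solve_sink_partition by blast
    have sk: "sinks I' q U \<pi> = sinks I q U \<pi>" by (simp add: sinks_def pairs_in_def terminals_in_def I')
    have tm: "terminals_in I' = terminals_in I" by (rule ext) (simp add: terminals_in_def pairs_in_def I')
    have "1 / (12 * real (width_bound I) ^ 3) * loss I * flow_value V ?f = 1 / (9 * real (width_bound I) ^ 3) * (loss I * (3 / 4 * flow_value V ?f))" by simp
    also have "\<dots> \<le> 1 / (9 * real (width_bound I) ^ 3) * (loss I' * flow_value V f')"
    proof (intro mult_left_mono mult_mono loss val)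
      have l0: "0 \<le> loss I" using loss_bounds False by simp
      then show "0 \<le> loss I'" using loss by linarith
      have "0 \<le> flow_sum ?f Q" for Q unfolding flow_sum_def using f0 by (intro sum_nonneg)
      then show "0 \<le> 3 / 4 * flow_value V ?f" unfolding flow_value_def marginal_def by (simp add: sum_nonneg)
    qed auto
    also have "\<dots> \<le> (\<Sum>i<q. sum (\<pi> i) (terminals_in I (U i)))" using lp unfolding sink_partition_def I' tm by (simp only: mult.assoc)
    finally have "linked_partition I q U \<pi>" unfolding linked_partition_iff sink_partition_def using lp sk by (simp add: sink_partition_def)
    then show ?thesis by blast
  qed
qed

theorem theorem9:
  shows "(\<exists>P c k. \<forall>(I :: (nat, nat) edp) x. valid_input I \<and> encodes_input x I \<longrightarrow>
            (\<exists>y n q U \<pi>. exec P x y n \<and> n \<le> c * vsize x ^ k \<and>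
               encodes_output y q U \<pi> \<and> linked_partition I q U \<pi>)) \<and>
         (\<forall>I :: ('a, 't) edp. valid_input I \<longrightarrow> (\<exists>q U \<pi>. linked_partition I q U \<pi>))"
  using algorithm existence by blast

end
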